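(* Let $n\ge2$, let $L_{0,hom}=\sum_{j=1}^nM_j^0D_j$ be strongly propagative (self-adjoint in $L^2(\mathbb{R}^n,\mathbb{C}^K)$), and let $R_{0,hom}(z)=(L_{0,hom}-z)^{-1}$, $\operatorname{Im}z\neq0$. For any $s>\tfrac12$ the limits $$R^\pm_{0,hom}(\mu)=\lim_{\varepsilon\downarrow0}R_{0,hom}(\mu\pm i\varepsilon),\qquad\mu\in\mathbb{R}\setminus\{0\},$$ exist in the uniform operator topology of $B(\Upsilon^s_Z,L^{2,-s}(\mathbb{R}^n,\mathbb{C}^K))$. Furthermore, the limit functions $R^\pm_{0,hom}(\mu)$, $\mu\ne0$, are locally bounded and locally Hölder continuous with respect to the uniform operator topology.
   Context: $M_j^0$ are constant Hermitian $K\times K$ matrices, $D_j=\frac1i\partial_{x_j}$; the symbol is $M_{0,hom}(\xi)=\sum_jM_j^0\xi_j$ under the unitary Fourier transform $\hat u(\xi)=(2\pi)^{-n/2}\int u(x)e^{-i\langle\xi,x\rangle}dx$. Strongly propagative: $\ker M_{0,hom}(\xi)$ has fixed dimension $0\le d<K$ for all $\xi\ne0$. $Z$ is the set of $\xi\ne0$ where the discriminant of the minimal polynomial of $M_{0,hom}(\xi)$ vanishes, $\bar Z=Z\cup\{0\}$. $L^{2,s}=\{u:\|u\|_{0,s}^2=\int(1+|x|^2)^s|u|^2dx<\infty\}$; $\mathcal H^s$ = Fourier transforms of $L^{2,s}$ with $\|\hat u\|_{\mathcal H^s}=\|u\|_{0,s}$. $\Upsilon^s_Z\subseteq L^{2,s}(\mathbb{R}^n,\mathbb{C}^K)$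 is the set of inverse Fourier transforms of the closure of $C_0^\infty(\mathbb{R}^n\setminus\bar Z,\mathbb{C}^K)$ in $\mathcal H^s(\mathbb{R}^n,\mathbb{C}^K)$, a closed subspace with norm $\|\cdot\|_{0,s}$. *)

theory Defs
  imports "HOL-Analysis.Analysis"
begin

definition symb :: "('n::finite \<Rightarrow> complex^'k^'k) \<Rightarrow> real^'n \<Rightarrow> complex^'k^'k" where
  "symb M \<xi> = (\<Sum>j\<in>UNIV. (\<chi> a b. complex_of_real (\<xi> $ j) * (M j $ a $ b)))"

definition hermitian_mat :: "complex^'k^'k \<Rightarrow> bool" where
  "hermitian_mat A \<longleftrightarrow> (\<forall>a b. A $ a $ b = cnj (A $ b $ a))"

definition strongly_propagative :: "('n::finite \<Rightarrow> complex^'k::finite^'k) \<Rightarrow> bool" where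
  "strongly_propagative M \<longleftrightarrow>
     (\<exists>d. d < CARD('k) \<and> (\<forall>\<xi>. \<xi> \<noteq> 0 \<longrightarrow> vec.dim {v. symb M \<xi> *v v = 0} = d))"

definition eigenvalues_mat :: "complex^'k^'k \<Rightarrow> complex set" where
  "eigenvalues_mat A = {l. \<exists>v. v \<noteq> 0 \<and> A *v v = l *s v}"

definition Zset :: "('n::finite \<Rightarrow> complex^'k::finite^'k) \<Rightarrow> (real^'n) set" where
  "Zset M = {\<xi>. \<xi> \<noteq> 0 \<and>
      card (eigenvalues_mat (symb M \<xi>)) < Max (range (\<lambda>\<eta>. card (eigenvalues_mat (symb M \<eta>))))}"

definition Zbar :: "('n::finite \<Rightarrow> complex^'k::finite^'k) \<Rightarrow> (real^'n) set" where
  "Zbar M = Zset M \<union> {0}"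

coinductive C_inf :: "('a::real_normed_vector \<Rightarrow> 'b::real_normed_vector) \<Rightarrow> bool" where
  "(\<forall>x. f differentiable (at x)) \<Longrightarrow> (\<forall>v. C_inf (\<lambda>x. frechet_derivative f (at x) v))
     \<Longrightarrow> C_inf f"

definition Cc_inf :: "('a::euclidean_space) set \<Rightarrow> ('a \<Rightarrow> 'b::real_normed_vector) set" where
  "Cc_inf U = {f. C_inf f \<and> compact (closure {x. f x \<noteq> 0}) \<and> closure {x. f x \<noteq> 0} \<subseteq> U}"

definition wnorm2 :: "real \<Rightarrow> (real^'n::finite \<Rightarrow> complex^'k::finite) \<Rightarrow> ennreal" where
  "wnorm2 s u = (\<integral>\<^sup>+ x. ennreal ((1 + norm x ^ 2) powr s * norm (u x) ^ 2) \<partial>lborel)"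

definition wnorm :: "real \<Rightarrow> (real^'n::finite \<Rightarrow> complex^'k::finite) \<Rightarrow> ennreal" where
  "wnorm s u = (if wnorm2 s u = \<infinity> then \<infinity> else ennreal (sqrt (enn2real (wnorm2 s u))))"

definition L2w :: "real \<Rightarrow> (real^'n::finite \<Rightarrow> complex^'k::finite) set" where
  "L2w s = {u. u \<in> borel_measurable lborel \<and> wnorm2 s u < \<infinity>}"

text \<open>Classical (L^1) Fourier integral with sign sigma: sigma = -1 forward, sigma = 1 inverse,
  normalisation (2 pi)^(-n/2).\<close>
definition fourier_int :: "real \<Rightarrow> (real^'n::finite \<Rightarrow> complex^'k::finite) \<Rightarrow> real^'n \<Rightarrow> complex^'k" where
  "fourier_int \<sigma> u \<xi> = ((2 * pi) powr (- real CARD('n) / 2)) *\<^sub>R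
      (\<integral>x. (exp (\<i> * complex_of_real (\<sigma> * (\<xi> \<bullet> x)))) *s u x \<partial>lborel)"

definition fourier_L2 :: "real \<Rightarrow> (real^'n::finite \<Rightarrow> complex^'k::finite) \<Rightarrow> real^'n \<Rightarrow> complex^'k" where
  "fourier_L2 \<sigma> u = (SOME g. g \<in> L2w 0 \<and>
      ((\<lambda>R. wnorm2 0 (\<lambda>\<xi>. g \<xi> - fourier_int \<sigma> (\<lambda>x. indicator (cball 0 R) x *\<^sub>R u x) \<xi>))
         \<longlongrightarrow> 0) at_top)"

text \<open>Upsilon^s_Z: inverse Fourier transforms of the closure of C_0^infinity(R^n \ Zbar) in H^s;
  since ||g||_{H^s} = ||F^{-1} g||_{0,s}, this is the set of u in L^{2,s} approximated in
  ||.||_{0,s} by inverse Fourier transforms of such test functions.\<close>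
definition Upsilon :: "real \<Rightarrow> ('n::finite \<Rightarrow> complex^'k::finite^'k) \<Rightarrow> (real^'n \<Rightarrow> complex^'k) set" where
  "Upsilon s M = {u. u \<in> L2w s \<and>
      (\<exists>\<phi>. (\<forall>m. \<phi> m \<in> Cc_inf (- Zbar M)) \<and>
            ((\<lambda>m. wnorm2 s (\<lambda>x. fourier_int 1 (\<phi> m) x - u x)) \<longlonglongrightarrow> 0))}"

text \<open>Resolvent R_{0,hom}(z) = (L_{0,hom} - z)^{-1}, i.e. the Fourier multiplier (M(xi) - z)^{-1}.\<close>
definition resolvent :: "('n::finite \<Rightarrow> complex^'k::finite^'k) \<Rightarrow> complex
     \<Rightarrow> (real^'n \<Rightarrow> complex^'k) \<Rightarrow> (real^'n \<Rightarrow> complex^'k)" where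
  "resolvent M z u = fourier_L2 1
      (\<lambda>\<xi>. matrix_inv (symb M \<xi> - mat z) *v fourier_L2 (-1) u \<xi>)"

definition opnorm :: "real \<Rightarrow> ('n::finite \<Rightarrow> complex^'k::finite^'k)
     \<Rightarrow> ((real^'n \<Rightarrow> complex^'k) \<Rightarrow> (real^'n \<Rightarrow> complex^'k)) \<Rightarrow> ennreal" where
  "opnorm s M T = (SUP u\<in>{u\<in>Upsilon s M. wnorm s u \<le> 1}. wnorm (- s) (T u))"

definition opdist :: "real \<Rightarrow> ('n::finite \<Rightarrow> complex^'k::finite^'k)
     \<Rightarrow> ((real^'n \<Rightarrow> complex^'k) \<Rightarrow> (real^'n \<Rightarrow> complex^'k))
     \<Rightarrow> ((real^'n \<Rightarrow> complex^'k) \<Rightarrow> (real^'n \<Rightarrow> complex^'k)) \<Rightarrow> ennreal" where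
  "opdist s M A B = opnorm s M (\<lambda>u x. A u x - B u x)"

text \<open>T is an element of B(Upsilon^s_Z, L^{2,-s}) (linearity up to null functions,
  since functions are not quotiented by a.e. equality).\<close>
definition bounded_op :: "real \<Rightarrow> ('n::finite \<Rightarrow> complex^'k::finite^'k)
     \<Rightarrow> ((real^'n \<Rightarrow> complex^'k) \<Rightarrow> (real^'n \<Rightarrow> complex^'k)) \<Rightarrow> bool" where
  "bounded_op s M T \<longleftrightarrow>
     (\<forall>u\<in>Upsilon s M. T u \<in> L2w (- s)) \<and>
     (\<forall>u\<in>Upsilon s M. \<forall>v\<in>Upsilon s M. \<forall>a b::complex.
        wnorm (- s) (\<lambda>x. T (\<lambda>y. a *s u y + b *s v y) x - (a *s T u x + b *s T v x)) = 0) \<and>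
     opnorm s M T < \<infinity>"

end

theory Submission
  imports Defs "HOL-Probability.Characteristic_Functions"
begin

text \<open>
  On the Fourier side the resolvent is multiplication by the inverse of M(xi) - z. Since M is
  homogeneous of degree one, on each ray it splits into scalar factors 1 / (t l - z), where l runs
  through the eigenvalues of M(xi); strong propagativity bounds the nonzero ones below by a multiple
  of the norm of xi, so that the singularities met for z near a nonzero real number stay in a
  bounded region of frequencies. Averaging over dilations with a weight vanishing at both ends of
  the parameter interval reduces the sesquilinear form of the squared resolvent to integrals of a
  Hoelder continuous function against 1 / (t l - z)^2, which are bounded by the power a - 1 of the
  distance to the real axis. For functions supported in a ball of radius R the
  Hoelder norm along rays costs the power 1/2 + a of R, and a dyadic decomposition sums these costs
  as soon as s > 1/2 + a. The squared resolvent being the derivative of the resolvent, the argument of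
  Hardy and Littlewood turns the bound into Hoelder continuity up to the real axis.
\<close>

subsection \<open>Spectral theory of Hermitian matrices\<close>

text \<open>Eigenprojections of \<open>symb M \<xi>\<close> need not vary smoothly with \<xi> where
  eigenvalues cross, so differentiating them in all frequency directions is not an option. Along a
  ray nothing crosses: one orthonormal eigenframe serves every \<open>t *\<^sub>R \<xi>\<close>, and
  only radial derivatives of the transforms are taken. The frame is picked separately for each \<xi>
  and disappears from the ray estimate, whose two sides contain only quantities measurable in \<xi>;
  no measurable choice of eigenvectors arises. The form is studied through the square of the
  resolvent because, after the value at the resonance is subtracted, absolute values may be taken
  under the integral, while the remaining power of Im z is still integrable up to the axis. A radial
  derivative costs \<open>norm \<xi>\<close> times the radius R of the spatial support; the spectral
  gap bounds the first factor at every resonance, so that on one spatial scale only powers of R are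
  lost. Zero eigenvalues stay nonresonant because Re z keeps away from 0. The energies in the ray
  estimate are controlled by Plancherel's inequality, obtained with a Gaussian cut-off in
  frequency.\<close>

definition cip :: "complex^'k::finite \<Rightarrow> complex^'k \<Rightarrow> complex" where
  "cip u v = (\<Sum>i\<in>UNIV. u $ i * cnj (v $ i))"

lemma cip_add_left: "cip (u + v) w = cip u w + cip v w"
  by (simp add: cip_def algebra_simps sum.distrib)

lemma cip_add_right: "cip w (u + v) = cip w u + cip w v"
  by (simp add: cip_def algebra_simps sum.distrib)

lemma cip_diff_left: "cip (u - v) w = cip u w - cip v w"
  by (simp add: cip_def algebra_simps sum_subtractf)

lemma cip_diff_right: "cip w (u - v) = cip w u - cip w v"
  by (simp add: cip_def algebra_simps sum_subtractf)

lemma cip_scale_left: "cip (c *s u) w = c * cip u w"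
  by (simp add: cip_def sum_distrib_left algebra_simps)

lemma cip_scale_right: "cip w (c *s u) = cnj c * cip w u"
  by (simp add: cip_def sum_distrib_left algebra_simps)

lemma cip_scaleR_left: "cip (c *\<^sub>R u) w = of_real c * cip u w"
  by (simp add: cip_def sum_distrib_left algebra_simps scaleR_conv_of_real[where 'a=complex])

lemma cip_scaleR_right: "cip w (c *\<^sub>R u) = of_real c * cip w u"
  by (simp add: cip_def sum_distrib_left scaleR_conv_of_real[where 'a=complex] algebra_simps)

lemma cip_zero [simp]: "cip 0 v = 0" "cip v 0 = 0"
  by (simp_all add: cip_def)

lemma cip_sum_left: "cip (\<Sum>i\<in>A. f i) w = (\<Sum>i\<in>A. cip (f i) w)"
  by (induction A rule: infinite_finite_induct) (auto simp: cip_add_left)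

lemma cip_commute: "cip u v = cnj (cip v u)"
  by (simp add: cip_def mult.commute)

text \<open>The type class inner product of complex vectors is real. Through this identity real
  orthogonality, independence and the real Cauchy-Schwarz inequality become available for the
  sesquilinear form.\<close>

lemma Re_cip: "Re (cip u v) = u \<bullet> v"
  by (simp add: cip_def inner_vec_def inner_complex_def)

lemma cip_self: "cip u u = of_real ((norm u)\<^sup>2)"
proof -
  have "Im (cip u u) = 0" by (simp add: cip_def)
  moreover have "Re (cip u u) = (norm u)\<^sup>2"
    by (simp add: Re_cip power2_norm_eq_inner)
  ultimately show ?thesis by (simp add: complex_eq_iff)
qed

lemma norm_cscale: "norm (c *s (u::complex^'k::finite)) = cmod c * norm u"
proof -
  have "norm (c *s u) ^ 2 = (cmod c * norm u)^2"
  proof -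
    have "complex_of_real (norm (c *s u) ^ 2) = c * cnj c * cip u u"
      by (simp only: cip_self[symmetric] cip_scale_left cip_scale_right mult.assoc mult.left_commute)
    also have "\<dots> = complex_of_real ((cmod c * norm u)^2)"
      by (simp only: cip_self complex_norm_square[symmetric])
         (simp add: power_mult_distrib)
    finally show ?thesis by (simp only: of_real_eq_iff)
  qed
  thus ?thesis by (simp add: power2_eq_iff_nonneg)
qed

text \<open>A unimodular factor on u makes the form real and nonnegative without changing any norm;
  the real Cauchy-Schwarz inequality then applies.\<close>

lemma norm_cip_le: "cmod (cip u v) \<le> norm u * norm v"
proof (cases "cip u v = 0")
  case False
  define c where "c = cnj (cip u v) / cmod (cip u v)"
  have nc: "cmod c = 1" using False by (simp add: c_def norm_divide)
  have "cip (c *s u) v = of_real (cmod (cip u v))"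
    using False unfolding cip_scale_left c_def
    by (simp add: complex_norm_square[symmetric] mult.commute[of "cnj _"])
       (simp add: power2_eq_square)
  hence "cmod (cip u v) = (c *s u) \<bullet> v"
    by (metis Re_cip Re_complex_of_real)
  also have "\<dots> \<le> norm (c *s u) * norm v" by (rule norm_cauchy_schwarz)
  finally show ?thesis by (simp add: norm_cscale nc)
qed simp

lemma cip_hermitian:
  assumes "hermitian_mat A" shows "cip (A *v u) v = cip u (A *v v)"
proof -
  have "cip (A *v u) v = (\<Sum>i\<in>UNIV. \<Sum>j\<in>UNIV. A $ i $ j * u $ j * cnj (v $ i))"
    by (simp add: cip_def matrix_vector_mult_def sum_distrib_right)
  also have "\<dots> = (\<Sum>j\<in>UNIV. \<Sum>i\<in>UNIV. A $ i $ j * u $ j * cnj (v $ i))"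
    by (rule sum.swap)
  also have "\<dots> = (\<Sum>j\<in>UNIV. \<Sum>i\<in>UNIV. u $ j * cnj (A $ j $ i * v $ i))"
  proof (intro sum.cong refl)
    fix i j
    have "A $ i $ j = cnj (A $ j $ i)" using assms unfolding hermitian_mat_def by blast
    hence "cnj (A $ j $ i) = A $ i $ j" by (rule sym)
    thus "A $ i $ j * u $ j * cnj (v $ i) = u $ j * cnj (A $ j $ i * v $ i)" by simp
  qed
  also have "\<dots> = cip u (A *v v)"
    by (simp add: cip_def matrix_vector_mult_def sum_distrib_left)
  finally show ?thesis .
qed

lemma matrix_vector_mult_scaleR_complex:
  "A *v (c *\<^sub>R x) = c *\<^sub>R (A *v (x :: complex^'k::finite))"
  by (simp add: matrix_vector_mult_def vec_eq_iff scaleR_sum_right)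

text \<open>A maximiser of the quadratic form on the unit sphere of an invariant subspace is an
  eigenvector.\<close>

lemma hermitian_eigenvector_in_complement:
  fixes A :: "complex^'k::finite^'k"
  assumes herm: "hermitian_mat A"
    and eig: "\<And>e. e \<in> S \<Longrightarrow> \<exists>l. A *v e = l *s e"
    and x: "x \<noteq> 0" "\<And>e. e \<in> S \<Longrightarrow> cip x e = 0"
  obtains v l where "norm v = 1" "A *v v = of_real l *s v" "\<And>e. e \<in> S \<Longrightarrow> cip v e = 0"
proof -
  define V where "V = {v. \<forall>e\<in>S. cip v e = 0}"
  have addV: "u + v \<in> V" if "u \<in> V" "v \<in> V" for u v using that by (simp add: V_def cip_add_left)
  have diffV: "u - v \<in> V" if "u \<in> V" "v \<in> V" for u v using that by (simp add: V_def cip_diff_left)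
  have scV: "c *\<^sub>R u \<in> V" if "u \<in> V" for u c using that by (simp add: V_def cip_scaleR_left)
  have AV: "A *v u \<in> V" if "u \<in> V" for u
  proof -
    have "cip (A *v u) e = 0" if e: "e \<in> S" for e
    proof -
      obtain l where "A *v e = l *s e" using eig[OF e] by blast
      hence "cip (A *v u) e = cnj l * cip u e"
        by (simp add: cip_hermitian[OF herm] cip_scale_right)
      thus ?thesis using \<open>u \<in> V\<close> e by (simp add: V_def)
    qed
    thus ?thesis by (simp add: V_def)
  qed
  have clos: "closed V"
  proof -
    have "V = (\<Inter>e\<in>S. {v. cip v e = 0})" by (auto simp: V_def)
    moreover have "closed {v. cip v e = 0}" for e
      unfolding cip_def by (intro closed_Collect_eq continuous_intros)
    ultimately show ?thesis by auto
  qed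
  define Q where "Q = (\<lambda>v. (A *v v) \<bullet> v)"
  have contA: "continuous_on T (\<lambda>v. A *v v)" for T
    by (rule linear_continuous_on) (simp add: linear_conv_bounded_linear[symmetric])
  have cpt: "compact (V \<inter> sphere 0 1)" using clos by (simp add: closed_Int_compact)
  have xV: "x \<in> V" using x by (simp add: V_def)
  have ne: "V \<inter> sphere 0 1 \<noteq> {}"
    using scV[OF xV, of "1 / norm x"] x by (auto intro!: exI[of _ "(1 / norm x) *\<^sub>R x"])
  obtain v where v: "v \<in> V" "norm v = 1" and mx: "\<And>w. w \<in> V \<Longrightarrow> norm w = 1 \<Longrightarrow> Q w \<le> Q v"
  proof -
    have "continuous_on (V \<inter> sphere 0 1) Q"
      unfolding Q_def by (intro continuous_intros contA)
    from continuous_attains_sup[OF cpt ne this] that show ?thesis by auto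
  qed
  define l where "l = Q v"
  have mx': "Q w \<le> l * (norm w)\<^sup>2" if "w \<in> V" for w
  proof (cases "w = 0")
    case False
    have "Q ((1 / norm w) *\<^sub>R w) \<le> l"
      unfolding l_def using False that by (intro mx scV) auto
    moreover have "Q ((1 / norm w) *\<^sub>R w) = Q w / (norm w)\<^sup>2"
      by (simp add: Q_def matrix_vector_mult_scaleR_complex power2_eq_square)
    ultimately show ?thesis using False by (simp add: field_simps)
  qed (simp add: Q_def)
  \<comment> \<open>The residual of the eigenvalue equation. Perturbing the maximiser v along it
    makes the first-order term -2t times the square of \<open>norm d\<close>, which a maximum cannot
    tolerate unless d = 0.\<close>
  define d where "d = A *v v - l *\<^sub>R v"
  have dV: "d \<in> V" unfolding d_def by (intro diffV AV scV v)
  have sym: "(A *v d) \<bullet> v = (A *v v) \<bullet> d"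
    by (metis Re_cip cip_hermitian[OF herm] inner_commute)
  have ineq: "0 \<le> t\<^sup>2 * (l * (norm d)\<^sup>2 - Q d) - 2 * t * (norm d)\<^sup>2" for t
  proof -
    have "Q (v + t *\<^sub>R d) \<le> l * (norm (v + t *\<^sub>R d))\<^sup>2" by (intro mx' addV scV v dV)
    moreover have "Q (v + t *\<^sub>R d) = l + 2 * t * ((A *v v) \<bullet> d) + t\<^sup>2 * Q d"
      using sym by (simp add: Q_def l_def matrix_vector_mult_scaleR_complex matrix_vector_right_distrib
          inner_add_left inner_add_right power2_eq_square algebra_simps)
    moreover have "(norm (v + t *\<^sub>R d))\<^sup>2 = 1 + 2 * t * (v \<bullet> d) + t\<^sup>2 * (norm d)\<^sup>2"
      using v unfolding power2_norm_eq_inner inner_add_left inner_add_right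
      by (simp add: inner_commute power2_eq_square norm_eq_1 algebra_simps)
    moreover have N: "(norm d)\<^sup>2 = (A *v v) \<bullet> d - l * (v \<bullet> d)"
      unfolding power2_norm_eq_inner by (subst (1) d_def) (simp add: inner_diff_left)
    have "2 * t * (norm d)\<^sup>2 = 2 * t * ((A *v v) \<bullet> d) - l * (2 * t * (v \<bullet> d))"
      unfolding N by (simp add: algebra_simps)
    ultimately show ?thesis by (simp only: distrib_left) (simp add: algebra_simps)
  qed
  have "d = 0"
  proof (rule ccontr)
    assume "d \<noteq> 0"
    \<comment> \<open>At t = a / b the linear term beats the quadratic one, whose coefficient is at
      most b; the added 1 keeps b positive.\<close>
    define a where "a = (norm d)\<^sup>2"
    define b where "b = \<bar>l * (norm d)\<^sup>2 - Q d\<bar> + 1"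
    have a: "a > 0" using \<open>d \<noteq> 0\<close> by (simp add: a_def)
    have b: "b > 0" by (simp add: b_def add_pos_nonneg)
    have "0 \<le> (a/b)\<^sup>2 * (l * (norm d)\<^sup>2 - Q d) - 2 * (a/b) * a"
      using ineq[of "a/b"] by (simp add: a_def)
    also have "\<dots> \<le> (a/b)\<^sup>2 * b - 2 * (a/b) * a"
      by (intro diff_right_mono mult_left_mono) (auto simp: b_def)
    also have "\<dots> = - (a\<^sup>2 / b)" using b by (simp add: power2_eq_square field_simps)
    also have "\<dots> < 0" using a b by simp
    finally show False by simp
  qed
  hence "A *v v = of_real l *s v"
    by (simp add: d_def vec_eq_iff scaleR_conv_of_real[where 'a=complex])
  with v show ?thesis using that by (auto simp: V_def)
qed

definition eigen_frame :: "complex^'k::finite^'k \<Rightarrow> (complex^'k) set \<Rightarrow> bool" where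
  "eigen_frame A S \<longleftrightarrow> (\<forall>e\<in>S. norm e = 1 \<and> (\<exists>l. A *v e = complex_of_real l *s e)) \<and>
     (\<forall>e\<in>S. \<forall>e'\<in>S. e \<noteq> e' \<longrightarrow> cip e e' = 0)"

text \<open>Complex orthogonality implies real orthogonality, hence real independence. The bound is
  the real dimension, twice the complex one; it enters later only as a constant factor.\<close>

lemma eigen_frame_bound:
  fixes S :: "(complex^'k::finite) set"
  assumes "eigen_frame A S" shows "finite S" "card S \<le> DIM(complex^'k)"
proof -
  have "pairwise orthogonal S"
    using assms unfolding eigen_frame_def pairwise_def orthogonal_def by (metis Re_cip zero_complex.simps(1))
  moreover have "0 \<notin> S" using assms unfolding eigen_frame_def by force
  ultimately have "independent S" by (rule pairwise_orthogonal_independent)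
  thus "finite S" "card S \<le> DIM(complex^'k)" using independent_bound by blast+
qed

text \<open>Cardinalities of eigenframes are bounded, so a largest one exists. A nonzero vector
  orthogonal to it would yield one more unit eigenvector; hence the remainder of the expansion of x,
  being orthogonal to the frame, is zero.\<close>

lemma hermitian_spectral:
  fixes A :: "complex^'k::finite^'k"
  assumes herm: "hermitian_mat A"
  obtains S where "eigen_frame A S" "finite S" "card S \<le> DIM(complex^'k)"
    "\<And>x. x = (\<Sum>e\<in>S. cip x e *s e)"
proof -
  have "eigen_frame A {}" by (simp add: eigen_frame_def)
  then obtain S where S: "eigen_frame A S" and mx: "\<And>T. eigen_frame A T \<Longrightarrow> card T \<le> card S"
    using ex_has_greatest_nat[of "eigen_frame A" "{}" card "DIM(complex^'k) + 1"] eigen_frame_bound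
    by (metis less_add_one le_less_trans less_imp_le)
  note fS = eigen_frame_bound[OF S]
  have triv: "x = 0" if x: "\<And>e. e \<in> S \<Longrightarrow> cip x e = 0" for x
  proof (rule ccontr)
    assume "x \<noteq> 0"
    obtain v l where v: "norm v = 1" "A *v v = of_real l *s v" "\<And>e. e \<in> S \<Longrightarrow> cip v e = 0"
      using hermitian_eigenvector_in_complement[OF herm, of S x] S x \<open>x \<noteq> 0\<close>
      unfolding eigen_frame_def by metis
    have "v \<notin> S"
    proof
      assume "v \<in> S"
      hence "cip v v = 0" using v(3) by blast
      thus False using v(1) by (simp add: cip_self)
    qed
    have "eigen_frame A (insert v S)"
      unfolding eigen_frame_def
    proof (intro conjI ballI impI)
      fix e e' assume "e \<in> insert v S" "e' \<in> insert v S" "e \<noteq> e'"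
      thus "cip e e' = 0"
        using S v(3) cip_commute[of e v] by (auto simp: eigen_frame_def)
    qed (use S v in \<open>auto simp: eigen_frame_def\<close>)
    from mx[OF this] show False using \<open>v \<notin> S\<close> fS by simp
  qed
  have "x = (\<Sum>e\<in>S. cip x e *s e)" for x
  proof -
    have "x - (\<Sum>e\<in>S. cip x e *s e) = 0"
    proof (rule triv)
      fix e assume e: "e \<in> S"
      have "cip (\<Sum>e\<in>S. cip x e *s e) e = (\<Sum>e'\<in>S. if e' = e then cip x e else 0)"
        unfolding cip_sum_left cip_scale_left
        using S e by (intro sum.cong) (auto simp: eigen_frame_def cip_self)
      thus "cip (x - (\<Sum>e\<in>S. cip x e *s e)) e = 0"
        using e fS by (simp add: cip_diff_left)
    qed
    thus ?thesis by simp
  qed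
  thus ?thesis using that S fS by blast
qed

section \<open>The symbol as a linear family of Hermitian matrices\<close>

lemma symb_nth: "symb M \<xi> $ a $ b = (\<Sum>j\<in>UNIV. complex_of_real (\<xi> $ j) * M j $ a $ b)"
  by (simp add: symb_def)

lemma hermitian_symb:
  assumes "\<forall>j. hermitian_mat (M j)" shows "hermitian_mat (symb M \<xi>)"
  unfolding hermitian_mat_def symb_nth
proof (intro allI)
  fix a b
  have *: "M j $ a $ b = cnj (M j $ b $ a)" for j using assms unfolding hermitian_mat_def by blast
  show "(\<Sum>j\<in>UNIV. complex_of_real (\<xi> $ j) * M j $ a $ b) =
    cnj (\<Sum>j\<in>UNIV. complex_of_real (\<xi> $ j) * M j $ b $ a)"
    by (simp add: *[symmetric])
qed

lemma symb_diff: "symb M (\<xi> - \<eta>) = symb M \<xi> - symb M \<eta>"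
  by (simp add: vec_eq_iff symb_nth sum_subtractf algebra_simps)

lemma symb_scaleR: "symb M (c *\<^sub>R \<xi>) *v x = of_real c *s (symb M \<xi> *v x)"
  by (simp add: vec_eq_iff symb_nth matrix_vector_mult_def sum_distrib_left sum_distrib_right mult_ac)

lemma symb_bound:
  obtains C where "C > 0" "\<And>\<xi> x. norm (symb M \<xi> *v x) \<le> C * norm \<xi> * norm x"
proof -
  \<comment> \<open>The added 1 keeps C positive even when all coefficients vanish.\<close>
  define C where "C = (\<Sum>a\<in>UNIV. \<Sum>b\<in>UNIV. \<Sum>j\<in>UNIV. norm (M j $ a $ b)) + 1"
  have C: "C > 0" unfolding C_def by (intro add_nonneg_pos sum_nonneg) auto
  moreover have "norm (symb M \<xi> *v x) \<le> C * norm \<xi> * norm x" for \<xi> x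
  proof -
    have "norm (symb M \<xi> *v x) \<le> (\<Sum>a\<in>UNIV. norm ((symb M \<xi> *v x) $ a))"
      unfolding norm_vec_def by (rule L2_set_le_sum) simp
    also have "\<dots> \<le> (\<Sum>a\<in>UNIV. \<Sum>b\<in>UNIV. \<Sum>j\<in>UNIV. norm (M j $ a $ b) * (norm \<xi> * norm x))"
    proof (intro sum_mono)
      fix a
      have "norm ((symb M \<xi> *v x) $ a) \<le> (\<Sum>b\<in>UNIV. norm (symb M \<xi> $ a $ b * x $ b))"
        by (simp add: matrix_vector_mult_def norm_sum)
      also have "\<dots> \<le> (\<Sum>b\<in>UNIV. \<Sum>j\<in>UNIV. norm (M j $ a $ b) * (norm \<xi> * norm x))"
      proof (intro sum_mono)
        fix b
        have "norm (symb M \<xi> $ a $ b * x $ b) \<le> (\<Sum>j\<in>UNIV. \<bar>\<xi> $ j\<bar> * norm (M j $ a $ b)) * norm (x $ b)"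
          unfolding symb_nth norm_mult
          by (intro mult_right_mono order_trans[OF norm_sum]) (auto simp: norm_mult)
        also have "\<dots> = (\<Sum>j\<in>UNIV. norm (M j $ a $ b) * (\<bar>\<xi> $ j\<bar> * norm (x $ b)))"
          by (simp add: sum_distrib_left sum_distrib_right mult_ac)
        also have "\<dots> \<le> (\<Sum>j\<in>UNIV. norm (M j $ a $ b) * (norm \<xi> * norm x))"
          by (intro sum_mono mult_left_mono mult_mono component_le_norm_cart)
             (auto simp: Finite_Cartesian_Product.norm_nth_le)
        finally show "norm (symb M \<xi> $ a $ b * x $ b) \<le> (\<Sum>j\<in>UNIV. norm (M j $ a $ b) * (norm \<xi> * norm x))" .
      qed
      finally show "norm ((symb M \<xi> *v x) $ a) \<le> (\<Sum>b\<in>UNIV. \<Sum>j\<in>UNIV. norm (M j $ a $ b) * (norm \<xi> * norm x))" .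
    qed
    also have "\<dots> = (C - 1) * (norm \<xi> * norm x)"
      by (simp add: C_def sum_distrib_right)
    also have "\<dots> \<le> C * norm \<xi> * norm x" by (simp add: algebra_simps)
    finally show ?thesis .
  qed
  ultimately show ?thesis using that by blast
qed

section \<open>Resolvents of Hermitian matrices\<close>

lemma mat_diff_mult: "(A - mat z) *v x = A *v x - z *s (x :: complex^'k::finite)"
proof -
  have "(mat z *v x) = z *s x"
    by (simp add: vec_eq_iff matrix_vector_mult_def mat_def if_distrib[where f="\<lambda>c. c * _"] cong: if_cong)
  thus ?thesis by (simp add: matrix_vector_mult_diff_rdistrib)
qed

text \<open>The number \<open>cip (A *v x) x\<close> is real, so the imaginary part of
  \<open>cip ((A - mat z) *v x) x\<close> comes from z alone; Cauchy-Schwarz does the rest.\<close>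

lemma hermitian_resolvent_lower:
  assumes "hermitian_mat A"
  shows "\<bar>Im z\<bar> * norm x \<le> norm ((A - mat z) *v x)"
proof (cases "x = 0")
  case False
  have "cnj (cip (A *v x) x) = cip (A *v x) x"
    using cip_hermitian[OF assms, of x x] cip_commute[of "A *v x" x] by simp
  hence im0: "Im (cip (A *v x) x) = 0" by (metis Reals_cnj_iff complex_is_Real_iff)
  have "Im (cip ((A - mat z) *v x) x) = - Im z * (norm x)\<^sup>2"
    by (simp add: mat_diff_mult cip_diff_left cip_scale_left im0 cip_self)
  hence "\<bar>Im z\<bar> * (norm x)\<^sup>2 = \<bar>Im (cip ((A - mat z) *v x) x)\<bar>"
    by (simp add: abs_mult)
  also have "\<dots> \<le> cmod (cip ((A - mat z) *v x) x)" by (rule abs_Im_le_cmod)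
  also have "\<dots> \<le> norm ((A - mat z) *v x) * norm x" by (rule norm_cip_le)
  finally show ?thesis using False by (simp add: power2_eq_square)
qed simp

context
  fixes A :: "complex^'k::finite^'k" and z :: complex
  assumes herm: "hermitian_mat A" and im: "Im z \<noteq> 0"
begin

text \<open>\<open>matrix_inv\<close> is a choice operator, meaningful only once an inverse is known
  to exist. Injectivity follows from the lower bound, and for square matrices this gives a two-sided
  inverse.\<close>

lemma hermitian_resolvent_inverse:
  "(A - mat z) ** matrix_inv (A - mat z) = mat 1" "matrix_inv (A - mat z) ** (A - mat z) = mat 1"
proof -
  have "x = 0" if "(A - mat z) *v x = 0" for x
    using hermitian_resolvent_lower[OF herm, of z x] that im by (simp add: mult_le_0_iff)
  hence "\<exists>B. B ** (A - mat z) = mat 1" using matrix_left_invertible_ker by blast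
  hence "invertible (A - mat z)" by (simp add: invertible_left_inverse)
  hence "\<exists>B. (A - mat z) ** B = mat 1 \<and> B ** (A - mat z) = mat 1" by (simp add: invertible_def)
  from someI_ex[OF this]
  show "(A - mat z) ** matrix_inv (A - mat z) = mat 1" "matrix_inv (A - mat z) ** (A - mat z) = mat 1"
    unfolding matrix_inv_def by blast+
qed

lemma hermitian_resolvent_right: "(A - mat z) *v (matrix_inv (A - mat z) *v x) = x"
  by (simp add: matrix_vector_mul_assoc hermitian_resolvent_inverse)

lemma hermitian_resolvent_left: "matrix_inv (A - mat z) *v ((A - mat z) *v x) = x"
  by (simp add: matrix_vector_mul_assoc hermitian_resolvent_inverse)

lemma hermitian_resolvent_bound: "norm (matrix_inv (A - mat z) *v x) \<le> norm x / \<bar>Im z\<bar>"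
  using hermitian_resolvent_lower[OF herm, of z "matrix_inv (A - mat z) *v x"] im
  by (simp add: hermitian_resolvent_right field_simps)

lemma hermitian_resolvent_eigenvector:
  assumes "A *v e = of_real l *s e"
  shows "matrix_inv (A - mat z) *v e = (1 / (of_real l - z)) *s e"
proof -
  have nz: "of_real l - z \<noteq> 0" using im by (auto simp: complex_eq_iff)
  have "(A - mat z) *v ((1 / (of_real l - z)) *s e) = e"
  proof -
    have "(A - mat z) *v ((1 / (of_real l - z)) *s e) = ((1 / (of_real l - z)) * (of_real l - z)) *s e"
      unfolding mat_diff_mult vector_scalar_commute assms vec_eq_iff vector_minus_component vector_smult_component
      by (simp only: right_diff_distrib left_diff_distrib mult.assoc mult.left_commute) simp
    thus ?thesis using nz by simp
  qed
  thus ?thesis using hermitian_resolvent_left by metis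
qed

end

text \<open>The first resolvent identity: with y the resolvent at w applied to x, one has x = (A -
  z) y + (z - w) y, and the resolvent at z is applied to both terms.\<close>

lemma hermitian_resolvent_identity:
  assumes herm: "hermitian_mat A" and "Im z \<noteq> 0" "Im w \<noteq> 0"
  shows "matrix_inv (A - mat z) *v x - matrix_inv (A - mat w) *v x =
    (z - w) *s (matrix_inv (A - mat z) *v (matrix_inv (A - mat w) *v x))"
proof -
  define y where "y = matrix_inv (A - mat w) *v x"
  have x: "x = (A - mat z) *v y + (z - w) *s y"
    using hermitian_resolvent_right[OF herm assms(3), of x, folded y_def]
    unfolding mat_diff_mult by (simp add: vec_eq_iff algebra_simps)
  show ?thesis unfolding y_def[symmetric]
    by (subst x) (simp only: matrix_vector_right_distrib hermitian_resolvent_left[OF herm assms(2)] vector_scalar_commute add_diff_cancel_left')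
qed

text \<open>The second resolvent identity bounds the difference at two frequencies by the symbol of
  their difference between two resolvents, each costing \<open>1 / \<bar>Im z\<bar>\<close>. The map
  is therefore Lipschitz; what is used later is that it is measurable.\<close>

lemma continuous_symb_resolvent:
  assumes herm: "\<forall>j. hermitian_mat (M j)" and z: "Im z \<noteq> 0"
  shows "continuous_on UNIV (\<lambda>\<xi>. matrix_inv (symb M \<xi> - mat z) *v x)"
proof -
  obtain C where C: "C > 0" "\<And>\<xi> x. norm (symb M \<xi> *v x) \<le> C * norm \<xi> * norm x"
    using symb_bound[of M] by blast
  define R where "R = (\<lambda>\<xi>. matrix_inv (symb M \<xi> - mat z))"
  note hs = hermitian_symb[OF herm]
  have lip: "norm (R \<xi> *v x - R \<eta> *v x) \<le> (C * norm x / \<bar>Im z\<bar>\<^sup>2) * norm (\<xi> - \<eta>)" for \<xi> \<eta>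
  proof -
    define y where "y = R \<eta> *v x"
    have x: "x = (symb M \<xi> - mat z) *v y - symb M (\<xi> - \<eta>) *v y"
      using hermitian_resolvent_right[OF hs z, of \<eta> x]
      unfolding mat_diff_mult symb_diff matrix_vector_mult_diff_rdistrib y_def R_def by (simp add: algebra_simps)
    have "R \<xi> *v x = y - R \<xi> *v (symb M (\<xi> - \<eta>) *v y)"
      by (subst x) (simp only: matrix_vector_mult_diff_distrib R_def hermitian_resolvent_left[OF hs z])
    hence "norm (R \<xi> *v x - R \<eta> *v x) = norm (R \<xi> *v (symb M (\<xi> - \<eta>) *v y))"
      by (simp add: y_def[symmetric])
    also have "\<dots> \<le> norm (symb M (\<xi> - \<eta>) *v y) / \<bar>Im z\<bar>"
      unfolding R_def by (rule hermitian_resolvent_bound[OF hs z])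
    also have "\<dots> \<le> (C * norm (\<xi> - \<eta>) * norm y) / \<bar>Im z\<bar>"
      by (intro divide_right_mono C) auto
    also have "\<dots> \<le> (C * norm (\<xi> - \<eta>) * (norm x / \<bar>Im z\<bar>)) / \<bar>Im z\<bar>"
      unfolding y_def R_def
      by (intro divide_right_mono mult_left_mono hermitian_resolvent_bound[OF hs z]) (use C in auto)
    also have "\<dots> = (C * norm x / \<bar>Im z\<bar>\<^sup>2) * norm (\<xi> - \<eta>)" by (simp add: power2_eq_square)
    finally show ?thesis .
  qed
  have "(C * norm x / \<bar>Im z\<bar>\<^sup>2)-lipschitz_on UNIV (\<lambda>\<xi>. R \<xi> *v x)"
    using C lip by (auto simp: lipschitz_on_def dist_norm)
  thus ?thesis unfolding R_def by (rule lipschitz_on_continuous_on)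
qed

section \<open>Measurability of vector functions and matrix multipliers\<close>

lemma borel_measurable_vecI:
  fixes f :: "'a \<Rightarrow> complex^'k::finite"
  assumes "\<And>i. (\<lambda>x. f x $ i) \<in> borel_measurable N"
  shows "f \<in> borel_measurable N"
proof -
  have [measurable]: "\<And>i. (\<lambda>x. f x $ i) \<in> borel_measurable N" by fact
  have "f = (\<lambda>x. \<Sum>i\<in>UNIV. axis i (f x $ i))"
    by (rule ext) (simp add: vec_eq_iff axis_def if_distrib cong: if_cong)
  moreover have "(\<lambda>x. axis i (f x $ i)) \<in> borel_measurable N" for i
  proof -
    have "continuous_on UNIV (axis i :: complex \<Rightarrow> complex^'k)"
      unfolding axis_def
    proof (intro continuous_on_vec_lambda)
      show "continuous_on UNIV (\<lambda>x::complex. if j = i then x else 0)" for j by (cases "j = i") auto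
    qed
    hence "axis i \<in> borel_measurable (borel :: complex measure)"
      by (rule borel_measurable_continuous_onI)
    from measurable_compose[OF assms[of i] this] show ?thesis .
  qed
  ultimately show ?thesis using borel_measurable_sum[of UNIV "\<lambda>i x. axis i (f x $ i)" N] by simp
qed

lemma borel_measurable_vec_nth [measurable (raw)]:
  fixes f :: "'a \<Rightarrow> ('b::{second_countable_topology,real_normed_vector})^'k::finite"
  assumes "f \<in> borel_measurable N" shows "(\<lambda>x. f x $ i) \<in> borel_measurable N"
  by (rule measurable_compose[OF assms]) (intro borel_measurable_continuous_onI continuous_intros)

text \<open>The matrix function enters only through its action on fixed vectors, the form in which
  \<open>continuous_symb_resolvent\<close> supplies it; acting on coordinate vectors it reveals its
  entries.\<close>

lemma borel_measurable_matrix_vector_mult: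
  fixes f :: "'a \<Rightarrow> complex^'k::finite"
  assumes "\<And>x. (\<lambda>\<xi>. B \<xi> *v x) \<in> borel_measurable N" "f \<in> borel_measurable N"
  shows "(\<lambda>\<xi>. B \<xi> *v f \<xi>) \<in> borel_measurable N"
proof (rule borel_measurable_vecI)
  fix i
  have [measurable]: "(\<lambda>\<xi>. B \<xi> $ i $ j) \<in> borel_measurable N" for j
  proof -
    have "(B \<xi> *v axis j 1) $ i = B \<xi> $ i $ j" for \<xi>
      by (simp add: matrix_vector_mult_def axis_def if_distrib cong: if_cong)
    thus ?thesis using borel_measurable_vec_nth[OF assms(1)[of "axis j 1"], of i] by simp
  qed
  note assms(2)[measurable]
  show "(\<lambda>\<xi>. (B \<xi> *v f \<xi>) $ i) \<in> borel_measurable N"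
    unfolding matrix_vector_mult_def by simp
qed

lemma borel_measurable_symb_resolvent:
  assumes "\<forall>j. hermitian_mat (M j)" "Im z \<noteq> 0" "f \<in> borel_measurable borel"
  shows "(\<lambda>\<xi>. matrix_inv (symb M \<xi> - mat z) *v f \<xi>) \<in> borel_measurable borel"
  by (rule borel_measurable_matrix_vector_mult)
     (intro borel_measurable_continuous_onI continuous_symb_resolvent assms)+

section \<open>A uniform gap around the eigenvalue zero\<close>

lemma subspaces_meet:
  fixes BU BW :: "(complex^'k::finite) set"
  assumes iU: "vec.independent BU" and iW: "vec.independent BW"
    and card: "card BU + card BW > CARD('k)"
  obtains x where "x \<noteq> 0" "x \<in> vec.span BU" "x \<in> vec.span BW"
proof (rule ccontr)
  assume "\<not> thesis"
  with that have triv: "\<And>x. x \<in> vec.span BU \<Longrightarrow> x \<in> vec.span BW \<Longrightarrow> x = 0" by blast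
  note fin = vec.finiteI_independent[OF iU] vec.finiteI_independent[OF iW]
  have disj: "BU \<inter> BW = {}"
  proof -
    have "x = 0" if "x \<in> BU" "x \<in> BW" for x using triv that vec.span_base by blast
    thus ?thesis using vec.dependent_zero iU by blast
  qed
  have "vec.independent (BU \<union> BW)"
  proof (rule vec.independent_if_scalars_zero)
    fix f x assume s0: "(\<Sum>x\<in>BU \<union> BW. f x *s x) = 0" and x: "x \<in> BU \<union> BW"
    have s1: "(\<Sum>x\<in>BU. f x *s x) = - (\<Sum>x\<in>BW. f x *s x)"
      using s0 by (simp add: sum.union_disjoint[OF fin disj] eq_neg_iff_add_eq_0)
    have sp: "(\<Sum>x\<in>BU. f x *s x) \<in> vec.span BU" "(\<Sum>x\<in>BW. f x *s x) \<in> vec.span BW"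
      by (intro vec.span_sum vec.span_scale vec.span_base; assumption)+
    have "(\<Sum>x\<in>BU. f x *s x) \<in> vec.span BW"
      using vec.span_neg[OF sp(2)] s1 by simp
    hence z: "(\<Sum>x\<in>BU. f x *s x) = 0" using triv sp by blast
    hence z': "(\<Sum>x\<in>BW. f x *s x) = 0" using s1 by simp
    from x show "f x = 0"
      using vec.independentD[OF iU fin(1) order_refl z] vec.independentD[OF iW fin(2) order_refl z'] by blast
  qed (use fin in auto)
  from vec.independent_card_le_dim[OF _ this, of UNIV]
  have "card (BU \<union> BW) \<le> CARD('k)" by (simp add: vec.dim_UNIV card_cart_basis)
  thus False using card by (simp add: card_Un_disjoint[OF fin disj])
qed

text \<open>Let W be a complement of the kernel of A, on which A is bounded below. The kernel of B
  together with one eigenvector v for l nonzero spans dimension d + 1, so it meets W, of dimension K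
  - d, in some x nonzero. On x the matrix B is small, of size at most |l| times the norm, while A is
  not; as B is close to A, l cannot be small. The equality of the two kernel dimensions is what
  makes the count work.\<close>

lemma spectral_gap_local:
  fixes A :: "complex^'k::finite^'k"
  assumes dA: "vec.dim {v. A *v v = 0} = d"
  obtains c where "c > 0" "\<And>B v l. \<lbrakk>hermitian_mat B; vec.dim {v. B *v v = 0} = d;
     \<And>x. norm ((B - A) *v x) \<le> c * norm x; v \<noteq> 0; B *v v = of_real l *s v; l \<noteq> 0\<rbrakk> \<Longrightarrow> c \<le> \<bar>l\<bar>"
proof -
  \<comment> \<open>A basis of the kernel of A is extended to a basis of the whole space; the added
    vectors \<open>BW\<close> span the complement W.\<close>
  obtain BN where BN: "BN \<subseteq> {v. A *v v = 0}" "vec.independent BN" "{v. A *v v = 0} \<subseteq> vec.span BN" "card BN = d"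
    using vec.basis_exists[of "{v. A *v v = 0}"] dA by metis
  define E where "E = vec.extend_basis BN"
  have E: "BN \<subseteq> E" "vec.independent E" "vec.span E = UNIV"
    using vec.extend_basis_superset[OF BN(2)] vec.independent_extend_basis[OF BN(2)] vec.span_extend_basis[OF BN(2)]
    by (auto simp: E_def)
  define BW where "BW = E - BN"
  have iW: "vec.independent BW" using E vec.independent_mono unfolding BW_def by blast
  have "card E = CARD('k)"
    using vec.dim_eq_card_independent[OF E(2)] E(3) vec.dim_span[of E] by (simp add: card_cart_basis vec.dim_UNIV)
  hence cW: "card BW + d = CARD('k)"
    using BN(4) E vec.finiteI_independent[OF E(2)] unfolding BW_def
    by (metis card_Diff_subset card_mono finite_subset le_add_diff_inverse2)
  have kerA: "{v. A *v v = 0} = vec.span BN"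
  proof
    show "vec.span BN \<subseteq> {v. A *v v = 0}"
      using BN(1) by (intro vec.span_minimal) (auto simp: vec.subspace_def matrix_vector_right_distrib vector_scalar_commute)
  qed (rule BN(3))
  have trivial: "x = 0" if x: "x \<in> vec.span BW" "A *v x = 0" for x
  proof (rule ccontr)
    assume x0: "x \<noteq> 0"
    have xN: "x \<in> vec.span BN" using x kerA by blast
    note fin = vec.finiteI_independent[OF BN(2)] vec.finiteI_independent[OF iW]
    obtain f where f: "x = (\<Sum>b\<in>BN. f b *s b)" using xN vec.span_finite[OF fin(1)] by auto
    obtain g where g: "x = (\<Sum>b\<in>BW. g b *s b)" using x(1) vec.span_finite[OF fin(2)] by auto
    define h where "h = (\<lambda>b. if b \<in> BN then f b else - g b)"
    have EE: "E = BN \<union> BW" "BN \<inter> BW = {}" using E by (auto simp: BW_def)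
    have "(\<Sum>b\<in>E. h b *s b) = (\<Sum>b\<in>BN. h b *s b) + (\<Sum>b\<in>BW. h b *s b)"
      unfolding EE by (rule sum.union_disjoint[OF fin EE(2)])
    also have "(\<Sum>b\<in>BN. h b *s b) = x" using f by (simp add: h_def)
    also have "(\<Sum>b\<in>BW. h b *s b) = (\<Sum>b\<in>BW. - (g b *s b))"
      by (intro sum.cong) (auto simp: h_def BW_def vec_eq_iff)
    also have "\<dots> = - x" using g by (simp add: sum_negf)
    finally have "(\<Sum>b\<in>E. h b *s b) = 0" by simp
    hence "h b = 0" if "b \<in> E" for b
      using vec.independentD[OF E(2) vec.finiteI_independent[OF E(2)] order_refl _ that] by blast
    hence "f b = 0" if "b \<in> BN" for b using that E(1) unfolding h_def by (metis subsetD)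
    hence "x = 0" using f by simp
    thus False using x0 by simp
  qed
  have clW: "closed (vec.span BW)"
  proof (rule closed_subspace)
    show "subspace (vec.span BW)"
      unfolding subspace_def
    proof (intro conjI ballI allI)
      fix x c assume "x \<in> vec.span BW"
      hence "complex_of_real c *s x \<in> vec.span BW" by (rule vec.span_scale)
      moreover have "complex_of_real c *s x = c *\<^sub>R x" by (simp add: vec_eq_iff scaleR_conv_of_real[where 'a=complex])
      ultimately show "c *\<^sub>R x \<in> vec.span BW" by simp
    qed (auto intro: vec.span_zero vec.span_add)
  qed
  \<comment> \<open>A is injective on W, so compactness of the unit sphere of W gives a lower bound.
    If that sphere is empty, W is zero and any constant will do, here 1.\<close>
  obtain c0 where c0: "c0 > 0" "\<And>x. x \<in> vec.span BW \<Longrightarrow> c0 * norm x \<le> norm (A *v x)"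
  proof (cases "vec.span BW \<inter> sphere 0 1 = {}")
    case True
    have "x = 0" if x: "x \<in> vec.span BW" for x
    proof (rule ccontr)
      assume "x \<noteq> 0"
      have "complex_of_real (1 / norm x) *s x \<in> vec.span BW" using x by (rule vec.span_scale)
      moreover have "norm (complex_of_real (1 / norm x) *s x) = 1"
        using \<open>x \<noteq> 0\<close> unfolding norm_cscale by (simp add: norm_divide)
      ultimately show False using True by (auto simp: sphere_def)
    qed
    thus ?thesis using that[of 1] by force
  next
    case False
    have "continuous_on (vec.span BW \<inter> sphere 0 1) (\<lambda>x. norm (A *v x))"
      by (intro continuous_on_norm linear_continuous_on) (simp add: linear_conv_bounded_linear[symmetric])
    from continuous_attains_inf[OF _ False this] clW
    obtain w where w: "w \<in> vec.span BW" "norm w = 1"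
      "\<And>x. x \<in> vec.span BW \<Longrightarrow> norm x = 1 \<Longrightarrow> norm (A *v w) \<le> norm (A *v x)"
      by (auto simp: closed_Int_compact)
    show ?thesis
    proof (rule that)
      show "norm (A *v w) > 0" using trivial[OF w(1)] w(2) by force
      fix x assume x: "x \<in> vec.span BW"
      show "norm (A *v w) * norm x \<le> norm (A *v x)"
      proof (cases "x = 0")
        case False
        have "norm (A *v w) \<le> norm (A *v (complex_of_real (1 / norm x) *s x))"
          using False by (intro w(3) vec.span_scale x) (simp add: norm_cscale norm_divide)
        also have "\<dots> = norm (A *v x) / norm x"
          by (simp add: vector_scalar_commute norm_cscale norm_divide)
        finally show ?thesis using False by (simp add: field_simps)
      qed simp
    qed
  qed
  \<comment> \<open>Half of the lower bound is spent on the perturbation B - A, the other half is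
    left for the eigenvalue.\<close>
  show ?thesis
  proof (rule that[of "c0 / 2"])
    show "c0 / 2 > 0" using c0 by simp
    fix B :: "complex^'k^'k" and v l
    assume B: "hermitian_mat B" "vec.dim {v. B *v v = 0} = d" "\<And>x. norm ((B - A) *v x) \<le> c0/2 * norm x"
      and v: "v \<noteq> 0" "B *v v = of_real l *s v" "l \<noteq> 0"
    obtain BK where BK: "BK \<subseteq> {v. B *v v = 0}" "vec.independent BK" "{v. B *v v = 0} \<subseteq> vec.span BK" "card BK = d"
      using vec.basis_exists[of "{v. B *v v = 0}"] B(2) by metis
    have kerB: "{v. B *v v = 0} = vec.span BK"
    proof
      show "vec.span BK \<subseteq> {v. B *v v = 0}"
        using BK(1) by (intro vec.span_minimal) (auto simp: vec.subspace_def matrix_vector_right_distrib vector_scalar_commute)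
    qed (rule BK(3))
    have "B *v v \<noteq> 0" using v by (auto simp: vec_eq_iff)
    hence vn: "v \<notin> vec.span BK" using kerB by blast
    have iU: "vec.independent (insert v BK)" using vn BK(2) vec.independent_insertI by blast
    have "card (insert v BK) = d + 1"
      using vn vec.span_base vec.finiteI_independent[OF BK(2)] BK(4) by (subst card_insert_disjoint) auto
    then obtain x where x: "x \<noteq> 0" "x \<in> vec.span (insert v BK)" "x \<in> vec.span BW"
      using subspaces_meet[OF iU iW] cW by auto
    obtain a where a: "x - a *s v \<in> vec.span BK" using x(2) vec.span_insert[of v BK] by auto
    define k where "k = x - a *s v"
    have k: "B *v k = 0" using a kerB k_def by blast
    have xk: "x = k + a *s v" by (simp add: k_def)
    \<comment> \<open>Eigenvectors of B for the distinct eigenvalues l and 0 are orthogonal, so by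
      Pythagoras the component of x along v is no longer than x.\<close>
    have "complex_of_real l * cip v k = 0"
      using cip_hermitian[OF B(1), of v k] by (simp add: v cip_scale_left k)
    hence ort: "cip v k = 0" "cip k v = 0" using v cip_commute[of k v] by auto
    have "complex_of_real ((norm x)\<^sup>2) = cip k k + a * cnj a * cip v v"
      by (simp only: cip_self[symmetric] xk cip_add_left cip_add_right cip_scale_left cip_scale_right ort)
         (simp add: algebra_simps)
    also have "\<dots> = complex_of_real ((norm k)\<^sup>2 + (cmod a * norm v)\<^sup>2)"
      by (simp only: cip_self complex_norm_square[symmetric]) (simp add: power_mult_distrib)
    finally have "(norm x)\<^sup>2 = (norm k)\<^sup>2 + (cmod a * norm v)\<^sup>2" by (simp only: of_real_eq_iff)
    hence "(cmod a * norm v)\<^sup>2 \<le> (norm x)\<^sup>2" by simp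
    hence av: "cmod a * norm v \<le> norm x" by (rule power2_le_imp_le) simp
    have "c0 * norm x \<le> norm (A *v x)" by (rule c0(2)[OF x(3)])
    also have "A *v x = B *v x - (B - A) *v x" by (simp add: matrix_vector_mult_diff_rdistrib)
    also have "norm \<dots> \<le> norm (B *v x) + norm ((B - A) *v x)" by (rule norm_triangle_ineq4)
    also have "B *v x = a *s (of_real l *s v)"
      by (simp add: xk matrix_vector_right_distrib k vector_scalar_commute v)
    also have "norm \<dots> = \<bar>l\<bar> * (cmod a * norm v)" by (simp only: norm_cscale norm_of_real) simp
    also have "\<dots> \<le> \<bar>l\<bar> * norm x" using av by (intro mult_left_mono) auto
    finally have "c0 * norm x \<le> \<bar>l\<bar> * norm x + c0/2 * norm x" using B(3)[of x] by linarith
    hence "(c0/2) * norm x \<le> \<bar>l\<bar> * norm x" by (simp add: algebra_simps)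
    thus "c0/2 \<le> \<bar>l\<bar>" using x(1) by simp
  qed
qed

text \<open>By homogeneity only the unit sphere matters. If no constant worked there, unit
  frequencies violating the constants 1 / (m + 1) would accumulate at some w; strong propagativity
  gives all of them the kernel dimension of w, and the local gap at w is contradicted.\<close>

lemma spectral_gap:
  fixes M :: "'n::finite \<Rightarrow> complex^'k::finite^'k"
  assumes herm: "\<forall>j. hermitian_mat (M j)" and sp: "strongly_propagative M"
  obtains c where "c > 0"
    "\<And>\<xi> v l. v \<noteq> 0 \<Longrightarrow> symb M \<xi> *v v = of_real l *s v \<Longrightarrow> l \<noteq> 0 \<Longrightarrow> c * norm \<xi> \<le> \<bar>l\<bar>"
proof -
  obtain d where d: "\<And>\<xi>. \<xi> \<noteq> 0 \<Longrightarrow> vec.dim {v. symb M \<xi> *v v = 0} = d"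
    using sp unfolding strongly_propagative_def by blast
  obtain C where C: "C > 0" "\<And>\<xi> x. norm (symb M \<xi> *v x) \<le> C * norm \<xi> * norm x"
    using symb_bound[of M] by blast
  define P where "P = (\<lambda>c \<xi>. \<forall>v l. v \<noteq> 0 \<longrightarrow> symb M \<xi> *v v = of_real l *s v \<longrightarrow> l \<noteq> 0 \<longrightarrow> c \<le> \<bar>l\<bar>)"
  have "\<exists>c>0. \<forall>\<xi>. norm \<xi> = 1 \<longrightarrow> P c \<xi>"
  proof (rule ccontr)
    assume "\<not> ?thesis"
    hence neg: "\<And>c. c > 0 \<Longrightarrow> \<exists>\<xi>. norm \<xi> = 1 \<and> \<not> P c \<xi>" by blast
    have "\<forall>m. \<exists>\<xi>. norm \<xi> = 1 \<and> \<not> P (1 / real (Suc m)) \<xi>" using neg by simp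
    then obtain X where X: "\<And>m. norm (X m) = 1" "\<And>m. \<not> P (1 / real (Suc m)) (X m)" by metis
    have "seq_compact (sphere (0::real^'n) 1)" using compact_imp_seq_compact compact_sphere by blast
    then obtain w r where w: "w \<in> sphere 0 1" "strict_mono r" "(X \<circ> r) \<longlonglongrightarrow> w"
      using X(1) unfolding seq_compact_def by (metis mem_sphere_0)
    have w0: "w \<noteq> 0" using w(1) by auto
    obtain c where c: "c > 0" "\<And>B v l. \<lbrakk>hermitian_mat B; vec.dim {v. B *v v = 0} = d;
     \<And>x. norm ((B - symb M w) *v x) \<le> c * norm x; v \<noteq> 0; B *v v = of_real l *s v; l \<noteq> 0\<rbrakk> \<Longrightarrow> c \<le> \<bar>l\<bar>"
      using spectral_gap_local[OF d[OF w0]] by blast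
    have "\<forall>\<^sub>F m in sequentially. dist ((X \<circ> r) m) w < c / C"
      using tendstoD[OF w(3), of "c / C"] c(1) C(1) by simp
    moreover have "\<forall>\<^sub>F m in sequentially. 1 / real (Suc m) < c"
      using c LIMSEQ_inverse_real_of_nat by (auto simp: inverse_eq_divide dest: order_tendstoD(2))
    ultimately have "\<forall>\<^sub>F m in sequentially. dist ((X \<circ> r) m) w < c / C \<and> 1 / real (Suc m) < c"
      by eventually_elim auto
    then obtain m where m: "dist (X (r m)) w < c / C" "1 / real (Suc m) < c"
      by (auto simp: eventually_sequentially)
    have "m \<le> r m" using w(2) by (simp add: seq_suble)
    hence "1 / real (Suc (r m)) \<le> 1 / real (Suc m)" by (simp add: frac_le)
    hence m2: "1 / real (Suc (r m)) \<le> c" using m by linarith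
    have bd: "norm ((symb M (X (r m)) - symb M w) *v x) \<le> c * norm x" for x
    proof -
      have "norm (symb M (X (r m) - w) *v x) \<le> C * norm (X (r m) - w) * norm x" by (rule C)
      also have "\<dots> \<le> c * norm x"
        using m(1) C(1) by (intro mult_right_mono) (auto simp: dist_norm field_simps)
      finally show ?thesis by (simp add: symb_diff)
    qed
    have "X (r m) \<noteq> 0" using X(1)[of "r m"] by auto
    hence "P c (X (r m))"
      unfolding P_def using c(2)[OF hermitian_symb[OF herm] d bd] by blast
    hence "P (1 / real (Suc (r m))) (X (r m))" using m2 unfolding P_def by (meson order_trans)
    thus False using X(2) by blast
  qed
  then obtain c where c: "c > 0" "\<And>\<xi>. norm \<xi> = 1 \<Longrightarrow> P c \<xi>" by blast
  show ?thesis
  proof (rule that[OF c(1)])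
    fix \<xi> v l assume v: "v \<noteq> 0" "symb M \<xi> *v v = of_real l *s v" "l \<noteq> 0"
    show "c * norm \<xi> \<le> \<bar>l\<bar>"
    proof (cases "\<xi> = 0")
      case False
      have "symb M ((1 / norm \<xi>) *\<^sub>R \<xi>) *v v = of_real (l / norm \<xi>) *s v"
        unfolding symb_scaleR v by (simp add: vec_eq_iff)
      moreover have "P c ((1 / norm \<xi>) *\<^sub>R \<xi>)" using False by (intro c) simp
      ultimately have "c \<le> \<bar>l / norm \<xi>\<bar>" using v False unfolding P_def by (metis divide_eq_0_iff norm_eq_zero)
      thus ?thesis using False by (simp add: field_simps)
    qed simp
  qed
qed

subsection \<open>Singular integrals along a ray\<close>

lemma integrable_mult_L2:
  fixes f g :: "'a \<Rightarrow> real"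
  assumes [measurable]: "f \<in> borel_measurable N" "g \<in> borel_measurable N"
    and "integrable N (\<lambda>x. (f x)\<^sup>2)" "integrable N (\<lambda>x. (g x)\<^sup>2)"
  shows "integrable N (\<lambda>x. f x * g x)"
proof (rule Bochner_Integration.integrable_bound[OF Bochner_Integration.integrable_add[OF assms(3,4)]])
  have "\<bar>a * b\<bar> \<le> a\<^sup>2 + b\<^sup>2" for a b :: real
  proof -
    have "2 * (\<bar>a\<bar> * \<bar>b\<bar>) \<le> a\<^sup>2 + b\<^sup>2"
      using sum_squares_bound[of "\<bar>a\<bar>" "\<bar>b\<bar>"] by simp
    moreover have "0 \<le> \<bar>a\<bar> * \<bar>b\<bar>" by simp
    ultimately show ?thesis unfolding abs_mult by linarith
  qed
  thus "AE x in N. norm (f x * g x) \<le> norm ((f x)\<^sup>2 + (g x)\<^sup>2)" by simp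
qed simp

lemma Cauchy_Schwarz_integral:
  fixes f g :: "'a \<Rightarrow> real"
  assumes [measurable]: "f \<in> borel_measurable N" "g \<in> borel_measurable N"
    and i: "integrable N (\<lambda>x. (f x)\<^sup>2)" "integrable N (\<lambda>x. (g x)\<^sup>2)"
  shows "(\<integral>x. f x * g x \<partial>N) \<le> sqrt (\<integral>x. (f x)\<^sup>2 \<partial>N) * sqrt (\<integral>x. (g x)\<^sup>2 \<partial>N)"
proof -
  define a b c where "a = (\<integral>x. (f x)\<^sup>2 \<partial>N)" and "b = (\<integral>x. f x * g x \<partial>N)" and "c = (\<integral>x. (g x)\<^sup>2 \<partial>N)"
  have fg: "integrable N (\<lambda>x. f x * g x)" by (rule integrable_mult_L2) (use assms in auto)
  have q: "0 \<le> a - 2 * t * b + t\<^sup>2 * c" for t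
  proof -
    have "0 \<le> (\<integral>x. (f x - t * g x)\<^sup>2 \<partial>N)" by simp
    also have "\<dots> = (\<integral>x. (f x)\<^sup>2 - 2 * t * (f x * g x) + t\<^sup>2 * (g x)\<^sup>2 \<partial>N)"
      by (simp add: power2_diff power_mult_distrib algebra_simps)
    also have "\<dots> = a - 2 * t * b + t\<^sup>2 * c"
      using fg i by (simp add: a_def b_def c_def)
    finally show ?thesis .
  qed
  have nn: "a \<ge> 0" "c \<ge> 0" by (auto simp: a_def c_def)
  have "b\<^sup>2 \<le> a * c"
  proof (cases "c = 0")
    case True
    have "b = 0"
    proof (rule ccontr)
      assume "b \<noteq> 0"
      \<comment> \<open>For c = 0 the quadratic is affine in t, and at this t its value is
        -1.\<close>
      have "0 \<le> a - 2 * ((a + 1) / (2 * b)) * b" using q[of "(a + 1) / (2 * b)"] True by simp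
      thus False using \<open>b \<noteq> 0\<close> by simp
    qed
    thus ?thesis using True by simp
  next
    case False
    hence "c > 0" using nn by simp
    have "0 \<le> a - b\<^sup>2 / c" using q[of "b / c"] \<open>c > 0\<close> by (simp add: power2_eq_square field_simps)
    thus ?thesis using \<open>c > 0\<close> by (simp add: field_simps)
  qed
  hence "sqrt (b\<^sup>2) \<le> sqrt (a * c)" by (rule real_sqrt_le_mono)
  thus ?thesis unfolding a_def b_def c_def by (simp add: real_sqrt_mult)
qed

section \<open>The model kernel and its scaling\<close>

definition singular_const :: "real \<Rightarrow> real" where
  "singular_const \<alpha> = enn2real (\<integral>\<^sup>+ s. ennreal (\<bar>s\<bar> powr \<alpha> / (1 + s\<^sup>2)) \<partial>lborel)"

text \<open>Since \<open>enn2real\<close> sends infinity to 0, \<open>singular_const\<close> carries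
  information only through this lemma. On [-1, 1] the integrand is at most 1; outside, \<alpha> at
  most 1/2 gives the majorant |s| to the power -3/2, written as g on the positive half-line and its
  reflection.\<close>

lemma singular_const_finite:
  assumes "0 < \<alpha>" "\<alpha> \<le> 1/2"
  shows "(\<integral>\<^sup>+ s. ennreal (\<bar>s\<bar> powr \<alpha> / (1 + s\<^sup>2)) \<partial>lborel) = ennreal (singular_const \<alpha>)"
proof -
  define g where "g = (\<lambda>s::real. indicator {1..} s * s powr (-3/2))"
  have gi: "(\<integral>\<^sup>+ s. ennreal (g s) \<partial>lborel) < \<infinity>"
  proof -
    have "((\<lambda>x. x powr (-3/2)) has_integral -(1 powr (-3/2+1)) / (-3/2+1)) {1::real..}"
      by (rule has_integral_powr_to_inf) auto
    from nn_integral_has_integral_lborel[OF _ _ has_integral_restrict_UNIV[THEN iffD2, OF this]]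
    have "(\<integral>\<^sup>+ s. ennreal (if s \<in> {1..} then s powr (-3/2) else 0) \<partial>lborel) = ennreal (-(1 powr (-3/2+1)) / (-3/2+1))"
      by (auto simp: measurable_If_set)
    moreover have "(\<lambda>s. ennreal (if s \<in> {1..} then s powr (-3/2) else 0)) = (\<lambda>s. ennreal (g s))"
      by (auto simp: g_def)
    ultimately show ?thesis by simp
  qed
  have gm[measurable]: "g \<in> borel_measurable borel" unfolding g_def by simp
  have gn: "g s \<ge> 0" for s by (simp add: g_def)
  have refl: "(\<integral>\<^sup>+ s. ennreal (g (-s)) \<partial>lborel) = (\<integral>\<^sup>+ s. ennreal (g s) \<partial>lborel)"
    using nn_integral_real_affine[of "\<lambda>s. ennreal (g s)" "-1" 0] by simp
  have pw: "\<bar>s\<bar> powr \<alpha> / (1 + s\<^sup>2) \<le> g s + (g (-s) + indicator {-1..1} s)" for s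
  proof (cases "\<bar>s\<bar> \<le> 1")
    case True
    have "\<bar>s\<bar> powr \<alpha> \<le> 1" using True assms by (auto intro: powr_le1)
    hence "\<bar>s\<bar> powr \<alpha> / (1 + s\<^sup>2) \<le> 1" by (simp add: divide_le_eq_1 add_nonneg_pos) (smt (verit) zero_le_power2)
    thus ?thesis using True gn[of s] gn[of "-s"] by (auto simp: indicator_def)
  next
    case False
    hence s1: "\<bar>s\<bar> > 1" by simp
    have "\<bar>s\<bar> powr \<alpha> / (1 + s\<^sup>2) \<le> \<bar>s\<bar> powr (1/2) / s\<^sup>2"
      using s1 assms by (intro frac_le powr_mono) auto
    also have "s\<^sup>2 = \<bar>s\<bar> powr 2" using s1 by (simp add: powr_numeral)
    also have "\<bar>s\<bar> powr (1/2) / \<bar>s\<bar> powr 2 = \<bar>s\<bar> powr (-3/2)"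
      by (subst powr_diff[symmetric]) simp
    also have "\<dots> \<le> g s + g (-s)" using s1 by (cases "s \<ge> 0") (auto simp: g_def indicator_def)
    finally show ?thesis by (auto simp: indicator_def)
  qed
  have "(\<integral>\<^sup>+ s. ennreal (\<bar>s\<bar> powr \<alpha> / (1 + s\<^sup>2)) \<partial>lborel) \<le>
      (\<integral>\<^sup>+ s. ennreal (g s) + (ennreal (g (-s)) + indicator {-1..1} s) \<partial>lborel)"
  proof (intro nn_integral_mono)
    fix s
    have "ennreal (\<bar>s\<bar> powr \<alpha> / (1 + s\<^sup>2)) \<le> ennreal (g s + (g (-s) + indicator {-1..1} s))"
      by (intro ennreal_leI pw)
    also have "\<dots> = ennreal (g s) + (ennreal (g (-s)) + indicator {-1..1} s)"
      using gn by (simp add: ennreal_plus ennreal_indicator)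
    finally show "ennreal (\<bar>s\<bar> powr \<alpha> / (1 + s\<^sup>2)) \<le> ennreal (g s) + (ennreal (g (-s)) + indicator {-1..1} s)" .
  qed
  also have "\<dots> = (\<integral>\<^sup>+ s. ennreal (g s) \<partial>lborel) + ((\<integral>\<^sup>+ s. ennreal (g (-s)) \<partial>lborel) + 2)"
    by (simp add: nn_integral_add)
  also have "\<dots> < \<infinity>" using gi by (simp add: refl ennreal_add_eq_top less_top)
  finally show ?thesis unfolding singular_const_def by (simp add: less_top)
qed

lemma singular_const_nonneg: "singular_const \<alpha> \<ge> 0"
  by (simp add: singular_const_def)

text \<open>The substitution t = r + c s with c = |y| / |l| reduces the integral to the model
  kernel. Beyond the resonance width c, the numerator gains only c to the power \<alpha>, which is
  where the exponent \<alpha> - 1 of |y| originates.\<close>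

lemma nn_integral_singular_kernel:
  assumes \<alpha>: "0 < \<alpha>" "\<alpha> \<le> 1/2" and l: "l \<noteq> 0" and y: "y \<noteq> 0"
  shows "(\<integral>\<^sup>+ t. ennreal (\<bar>t - r\<bar> powr \<alpha> / ((l * (t - r))\<^sup>2 + y\<^sup>2)) \<partial>lborel) =
    ennreal (singular_const \<alpha> * \<bar>l\<bar> powr (-1 - \<alpha>) * \<bar>y\<bar> powr (\<alpha> - 1))"
proof -
  define c where "c = \<bar>y\<bar> / \<bar>l\<bar>"
  have c: "c > 0" using l y by (simp add: c_def)
  have "(\<integral>\<^sup>+ t. ennreal (\<bar>t - r\<bar> powr \<alpha> / ((l * (t - r))\<^sup>2 + y\<^sup>2)) \<partial>lborel) =
     \<bar>c\<bar> * (\<integral>\<^sup>+ s. ennreal (\<bar>(r + c * s) - r\<bar> powr \<alpha> / ((l * ((r + c * s) - r))\<^sup>2 + y\<^sup>2)) \<partial>lborel)"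
    by (rule nn_integral_real_affine) (use c in auto)
  also have "\<dots> = ennreal c * (\<integral>\<^sup>+ s. ennreal (c powr \<alpha> / y\<^sup>2) * ennreal (\<bar>s\<bar> powr \<alpha> / (1 + s\<^sup>2)) \<partial>lborel)"
  proof -
    have "\<bar>(r + c * s) - r\<bar> powr \<alpha> / ((l * ((r + c * s) - r))\<^sup>2 + y\<^sup>2) = (c powr \<alpha> / y\<^sup>2) * (\<bar>s\<bar> powr \<alpha> / (1 + s\<^sup>2))" for s
    proof -
      have "(l * ((r + c * s) - r))\<^sup>2 = y\<^sup>2 * s\<^sup>2"
        using l by (simp add: c_def power_mult_distrib power_divide)
      hence "(l * ((r + c * s) - r))\<^sup>2 + y\<^sup>2 = y\<^sup>2 * (1 + s\<^sup>2)" by (simp add: algebra_simps)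
      moreover have "\<bar>(r + c * s) - r\<bar> powr \<alpha> = c powr \<alpha> * \<bar>s\<bar> powr \<alpha>"
        using c by (simp add: abs_mult powr_mult)
      ultimately show ?thesis by simp
    qed
    thus ?thesis using c by (simp add: ennreal_mult'[symmetric])
  qed
  also have "\<dots> = ennreal (c * (c powr \<alpha> / y\<^sup>2) * singular_const \<alpha>)"
    using c singular_const_nonneg[of \<alpha>]
    by (subst nn_integral_cmult) (auto simp: singular_const_finite[OF \<alpha>] ennreal_mult'[symmetric] mult_ac)
  also have "c * (c powr \<alpha> / y\<^sup>2) * singular_const \<alpha> = singular_const \<alpha> * \<bar>l\<bar> powr (-1 - \<alpha>) * \<bar>y\<bar> powr (\<alpha> - 1)"
  proof -
    have "c * c powr \<alpha> = c powr (1 + \<alpha>)" using c by (simp add: powr_add)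
    also have "\<dots> = \<bar>y\<bar> powr (1 + \<alpha>) * \<bar>l\<bar> powr (- (1 + \<alpha>))"
      unfolding c_def powr_minus by (simp add: powr_divide divide_inverse[symmetric])
    finally have 1: "c * c powr \<alpha> = \<bar>y\<bar> powr (1 + \<alpha>) * \<bar>l\<bar> powr (-1 - \<alpha>)" by simp
    have "y\<^sup>2 = \<bar>y\<bar> powr 2" using y by (simp add: powr_numeral)
    hence "\<bar>y\<bar> powr (1 + \<alpha>) / y\<^sup>2 = \<bar>y\<bar> powr (1 + \<alpha> - 2)" by (simp only: powr_diff)
    hence "\<bar>y\<bar> powr (1 + \<alpha>) / y\<^sup>2 = \<bar>y\<bar> powr (\<alpha> - 1)" by simp
    moreover have "c * (c powr \<alpha> / y\<^sup>2) * singular_const \<alpha> =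
      singular_const \<alpha> * \<bar>l\<bar> powr (-1 - \<alpha>) * (\<bar>y\<bar> powr (1 + \<alpha>) / y\<^sup>2)"
      unfolding times_divide_eq_right 1 by (simp add: mult_ac)
    ultimately show ?thesis by simp
  qed
  finally show ?thesis .
qed

definition wt :: "real \<Rightarrow> real" where "wt t = (t - 1) * (2 - t)"

lemma wt_bounds:
  assumes "t \<in> {1..2}" shows "0 \<le> wt t" "wt t \<le> t - 1" "wt t \<le> 2 - t" "wt t \<le> 1"
proof -
  show "0 \<le> wt t" "wt t \<le> t - 1" "wt t \<le> 2 - t" using assms
    by (auto simp: wt_def mult_left_le mult_left_le_one_le)
  thus "wt t \<le> 1" using assms by auto
qed

lemma cmod_linear_resolvent_sq:
  "l \<noteq> 0 \<Longrightarrow> (cmod (of_real (l * t) - z))\<^sup>2 = (l * (t - Re z / l))\<^sup>2 + (Im z)\<^sup>2"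
  by (simp add: cmod_power2 right_diff_distrib)

lemma le_powr_self: "0 \<le> x \<Longrightarrow> x \<le> 1 \<Longrightarrow> \<alpha> \<le> 1 \<Longrightarrow> x \<le> x powr (\<alpha>::real)"
  by (cases "x = 0") (use powr_mono'[of \<alpha> 1 x] in auto)

text \<open>Terms that stay bounded near the real axis are absorbed into the singular power by this
  inequality, at the price of a factor 3; it is the reason for keeping |Im z| at most 3.\<close>

lemma powr_ge_const:
  assumes "0 < \<alpha>" "\<alpha> \<le> 1/2" "0 < y" "y \<le> 3" shows "(1::real) \<le> 3 * y powr (\<alpha> - 1)"
proof -
  have "3 powr (\<alpha> - 1) \<le> y powr (\<alpha> - 1)" using assms by (intro powr_mono2') auto
  moreover have "(3::real) powr (-1) \<le> 3 powr (\<alpha> - 1)" using assms by (intro powr_mono) auto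
  ultimately show ?thesis by (simp add: powr_minus)
qed

text \<open>The weight vanishes at the end points of the interval, so the boundary terms of the
  subtracted constant stay bounded uniformly in the position of the singularity.\<close>

lemma singular_integral_bound:
  fixes h :: "real \<Rightarrow> complex"
  assumes \<alpha>: "0 < \<alpha>" "\<alpha> \<le> 1/2" and m: "0 < m" and l: "m / 4 \<le> \<bar>l\<bar>"
    and z: "Im z \<noteq> 0" "\<bar>Im z\<bar> \<le> 3"
    and hc: "continuous_on {1..2} h"
    and hb: "\<And>t. t \<in> {1..2} \<Longrightarrow> cmod (h t) \<le> wt t * H"
    and hh: "\<And>t t'. t \<in> {1..2} \<Longrightarrow> t' \<in> {1..2} \<Longrightarrow> cmod (h t - h t') \<le> H * \<bar>t - t'\<bar> powr \<alpha>"
  shows "cmod (LINT t:{1..2}|lborel. h t / (of_real (l * t) - z)\<^sup>2) \<le>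
    (singular_const \<alpha> * (m/4) powr (-1 - \<alpha>) + 96 / m\<^sup>2) * H * \<bar>Im z\<bar> powr (\<alpha> - 1)"
proof -
  have l0: "l \<noteq> 0" using l m by auto
  \<comment> \<open>The parameter at which the real part of the denominator vanishes. The constant
    subtracted from h is its value there, or 0 when the resonance falls outside the
    interval.\<close>
  define r where "r = Re z / l"
  define h0 where "h0 = (if r \<in> {1..2} then h r else 0)"
  define k where "k = (\<lambda>t. (complex_of_real (l * t) - z)\<^sup>2)"
  have nz: "complex_of_real (l * t) - z \<noteq> 0" for t using z by (auto simp: complex_eq_iff)
  have k0: "k t \<noteq> 0" for t using nz by (simp add: k_def)
  have kn: "cmod (k t) = (l * (t - r))\<^sup>2 + (Im z)\<^sup>2" for t
    unfolding k_def norm_power r_def by (rule cmod_linear_resolvent_sq[OF l0])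
  have H0: "H \<ge> 0" using hh[of 1 2] order_trans[OF norm_ge_zero[of "h 1 - h 2"]] by simp
  have contk: "continuous_on {1..2} k" unfolding k_def by (intro continuous_intros)
  have int1: "set_integrable lborel {1..2} (\<lambda>t. (h t - h0) / k t)"
    by (intro borel_integrable_atLeastAtMost' continuous_intros hc contk) (use k0 in auto)
  have int2: "set_integrable lborel {1..2} (\<lambda>t. h0 / k t)"
    by (intro borel_integrable_atLeastAtMost' continuous_intros contk) (use k0 in auto)
  have split: "(LINT t:{1..2}|lborel. h t / k t) =
     (LINT t:{1..2}|lborel. (h t - h0) / k t) + (LINT t:{1..2}|lborel. h0 / k t)"
    using set_integral_add(2)[OF int1 int2] by (simp add: diff_divide_distrib)
  have hdiff: "cmod (h t - h0) \<le> H * \<bar>t - r\<bar> powr \<alpha>" if t: "t \<in> {1..2}" for t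
  proof (cases "r \<in> {1..2}")
    case True thus ?thesis using hh[OF t True] by (simp add: h0_def)
  next
    case False
    note w = wt_bounds[OF t]
    \<comment> \<open>With the resonance outside, t is farther from r than from the end point of the
      interval on that side, and the weight is at most the distance to either end point. So the
      vanishing of the weight replaces the missing Hoelder estimate at r.\<close>
    have "wt t \<le> \<bar>t - r\<bar>" using False w(2,3) t by auto
    moreover have "wt t \<le> wt t powr \<alpha>" using w \<alpha> by (intro le_powr_self) auto
    moreover have "wt t powr \<alpha> \<le> \<bar>t - r\<bar> powr \<alpha>" using w \<alpha> calculation(1) by (intro powr_mono2) auto
    ultimately have "wt t \<le> \<bar>t - r\<bar> powr \<alpha>" by simp
    hence "wt t * H \<le> \<bar>t - r\<bar> powr \<alpha> * H" using H0 by (rule mult_right_mono)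
    thus ?thesis using hb[OF t] False unfolding h0_def by (auto simp: mult.commute)
  qed
  have b1: "cmod (LINT t:{1..2}|lborel. (h t - h0) / k t) \<le>
     singular_const \<alpha> * (m/4) powr (-1 - \<alpha>) * H * \<bar>Im z\<bar> powr (\<alpha> - 1)"
  proof -
    have "ennreal (cmod (LINT t:{1..2}|lborel. (h t - h0) / k t)) \<le>
       (\<integral>\<^sup>+ t. ennreal (cmod (indicator {1..2} t *\<^sub>R ((h t - h0) / k t))) \<partial>lborel)"
      unfolding set_lebesgue_integral_def
      using int1 by (intro integral_norm_bound_ennreal) (simp add: set_integrable_def)
    also have "\<dots> \<le> (\<integral>\<^sup>+ t. ennreal H * ennreal (\<bar>t - r\<bar> powr \<alpha> / ((l * (t - r))\<^sup>2 + (Im z)\<^sup>2)) \<partial>lborel)"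
    proof (intro nn_integral_mono)
      fix t
      have "cmod (indicator {1..2} t *\<^sub>R ((h t - h0) / k t)) \<le> H * (\<bar>t - r\<bar> powr \<alpha> / ((l * (t - r))\<^sup>2 + (Im z)\<^sup>2))"
      proof (cases "t \<in> {1..2}")
        case True
        have "cmod ((h t - h0) / k t) \<le> H * \<bar>t - r\<bar> powr \<alpha> / cmod (k t)"
          unfolding norm_divide by (intro divide_right_mono hdiff True) auto
        thus ?thesis using True by (simp add: kn)
      qed (use H0 in auto)
      thus "ennreal (cmod (indicator {1..2} t *\<^sub>R ((h t - h0) / k t))) \<le>
         ennreal H * ennreal (\<bar>t - r\<bar> powr \<alpha> / ((l * (t - r))\<^sup>2 + (Im z)\<^sup>2))"
        using H0 by (simp add: ennreal_mult'[symmetric] ennreal_leI)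
    qed
    also have "\<dots> = ennreal (H * (singular_const \<alpha> * \<bar>l\<bar> powr (-1 - \<alpha>) * \<bar>Im z\<bar> powr (\<alpha> - 1)))"
      using H0 by (subst nn_integral_cmult) (auto simp: nn_integral_singular_kernel[OF \<alpha> l0 z(1)] ennreal_mult')
    finally have "cmod (LINT t:{1..2}|lborel. (h t - h0) / k t) \<le>
      H * (singular_const \<alpha> * \<bar>l\<bar> powr (-1 - \<alpha>) * \<bar>Im z\<bar> powr (\<alpha> - 1))"
      using H0 singular_const_nonneg by (simp add: ennreal_le_iff)
    also have "\<dots> \<le> H * (singular_const \<alpha> * (m/4) powr (-1 - \<alpha>) * \<bar>Im z\<bar> powr (\<alpha> - 1))"
      using l m \<alpha> H0 singular_const_nonneg
      by (intro mult_left_mono mult_right_mono powr_mono2') auto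
    finally show ?thesis by (simp add: mult_ac)
  qed
  have b2: "cmod (LINT t:{1..2}|lborel. h0 / k t) \<le> (96 / m\<^sup>2) * H * \<bar>Im z\<bar> powr (\<alpha> - 1)"
  proof (cases "r \<in> {1..2}")
    case False
    hence "h0 = 0" unfolding h0_def by (rule if_not_P)
    thus ?thesis using H0 by simp
  next
    case True
    \<comment> \<open>A primitive of the constant over the squared denominator: this term is
      integrated exactly, since taking absolute values would give a full power of 1 / |Im
      z|.\<close>
    define G where "G = (\<lambda>t. - (h0 / of_real l) / (complex_of_real (l * t) - z))"
    have FTC: "(LINT t:{1..2}|lborel. h0 / k t) = G 2 - G 1"
      unfolding set_lebesgue_integral_def
    proof (rule integral_FTC_atLeastAtMost)
      show "continuous_on {1..2} (\<lambda>t. h0 / k t)" by (intro continuous_intros contk) (use k0 in auto)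
      fix t
      have "((\<lambda>w. - (h0 / of_real l) / (of_real l * w - z)) has_field_derivative
           h0 / k t) (at (complex_of_real t))"
        using nz[of t] l0 by (auto intro!: derivative_eq_intros simp: k_def power2_eq_square)
      from has_vector_derivative_real_field[OF this]
      show "(G has_vector_derivative h0 / k t) (at t within {1..2})"
        unfolding G_def by (simp add: has_vector_derivative_at_within)
    qed simp
    have G: "cmod (G e) \<le> H / l\<^sup>2" if e: "e = 1 \<or> e = 2" for e
    proof -
      \<comment> \<open>The weight bounds the subtracted value by a multiple of its distance to the
        end point e, and this distance is exactly what the denominator of G at e may lack.\<close>
      have hw: "cmod h0 \<le> \<bar>e - r\<bar> * H"
        using hb[OF True] wt_bounds[OF True] e True H0 unfolding h0_def
        by (auto intro: order_trans[OF _ mult_right_mono])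
      have "\<bar>l\<bar> * \<bar>e - r\<bar> \<le> cmod (complex_of_real (l * e) - z)"
        using abs_Re_le_cmod[of "complex_of_real (l * e) - z"] l0
        by (simp add: r_def abs_mult[symmetric] right_diff_distrib)
      hence "cmod h0 * \<bar>l\<bar> \<le> H * cmod (complex_of_real (l * e) - z)"
        using mult_right_mono[OF hw, of "\<bar>l\<bar>"] mult_right_mono[of _ _ H] H0
        by (smt (verit, best) abs_ge_zero mult.assoc mult.commute)
      have "cmod h0 / \<bar>l\<bar> / cmod (complex_of_real (l * e) - z) \<le> H / l\<^sup>2"
      proof -
        let ?k = "cmod (complex_of_real (l * e) - z)"
        have k: "?k > 0" using nz[of e] by simp
        have "cmod h0 / \<bar>l\<bar> / ?k = cmod h0 * \<bar>l\<bar> / (l\<^sup>2 * ?k)"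
        proof -
          have sq: "l\<^sup>2 = \<bar>l\<bar> * \<bar>l\<bar>" by (simp add: power2_eq_square)
          have div: "a / b / c = a * b / (b * b * c)" if "b \<noteq> 0" for a b c :: real using that by simp
          show ?thesis unfolding sq by (rule div) (use l0 in simp)
        qed
        also have "\<dots> \<le> H * ?k / (l\<^sup>2 * ?k)" using \<open>cmod h0 * \<bar>l\<bar> \<le> H * ?k\<close> k by (intro divide_right_mono) auto
        finally show ?thesis using k by simp
      qed
      thus ?thesis by (simp add: G_def norm_divide norm_mult)
    qed
    have "cmod (LINT t:{1..2}|lborel. h0 / k t) \<le> 2 * (H / l\<^sup>2)"
      unfolding FTC mult_2 by (intro order_trans[OF norm_triangle_ineq4 add_mono] G) auto
    \<comment> \<open>From |l| at least m/4 each end point contributes at most 16 H / m squared; two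
      end points and the factor 3 of \<open>powr_ge_const\<close> make 96.\<close>
    also have "\<dots> \<le> 2 * (H / (m/4)\<^sup>2)"
    proof -
      have "(m/4)\<^sup>2 \<le> l\<^sup>2" using l m by (intro abs_le_square_iff[THEN iffD1]) auto
      thus ?thesis using m H0 l0 by (intro mult_left_mono divide_left_mono mult_pos_pos) auto
    qed
    also have "\<dots> = 32 / m\<^sup>2 * H * 1" by (simp add: power2_eq_square)
    also have "\<dots> \<le> 32 / m\<^sup>2 * H * (3 * \<bar>Im z\<bar> powr (\<alpha> - 1))"
      using z \<alpha> H0 by (intro mult_left_mono powr_ge_const) auto
    finally show ?thesis by simp
  qed
  show ?thesis using norm_triangle_ineq[of "LINT t:{1..2}|lborel. (h t - h0) / k t" "LINT t:{1..2}|lborel. h0 / k t"] b1 b2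
    unfolding split[unfolded k_def] k_def by (simp add: algebra_simps)
qed

section \<open>One-dimensional Sobolev estimates on the interval from 1 to 2\<close>

lemma set_integral_mono_subset_nonneg:
  fixes f :: "real \<Rightarrow> real"
  assumes "set_integrable lborel B f" "A \<subseteq> B" "A \<in> sets borel" "\<And>x. x \<in> B \<Longrightarrow> 0 \<le> f x"
  shows "(LINT t:A|lborel. f t) \<le> (LINT t:B|lborel. f t)"
proof -
  have "set_integrable lborel A f" by (rule set_integrable_subset[OF assms(1)]) (use assms in auto)
  thus ?thesis using assms unfolding set_lebesgue_integral_def set_integrable_def
    by (intro integral_mono) (auto simp: indicator_def)
qed

text \<open>The fundamental theorem of calculus followed by Cauchy-Schwarz against the indicator of
  the interval: a square-integrable derivative gives Hoelder exponent 1/2.\<close>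

lemma ray_difference_bound:
  fixes F :: "real \<Rightarrow> complex"
  assumes F: "\<And>t. t \<in> {1..2} \<Longrightarrow> (F has_vector_derivative F' t) (at t)"
    and F'c: "continuous_on {1..2} F'"
    and D: "(LINT t:{1..2}|lborel. (cmod (F' t))\<^sup>2) \<le> D\<^sup>2" "D \<ge> 0"
    and t: "t \<in> {1..2}" "t' \<in> {1..2}"
  shows "cmod (F t - F t') \<le> D * sqrt \<bar>t - t'\<bar>"
proof -
  have main: "cmod (F b - F a) \<le> D * sqrt (b - a)" if ab: "1 \<le> a" "a \<le> b" "b \<le> 2" for a b
  proof -
    have sub: "{a..b} \<subseteq> {1..2}" using ab by auto
    have c: "continuous_on {a..b} F'" using F'c sub continuous_on_subset by blast
    have i2: "set_integrable lborel {1..2} (\<lambda>t. (cmod (F' t))\<^sup>2)"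
      by (intro borel_integrable_atLeastAtMost' continuous_intros F'c)
    have "(LINT t:{a..b}|lborel. F' t) = F b - F a"
      unfolding set_lebesgue_integral_def
    proof (rule integral_FTC_atLeastAtMost)
      fix x assume "a \<le> x" "x \<le> b"
      thus "(F has_vector_derivative F' x) (at x within {a..b})"
        using F[of x] ab by (auto intro: has_vector_derivative_at_within)
    qed (use ab c in auto)
    hence "cmod (F b - F a) \<le> (LINT t|lborel. cmod (indicator {a..b} t *\<^sub>R F' t))"
      unfolding set_lebesgue_integral_def by (metis integral_norm_bound)
    also have "\<dots> = (LINT t|lborel. indicator {a..b} t * (indicator {a..b} t * cmod (F' t)))"
      by (intro Bochner_Integration.integral_cong) (auto simp: indicator_def)
    also have "\<dots> \<le> sqrt (LINT t|lborel. (indicator {a..b} t)\<^sup>2) * sqrt (LINT t|lborel. (indicator {a..b} t * cmod (F' t))\<^sup>2)"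
    proof (rule Cauchy_Schwarz_integral)
      have "set_integrable lborel {a..b} F'" by (rule borel_integrable_atLeastAtMost'[OF c])
      hence "(\<lambda>t. indicator {a..b} t *\<^sub>R F' t) \<in> borel_measurable lborel"
        unfolding set_integrable_def by (rule borel_measurable_integrable)
      hence "(\<lambda>t. cmod (indicator {a..b} t *\<^sub>R F' t)) \<in> borel_measurable lborel"
        by measurable
      also have "(\<lambda>t. cmod (indicator {a..b} t *\<^sub>R F' t)) = (\<lambda>t. indicator {a..b} t * cmod (F' t))"
        by (auto simp: indicator_def)
      finally show "(\<lambda>t. indicator {a..b} t * cmod (F' t)) \<in> borel_measurable lborel" .
      have "set_integrable lborel {a..b} (\<lambda>t. (cmod (F' t))\<^sup>2)"
        by (rule set_integrable_subset[OF i2]) (use sub in auto)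
      thus "integrable lborel (\<lambda>t. (indicator {a..b} t * cmod (F' t))\<^sup>2)"
        unfolding set_integrable_def
        by (rule Bochner_Integration.integrable_cong[THEN iffD1, rotated -1]) (auto simp: indicator_def)
      have "integrable lborel (\<lambda>t. indicator {a..b} t :: real)"
        by (rule integrable_real_indicator) (auto simp: emeasure_lborel_Icc_eq)
      thus "integrable lborel (\<lambda>t. (indicator {a..b} t :: real)\<^sup>2)"
        by (rule Bochner_Integration.integrable_cong[THEN iffD1, rotated -1]) (auto simp: indicator_def)
    qed simp
    also have "(LINT t|lborel. (indicator {a..b} t :: real)\<^sup>2) = (LINT t|lborel. indicator {a..b} t)"
      by (intro Bochner_Integration.integral_cong) (auto simp: indicator_def)
    also have "\<dots> = b - a" using ab by simp
    also have "(LINT t|lborel. (indicator {a..b} t * cmod (F' t))\<^sup>2) = (LINT t:{a..b}|lborel. (cmod (F' t))\<^sup>2)"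
      unfolding set_lebesgue_integral_def
      by (intro Bochner_Integration.integral_cong) (auto simp: indicator_def)
    also have "sqrt (b - a) * sqrt (LINT t:{a..b}|lborel. (cmod (F' t))\<^sup>2) \<le> sqrt (b - a) * sqrt (D\<^sup>2)"
      using set_integral_mono_subset_nonneg[OF i2 sub] D ab
      by (intro mult_left_mono real_sqrt_le_mono) auto
    finally show ?thesis using D by (simp add: mult.commute)
  qed
  show ?thesis
  proof (cases "t \<le> t'")
    case True
    thus ?thesis using main[of t t'] t by (simp add: norm_minus_commute)
  next
    case False
    thus ?thesis using main[of t' t] t by simp
  qed
qed

text \<open>The natural length is 1 / R, on which F varies by at most sqrt R times P. Averaging over
  a window of that length bounds the supremum. The Hoelder bound of lower order then interpolates:
  short distances use the exponent 1/2, long ones the supremum.\<close>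

lemma ray_sobolev:
  fixes F :: "real \<Rightarrow> complex"
  assumes F: "\<And>t. t \<in> {1..2} \<Longrightarrow> (F has_vector_derivative F' t) (at t)"
    and F'c: "continuous_on {1..2} F'" and R: "1 \<le> R" and P: "P \<ge> 0"
    and i0: "(LINT t:{1..2}|lborel. (cmod (F t))\<^sup>2) \<le> P\<^sup>2"
    and i1: "(LINT t:{1..2}|lborel. (cmod (F' t))\<^sup>2) \<le> (R * P)\<^sup>2"
    and \<alpha>: "0 < \<alpha>" "\<alpha> \<le> 1/2"
  shows "t \<in> {1..2} \<Longrightarrow> cmod (F t) \<le> 2 * sqrt R * P"
    and "t \<in> {1..2} \<Longrightarrow> t' \<in> {1..2} \<Longrightarrow> cmod (F t - F t') \<le> 4 * R powr (1/2 + \<alpha>) * P * \<bar>t - t'\<bar> powr \<alpha>"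
proof -
  have RP: "0 \<le> R * P" using R P by simp
  have diff: "cmod (F t - F t') \<le> R * P * sqrt \<bar>t - t'\<bar>" if "t \<in> {1..2}" "t' \<in> {1..2}" for t t'
    using ray_difference_bound[of F F' "R * P"] F F'c i1 RP that by blast
  have Fc: "continuous_on {1..2} F"
    using F by (intro continuous_at_imp_continuous_on ballI has_vector_derivative_continuous) blast
  have i2: "set_integrable lborel {1..2} (\<lambda>t. (cmod (F t))\<^sup>2)"
    by (intro borel_integrable_atLeastAtMost' continuous_intros Fc)
  have sup: "cmod (F t) \<le> 2 * sqrt R * P" if t: "t \<in> {1..2}" for t
  proof -
    \<comment> \<open>The left end of a window of length 1 / R that contains t; the minimum pushes
      the window back inside [1, 2] when t is near 2.\<close>
    define c where "c = min t (2 - 1/R)"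
    have R1: "1 / R \<le> 1" "1 / R > 0" using R by auto
    have c: "1 \<le> c" "c + 1/R \<le> 2" "c \<le> t" "t \<le> c + 1/R"
      using t R1 unfolding c_def atLeastAtMost_iff by linarith+
    have sub: "{c..c + 1/R} \<subseteq> {1..2}" using c by auto
    have i3: "set_integrable lborel {c..c + 1/R} (\<lambda>t. (cmod (F t))\<^sup>2)"
      by (rule set_integrable_subset[OF i2]) (use sub in auto)
    have "(LINT t'|lborel. indicator {c..c+1/R} t' * ((cmod (F t))\<^sup>2 - 2 * R * P\<^sup>2)) \<le>
       (LINT t'|lborel. 2 * (indicator {c..c+1/R} t' *\<^sub>R (cmod (F t'))\<^sup>2))"
    proof (intro integral_mono)
      show "integrable lborel (\<lambda>t'. 2 * (indicator {c..c + 1 / R} t' *\<^sub>R (cmod (F t'))\<^sup>2))"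
        using i3 unfolding set_integrable_def by simp
      fix t'
      have "(cmod (F t))\<^sup>2 - 2 * R * P\<^sup>2 \<le> 2 * (cmod (F t'))\<^sup>2" if t': "t' \<in> {c..c+1/R}"
      proof -
        have "\<bar>t - t'\<bar> \<le> 1/R" using t' c by auto
        hence "cmod (F t - F t') \<le> R * P * sqrt (1/R)"
          using diff[of t t'] t t' sub RP
          by (meson order_trans mult_left_mono real_sqrt_le_mono subsetD)
        hence "(cmod (F t - F t'))\<^sup>2 \<le> (R * P * sqrt (1/R))\<^sup>2" by (intro power_mono) auto
        also have "\<dots> = R * P\<^sup>2" using R by (simp add: power_mult_distrib power2_eq_square real_sqrt_divide)
        finally have d: "(cmod (F t - F t'))\<^sup>2 \<le> R * P\<^sup>2" .
        have "cmod (F t) \<le> cmod (F t') + cmod (F t - F t')" using norm_triangle_sub by blast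
        hence "(cmod (F t))\<^sup>2 \<le> (cmod (F t') + cmod (F t - F t'))\<^sup>2" by (intro power_mono) auto
        also have "\<dots> \<le> 2 * (cmod (F t'))\<^sup>2 + 2 * (cmod (F t - F t'))\<^sup>2"
          using sum_squares_bound[of "cmod (F t')" "cmod (F t - F t')"] by (simp add: power2_sum)
        finally show ?thesis using d by linarith
      qed
      thus "indicator {c..c+1/R} t' * ((cmod (F t))\<^sup>2 - 2 * R * P\<^sup>2) \<le>
        2 * (indicator {c..c+1/R} t' *\<^sub>R (cmod (F t'))\<^sup>2)" by (auto simp: indicator_def)
    next
      have "integrable lborel (indicat_real {c..c + 1/R})"
        by (rule integrable_real_indicator) (auto simp: emeasure_lborel_Icc_eq)
      thus "integrable lborel (\<lambda>t'. indicator {c..c+1/R} t' * ((cmod (F t))\<^sup>2 - 2 * R * P\<^sup>2))" by simp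
    qed
    also have "\<dots> \<le> 2 * P\<^sup>2"
      using set_integral_mono_subset_nonneg[OF i2 sub] i0 unfolding set_lebesgue_integral_def by simp
    also have "(LINT t'|lborel. indicator {c..c+1/R} t' * ((cmod (F t))\<^sup>2 - 2 * R * P\<^sup>2)) =
      (1/R) * ((cmod (F t))\<^sup>2 - 2 * R * P\<^sup>2)" using R1 by simp
    finally have "(cmod (F t))\<^sup>2 - 2 * R * P\<^sup>2 \<le> 2 * P\<^sup>2 * R" using R by (simp add: field_simps)
    hence "(cmod (F t))\<^sup>2 \<le> 4 * R * P\<^sup>2" by (simp add: algebra_simps)
    also have "\<dots> = (2 * sqrt R * P)\<^sup>2" using R by (simp add: power_mult_distrib)
    finally show ?thesis by (rule power2_le_imp_le) (use R P in auto)
  qed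
  thus "t \<in> {1..2} \<Longrightarrow> cmod (F t) \<le> 2 * sqrt R * P" by blast
  assume t: "t \<in> {1..2}" "t' \<in> {1..2}"
  define \<tau> where "\<tau> = \<bar>t - t'\<bar>"
  have sR: "sqrt R = R powr (1/2)" using R by (simp add: powr_half_sqrt)
  show "cmod (F t - F t') \<le> 4 * R powr (1/2 + \<alpha>) * P * \<bar>t - t'\<bar> powr \<alpha>"
  proof (cases "t = t'")
    case False
    hence \<tau>: "\<tau> > 0" by (simp add: \<tau>_def)
    \<comment> \<open>At distance 1 / R the two bounds match. Below it the surplus power 1/2 -
      \<alpha> of the distance is traded for R; above it R times the distance is at least 1 and may
      be inserted.\<close>
    show ?thesis unfolding \<tau>_def[symmetric]
    proof (cases "\<tau> \<le> 1 / R")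
      case True
      have "cmod (F t - F t') \<le> R * P * sqrt \<tau>" using diff[OF t] by (simp add: \<tau>_def)
      also have "sqrt \<tau> = \<tau> powr (1/2 - \<alpha>) * \<tau> powr \<alpha>"
        using \<tau> by (simp add: powr_half_sqrt flip: powr_add)
      also have "R * P * (\<tau> powr (1/2 - \<alpha>) * \<tau> powr \<alpha>) \<le> R * P * ((1/R) powr (1/2 - \<alpha>) * \<tau> powr \<alpha>)"
        using True \<alpha> \<tau> RP by (intro mult_left_mono mult_right_mono powr_mono2) auto
      also have "(1/R) powr (1/2 - \<alpha>) = R powr (\<alpha> - 1/2)"
        using R by (simp add: powr_divide powr_minus_divide[symmetric])
      also have "R * P * (R powr (\<alpha> - 1/2) * \<tau> powr \<alpha>) = (R powr 1 * R powr (\<alpha> - 1/2)) * P * \<tau> powr \<alpha>"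
        using R by simp
      also have "R powr 1 * R powr (\<alpha> - 1/2) = R powr (1/2 + \<alpha>)" by (subst powr_add[symmetric]) simp
      also have "R powr (1/2 + \<alpha>) * P * \<tau> powr \<alpha> \<le> 4 * (R powr (1/2 + \<alpha>) * P * \<tau> powr \<alpha>)"
        using P by simp
      finally show "cmod (F t - F t') \<le> 4 * R powr (1/2 + \<alpha>) * P * \<tau> powr \<alpha>" by (simp add: mult.assoc)
    next
      case False
      hence "1 \<le> R * \<tau>" using R by (simp add: field_simps)
      hence "1 \<le> (R * \<tau>) powr \<alpha>" using \<alpha> by (simp add: ge_one_powr_ge_zero)
      hence ge: "1 \<le> R powr \<alpha> * \<tau> powr \<alpha>" using R \<tau> by (simp add: powr_mult)
      have "cmod (F t - F t') \<le> cmod (F t) + cmod (F t')" by (rule norm_triangle_ineq4)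
      also have "\<dots> \<le> 4 * sqrt R * P * 1" using sup[OF t(1)] sup[OF t(2)] by simp
      also have "\<dots> \<le> 4 * sqrt R * P * (R powr \<alpha> * \<tau> powr \<alpha>)"
        using ge R P by (intro mult_left_mono) auto
      also have "\<dots> = 4 * (R powr (1/2) * R powr \<alpha>) * P * \<tau> powr \<alpha>" by (simp add: sR mult_ac)
      finally show "cmod (F t - F t') \<le> 4 * R powr (1/2 + \<alpha>) * P * \<tau> powr \<alpha>" by (simp flip: powr_add)
    qed
  qed simp
qed

lemma wt_lipschitz:
  assumes "t \<in> {1..2}" "t' \<in> {1..2}" shows "\<bar>wt t - wt t'\<bar> \<le> \<bar>t - t'\<bar>"
proof -
  have "wt t - wt t' = (t - t') * (3 - t - t')" by (simp add: wt_def algebra_simps)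
  hence "\<bar>wt t - wt t'\<bar> = \<bar>t - t'\<bar> * \<bar>3 - t - t'\<bar>" by (simp add: abs_mult)
  also have "\<dots> \<le> \<bar>t - t'\<bar> * 1" using assms by (intro mult_left_mono) auto
  finally show ?thesis by simp
qed

text \<open>\<open>singular_integral_bound\<close> for the weighted product of F and the conjugate
  of G. The factor 20 is a Hoelder constant: 4 from the variation of the weight and 8 from that of
  each of F and G.\<close>

lemma ray_estimate:
  fixes F G :: "real \<Rightarrow> complex"
  assumes \<alpha>: "0 < \<alpha>" "\<alpha> \<le> 1/2" and m: "0 < m" and l: "m / 4 \<le> \<bar>l\<bar>"
    and z: "Im z \<noteq> 0" "\<bar>Im z\<bar> \<le> 3"
    and F: "\<And>t. t \<in> {1..2} \<Longrightarrow> (F has_vector_derivative F' t) (at t)" "continuous_on {1..2} F'"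
      "1 \<le> R" "P \<ge> 0" "(LINT t:{1..2}|lborel. (cmod (F t))\<^sup>2) \<le> P\<^sup>2"
      "(LINT t:{1..2}|lborel. (cmod (F' t))\<^sup>2) \<le> (R * P)\<^sup>2"
    and G: "\<And>t. t \<in> {1..2} \<Longrightarrow> (G has_vector_derivative G' t) (at t)" "continuous_on {1..2} G'"
      "1 \<le> S" "Q \<ge> 0" "(LINT t:{1..2}|lborel. (cmod (G t))\<^sup>2) \<le> Q\<^sup>2"
      "(LINT t:{1..2}|lborel. (cmod (G' t))\<^sup>2) \<le> (S * Q)\<^sup>2"
  shows "cmod (LINT t:{1..2}|lborel. of_real (wt t) * (F t * cnj (G t)) / (of_real (l * t) - z)\<^sup>2) \<le>
    20 * (singular_const \<alpha> * (m/4) powr (-1 - \<alpha>) + 96 / m\<^sup>2) * (R * S) powr (1/2 + \<alpha>) * P * Q * \<bar>Im z\<bar> powr (\<alpha> - 1)"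
proof -
  define E where "E = (R * S) powr (1/2 + \<alpha>) * P * Q"
  have Fs: "t \<in> {1..2} \<Longrightarrow> cmod (F t) \<le> 2 * sqrt R * P"
    "t \<in> {1..2} \<Longrightarrow> t' \<in> {1..2} \<Longrightarrow> cmod (F t - F t') \<le> 4 * R powr (1/2 + \<alpha>) * P * \<bar>t - t'\<bar> powr \<alpha>" for t t'
    using ray_sobolev[of F F' R P \<alpha>] F \<alpha> by blast+
  have Gs: "t \<in> {1..2} \<Longrightarrow> cmod (G t) \<le> 2 * sqrt S * Q"
    "t \<in> {1..2} \<Longrightarrow> t' \<in> {1..2} \<Longrightarrow> cmod (G t - G t') \<le> 4 * S powr (1/2 + \<alpha>) * Q * \<bar>t - t'\<bar> powr \<alpha>" for t t'
    using ray_sobolev[of G G' S Q \<alpha>] G \<alpha> by blast+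
  have Fc: "continuous_on {1..2} F"
    using F(1) by (intro continuous_at_imp_continuous_on ballI has_vector_derivative_continuous) blast
  have Gc: "continuous_on {1..2} G"
    using G(1) by (intro continuous_at_imp_continuous_on ballI has_vector_derivative_continuous) blast
  have sR: "sqrt R \<le> R powr (1/2 + \<alpha>)" if "1 \<le> R" for R
  proof -
    have "sqrt R = R powr (1/2)" using that by (simp add: powr_half_sqrt)
    also have "\<dots> \<le> R powr (1/2 + \<alpha>)" using that \<alpha> by (intro powr_mono) auto
    finally show ?thesis .
  qed
  have E: "E = (R powr (1/2 + \<alpha>) * P) * (S powr (1/2 + \<alpha>) * Q)"
    using F(3) G(3) by (simp add: E_def powr_mult)
  have E0: "E \<ge> 0" using F(4) G(4) by (simp add: E)
  have Fb: "cmod (F t) \<le> 2 * (R powr (1/2 + \<alpha>) * P)" if "t \<in> {1..2}" for t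
    using Fs(1)[OF that] mult_right_mono[OF sR[OF F(3)] F(4)] by linarith
  have Gb: "cmod (G t) \<le> 2 * (S powr (1/2 + \<alpha>) * Q)" if "t \<in> {1..2}" for t
    using Gs(1)[OF that] mult_right_mono[OF sR[OF G(3)] G(4)] by linarith
  have FGb: "cmod (F t * cnj (G t)) \<le> 4 * E" if "t \<in> {1..2}" for t
  proof -
    have "cmod (F t * cnj (G t)) \<le> (2 * (R powr (1/2 + \<alpha>) * P)) * (2 * (S powr (1/2 + \<alpha>) * Q))"
      unfolding norm_mult complex_mod_cnj by (intro mult_mono Fb Gb that) (use F(4) in auto)
    thus ?thesis by (simp add: E)
  qed
  have "cmod (LINT t:{1..2}|lborel. (of_real (wt t) * (F t * cnj (G t))) / (of_real (l * t) - z)\<^sup>2) \<le>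
    (singular_const \<alpha> * (m/4) powr (-1 - \<alpha>) + 96 / m\<^sup>2) * (20 * E) * \<bar>Im z\<bar> powr (\<alpha> - 1)"
  proof (rule singular_integral_bound[OF \<alpha> m l z])
    show "continuous_on {1..2} (\<lambda>t. of_real (wt t) * (F t * cnj (G t)))"
      unfolding wt_def by (intro continuous_intros Fc Gc)
  next
    fix t :: real assume t: "t \<in> {1..2}"
    have "cmod (of_real (wt t) * (F t * cnj (G t))) = wt t * cmod (F t * cnj (G t))"
      unfolding norm_mult[of "of_real (wt t)"] using wt_bounds[OF t] by simp
    also have "\<dots> \<le> wt t * (20 * E)"
      using wt_bounds[OF t] FGb[OF t] E0 by (intro mult_left_mono) auto
    finally show "cmod (of_real (wt t) * (F t * cnj (G t))) \<le> wt t * (20 * E)" .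
    fix t' :: real assume t': "t' \<in> {1..2}"
    define \<tau> where "\<tau> = \<bar>t - t'\<bar> powr \<alpha>"
    have \<tau>0: "\<tau> \<ge> 0" by (simp add: \<tau>_def)
    have "\<bar>t - t'\<bar> \<le> \<tau>" unfolding \<tau>_def using t t' \<alpha> by (intro le_powr_self) auto
    hence w: "\<bar>wt t - wt t'\<bar> \<le> \<tau>" using wt_lipschitz[OF t t'] by linarith
    \<comment> \<open>Three-term product rule for differences: the weight varies first, then F, then
      G, with the other factors bounded by their suprema.\<close>
    have d: "of_real (wt t) * (F t * cnj (G t)) - of_real (wt t') * (F t' * cnj (G t')) =
      of_real (wt t - wt t') * (F t * cnj (G t)) + of_real (wt t') * ((F t - F t') * cnj (G t) + F t' * cnj (G t - G t'))"
      by (simp add: algebra_simps)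
    have a1: "cmod (of_real (wt t - wt t') * (F t * cnj (G t))) \<le> \<tau> * (4 * E)"
      unfolding norm_mult[of "of_real _"] norm_of_real using w FGb[OF t] \<tau>0 by (intro mult_mono) auto
    have a2: "cmod ((F t - F t') * cnj (G t)) \<le> (4 * (R powr (1/2 + \<alpha>) * P) * \<tau>) * (2 * (S powr (1/2 + \<alpha>) * Q))"
      unfolding norm_mult complex_mod_cnj using Fs(2)[OF t t'] Gb[OF t] F(4) \<tau>0
      by (intro mult_mono) (auto simp: \<tau>_def mult_ac)
    have a3: "cmod (F t' * cnj (G t - G t')) \<le> (2 * (R powr (1/2 + \<alpha>) * P)) * (4 * (S powr (1/2 + \<alpha>) * Q) * \<tau>)"
      unfolding norm_mult complex_mod_cnj using Gs(2)[OF t t'] Fb[OF t'] F(4) \<tau>0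
      by (intro mult_mono) (auto simp: \<tau>_def mult_ac)
    have a4: "cmod ((F t - F t') * cnj (G t) + F t' * cnj (G t - G t')) \<le> 16 * E * \<tau>"
      using norm_triangle_ineq[of "(F t - F t') * cnj (G t)" "F t' * cnj (G t - G t')"] a2 a3
      by (simp add: E algebra_simps)
    have a5: "cmod (of_real (wt t') * ((F t - F t') * cnj (G t) + F t' * cnj (G t - G t'))) \<le> 1 * (16 * E * \<tau>)"
      unfolding norm_mult[of "of_real _"] norm_of_real using wt_bounds[OF t'] a4 by (intro mult_mono) auto
    show "cmod (of_real (wt t) * (F t * cnj (G t)) - of_real (wt t') * (F t' * cnj (G t'))) \<le> 20 * E * \<bar>t - t'\<bar> powr \<alpha>"
      unfolding d \<tau>_def[symmetric]
      by (rule order_trans[OF norm_triangle_ineq order_trans[OF add_mono[OF a1 a5]]]) (simp add: algebra_simps)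
  qed
  thus ?thesis by (simp only: E_def mult_ac)
qed

subsection \<open>Square-integrable functions\<close>

definition l2 :: "(real^'n::finite \<Rightarrow> complex^'k::finite) \<Rightarrow> bool" where
  "l2 u \<longleftrightarrow> u \<in> borel_measurable borel \<and> integrable lborel (\<lambda>x. (norm (u x))\<^sup>2)"

text \<open>Functions are not identified almost everywhere, so this is a seminorm. As the integral
  of a non-integrable function is 0, a bound on \<open>nrm\<close> says something only in company
  with \<open>l2\<close>.\<close>

definition nrm :: "(real^'n::finite \<Rightarrow> complex^'k::finite) \<Rightarrow> real" where
  "nrm u = sqrt (\<integral>x. (norm (u x))\<^sup>2 \<partial>lborel)"

definition ipr :: "(real^'n::finite \<Rightarrow> complex^'k::finite) \<Rightarrow> (real^'n \<Rightarrow> complex^'k) \<Rightarrow> complex" where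
  "ipr u v = (\<integral>x. cip (u x) (v x) \<partial>lborel)"

lemma l2_measurable [measurable_dest]: "l2 u \<Longrightarrow> u \<in> borel_measurable borel"
  by (simp add: l2_def)

lemma l2_integrable: "l2 u \<Longrightarrow> integrable lborel (\<lambda>x. (norm (u x))\<^sup>2)"
  by (simp add: l2_def)

lemma nrm_nonneg [simp]: "nrm u \<ge> 0" by (simp add: nrm_def)

lemma nrm_sq: "(nrm u)\<^sup>2 = (\<integral>x. (norm (u x))\<^sup>2 \<partial>lborel)"
  by (simp add: nrm_def)

lemma nn_integral_l2: "l2 u \<Longrightarrow> (\<integral>\<^sup>+x. ennreal ((norm (u x))\<^sup>2) \<partial>lborel) = ennreal ((nrm u)\<^sup>2)"
  unfolding nrm_sq by (rule nn_integral_eq_integral) (auto simp: l2_def)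

text \<open>One bound on a nonnegative integral delivers membership and norm estimate together;
  results of Tonelli's theorem and Fatou's lemma return to \<open>l2\<close> this way.\<close>

lemma l2I_nn:
  assumes "u \<in> borel_measurable borel" "(\<integral>\<^sup>+x. ennreal ((norm (u x))\<^sup>2) \<partial>lborel) \<le> ennreal (B\<^sup>2)" "B \<ge> 0"
  shows "l2 u" "nrm u \<le> B"
proof -
  have "integrable lborel (\<lambda>x. (norm (u x))\<^sup>2)"
  proof (rule integrableI_nonneg)
    show "(\<integral>\<^sup>+x. ennreal ((norm (u x))\<^sup>2) \<partial>lborel) < \<infinity>"
      using assms(2) by (rule le_less_trans) simp
  qed (use assms(1) in auto)
  thus "l2 u" using assms(1) by (simp add: l2_def)
  from nn_integral_l2[OF this] assms have "ennreal ((nrm u)\<^sup>2) \<le> ennreal (B\<^sup>2)" by simp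
  hence "(nrm u)\<^sup>2 \<le> B\<^sup>2" by (simp add: ennreal_le_iff)
  thus "nrm u \<le> B" by (rule power2_le_imp_le) fact
qed

lemma l2_dominated:
  assumes "l2 u" "v \<in> borel_measurable borel" "C \<ge> 0" "\<And>x. norm (v x) \<le> C * norm (u x)"
  shows "l2 v" "nrm v \<le> C * nrm u"
proof -
  note [measurable] = assms(2) l2_measurable[OF assms(1)]
  have "(\<integral>\<^sup>+x. ennreal ((norm (v x))\<^sup>2) \<partial>lborel) \<le> (\<integral>\<^sup>+x. ennreal (C\<^sup>2) * ennreal ((norm (u x))\<^sup>2) \<partial>lborel)"
    using assms(3,4) by (intro nn_integral_mono) (auto simp: ennreal_mult'[symmetric] power_mult_distrib[symmetric] intro!: ennreal_leI power_mono)
  also have "\<dots> = ennreal (C\<^sup>2) * ennreal ((nrm u)\<^sup>2)"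
    using nn_integral_l2[OF assms(1)] by (subst nn_integral_cmult) auto
  also have "\<dots> = ennreal ((C * nrm u)\<^sup>2)" by (simp add: ennreal_mult'[symmetric] power_mult_distrib)
  finally have *: "(\<integral>\<^sup>+x. ennreal ((norm (v x))\<^sup>2) \<partial>lborel) \<le> ennreal ((C * nrm u)\<^sup>2)" .
  show "l2 v" "nrm v \<le> C * nrm u" by (rule l2I_nn[OF assms(2) *]; use assms(3) in simp)+
qed

lemma l2_integrable_mult:
  assumes "l2 u" "l2 v" shows "integrable lborel (\<lambda>x. norm (u x) * norm (v x))"
proof (rule integrable_mult_L2)
  note [measurable] = assms[THEN l2_measurable]
  show "(\<lambda>x. norm (u x)) \<in> borel_measurable lborel" "(\<lambda>x. norm (v x)) \<in> borel_measurable lborel" by measurable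
qed (use assms in \<open>auto simp: l2_def\<close>)

lemma l2_mult_le:
  assumes "l2 u" "l2 v" shows "(\<integral>x. norm (u x) * norm (v x) \<partial>lborel) \<le> nrm u * nrm v"
  unfolding nrm_def
proof (rule Cauchy_Schwarz_integral)
  note [measurable] = assms[THEN l2_measurable]
  show "(\<lambda>x. norm (u x)) \<in> borel_measurable lborel" "(\<lambda>x. norm (v x)) \<in> borel_measurable lborel" by measurable
qed (use assms in \<open>auto simp: l2_def\<close>)

lemma borel_measurable_cip [measurable (raw)]:
  assumes [measurable]: "u \<in> borel_measurable N" "v \<in> borel_measurable N"
  shows "(\<lambda>x. cip (u x) (v x)) \<in> borel_measurable N"
proof -
  have [measurable]: "cnj \<in> borel_measurable borel"
    by (intro borel_measurable_continuous_onI continuous_intros)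
  show ?thesis unfolding cip_def by measurable
qed

lemma borel_measurable_cscale [measurable (raw)]:
  fixes u :: "'a \<Rightarrow> complex^'k::finite"
  assumes [measurable]: "c \<in> borel_measurable N" "u \<in> borel_measurable N"
  shows "(\<lambda>x. c x *s u x) \<in> borel_measurable N"
  by (rule borel_measurable_vecI) simp

lemma integrable_cip:
  assumes "l2 u" "l2 v" shows "integrable lborel (\<lambda>x. cip (u x) (v x))"
proof (rule Bochner_Integration.integrable_bound[OF l2_integrable_mult[OF assms]])
  note [measurable] = assms[THEN l2_measurable]
  show "(\<lambda>x. cip (u x) (v x)) \<in> borel_measurable lborel" by measurable
qed (auto intro!: norm_cip_le)

lemma norm_ipr_le:
  assumes "l2 u" "l2 v" shows "cmod (ipr u v) \<le> nrm u * nrm v"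
proof -
  have "cmod (ipr u v) \<le> (\<integral>x. cmod (cip (u x) (v x)) \<partial>lborel)"
    unfolding ipr_def by (rule integral_norm_bound)
  also have "\<dots> \<le> (\<integral>x. norm (u x) * norm (v x) \<partial>lborel)"
    by (intro integral_mono integrable_norm integrable_cip l2_integrable_mult assms norm_cip_le)
  also have "\<dots> \<le> nrm u * nrm v" by (rule l2_mult_le[OF assms])
  finally show ?thesis .
qed

lemma l2_add: assumes "l2 u" "l2 v" shows "l2 (\<lambda>x. u x + v x)"
proof -
  note [measurable] = assms[THEN l2_measurable]
  have "integrable lborel (\<lambda>x. (norm (u x + v x))\<^sup>2)"
  proof (rule Bochner_Integration.integrable_bound[where f="\<lambda>x. 2 * (norm (u x))\<^sup>2 + 2 * (norm (v x))\<^sup>2"])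
    show "integrable lborel (\<lambda>x. 2 * (norm (u x))\<^sup>2 + 2 * (norm (v x))\<^sup>2)"
      using assms[THEN l2_integrable] by simp
    have "(norm (a + b))\<^sup>2 \<le> 2 * (norm a)\<^sup>2 + 2 * (norm b)\<^sup>2" for a b :: "complex^'b"
    proof -
      have "(norm (a + b))\<^sup>2 \<le> (norm a + norm b)\<^sup>2" by (intro power_mono norm_triangle_ineq) auto
      also have "\<dots> \<le> 2 * (norm a)\<^sup>2 + 2 * (norm b)\<^sup>2"
        using sum_squares_bound[of "norm a" "norm b"] by (simp add: power2_sum)
      finally show ?thesis .
    qed
    thus "AE x in lborel. norm ((norm (u x + v x))\<^sup>2) \<le> norm (2 * (norm (u x))\<^sup>2 + 2 * (norm (v x))\<^sup>2)"
      by simp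
  qed measurable
  thus ?thesis by (simp add: l2_def)
qed

lemma l2_scale: assumes "l2 u" shows "l2 (\<lambda>x. c *s u x)" "nrm (\<lambda>x. c *s u x) = cmod c * nrm u"
proof -
  note [measurable] = assms[THEN l2_measurable]
  show "l2 (\<lambda>x. c *s u x)"
    by (rule l2_dominated[OF assms, where C="cmod c"]) (auto simp: norm_cscale)
  show "nrm (\<lambda>x. c *s u x) = cmod c * nrm u"
    by (simp add: nrm_def norm_cscale power_mult_distrib real_sqrt_mult)
qed

lemma l2_uminus: "l2 u \<Longrightarrow> l2 (\<lambda>x. - u x)" by (simp add: l2_def)

lemma l2_diff: assumes "l2 u" "l2 v" shows "l2 (\<lambda>x. u x - v x)"
  using l2_add[OF assms(1) l2_uminus[OF assms(2)]] by simp

lemma nrm_commute: "nrm (\<lambda>x. u x - v x) = nrm (\<lambda>x. v x - u x)"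
  by (simp add: nrm_def norm_minus_commute)

text \<open>The square of |u + v| is at most |u| |u + v| + |v| |u + v|; Cauchy-Schwarz on each term
  leaves one factor \<open>nrm\<close> of the sum, which is divided out unless it vanishes.\<close>

lemma nrm_triangle:
  assumes "l2 u" "l2 v" shows "nrm (\<lambda>x. u x + v x) \<le> nrm u + nrm v"
proof -
  note s = l2_add[OF assms]
  have i1: "integrable lborel (\<lambda>x. norm (u x) * norm (u x + v x))" by (intro l2_integrable_mult s assms)
  have i2: "integrable lborel (\<lambda>x. norm (v x) * norm (u x + v x))" by (intro l2_integrable_mult s assms)
  have "(nrm (\<lambda>x. u x + v x))\<^sup>2 \<le> (\<integral>x. norm (u x) * norm (u x + v x) + norm (v x) * norm (u x + v x) \<partial>lborel)"
    unfolding nrm_sq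
  proof (intro integral_mono l2_integrable s Bochner_Integration.integrable_add i1 i2)
    fix x
    show "(norm (u x + v x))\<^sup>2 \<le> norm (u x) * norm (u x + v x) + norm (v x) * norm (u x + v x)"
      unfolding power2_eq_square distrib_right[symmetric] by (intro mult_right_mono norm_triangle_ineq) auto
  qed
  also have "\<dots> = (\<integral>x. norm (u x) * norm (u x + v x) \<partial>lborel) + (\<integral>x. norm (v x) * norm (u x + v x) \<partial>lborel)"
    by (rule Bochner_Integration.integral_add[OF i1 i2])
  also have "\<dots> \<le> (nrm u + nrm v) * nrm (\<lambda>x. u x + v x)"
    using l2_mult_le[OF assms(1) s] l2_mult_le[OF assms(2) s] by (simp add: distrib_right)
  finally show ?thesis
    by (cases "nrm (\<lambda>x. u x + v x) = 0") (auto simp: power2_eq_square order_less_le)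
qed

lemma nrm_triangle_diff:
  assumes "l2 u" "l2 v" "l2 w"
  shows "nrm (\<lambda>x. u x - w x) \<le> nrm (\<lambda>x. u x - v x) + nrm (\<lambda>x. v x - w x)"
  using nrm_triangle[OF l2_diff[OF assms(1,2)] l2_diff[OF assms(2,3)]] by simp

lemma nrm_triangle_sub:
  assumes "l2 u" "l2 v" shows "nrm u \<le> nrm v + nrm (\<lambda>x. u x - v x)"
  using nrm_triangle[OF assms(2) l2_diff[OF assms]] by simp

lemma ipr_diff_left: "l2 u \<Longrightarrow> l2 v \<Longrightarrow> l2 w \<Longrightarrow> ipr (\<lambda>x. u x - v x) w = ipr u w - ipr v w"
  unfolding ipr_def cip_diff_left by (intro Bochner_Integration.integral_diff integrable_cip)

lemma ipr_diff_right: "l2 u \<Longrightarrow> l2 v \<Longrightarrow> l2 w \<Longrightarrow> ipr w (\<lambda>x. u x - v x) = ipr w u - ipr w v"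
  unfolding ipr_def cip_diff_right by (intro Bochner_Integration.integral_diff integrable_cip)

lemma ipr_scale_left: "ipr (\<lambda>x. c *s u x) w = c * ipr u w"
  unfolding ipr_def cip_scale_left by simp

lemma ipr_diff_le:
  assumes "l2 f" "l2 f'" "l2 g" "l2 g'"
  shows "cmod (ipr f g - ipr f' g') \<le> nrm (\<lambda>x. f x - f' x) * nrm g + nrm f' * nrm (\<lambda>x. g x - g' x)"
proof -
  have "ipr f g - ipr f' g' = ipr (\<lambda>x. f x - f' x) g + ipr f' (\<lambda>x. g x - g' x)"
    using assms by (simp add: ipr_diff_left ipr_diff_right)
  also have "cmod \<dots> \<le> nrm (\<lambda>x. f x - f' x) * nrm g + nrm f' * nrm (\<lambda>x. g x - g' x)"
    using assms by (intro order_trans[OF norm_triangle_ineq add_mono] norm_ipr_le l2_diff)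
  finally show ?thesis .
qed

text \<open>Stated for an arbitrary filter because it serves both for truncation radii tending to
  infinity through the reals and for dyadic radii along a sequence.\<close>

lemma ipr_tendsto:
  assumes f: "\<And>m. l2 (f m)" "l2 f0" and g: "\<And>m. l2 (g m)" "l2 g0"
    and lf: "((\<lambda>m. nrm (\<lambda>x. f0 x - f m x)) \<longlongrightarrow> 0) F" and lg: "((\<lambda>m. nrm (\<lambda>x. g0 x - g m x)) \<longlongrightarrow> 0) F"
  shows "((\<lambda>m. ipr (f m) (g m)) \<longlongrightarrow> ipr f0 g0) F"
proof (rule Lim_null[THEN iffD2], rule Lim_null_comparison)
  have "cmod (ipr (f m) (g m) - ipr f0 g0) \<le>
      nrm (\<lambda>x. f0 x - f m x) * (nrm g0 + nrm (\<lambda>x. g0 x - g m x)) + nrm f0 * nrm (\<lambda>x. g0 x - g m x)" for m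
  proof -
    have "nrm (g m) \<le> nrm g0 + nrm (\<lambda>x. g0 x - g m x)"
      using nrm_triangle_sub[OF g(1) g(2), of m] nrm_commute by metis
    moreover have "cmod (ipr (f m) (g m) - ipr f0 g0) \<le>
       nrm (\<lambda>x. f0 x - f m x) * nrm (g m) + nrm f0 * nrm (\<lambda>x. g0 x - g m x)"
      using ipr_diff_le[OF f(1) f(2) g(1) g(2), of m m] nrm_commute[of "f m" f0] nrm_commute[of "g m" g0] by simp
    ultimately show ?thesis by (meson add_right_mono mult_left_mono nrm_nonneg order_trans)
  qed
  thus "\<forall>\<^sub>F m in F. cmod (ipr (f m) (g m) - ipr f0 g0) \<le>
      nrm (\<lambda>x. f0 x - f m x) * (nrm g0 + nrm (\<lambda>x. g0 x - g m x)) + nrm f0 * nrm (\<lambda>x. g0 x - g m x)" by simp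
  show "((\<lambda>m. nrm (\<lambda>x. f0 x - f m x) * (nrm g0 + nrm (\<lambda>x. g0 x - g m x)) + nrm f0 * nrm (\<lambda>x. g0 x - g m x)) \<longlongrightarrow> 0) F"
    by (rule tendsto_eq_intros lf lg | simp)+
qed

text \<open>Along a fast subsequence, the sum of the weighted squares of the increments has finite
  integral, hence the increments are almost everywhere geometrically small.\<close>

lemma l2_complete:
  fixes u :: "nat \<Rightarrow> real^'n::finite \<Rightarrow> complex^'k::finite"
  assumes u: "\<And>m. l2 (u m)" and cau: "\<And>m k. m \<le> k \<Longrightarrow> nrm (\<lambda>x. u k x - u m x) \<le> e m"
    and e: "e \<longlonglongrightarrow> 0"
  obtains g where "l2 g" "\<And>m. nrm (\<lambda>x. g x - u m x) \<le> e m"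
proof -
  note [measurable] = u[THEN l2_measurable]
  have e0: "e m \<ge> 0" for m using cau[of m m] nrm_nonneg order_trans by blast
  have "\<exists>j. \<forall>m\<ge>j. e m < (1/2)^i" for i :: nat
    using order_tendstoD(2)[OF e, of "(1/2)^i"] by (auto simp: eventually_sequentially)
  then obtain N where N: "\<And>i m. m \<ge> N i \<Longrightarrow> e m < (1/2)^i" by metis
  \<comment> \<open>Adding up the thresholds makes the selection monotone and larger than both i and
    \<open>N i\<close>, so consecutive increments have norm at most 2 to the power -i.\<close>
  define r where "r = (\<lambda>i. i + (\<Sum>j\<le>i. N j))"
  have rmono: "r i \<le> r (Suc i)" for i by (simp add: r_def)
  have "N i \<le> (\<Sum>j\<le>i. N j)" for i by (intro member_le_sum) auto
  hence rN: "r i \<ge> N i" for i unfolding r_def by (meson le_add2 le_trans)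
  have ri: "i \<le> r i" for i by (simp add: r_def)
  define d where "d = (\<lambda>i x. u (r (Suc i)) x - u (r i) x)"
  have dl: "l2 (d i)" for i unfolding d_def by (intro l2_diff u)
  have dm[measurable]: "d i \<in> borel_measurable borel" for i using dl l2_measurable by blast
  have dn: "nrm (d i) \<le> (1/2)^i" for i
    using cau[OF rmono, of i] N[OF rN, of i] unfolding d_def by linarith
  have "(\<integral>\<^sup>+x. (\<Sum>i. ennreal (2^i * (norm (d i x))\<^sup>2)) \<partial>lborel) = (\<Sum>i. \<integral>\<^sup>+x. ennreal (2^i * (norm (d i x))\<^sup>2) \<partial>lborel)"
    by (rule nn_integral_suminf) simp
  also have "\<dots> = (\<Sum>i. ennreal (2^i * (nrm (d i))\<^sup>2))"
  proof (intro suminf_cong)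
    fix i
    have "(\<integral>\<^sup>+x. ennreal (2^i * (norm (d i x))\<^sup>2) \<partial>lborel) = (\<integral>\<^sup>+x. ennreal (2^i) * ennreal ((norm (d i x))\<^sup>2) \<partial>lborel)"
      by (simp add: ennreal_mult')
    also have "\<dots> = ennreal (2^i) * ennreal ((nrm (d i))\<^sup>2)"
      by (subst nn_integral_cmult) (auto simp: nn_integral_l2[OF dl])
    finally show "(\<integral>\<^sup>+x. ennreal (2^i * (norm (d i x))\<^sup>2) \<partial>lborel) = ennreal (2^i * (nrm (d i))\<^sup>2)"
      by (simp add: ennreal_mult')
  qed
  also have "\<dots> \<le> (\<Sum>i. ennreal ((1/2)^i))"
  proof (intro suminf_le ennreal_leI)
    fix i
    have "(nrm (d i))\<^sup>2 \<le> ((1/2)^i)\<^sup>2" by (intro power_mono dn) simp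
    hence "2^i * (nrm (d i))\<^sup>2 \<le> 2^i * ((1/2)^i)\<^sup>2" by (intro mult_left_mono) auto
    also have "\<dots> = (1/2)^i" by (simp add: power2_eq_square power_divide)
    finally show "2^i * (nrm (d i))\<^sup>2 \<le> (1/2)^i" .
  qed auto
  also have "\<dots> < \<infinity>" by (subst suminf_ennreal_eq[OF _ geometric_sums]) auto
  finally have "AE x in lborel. (\<Sum>i. ennreal (2^i * (norm (d i x))\<^sup>2)) \<noteq> \<infinity>"
    by (intro nn_integral_noteq_infinite) auto
  hence ae: "AE x in lborel. convergent (\<lambda>i. u (r i) x)"
  proof (rule AE_mp, intro AE_I2 impI)
    fix x assume fin: "(\<Sum>i. ennreal (2^i * (norm (d i x))\<^sup>2)) \<noteq> \<infinity>"
    define q where "q = sqrt (1/2)"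
    have q: "0 < q" "q < 1" "q\<^sup>2 = 1/2" unfolding q_def by (auto simp: real_sqrt_less_iff intro: real_sqrt_gt_zero)
    have sm: "summable (\<lambda>i. 2^i * (norm (d i x))\<^sup>2)"
      using fin by (intro summable_suminf_not_top) auto
    have "(\<lambda>i. 2^i * (norm (d i x))\<^sup>2) \<longlonglongrightarrow> 0" using sm by (rule summable_LIMSEQ_zero)
    hence "\<forall>\<^sub>F i in sequentially. 2^i * (norm (d i x))\<^sup>2 < 1" by (rule order_tendstoD) simp
    then obtain i0 where i0: "\<And>i. i \<ge> i0 \<Longrightarrow> 2^i * (norm (d i x))\<^sup>2 < 1" by (auto simp: eventually_sequentially)
    have "summable (\<lambda>i. d i x)"
    proof (rule summable_comparison_test)
      show "summable (\<lambda>i. q^i)" using q by (intro summable_geometric) auto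
      have "norm (d i x) \<le> q^i" if "i \<ge> i0" for i
      proof -
        have "(norm (d i x))\<^sup>2 \<le> (1/2)^i" using i0[OF that] by (simp add: field_simps power_divide)
        also have "\<dots> = (q^i)\<^sup>2" by (simp add: q(3)[symmetric] power_mult[symmetric] mult.commute)
        finally show ?thesis by (rule power2_le_imp_le) (use q in auto)
      qed
      thus "\<exists>N. \<forall>i\<ge>N. norm (d i x) \<le> q^i" by blast
    qed
    hence "convergent (\<lambda>n. \<Sum>i<n. d i x)" by (simp add: summable_iff_convergent)
    moreover have "(\<Sum>i<n. d i x) = u (r n) x - u (r 0) x" for n
      unfolding d_def by (rule sum_lessThan_telescope)
    ultimately have "convergent (\<lambda>n. u (r n) x - u (r 0) x)" by simp
    from convergent_add[OF this convergent_const[of "u (r 0) x"]]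
    show "convergent (\<lambda>i. u (r i) x)" by simp
  qed
  define g where "g = (\<lambda>x. lim (\<lambda>i. u (r i) x))"
  have gm[measurable]: "g \<in> borel_measurable borel"
    unfolding g_def by (intro borel_measurable_lim_metric) measurable
  \<comment> \<open>Fatou's lemma along the subsequence compares the limit with every term u m of
    the original sequence and preserves the prescribed rate.\<close>
  have "l2 (\<lambda>x. g x - u m x) \<and> nrm (\<lambda>x. g x - u m x) \<le> e m" for m
  proof -
    have "(\<integral>\<^sup>+x. ennreal ((norm (g x - u m x))\<^sup>2) \<partial>lborel) =
       (\<integral>\<^sup>+x. liminf (\<lambda>i. ennreal ((norm (u (r i) x - u m x))\<^sup>2)) \<partial>lborel)"
    proof (intro nn_integral_cong_AE, use ae in eventually_elim)
      fix x assume "convergent (\<lambda>i. u (r i) x)"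
      hence "(\<lambda>i. u (r i) x) \<longlonglongrightarrow> g x" unfolding g_def by (simp add: convergent_LIMSEQ_iff)
      hence "(\<lambda>i. ennreal ((norm (u (r i) x - u m x))\<^sup>2)) \<longlonglongrightarrow> ennreal ((norm (g x - u m x))\<^sup>2)"
        by (intro tendsto_intros)
      thus "ennreal ((norm (g x - u m x))\<^sup>2) = liminf (\<lambda>i. ennreal ((norm (u (r i) x - u m x))\<^sup>2))"
        by (intro lim_imp_Liminf[symmetric]) auto
    qed
    also have "\<dots> \<le> liminf (\<lambda>i. \<integral>\<^sup>+x. ennreal ((norm (u (r i) x - u m x))\<^sup>2) \<partial>lborel)"
      by (rule nn_integral_liminf) simp
    also have "\<dots> \<le> ennreal ((e m)\<^sup>2)"
    proof -
      have "(\<integral>\<^sup>+x. ennreal ((norm (u (r i) x - u m x))\<^sup>2) \<partial>lborel) \<le> ennreal ((e m)\<^sup>2)" if "i \<ge> m" for i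
      proof -
        have "m \<le> r i" using ri[of i] that by simp
        hence "(nrm (\<lambda>x. u (r i) x - u m x))\<^sup>2 \<le> (e m)\<^sup>2" by (intro power_mono cau) auto
        thus ?thesis using nn_integral_l2[OF l2_diff[OF u[of "r i"] u[of m]]] by (simp add: ennreal_leI)
      qed
      hence "\<forall>\<^sub>F i in sequentially. (\<integral>\<^sup>+x. ennreal ((norm (u (r i) x - u m x))\<^sup>2) \<partial>lborel) \<le> ennreal ((e m)\<^sup>2)"
        by (auto simp: eventually_sequentially)
      from order_trans[OF Liminf_le_Limsup[OF sequentially_bot] Limsup_bounded[OF this]]
      show ?thesis .
    qed
    finally show ?thesis using l2I_nn[of "\<lambda>x. g x - u m x" "e m"] e0 by auto
  qed
  note G = this
  have "l2 (\<lambda>x. (g x - u 0 x) + u 0 x)" using G u by (intro l2_add) auto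
  hence "l2 g" by simp
  thus ?thesis using that G by blast
qed

text \<open>Multiplication by the s-th power of the Japanese bracket of x. Weighted statements
  become statements about \<open>l2\<close> and \<open>nrm\<close>, and \<open>jap (-s)\<close>
  undoes \<open>jap s\<close> because the weight is everywhere positive.\<close>

definition jap :: "real \<Rightarrow> (real^'n::finite \<Rightarrow> complex^'k::finite) \<Rightarrow> (real^'n \<Rightarrow> complex^'k)" where
  "jap s u x = ((1 + (norm x)\<^sup>2) powr (s / 2)) *\<^sub>R u x"

lemma one_plus_norm_pos [simp]: "0 < 1 + (norm (x::'a::real_normed_vector))\<^sup>2" "1 + (norm x)\<^sup>2 \<noteq> 0" "1 \<le> 1 + (norm x)\<^sup>2"
  by (auto simp: add_pos_nonneg) (smt (verit) zero_le_power2)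

lemma jap_measurable [measurable]: "u \<in> borel_measurable borel \<Longrightarrow> jap s u \<in> borel_measurable borel"
  unfolding jap_def by measurable

lemma jap_jap: "jap s (jap t u) = jap (s + t) u"
  unfolding jap_def by (auto simp: powr_add[symmetric] add_divide_distrib)

lemma jap_zero: "jap 0 u = u" unfolding jap_def by auto

lemma norm_jap_sq: "(norm (jap s u x))\<^sup>2 = (1 + (norm x)\<^sup>2) powr s * (norm (u x))\<^sup>2"
proof -
  have "((1 + (norm x)\<^sup>2) powr (s / 2))\<^sup>2 = (1 + (norm x)\<^sup>2) powr s"
    by (simp add: power2_eq_square powr_add[symmetric])
  thus ?thesis by (simp add: jap_def power_mult_distrib)
qed

lemma jap_diff: "jap s (\<lambda>x. u x - v x) = (\<lambda>x. jap s u x - jap s v x)"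
  by (auto simp: jap_def scaleR_diff_right)

lemma wnorm2_jap: "wnorm2 s u = (\<integral>\<^sup>+x. ennreal ((norm (jap s u x))\<^sup>2) \<partial>lborel)"
  unfolding wnorm2_def norm_jap_sq by simp

lemma L2w_iff: "u \<in> L2w s \<longleftrightarrow> l2 (jap s u)"
proof
  assume "u \<in> L2w s"
  hence m: "u \<in> borel_measurable borel" and "wnorm2 s u < \<infinity>" by (auto simp: L2w_def)
  hence "integrable lborel (\<lambda>x. (norm (jap s u x))\<^sup>2)"
    unfolding wnorm2_jap by (intro integrableI_nonneg) auto
  thus "l2 (jap s u)" using m by (simp add: l2_def)
next
  assume l: "l2 (jap s u)"
  have "jap (-s) (jap s u) = u" by (simp add: jap_jap jap_zero)
  hence "u \<in> borel_measurable borel" using jap_measurable[OF l2_measurable[OF l], of "-s"] by simp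
  moreover have "wnorm2 s u < \<infinity>" using nn_integral_l2[OF l] by (simp add: wnorm2_jap)
  ultimately show "u \<in> L2w s" by (simp add: L2w_def)
qed

lemma wnorm2_eq: "l2 (jap s u) \<Longrightarrow> wnorm2 s u = ennreal ((nrm (jap s u))\<^sup>2)"
  by (simp add: wnorm2_jap nn_integral_l2)

lemma wnorm_eq: "l2 (jap s u) \<Longrightarrow> wnorm s u = ennreal (nrm (jap s u))"
  by (simp add: wnorm_def wnorm2_eq)

lemma jap_mono:
  assumes "l2 (jap t u)" "s \<le> t" shows "l2 (jap s u)" "nrm (jap s u) \<le> nrm (jap t u)"
proof -
  have "jap (-t) (jap t u) = u" by (simp add: jap_jap jap_zero)
  hence m: "u \<in> borel_measurable borel" using jap_measurable[OF l2_measurable[OF assms(1)], of "-t"] by simp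
  have le: "norm (jap s u x) \<le> 1 * norm (jap t u x)" for x
    using assms(2) by (auto simp: jap_def intro!: mult_right_mono powr_mono)
  show "l2 (jap s u)" by (rule l2_dominated[OF assms(1) _ _ le]) (use m in auto)
  show "nrm (jap s u) \<le> nrm (jap t u)" using l2_dominated(2)[OF assms(1) _ _ le] m by simp
qed

subsection \<open>The Fourier transform on square-integrable functions\<close>

lemma lborel_integral_prod:
  fixes f :: "'a::euclidean_space \<Rightarrow> real \<Rightarrow> complex"
  assumes f: "\<And>b. b \<in> Basis \<Longrightarrow> integrable lborel (f b)"
  shows "integrable lborel (\<lambda>x::'a. \<Prod>b\<in>Basis. f b (x \<bullet> b))"
    "(\<integral>x. (\<Prod>b\<in>Basis. f b (x \<bullet> b)) \<partial>lborel) = (\<Prod>b\<in>Basis. \<integral>t. f b t \<partial>lborel)"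
proof -
  interpret product_sigma_finite "\<lambda>_::'a. lborel :: real measure" by standard
  let ?T = "\<lambda>g. \<Sum>b\<in>Basis. g b *\<^sub>R (b::'a)"
  have T[measurable]: "?T \<in> measurable (\<Pi>\<^sub>M b\<in>(Basis::'a set). lborel) borel" by measurable
  have [measurable]: "b \<in> Basis \<Longrightarrow> f b \<in> borel_measurable borel" for b using borel_measurable_integrable[OF f] by simp
  have meas: "(\<lambda>x::'a. \<Prod>b\<in>Basis. f b (x \<bullet> b)) \<in> borel_measurable borel" by measurable
  have eq: "(\<Prod>b\<in>Basis. f b (?T g \<bullet> b)) = (\<Prod>b\<in>Basis. f b (g b))" for g :: "'a \<Rightarrow> real"
    by (intro prod.cong) (auto simp: inner_sum_left inner_Basis if_distrib cong: if_cong)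
  show "integrable lborel (\<lambda>x::'a. \<Prod>b\<in>Basis. f b (x \<bullet> b))"
    by (subst lborel_eq, subst integrable_distr_eq[OF T meas]) (simp only: eq product_integrable_prod[OF finite_Basis f])
  show "(\<integral>x. (\<Prod>b\<in>Basis. f b (x \<bullet> b)) \<partial>lborel) = (\<Prod>b\<in>Basis. \<integral>t. f b t \<partial>lborel)"
    by (subst lborel_eq, subst integral_distr[OF T meas]) (simp only: eq product_integral_prod[OF finite_Basis f])
qed

text \<open>The characteristic function of the standard normal distribution, rescaled by y = e t.
  The Gaussian of width 1 / e in frequency turns into a normal density of standard deviation e
  centred at a.\<close>

lemma gaussian_fourier_1d:
  assumes e: "e > 0" and \<sigma>: "\<sigma> = 1 \<or> \<sigma> = -1"
  shows "integrable lborel (\<lambda>t. iexp (\<sigma> * (b - a) * t) * of_real (exp (- (e * t)\<^sup>2 / 2)))"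
    "(\<integral>t. iexp (\<sigma> * (b - a) * t) * of_real (exp (- (e * t)\<^sup>2 / 2)) \<partial>lborel) = of_real (2 * pi * normal_density a e b)"
proof -
  define s where "s = \<sigma> * (b - a) / e"
  define g where "g = (\<lambda>y. std_normal_density y *\<^sub>R iexp (s * y))"
  have "char std_normal_distribution s = (\<integral>y. g y \<partial>lborel)"
    unfolding char_def g_def by (subst integral_density) auto
  hence gi: "(\<integral>y. g y \<partial>lborel) = of_real (exp (- s\<^sup>2 / 2))" by (simp add: char_std_normal_distribution)
  have gint: "integrable lborel g"
    unfolding g_def
    by (rule Bochner_Integration.integrable_bound[OF integrable_normal_density[of 1 0]]) auto
  have geq: "g (0 + e * t) = of_real (1 / sqrt (2 * pi)) * (iexp (\<sigma> * (b - a) * t) * of_real (exp (- (e * t)\<^sup>2 / 2)))" for t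
    using e by (simp add: g_def std_normal_density_def scaleR_conv_of_real s_def mult_ac)
  have "integrable lborel (\<lambda>t. g (0 + e * t))" using gint e by (subst lborel_integrable_real_affine_iff) auto
  hence "integrable lborel (\<lambda>t. of_real (sqrt (2 * pi)) * g (0 + e * t))" by simp
  thus int: "integrable lborel (\<lambda>t. iexp (\<sigma> * (b - a) * t) * of_real (exp (- (e * t)\<^sup>2 / 2)))"
    unfolding geq by simp
  have "of_real (exp (- s\<^sup>2 / 2)) = e *\<^sub>R (\<integral>t. g (0 + e * t) \<partial>lborel)"
    using lborel_integral_real_affine[of e g 0] e gi by simp
  also have "\<dots> = of_real (e / sqrt (2 * pi)) * (\<integral>t. iexp (\<sigma> * (b - a) * t) * of_real (exp (- (e * t)\<^sup>2 / 2)) \<partial>lborel)"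
    unfolding geq by (simp add: scaleR_conv_of_real)
  finally have "(\<integral>t. iexp (\<sigma> * (b - a) * t) * of_real (exp (- (e * t)\<^sup>2 / 2)) \<partial>lborel) =
     of_real (sqrt (2 * pi) / e) * of_real (exp (- s\<^sup>2 / 2))"
    using e by (simp add: field_simps)
  also have "\<dots> = of_real (2 * pi * normal_density a e b)"
  proof -
    have "sqrt (2 * pi) / e = 2 * pi / sqrt (2 * pi * e\<^sup>2)"
      using e by (simp add: real_sqrt_mult field_simps)
    moreover have "s\<^sup>2 / 2 = (b - a)\<^sup>2 / (2 * e\<^sup>2)"
      using \<sigma> by (auto simp: s_def power_mult_distrib power_divide)
    ultimately show ?thesis unfolding normal_density_def of_real_mult[symmetric] by simp
  qed
  finally show "(\<integral>t. iexp (\<sigma> * (b - a) * t) * of_real (exp (- (e * t)\<^sup>2 / 2)) \<partial>lborel) = of_real (2 * pi * normal_density a e b)" .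
qed

text \<open>The approximate identity produced by a Gaussian cut-off in frequency: a normal density
  of width e around x, with total mass (2 pi)^n, which is the constant in Plancherel's theorem for
  the unnormalised transform.\<close>

definition gauss_kernel :: "real \<Rightarrow> 'a::euclidean_space \<Rightarrow> 'a \<Rightarrow> real" where
  "gauss_kernel e x y = (\<Prod>b\<in>Basis. 2 * pi * normal_density (x \<bullet> b) e (y \<bullet> b))"

lemma gauss_kernel_nonneg: "gauss_kernel e x y \<ge> 0"
  unfolding gauss_kernel_def by (intro prod_nonneg) auto

lemma gauss_kernel_sym: "gauss_kernel e x y = gauss_kernel e y x"
  unfolding gauss_kernel_def normal_density_def by (simp add: power2_commute)

lemma gauss_kernel_integral:
  fixes x :: "'a::euclidean_space"
  assumes "e > 0" shows "(\<integral>\<^sup>+y. ennreal (gauss_kernel e x y) \<partial>lborel) = ennreal ((2 * pi) ^ DIM('a))"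
proof -
  have "(\<integral>\<^sup>+y. ennreal (gauss_kernel e x y) \<partial>lborel) = (\<integral>\<^sup>+y. (\<Prod>b\<in>Basis. ennreal (2 * pi * normal_density (x \<bullet> b) e (y \<bullet> b))) \<partial>lborel)"
    unfolding gauss_kernel_def by (subst prod_ennreal) auto
  also have "\<dots> = (\<Prod>b\<in>Basis. (\<integral>\<^sup>+t. ennreal (2 * pi * normal_density (x \<bullet> b) e t) \<partial>lborel))"
    by (subst nn_integral_lborel_prod[where f="\<lambda>b t. ennreal (2 * pi * normal_density (x \<bullet> b) e t)"]) auto
  also have "\<dots> = (\<Prod>b\<in>(Basis::'a set). ennreal (2 * pi))"
  proof (intro prod.cong refl)
    fix b
    have "(\<integral>\<^sup>+t. ennreal (2 * pi * normal_density (x \<bullet> b) e t) \<partial>lborel) = ennreal (\<integral>t. 2 * pi * normal_density (x \<bullet> b) e t \<partial>lborel)"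
      using assms by (intro nn_integral_eq_integral) auto
    thus "(\<integral>\<^sup>+t. ennreal (2 * pi * normal_density (x \<bullet> b) e t) \<partial>lborel) = ennreal (2 * pi)" using assms by simp
  qed
  also have "\<dots> = ennreal ((2 * pi) ^ DIM('a))" by (simp add: ennreal_power)
  finally show ?thesis .
qed

lemma gaussian_fourier:
  fixes x y :: "'a::euclidean_space"
  assumes e: "e > 0" and \<sigma>: "\<sigma> = 1 \<or> \<sigma> = -1"
  shows "integrable lborel (\<lambda>\<xi>. iexp (\<sigma> * (\<xi> \<bullet> (y - x))) * of_real (exp (- (e * norm \<xi>)\<^sup>2 / 2)))"
    "(\<integral>\<xi>. iexp (\<sigma> * (\<xi> \<bullet> (y - x))) * of_real (exp (- (e * norm \<xi>)\<^sup>2 / 2)) \<partial>lborel) = of_real (gauss_kernel e x y)"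
proof -
  define f where "f = (\<lambda>b t. iexp (\<sigma> * (y \<bullet> b - x \<bullet> b) * t) * complex_of_real (exp (- (e * t)\<^sup>2 / 2)))"
  have eq: "(\<lambda>\<xi>. iexp (\<sigma> * (\<xi> \<bullet> (y - x))) * of_real (exp (- (e * norm \<xi>)\<^sup>2 / 2))) = (\<lambda>\<xi>. \<Prod>b\<in>Basis. f b (\<xi> \<bullet> b))"
  proof
    fix \<xi> :: 'a
    have a: "\<xi> \<bullet> (y - x) = (\<Sum>b\<in>Basis. (y \<bullet> b - x \<bullet> b) * (\<xi> \<bullet> b))"
      by (subst euclidean_inner) (simp add: inner_diff_left mult.commute)
    have b: "(norm \<xi>)\<^sup>2 = (\<Sum>b\<in>Basis. (\<xi> \<bullet> b)\<^sup>2)"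
      unfolding power2_norm_eq_inner by (subst euclidean_inner) (simp add: power2_eq_square)
    have "(\<Prod>b\<in>Basis. f b (\<xi> \<bullet> b)) = (\<Prod>b\<in>Basis. iexp (\<sigma> * (y \<bullet> b - x \<bullet> b) * (\<xi> \<bullet> b))) *
        (\<Prod>b\<in>Basis. complex_of_real (exp (- (e * (\<xi> \<bullet> b))\<^sup>2 / 2)))"
      unfolding f_def by (rule prod.distrib)
    also have "(\<Prod>b\<in>Basis. iexp (\<sigma> * (y \<bullet> b - x \<bullet> b) * (\<xi> \<bullet> b))) = iexp (\<sigma> * (\<xi> \<bullet> (y - x)))"
      unfolding a by (simp add: exp_sum[symmetric] sum_distrib_left mult.assoc)
    also have "(\<Prod>b\<in>Basis. complex_of_real (exp (- (e * (\<xi> \<bullet> b))\<^sup>2 / 2))) = of_real (exp (- (e * norm \<xi>)\<^sup>2 / 2))"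
      unfolding power_mult_distrib b
      by (simp add: exp_sum[symmetric] of_real_prod[symmetric] sum_distrib_left sum_negf sum_divide_distrib del: of_real_prod)
    finally show "iexp (\<sigma> * (\<xi> \<bullet> (y - x))) * of_real (exp (- (e * norm \<xi>)\<^sup>2 / 2)) = (\<Prod>b\<in>Basis. f b (\<xi> \<bullet> b))" by simp
  qed
  have fi: "integrable lborel (f b)" for b unfolding f_def by (rule gaussian_fourier_1d(1)[OF e \<sigma>])
  show "integrable lborel (\<lambda>\<xi>. iexp (\<sigma> * (\<xi> \<bullet> (y - x))) * of_real (exp (- (e * norm \<xi>)\<^sup>2 / 2)))"
    unfolding eq by (rule lborel_integral_prod(1)[OF fi])
  have "(\<integral>\<xi>. (\<Prod>b\<in>Basis. f b (\<xi> \<bullet> b)) \<partial>lborel) = (\<Prod>b\<in>Basis. \<integral>t. f b t \<partial>lborel)"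
    by (rule lborel_integral_prod(2)[OF fi])
  also have "\<dots> = of_real (gauss_kernel e x y)"
    unfolding f_def gauss_kernel_def gaussian_fourier_1d(2)[OF e \<sigma>] of_real_prod ..
  finally show "(\<integral>\<xi>. iexp (\<sigma> * (\<xi> \<bullet> (y - x))) * of_real (exp (- (e * norm \<xi>)\<^sup>2 / 2)) \<partial>lborel) = of_real (gauss_kernel e x y)"
    unfolding eq .
qed

text \<open>Every exchange of integrals for Fourier kernels rests on this: k is the oscillating
  factor, of modulus at most 1, and f and g are integrable in separate variables.\<close>

lemma integrable_pair_bounded_mult:
  fixes f g :: "'a::euclidean_space \<Rightarrow> complex" and k :: "'a \<times> 'a \<Rightarrow> complex"
  assumes f: "integrable lborel f" and g: "integrable lborel g"
    and k[measurable]: "k \<in> borel_measurable borel" and kb: "\<And>p. cmod (k p) \<le> 1"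
  shows "integrable (lborel \<Otimes>\<^sub>M lborel) (\<lambda>(x, y). k (x, y) * f x * g y)"
proof (rule lborel_pair.Fubini_integrable)
  have [measurable]: "f \<in> borel_measurable borel" "g \<in> borel_measurable borel"
    using f g by (auto dest: borel_measurable_integrable)
  have k2[measurable]: "k \<in> borel_measurable (lborel \<Otimes>\<^sub>M lborel)"
    using k by (simp add: lborel_prod)
  show m: "(\<lambda>(x, y). k (x, y) * f x * g y) \<in> borel_measurable (lborel \<Otimes>\<^sub>M lborel)" by measurable
  have km: "(\<lambda>y. k (x, y)) \<in> borel_measurable borel" for x by measurable
  have i: "integrable lborel (\<lambda>y. k (x, y) * f x * g y)" for x
  proof (rule Bochner_Integration.integrable_bound[where f="\<lambda>y. f x * g y"])
    show "AE y in lborel. cmod (k (x, y) * f x * g y) \<le> cmod (f x * g y)"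
      using kb by (intro AE_I2) (simp add: norm_mult mult.assoc mult_left_le_one_le)
    show "(\<lambda>y. k (x, y) * f x * g y) \<in> borel_measurable lborel" using km by measurable
  qed (use g in simp)
  thus "AE x in lborel. integrable lborel (\<lambda>y. case (x, y) of (x, y) \<Rightarrow> k (x, y) * f x * g y)" by simp
  show "integrable lborel (\<lambda>x. \<integral>y. cmod (case (x, y) of (x, y) \<Rightarrow> k (x, y) * f x * g y) \<partial>lborel)"
  proof (rule Bochner_Integration.integrable_bound[where f="\<lambda>x. (\<integral>y. cmod (g y) \<partial>lborel) * cmod (f x)"])
    show "integrable lborel (\<lambda>x. (\<integral>y. cmod (g y) \<partial>lborel) * cmod (f x))" using f by simp
    show "(\<lambda>x. \<integral>y. cmod (case (x, y) of (x, y) \<Rightarrow> k (x, y) * f x * g y) \<partial>lborel) \<in> borel_measurable lborel"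
      using m by measurable
    have "norm (\<integral>y. cmod (k (x, y) * f x * g y) \<partial>lborel) \<le> norm ((\<integral>y. cmod (g y) \<partial>lborel) * cmod (f x))" for x
    proof -
      have "(\<integral>y. cmod (k (x, y) * f x * g y) \<partial>lborel) \<le> (\<integral>y. cmod (f x) * cmod (g y) \<partial>lborel)"
        using kb g by (intro integral_mono integrable_norm i) (auto simp: norm_mult mult.assoc mult_left_le_one_le)
      moreover have "0 \<le> (\<integral>y. cmod (k (x, y) * f x * g y) \<partial>lborel)" by simp
      ultimately show ?thesis by (simp add: mult.commute)
    qed
    thus "AE x in lborel. norm (\<integral>y. cmod (case (x, y) of (x, y) \<Rightarrow> k (x, y) * f x * g y) \<partial>lborel) \<le>
       norm ((\<integral>y. cmod (g y) \<partial>lborel) * cmod (f x))" by simp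
  qed
qed

section \<open>Plancherel's inequality for integrable scalar functions\<close>

definition ft :: "real \<Rightarrow> ('a::euclidean_space \<Rightarrow> complex) \<Rightarrow> 'a \<Rightarrow> complex" where
  "ft \<sigma> u \<xi> = (\<integral>x. iexp (\<sigma> * (\<xi> \<bullet> x)) * u x \<partial>lborel)"

lemma iexp_measurable [measurable]: "iexp \<in> borel_measurable borel"
  by (intro borel_measurable_continuous_onI continuous_intros)

lemma ft_measurable:
  assumes u: "integrable lborel u" shows "ft \<sigma> u \<in> borel_measurable borel"
proof -
  have [measurable]: "u \<in> borel_measurable borel" using u by (auto dest: borel_measurable_integrable)
  have "(\<lambda>\<xi>. ft \<sigma> u \<xi>) \<in> borel_measurable lborel"
    unfolding ft_def by (rule lborel.borel_measurable_lebesgue_integral) measurable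
  thus ?thesis by simp
qed

lemma ft_bound: "cmod (ft \<sigma> u \<xi>) \<le> (\<integral>x. cmod (u x) \<partial>lborel)"
  unfolding ft_def by (rule order_trans[OF integral_norm_bound]) (simp add: norm_mult)

text \<open>The transform of an integrable function is only bounded, so the Gaussian factor is
  needed to make all exchanges of integrals legitimate. Two of them turn the left side into a
  quadratic form of u with the symmetric positive kernel \<open>gauss_kernel\<close>, whose norm on
  square-integrable functions is at most its mass.\<close>

lemma ft_gaussian_bound:
  fixes u :: "'a::euclidean_space \<Rightarrow> complex"
  assumes u: "integrable lborel u" and \<sigma>: "\<sigma> = 1 \<or> \<sigma> = -1" and e: "e > 0"
  shows "(\<integral>\<^sup>+\<xi>. ennreal ((cmod (ft \<sigma> u \<xi>))\<^sup>2 * exp (- (e * norm \<xi>)\<^sup>2 / 2)) \<partial>lborel) \<le>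
    ennreal ((2 * pi) ^ DIM('a)) * (\<integral>\<^sup>+x. ennreal ((cmod (u x))\<^sup>2) \<partial>lborel)"
proof -
  define G where "G = (\<lambda>\<xi>::'a. exp (- (e * norm \<xi>)\<^sup>2 / 2))"
  define U where "U = ft \<sigma> u"
  have um[measurable]: "u \<in> borel_measurable borel" using u by (auto dest: borel_measurable_integrable)
  have Um[measurable]: "U \<in> borel_measurable borel" unfolding U_def by (rule ft_measurable[OF u])
  have Gm[measurable]: "G \<in> borel_measurable borel" unfolding G_def by measurable
  have cm[measurable]: "cnj \<in> borel_measurable borel"
    by (intro borel_measurable_continuous_onI continuous_intros)
  have Gi: "integrable lborel (\<lambda>\<xi>. complex_of_real (G \<xi>))"
    using gaussian_fourier(1)[OF e \<sigma>, of 0 0] by (simp add: G_def)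
  have k1: "(\<lambda>p::'a \<times> 'a. iexp (\<sigma> * (fst p \<bullet> snd p))) \<in> borel_measurable borel"
    by (intro borel_measurable_continuous_onI continuous_intros)
  have k2: "(\<lambda>p::'a \<times> 'a. iexp (\<sigma> * (fst p \<bullet> (snd p - x)))) \<in> borel_measurable borel" for x
    by (intro borel_measurable_continuous_onI continuous_intros)
  define B where "B = (\<integral>x. cmod (u x) \<partial>lborel)"
  have B0: "B \<ge> 0" by (simp add: B_def)
  have UGi: "integrable lborel (\<lambda>\<xi>. cnj (U \<xi>) * of_real (G \<xi>))"
  proof (rule Bochner_Integration.integrable_bound[where f="\<lambda>\<xi>. B * cmod (of_real (G \<xi>))"])
    show "integrable lborel (\<lambda>\<xi>. B * cmod (of_real (G \<xi>)))" using integrable_norm[OF Gi] by simp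
    show "AE \<xi> in lborel. cmod (cnj (U \<xi>) * of_real (G \<xi>)) \<le> norm (B * cmod (of_real (G \<xi>)))"
      using ft_bound[of \<sigma> u] B0 by (intro AE_I2) (simp add: norm_mult abs_mult U_def B_def mult_right_mono)
  qed measurable
  have "(\<integral>\<xi>. of_real ((cmod (U \<xi>))\<^sup>2 * G \<xi>) \<partial>lborel) = (\<integral>\<xi>. (\<integral>x. iexp (\<sigma> * (\<xi> \<bullet> x)) * (cnj (U \<xi>) * of_real (G \<xi>)) * u x \<partial>lborel) \<partial>lborel)"
  proof (intro Bochner_Integration.integral_cong refl)
    fix \<xi>
    have "(\<integral>x. iexp (\<sigma> * (\<xi> \<bullet> x)) * (cnj (U \<xi>) * of_real (G \<xi>)) * u x \<partial>lborel) =
        (\<integral>x. (cnj (U \<xi>) * of_real (G \<xi>)) * (iexp (\<sigma> * (\<xi> \<bullet> x)) * u x) \<partial>lborel)" by (simp add: mult_ac)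
    also have "\<dots> = (cnj (U \<xi>) * of_real (G \<xi>)) * U \<xi>" unfolding U_def ft_def by simp
    also have "\<dots> = of_real ((cmod (U \<xi>))\<^sup>2 * G \<xi>)"
      unfolding of_real_mult complex_norm_square by (simp add: mult_ac)
    finally show "of_real ((cmod (U \<xi>))\<^sup>2 * G \<xi>) = (\<integral>x. iexp (\<sigma> * (\<xi> \<bullet> x)) * (cnj (U \<xi>) * of_real (G \<xi>)) * u x \<partial>lborel)" by simp
  qed
  also have "\<dots> = (\<integral>x. (\<integral>\<xi>. iexp (\<sigma> * (\<xi> \<bullet> x)) * (cnj (U \<xi>) * of_real (G \<xi>)) * u x \<partial>lborel) \<partial>lborel)"
    using integrable_pair_bounded_mult[OF UGi u k1]
    by (intro lborel_pair.Fubini_integral[symmetric]) (simp add: case_prod_unfold)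
  also have "\<dots> = (\<integral>x. u x * cnj (\<integral>y. u y * of_real (gauss_kernel e x y) \<partial>lborel) \<partial>lborel)"
  proof (intro Bochner_Integration.integral_cong refl)
    fix x
    \<comment> \<open>The second factor U is written out as an integral over y; the oscillating
      factors combine to one depending on y - x, and its Gaussian integral is the kernel.\<close>
    have "(\<integral>\<xi>. iexp (- (\<sigma> * (\<xi> \<bullet> x))) * (U \<xi> * of_real (G \<xi>)) \<partial>lborel) =
       (\<integral>\<xi>. (\<integral>y. iexp (\<sigma> * (\<xi> \<bullet> (y - x))) * of_real (G \<xi>) * u y \<partial>lborel) \<partial>lborel)"
    proof (intro Bochner_Integration.integral_cong refl)
      fix \<xi>
      have split: "iexp (\<sigma> * (\<xi> \<bullet> (y - x))) * of_real (G \<xi>) * u y =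
         (iexp (- (\<sigma> * (\<xi> \<bullet> x))) * of_real (G \<xi>)) * (iexp (\<sigma> * (\<xi> \<bullet> y)) * u y)" for y
        by (simp add: inner_diff_right right_diff_distrib exp_diff exp_minus divide_inverse mult_ac)
      show "iexp (- (\<sigma> * (\<xi> \<bullet> x))) * (U \<xi> * of_real (G \<xi>)) = (\<integral>y. iexp (\<sigma> * (\<xi> \<bullet> (y - x))) * of_real (G \<xi>) * u y \<partial>lborel)"
        unfolding split integral_mult_right_zero ft_def[symmetric] U_def by (simp only: mult_ac)
    qed
    also have "\<dots> = (\<integral>y. (\<integral>\<xi>. iexp (\<sigma> * (\<xi> \<bullet> (y - x))) * of_real (G \<xi>) * u y \<partial>lborel) \<partial>lborel)"
      using integrable_pair_bounded_mult[OF Gi u k2]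
      by (intro lborel_pair.Fubini_integral[symmetric]) (simp add: case_prod_unfold)
    also have "\<dots> = (\<integral>y. u y * of_real (gauss_kernel e x y) \<partial>lborel)"
    proof (intro Bochner_Integration.integral_cong refl)
      fix y
      have "(\<integral>\<xi>. iexp (\<sigma> * (\<xi> \<bullet> (y - x))) * of_real (G \<xi>) * u y \<partial>lborel) = of_real (gauss_kernel e x y) * u y"
        unfolding G_def gaussian_fourier(2)[OF e \<sigma>, symmetric] by simp
      thus "(\<integral>\<xi>. iexp (\<sigma> * (\<xi> \<bullet> (y - x))) * of_real (G \<xi>) * u y \<partial>lborel) = u y * of_real (gauss_kernel e x y)" by simp
    qed
    finally have v: "(\<integral>\<xi>. iexp (- (\<sigma> * (\<xi> \<bullet> x))) * (U \<xi> * of_real (G \<xi>)) \<partial>lborel) = (\<integral>y. u y * of_real (gauss_kernel e x y) \<partial>lborel)" .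
    have "(\<integral>\<xi>. iexp (\<sigma> * (\<xi> \<bullet> x)) * (cnj (U \<xi>) * of_real (G \<xi>)) * u x \<partial>lborel) =
       (\<integral>\<xi>. cnj (iexp (- (\<sigma> * (\<xi> \<bullet> x))) * (U \<xi> * of_real (G \<xi>))) * u x \<partial>lborel)"
      by (simp add: exp_cnj)
    also have "\<dots> = u x * (\<integral>\<xi>. cnj (iexp (- (\<sigma> * (\<xi> \<bullet> x))) * (U \<xi> * of_real (G \<xi>))) \<partial>lborel)"
      by simp
    also have "(\<integral>\<xi>. cnj (iexp (- (\<sigma> * (\<xi> \<bullet> x))) * (U \<xi> * of_real (G \<xi>))) \<partial>lborel) =
       cnj (\<integral>\<xi>. iexp (- (\<sigma> * (\<xi> \<bullet> x))) * (U \<xi> * of_real (G \<xi>)) \<partial>lborel)" by (rule Bochner_Integration.integral_cnj)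
    finally show "(\<integral>\<xi>. iexp (\<sigma> * (\<xi> \<bullet> x)) * (cnj (U \<xi>) * of_real (G \<xi>)) * u x \<partial>lborel) =
      u x * cnj (\<integral>y. u y * of_real (gauss_kernel e x y) \<partial>lborel)" unfolding v .
  qed
  finally have main: "of_real (\<integral>\<xi>. (cmod (U \<xi>))\<^sup>2 * G \<xi> \<partial>lborel) = (\<integral>x. u x * cnj (\<integral>y. u y * of_real (gauss_kernel e x y) \<partial>lborel) \<partial>lborel)"
    unfolding integral_complex_of_real .
  have km[measurable]: "(\<lambda>p. gauss_kernel e (fst p) (snd p)) \<in> borel_measurable (lborel \<Otimes>\<^sub>M lborel)"
    unfolding gauss_kernel_def normal_density_def by measurable
  have km'[measurable]: "(\<lambda>y. gauss_kernel e x y) \<in> borel_measurable borel" "(\<lambda>y. gauss_kernel e y x) \<in> borel_measurable borel" for x :: 'a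
    unfolding gauss_kernel_def normal_density_def by measurable
  let ?A = "ennreal ((2 * pi) ^ DIM('a)) * (\<integral>\<^sup>+x. ennreal ((cmod (u x))\<^sup>2) \<partial>lborel)"
  have I1: "(\<integral>\<^sup>+x. \<integral>\<^sup>+y. ennreal ((cmod (u x))\<^sup>2 * gauss_kernel e x y) \<partial>lborel \<partial>lborel) = ?A"
  proof -
    have "(\<integral>\<^sup>+y. ennreal ((cmod (u x))\<^sup>2 * gauss_kernel e x y) \<partial>lborel) = ennreal ((2 * pi) ^ DIM('a)) * ennreal ((cmod (u x))\<^sup>2)" for x
    proof -
      have "(\<integral>\<^sup>+y. ennreal ((cmod (u x))\<^sup>2 * gauss_kernel e x y) \<partial>lborel) = (\<integral>\<^sup>+y. ennreal ((cmod (u x))\<^sup>2) * ennreal (gauss_kernel e x y) \<partial>lborel)"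
        by (simp add: ennreal_mult' gauss_kernel_nonneg)
      also have "\<dots> = ennreal ((cmod (u x))\<^sup>2) * ennreal ((2 * pi) ^ DIM('a))"
        by (subst nn_integral_cmult) (auto simp: gauss_kernel_integral[OF e])
      finally show ?thesis by (simp add: mult.commute)
    qed
    thus ?thesis by (simp add: nn_integral_cmult)
  qed
  have I2: "(\<integral>\<^sup>+x. \<integral>\<^sup>+y. ennreal ((cmod (u y))\<^sup>2 * gauss_kernel e x y) \<partial>lborel \<partial>lborel) = ?A"
  proof -
    have "(\<integral>\<^sup>+x. \<integral>\<^sup>+y. ennreal ((cmod (u y))\<^sup>2 * gauss_kernel e x y) \<partial>lborel \<partial>lborel) =
      (\<integral>\<^sup>+y. \<integral>\<^sup>+x. ennreal ((cmod (u y))\<^sup>2 * gauss_kernel e x y) \<partial>lborel \<partial>lborel)"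
      using km by (intro lborel_pair.Fubini'[symmetric]) (simp add: case_prod_unfold)
    also have "\<dots> = ?A" using I1 by (simp add: gauss_kernel_sym[of e])
    finally show ?thesis .
  qed
  have "ennreal (cmod (\<integral>x. u x * cnj (\<integral>y. u y * of_real (gauss_kernel e x y) \<partial>lborel) \<partial>lborel)) \<le>
     (\<integral>\<^sup>+x. \<integral>\<^sup>+y. ennreal (cmod (u x) * cmod (u y) * gauss_kernel e x y) \<partial>lborel \<partial>lborel)"
  proof -
    have nb: "ennreal (norm (integral\<^sup>L lborel f)) \<le> (\<integral>\<^sup>+x. ennreal (norm (f x)) \<partial>lborel)" for f :: "'a \<Rightarrow> complex"
      by (cases "integrable lborel f") (auto intro: integral_norm_bound_ennreal simp: not_integrable_integral_eq)
    have "ennreal (cmod (u x * cnj (\<integral>y. u y * of_real (gauss_kernel e x y) \<partial>lborel))) \<le>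
        (\<integral>\<^sup>+y. ennreal (cmod (u x) * cmod (u y) * gauss_kernel e x y) \<partial>lborel)" for x
    proof -
      have "ennreal (cmod (u x * cnj (\<integral>y. u y * of_real (gauss_kernel e x y) \<partial>lborel))) =
          ennreal (cmod (u x)) * ennreal (cmod (\<integral>y. u y * of_real (gauss_kernel e x y) \<partial>lborel))"
        by (simp add: norm_mult ennreal_mult')
      also have "\<dots> \<le> ennreal (cmod (u x)) * (\<integral>\<^sup>+y. ennreal (cmod (u y * of_real (gauss_kernel e x y))) \<partial>lborel)"
        by (intro mult_left_mono nb) auto
      also have "\<dots> = (\<integral>\<^sup>+y. ennreal (cmod (u x)) * ennreal (cmod (u y * of_real (gauss_kernel e x y))) \<partial>lborel)"
        by (rule nn_integral_cmult[symmetric]) measurable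
      also have "\<dots> = (\<integral>\<^sup>+y. ennreal (cmod (u x) * cmod (u y) * gauss_kernel e x y) \<partial>lborel)"
        by (simp add: norm_mult ennreal_mult'[symmetric] gauss_kernel_nonneg mult.assoc)
      finally show ?thesis .
    qed
    thus ?thesis by (intro order_trans[OF nb] nn_integral_mono)
  qed
  \<comment> \<open>Schur's test: the product of the two values is at most half the sum of their
    squares, and by symmetry the kernel has the same mass in either variable.\<close>
  also have "\<dots> \<le> (\<integral>\<^sup>+x. \<integral>\<^sup>+y. (ennreal ((cmod (u x))\<^sup>2 * gauss_kernel e x y) + ennreal ((cmod (u y))\<^sup>2 * gauss_kernel e x y)) / 2 \<partial>lborel \<partial>lborel)"
  proof (intro nn_integral_mono)
    fix x y
    have "cmod (u x) * cmod (u y) * gauss_kernel e x y \<le> ((cmod (u x))\<^sup>2 + (cmod (u y))\<^sup>2) / 2 * gauss_kernel e x y"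
      using sum_squares_bound[of "cmod (u x)" "cmod (u y)"] by (intro mult_right_mono gauss_kernel_nonneg) simp
    hence "ennreal (cmod (u x) * cmod (u y) * gauss_kernel e x y) \<le> ennreal (((cmod (u x))\<^sup>2 * gauss_kernel e x y + (cmod (u y))\<^sup>2 * gauss_kernel e x y) / 2)"
      by (intro ennreal_leI) (simp add: algebra_simps add_divide_distrib)
    also have "\<dots> = (ennreal ((cmod (u x))\<^sup>2 * gauss_kernel e x y) + ennreal ((cmod (u y))\<^sup>2 * gauss_kernel e x y)) / 2"
      by (simp add: ennreal_plus[symmetric] gauss_kernel_nonneg divide_ennreal[symmetric] del: ennreal_plus)
    finally show "ennreal (cmod (u x) * cmod (u y) * gauss_kernel e x y) \<le> \<dots>" .
  qed
  also have "\<dots> = (?A + ?A) / 2"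
  proof -
    have s: "(\<integral>\<^sup>+y. (ennreal ((cmod (u x))\<^sup>2 * gauss_kernel e x y) + ennreal ((cmod (u y))\<^sup>2 * gauss_kernel e x y)) / 2 \<partial>lborel) =
       ((\<integral>\<^sup>+y. ennreal ((cmod (u x))\<^sup>2 * gauss_kernel e x y) \<partial>lborel) + (\<integral>\<^sup>+y. ennreal ((cmod (u y))\<^sup>2 * gauss_kernel e x y) \<partial>lborel)) / 2" for x
      by (subst nn_integral_divide, measurable, subst nn_integral_add) auto
    have m: "(\<lambda>x. \<integral>\<^sup>+y. ennreal ((cmod (u x))\<^sup>2 * gauss_kernel e x y) \<partial>lborel) \<in> borel_measurable lborel"
      "(\<lambda>x. \<integral>\<^sup>+y. ennreal ((cmod (u y))\<^sup>2 * gauss_kernel e x y) \<partial>lborel) \<in> borel_measurable lborel"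
      using km by (auto intro!: lborel.borel_measurable_nn_integral simp: case_prod_unfold)
    show ?thesis unfolding s using m by (subst nn_integral_divide, simp, subst nn_integral_add) (auto simp: I1 I2)
  qed
  also have "\<dots> = ?A" by (simp add: mult_2[symmetric] ennreal_times_divide[symmetric] mult.commute[of 2])
  finally have le: "ennreal (cmod (\<integral>x. u x * cnj (\<integral>y. u y * of_real (gauss_kernel e x y) \<partial>lborel) \<partial>lborel)) \<le> ?A" .
  have int: "integrable lborel (\<lambda>\<xi>. (cmod (U \<xi>))\<^sup>2 * G \<xi>)"
  proof (rule Bochner_Integration.integrable_bound[where f="\<lambda>\<xi>. B * cmod (cnj (U \<xi>) * of_real (G \<xi>))"])
    show "integrable lborel (\<lambda>\<xi>. B * cmod (cnj (U \<xi>) * of_real (G \<xi>)))" using integrable_norm[OF UGi] by simp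
    show "AE \<xi> in lborel. norm ((cmod (U \<xi>))\<^sup>2 * G \<xi>) \<le> norm (B * cmod (cnj (U \<xi>) * of_real (G \<xi>)))"
      using ft_bound[of \<sigma> u] B0
      by (intro AE_I2) (simp add: norm_mult abs_mult U_def B_def mult_right_mono power2_eq_square mult.assoc)
  qed measurable
  have "(\<integral>\<^sup>+\<xi>. ennreal ((cmod (U \<xi>))\<^sup>2 * G \<xi>) \<partial>lborel) = ennreal (\<integral>\<xi>. (cmod (U \<xi>))\<^sup>2 * G \<xi> \<partial>lborel)"
    by (rule nn_integral_eq_integral[OF int]) (simp add: G_def)
  also have "(\<integral>\<xi>. (cmod (U \<xi>))\<^sup>2 * G \<xi> \<partial>lborel) = cmod (of_real (\<integral>\<xi>. (cmod (U \<xi>))\<^sup>2 * G \<xi> \<partial>lborel))"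
    by (simp add: G_def)
  finally show ?thesis using le unfolding main by (simp add: U_def G_def)
qed

text \<open>The widths 1 / (m + 1) tend to 0, so the Gaussian factors tend to 1 pointwise; Fatou's
  lemma passes to the limit, since the bound does not depend on the width.\<close>

lemma ft_plancherel_le:
  fixes u :: "'a::euclidean_space \<Rightarrow> complex"
  assumes u: "integrable lborel u" and \<sigma>: "\<sigma> = 1 \<or> \<sigma> = -1"
  shows "(\<integral>\<^sup>+\<xi>. ennreal ((cmod (ft \<sigma> u \<xi>))\<^sup>2) \<partial>lborel) \<le>
    ennreal ((2 * pi) ^ DIM('a)) * (\<integral>\<^sup>+x. ennreal ((cmod (u x))\<^sup>2) \<partial>lborel)" (is "_ \<le> ?A")
proof -
  note [measurable] = ft_measurable[OF u, of \<sigma>]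
  define h where "h = (\<lambda>(m::nat) \<xi>. ennreal ((cmod (ft \<sigma> u \<xi>))\<^sup>2 * exp (- (1 / real (Suc m) * norm \<xi>)\<^sup>2 / 2)))"
  have "(\<integral>\<^sup>+\<xi>. ennreal ((cmod (ft \<sigma> u \<xi>))\<^sup>2) \<partial>lborel) = (\<integral>\<^sup>+\<xi>. liminf (\<lambda>m. h m \<xi>) \<partial>lborel)"
  proof (intro nn_integral_cong)
    fix \<xi> :: 'a
    have "(\<lambda>m. inverse (real (Suc m))) \<longlonglongrightarrow> 0" by (rule LIMSEQ_inverse_real_of_nat)
    hence "(\<lambda>m. 1 / real (Suc m)) \<longlonglongrightarrow> 0" by (simp add: inverse_eq_divide)
    hence "(\<lambda>m. (cmod (ft \<sigma> u \<xi>))\<^sup>2 * exp (- (1 / real (Suc m) * norm \<xi>)\<^sup>2 / 2)) \<longlonglongrightarrow> (cmod (ft \<sigma> u \<xi>))\<^sup>2 * exp (- (0 * norm \<xi>)\<^sup>2 / 2)"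
      by (intro tendsto_intros) auto
    hence "(\<lambda>m. h m \<xi>) \<longlonglongrightarrow> ennreal ((cmod (ft \<sigma> u \<xi>))\<^sup>2)" unfolding h_def by (intro tendsto_ennrealI) simp
    thus "ennreal ((cmod (ft \<sigma> u \<xi>))\<^sup>2) = liminf (\<lambda>m. h m \<xi>)" by (intro lim_imp_Liminf[symmetric]) auto
  qed
  also have "\<dots> \<le> liminf (\<lambda>m. \<integral>\<^sup>+\<xi>. h m \<xi> \<partial>lborel)" by (rule nn_integral_liminf) (simp add: h_def)
  also have "\<dots> \<le> ?A"
  proof -
    have "\<forall>\<^sub>F m in sequentially. (\<integral>\<^sup>+\<xi>. h m \<xi> \<partial>lborel) \<le> ?A"
      unfolding h_def by (intro always_eventually allI ft_gaussian_bound[OF u \<sigma>]) simp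
    from order_trans[OF Liminf_le_Limsup[OF sequentially_bot] Limsup_bounded[OF this]]
    show ?thesis .
  qed
  finally show ?thesis .
qed

section \<open>Normalised transforms of vector-valued functions\<close>

lemma norm_vec_sq: "(norm (v :: complex^'k::finite))\<^sup>2 = (\<Sum>k\<in>UNIV. (cmod (v $ k))\<^sup>2)"
  by (simp add: norm_vec_def L2_set_def sum_nonneg)

lemma integrable_vec_nth:
  fixes u :: "'a \<Rightarrow> complex^'k::finite"
  assumes "integrable N u" shows "integrable N (\<lambda>x. u x $ k)"
  by (rule integrable_bounded_linear[OF bounded_linear_vec_nth assms])

lemma integral_vec_nth:
  fixes u :: "'a \<Rightarrow> complex^'k::finite"
  assumes "integrable N u" shows "(\<integral>x. u x \<partial>N) $ k = (\<integral>x. u x $ k \<partial>N)"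
  by (rule integral_bounded_linear[OF bounded_linear_vec_nth assms, symmetric])

lemma integrable_iexp_cscale:
  fixes u :: "'a::euclidean_space \<Rightarrow> complex^'k::finite"
  assumes u: "integrable lborel u" shows "integrable lborel (\<lambda>x. iexp (\<sigma> * (\<xi> \<bullet> x)) *s u x)"
proof (rule Bochner_Integration.integrable_bound[OF u])
  have [measurable]: "u \<in> borel_measurable borel" using u by (auto dest: borel_measurable_integrable)
  show "(\<lambda>x. iexp (\<sigma> * (\<xi> \<bullet> x)) *s u x) \<in> borel_measurable lborel" by measurable
qed (auto simp: norm_cscale)

definition fconst :: "'n::finite itself \<Rightarrow> real" where
  "fconst _ = (2 * pi) powr (- real CARD('n) / 2)"

lemma fconst_pos: "fconst TYPE('n::finite) > 0" by (simp add: fconst_def)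

lemma fconst_sq: "(fconst TYPE('n::finite))\<^sup>2 * (2 * pi) ^ CARD('n) = 1"
proof -
  have "(fconst TYPE('n))\<^sup>2 = (2 * pi) powr (- real CARD('n))"
    unfolding fconst_def power2_eq_square by (simp add: powr_add[symmetric])
  moreover have "(2 * pi) ^ CARD('n) = (2 * pi) powr (real CARD('n))" by (simp add: powr_realpow)
  ultimately show ?thesis by (simp add: powr_add[symmetric])
qed

lemma fourier_int_eq:
  "fourier_int \<sigma> u \<xi> = fconst TYPE('n) *\<^sub>R (\<integral>x. iexp (\<sigma> * (\<xi> \<bullet> x)) *s u x \<partial>lborel)"
  for u :: "real^'n::finite \<Rightarrow> complex^'k::finite"
  unfolding fourier_int_def fconst_def ..

lemma fourier_int_nth:
  fixes u :: "real^'n::finite \<Rightarrow> complex^'k::finite"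
  assumes u: "integrable lborel u"
  shows "fourier_int \<sigma> u \<xi> $ k = of_real (fconst TYPE('n)) * ft \<sigma> (\<lambda>x. u x $ k) \<xi>"
  unfolding fourier_int_eq vector_scaleR_component integral_vec_nth[OF integrable_iexp_cscale[OF u]]
    vector_smult_component ft_def[symmetric] by (rule scaleR_conv_of_real)

lemma fourier_int_measurable:
  fixes u :: "real^'n::finite \<Rightarrow> complex^'k::finite"
  assumes u: "integrable lborel u" shows "fourier_int \<sigma> u \<in> borel_measurable borel"
proof (rule borel_measurable_vecI)
  fix k
  note [measurable] = ft_measurable[OF integrable_vec_nth[OF u]]
  show "(\<lambda>x. fourier_int \<sigma> u x $ k) \<in> borel_measurable borel" unfolding fourier_int_nth[OF u] by measurable
qed

text \<open>Squared norms are summed over components; the squared normalising factor cancels (2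
  pi)^n exactly, so the transform is a contraction and can be extended by density.\<close>

lemma fourier_int_plancherel:
  fixes u :: "real^'n::finite \<Rightarrow> complex^'k::finite"
  assumes u: "integrable lborel u" "l2 u" and \<sigma>: "\<sigma> = 1 \<or> \<sigma> = -1"
  shows "l2 (fourier_int \<sigma> u)" "nrm (fourier_int \<sigma> u) \<le> nrm u"
proof -
  note [measurable] = l2_measurable[OF u(2)] ft_measurable[OF integrable_vec_nth[OF u(1)]]
  let ?c = "fconst TYPE('n)"
  have "(\<integral>\<^sup>+\<xi>. ennreal ((norm (fourier_int \<sigma> u \<xi>))\<^sup>2) \<partial>lborel) =
      (\<integral>\<^sup>+\<xi>. (\<Sum>k\<in>UNIV. ennreal (?c\<^sup>2) * ennreal ((cmod (ft \<sigma> (\<lambda>x. u x $ k) \<xi>))\<^sup>2)) \<partial>lborel)"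
    unfolding norm_vec_sq fourier_int_nth[OF u(1)]
    by (intro nn_integral_cong) (simp add: norm_mult power_mult_distrib ennreal_mult'[symmetric] sum_nonneg sum_ennreal)
  also have "\<dots> = (\<Sum>k\<in>UNIV. ennreal (?c\<^sup>2) * (\<integral>\<^sup>+\<xi>. ennreal ((cmod (ft \<sigma> (\<lambda>x. u x $ k) \<xi>))\<^sup>2) \<partial>lborel))"
    by (subst nn_integral_sum) (auto simp: nn_integral_cmult)
  also have "\<dots> \<le> (\<Sum>k\<in>UNIV. ennreal (?c\<^sup>2) * (ennreal ((2 * pi) ^ CARD('n)) * (\<integral>\<^sup>+x. ennreal ((cmod (u x $ k))\<^sup>2) \<partial>lborel)))"
    using ft_plancherel_le[OF integrable_vec_nth[OF u(1)] \<sigma>] by (intro sum_mono mult_left_mono) auto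
  also have "\<dots> = (\<Sum>k\<in>UNIV. (\<integral>\<^sup>+x. ennreal ((cmod (u x $ k))\<^sup>2) \<partial>lborel))"
  proof -
    have "ennreal (?c\<^sup>2) * ennreal ((2 * pi) ^ CARD('n)) = 1"
      by (subst ennreal_mult'[symmetric]) (simp_all only: fconst_sq zero_le_power2 ennreal_1)
    thus ?thesis by (simp only: mult.assoc[symmetric] mult_1)
  qed
  also have "\<dots> = (\<integral>\<^sup>+x. (\<Sum>k\<in>UNIV. ennreal ((cmod (u x $ k))\<^sup>2)) \<partial>lborel)"
    by (rule nn_integral_sum[symmetric]) measurable
  also have "\<dots> = (\<integral>\<^sup>+x. ennreal ((norm (u x))\<^sup>2) \<partial>lborel)"
    unfolding norm_vec_sq by (simp add: sum_ennreal)
  also have "\<dots> = ennreal ((nrm u)\<^sup>2)" by (rule nn_integral_l2[OF u(2)])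
  finally have *: "(\<integral>\<^sup>+\<xi>. ennreal ((norm (fourier_int \<sigma> u \<xi>))\<^sup>2) \<partial>lborel) \<le> ennreal ((nrm u)\<^sup>2)" .
  show "l2 (fourier_int \<sigma> u)" "nrm (fourier_int \<sigma> u) \<le> nrm u"
    by (rule l2I_nn[OF fourier_int_measurable[OF u(1)] *]; simp)+
qed

lemma integrable_cscale:
  fixes u :: "'a \<Rightarrow> complex^'k::finite"
  assumes "integrable N u" shows "integrable N (\<lambda>x. c *s u x)"
proof (rule integrable_bounded_linear[OF _ assms])
  have "linear (\<lambda>v::complex^'k. c *s v)"
    by (rule linearI) (auto simp: vec_eq_iff algebra_simps)
  thus "bounded_linear (\<lambda>v::complex^'k. c *s v)" by (simp add: linear_conv_bounded_linear)
qed

lemma integral_cscale: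
  fixes u :: "'a \<Rightarrow> complex^'k::finite"
  assumes "integrable N u" shows "(\<integral>x. c *s u x \<partial>N) = c *s (\<integral>x. u x \<partial>N)"
proof (rule integral_bounded_linear[OF _ assms])
  have "linear (\<lambda>v::complex^'k. c *s v)"
    by (rule linearI) (auto simp: vec_eq_iff algebra_simps)
  thus "bounded_linear (\<lambda>v::complex^'k. c *s v)" by (simp add: linear_conv_bounded_linear)
qed

lemma fourier_int_linear:
  fixes u v :: "real^'n::finite \<Rightarrow> complex^'k::finite"
  assumes u: "integrable lborel u" and v: "integrable lborel v"
  shows "fourier_int \<sigma> (\<lambda>x. a *s u x + b *s v x) \<xi> = a *s fourier_int \<sigma> u \<xi> + b *s fourier_int \<sigma> v \<xi>"
proof -
  note iu = integrable_iexp_cscale[OF u, of \<sigma> \<xi>] and iv = integrable_iexp_cscale[OF v, of \<sigma> \<xi>]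
  have "(\<integral>x. iexp (\<sigma> * (\<xi> \<bullet> x)) *s (a *s u x + b *s v x) \<partial>lborel) =
      (\<integral>x. a *s (iexp (\<sigma> * (\<xi> \<bullet> x)) *s u x) + b *s (iexp (\<sigma> * (\<xi> \<bullet> x)) *s v x) \<partial>lborel)"
    by (intro Bochner_Integration.integral_cong) (auto simp: vec_eq_iff algebra_simps)
  also have "\<dots> = a *s (\<integral>x. iexp (\<sigma> * (\<xi> \<bullet> x)) *s u x \<partial>lborel) + b *s (\<integral>x. iexp (\<sigma> * (\<xi> \<bullet> x)) *s v x \<partial>lborel)"
    by (simp only: Bochner_Integration.integral_add[OF integrable_cscale[OF iu] integrable_cscale[OF iv]] integral_cscale[OF iu] integral_cscale[OF iv])
  finally show ?thesis unfolding fourier_int_eq by (simp add: vec_eq_iff scaleR_conv_of_real[where 'a=complex] algebra_simps)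
qed

lemma fourier_int_diff:
  fixes u v :: "real^'n::finite \<Rightarrow> complex^'k::finite"
  assumes u: "integrable lborel u" and v: "integrable lborel v"
  shows "fourier_int \<sigma> (\<lambda>x. u x - v x) \<xi> = fourier_int \<sigma> u \<xi> - fourier_int \<sigma> v \<xi>"
proof -
  have "(\<lambda>x. u x - v x) = (\<lambda>x. 1 *s u x + (-1) *s v x)" by (auto simp: vec_eq_iff)
  thus ?thesis using fourier_int_linear[OF assms, of \<sigma> 1 "-1" \<xi>] by (simp add: vec_eq_iff)
qed

lemma bounded_linear_cip_left: "bounded_linear (\<lambda>u::complex^'k::finite. cip u w)"
proof -
  have "linear (\<lambda>u::complex^'k. cip u w)"
    by (rule linearI) (auto simp: cip_add_left cip_scaleR_left scaleR_conv_of_real[where 'a=complex])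
  thus ?thesis by (simp add: linear_conv_bounded_linear)
qed

lemma bounded_linear_cip_right: "bounded_linear (\<lambda>u::complex^'k::finite. cip w u)"
proof -
  have "linear (\<lambda>u::complex^'k. cip w u)"
    by (rule linearI) (auto simp: cip_add_right cip_scaleR_right scaleR_conv_of_real[where 'a=complex])
  thus ?thesis by (simp add: linear_conv_bounded_linear)
qed

text \<open>Fubini's theorem applied to the kernel; moving the exponential into the conjugate-linear
  second slot reverses the sign in its exponent.\<close>

lemma fourier_int_adjoint:
  fixes u v :: "real^'n::finite \<Rightarrow> complex^'k::finite"
  assumes u: "integrable lborel u" and v: "integrable lborel v"
  shows "ipr (fourier_int \<sigma> u) v = ipr u (fourier_int (-\<sigma>) v)"
proof -
  let ?c = "complex_of_real (fconst TYPE('n))"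
  have km: "(\<lambda>p::(real^'n) \<times> (real^'n). iexp (\<sigma> * (fst p \<bullet> snd p))) \<in> borel_measurable borel"
    by (intro borel_measurable_continuous_onI continuous_intros)
  have [measurable]: "u \<in> borel_measurable borel" "v \<in> borel_measurable borel"
    using u v by (auto dest: borel_measurable_integrable)
  have int: "integrable (lborel \<Otimes>\<^sub>M lborel) (\<lambda>(\<xi>, x). iexp (\<sigma> * (\<xi> \<bullet> x)) * cip (u x) (v \<xi>))"
  proof -
    have "integrable (lborel \<Otimes>\<^sub>M lborel) (\<lambda>(\<xi>, x). iexp (\<sigma> * (\<xi> \<bullet> x)) * cnj (v \<xi> $ k) * u x $ k)" for k
      using integrable_pair_bounded_mult[OF _ integrable_vec_nth[OF u] km, of "\<lambda>\<xi>. cnj (v \<xi> $ k)" k]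
        integrable_bounded_linear[OF bounded_linear_cnj integrable_vec_nth[OF v]] by (simp add: case_prod_unfold)
    hence "integrable (lborel \<Otimes>\<^sub>M lborel) (\<lambda>p. \<Sum>k\<in>UNIV. (case p of (\<xi>, x) \<Rightarrow> iexp (\<sigma> * (\<xi> \<bullet> x)) * cnj (v \<xi> $ k) * u x $ k))"
      by (intro Bochner_Integration.integrable_sum)
    also have "(\<lambda>p. \<Sum>k\<in>UNIV. (case p of (\<xi>, x) \<Rightarrow> iexp (\<sigma> * (\<xi> \<bullet> x)) * cnj (v \<xi> $ k) * u x $ k)) =
        (\<lambda>(\<xi>, x). iexp (\<sigma> * (\<xi> \<bullet> x)) * cip (u x) (v \<xi>))"
      by (auto simp: cip_def sum_distrib_left mult_ac)
    finally show ?thesis .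
  qed
  have "ipr (fourier_int \<sigma> u) v = (\<integral>\<xi>. ?c * (\<integral>x. iexp (\<sigma> * (\<xi> \<bullet> x)) * cip (u x) (v \<xi>) \<partial>lborel) \<partial>lborel)"
    unfolding ipr_def fourier_int_eq cip_scaleR_left cip_scale_left
      integral_bounded_linear[OF bounded_linear_cip_left integrable_iexp_cscale[OF u], symmetric] ..
  also have "\<dots> = ?c * (\<integral>\<xi>. (\<integral>x. iexp (\<sigma> * (\<xi> \<bullet> x)) * cip (u x) (v \<xi>) \<partial>lborel) \<partial>lborel)" by simp
  also have "(\<integral>\<xi>. (\<integral>x. iexp (\<sigma> * (\<xi> \<bullet> x)) * cip (u x) (v \<xi>) \<partial>lborel) \<partial>lborel) =
      (\<integral>x. (\<integral>\<xi>. iexp (\<sigma> * (\<xi> \<bullet> x)) * cip (u x) (v \<xi>) \<partial>lborel) \<partial>lborel)"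
    by (rule lborel_pair.Fubini_integral[OF int, symmetric])
  also have "\<dots> = (\<integral>x. (\<integral>\<xi>. cip (u x) (iexp (-\<sigma> * (x \<bullet> \<xi>)) *s v \<xi>) \<partial>lborel) \<partial>lborel)"
    by (simp add: cip_scale_right exp_cnj inner_commute)
  also have "\<dots> = (\<integral>x. cip (u x) (\<integral>\<xi>. iexp (-\<sigma> * (x \<bullet> \<xi>)) *s v \<xi> \<partial>lborel) \<partial>lborel)"
    by (simp only: integral_bounded_linear[OF bounded_linear_cip_right integrable_iexp_cscale[OF v]])
  also have "?c * \<dots> = ipr u (fourier_int (-\<sigma>) v)"
    unfolding ipr_def fourier_int_eq cip_scaleR_right by simp
  finally show ?thesis .
qed

section \<open>Extension to square-integrable functions by truncation\<close>

definition trunc :: "real \<Rightarrow> (real^'n::finite \<Rightarrow> complex^'k::finite) \<Rightarrow> (real^'n \<Rightarrow> complex^'k)" where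
  "trunc R u x = indicator (cball 0 R) x *\<^sub>R u x"

lemma l2_indicator:
  assumes "l2 u" "A \<in> sets borel"
  shows "l2 (\<lambda>x. indicator A x *\<^sub>R u x)" "nrm (\<lambda>x. indicator A x *\<^sub>R u x) \<le> nrm u"
proof -
  note [measurable] = l2_measurable[OF assms(1)] assms(2)
  have le: "norm (indicator A x *\<^sub>R u x) \<le> 1 * norm (u x)" for x by (auto simp: indicator_def)
  have m: "(\<lambda>x. indicat_real A x *\<^sub>R u x) \<in> borel_measurable borel" by measurable
  show "l2 (\<lambda>x. indicator A x *\<^sub>R u x)" "nrm (\<lambda>x. indicator A x *\<^sub>R u x) \<le> nrm u"
    using l2_dominated[OF assms(1) m _ le] by simp_all
qed

text \<open>From a at most 1 + a^2, the function is dominated by the indicator of the ball plus its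
  own square.\<close>

lemma l2_bounded_support_integrable:
  fixes u :: "real^'n::finite \<Rightarrow> complex^'k::finite"
  assumes u: "l2 u" and supp: "\<And>x. x \<notin> cball 0 R \<Longrightarrow> u x = 0"
  shows "integrable lborel u"
proof (rule Bochner_Integration.integrable_bound[where f="\<lambda>x. indicator (cball 0 R) x + (norm (u x))\<^sup>2"])
  note [measurable] = l2_measurable[OF u]
  have "integrable lborel (indicat_real (cball (0::real^'n) R))"
    by (rule integrable_real_indicator)
       (simp_all add: emeasure_bounded_finite[OF bounded_cball, simplified])
  thus "integrable lborel (\<lambda>x. indicator (cball 0 R) x + (norm (u x))\<^sup>2)"
    using l2_integrable[OF u] by (rule Bochner_Integration.integrable_add)
  show "u \<in> borel_measurable lborel" by simp
  have a: "a \<le> 1 + a\<^sup>2" for a :: real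
  proof -
    have "2 * a \<le> a\<^sup>2 + 1" using sum_squares_bound[of a 1] by simp
    moreover have "0 \<le> a\<^sup>2" by simp
    ultimately show ?thesis by linarith
  qed
  have "norm (u x) \<le> indicator (cball 0 R) x + (norm (u x))\<^sup>2" for x
    using a[of "norm (u x)"] supp[of x] by (cases "x \<in> cball 0 R") (auto simp: indicator_def)
  thus "AE x in lborel. norm (u x) \<le> norm (indicator (cball 0 R) x + (norm (u x))\<^sup>2)"
    by (intro AE_I2) (smt (verit) real_norm_def)
qed

lemma trunc_l2: "l2 u \<Longrightarrow> l2 (trunc R u)" "l2 u \<Longrightarrow> nrm (trunc R u) \<le> nrm u"
  unfolding trunc_def by (auto intro: l2_indicator)

lemma trunc_integrable: "l2 u \<Longrightarrow> integrable lborel (trunc R u)"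
  by (rule l2_bounded_support_integrable[OF trunc_l2(1), where R=R]) (auto simp: trunc_def)

lemma trunc_tendsto:
  fixes u :: "real^'n::finite \<Rightarrow> complex^'k::finite"
  assumes u: "l2 u" shows "((\<lambda>R. nrm (\<lambda>x. u x - trunc R u x)) \<longlongrightarrow> 0) at_top"
proof -
  note [measurable] = l2_measurable[OF u]
  have "((\<lambda>R. \<integral>x. (norm (u x - trunc R u x))\<^sup>2 \<partial>lborel) \<longlongrightarrow> (\<integral>x. 0 \<partial>(lborel :: (real^'n) measure))) at_top"
  proof (rule integral_dominated_convergence_at_top[where w="\<lambda>x. (norm (u x))\<^sup>2"])
    show "integrable lborel (\<lambda>x. (norm (u x))\<^sup>2)" by (rule l2_integrable[OF u])
    show "AE x in lborel. ((\<lambda>R. (norm (u x - trunc R u x))\<^sup>2) \<longlongrightarrow> 0) at_top"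
    proof (intro AE_I2 tendsto_eventually)
      fix x show "\<forall>\<^sub>F R in at_top. (norm (u x - trunc R u x))\<^sup>2 = 0"
        using eventually_ge_at_top[of "norm x"] by eventually_elim (simp add: trunc_def)
    qed
    show "\<forall>\<^sub>F R in at_top. AE x in lborel. norm ((norm (u x - trunc R u x))\<^sup>2) \<le> (norm (u x))\<^sup>2"
      by (intro always_eventually allI AE_I2) (auto simp: trunc_def indicator_def)
    show "(\<lambda>x. (norm (u x - trunc R u x))\<^sup>2) \<in> borel_measurable lborel" for R
      using l2_measurable[OF l2_diff[OF u trunc_l2(1)[OF u]]] by measurable
  qed simp
  from tendsto_real_sqrt[OF this] show ?thesis by (simp add: nrm_def)
qed

lemma nrm_trunc_diff:
  assumes u: "l2 u" and "R \<le> R'" shows "nrm (\<lambda>x. trunc R' u x - trunc R u x) \<le> nrm (\<lambda>x. u x - trunc R u x)"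
proof -
  have l: "l2 (\<lambda>x. u x - trunc R u x)" by (intro l2_diff trunc_l2 u)
  have m: "(\<lambda>x. trunc R' u x - trunc R u x) \<in> borel_measurable borel"
    using l2_measurable[OF l2_diff[OF trunc_l2(1)[OF u] trunc_l2(1)[OF u]]] .
  have "norm (trunc R' u x - trunc R u x) \<le> 1 * norm (u x - trunc R u x)" for x
    using assms(2) by (auto simp: trunc_def indicator_def)
  from l2_dominated(2)[OF l m _ this] show ?thesis by simp
qed

text \<open>Transforms of two truncations differ by no more than the tail of u beyond the smaller
  radius, so completeness applies along integer radii. A real radius R is then compared with its
  integer part, at twice that tail.\<close>

lemma fourier_L2_exists:
  fixes u :: "real^'n::finite \<Rightarrow> complex^'k::finite"
  assumes u: "l2 u" and \<sigma>: "\<sigma> = 1 \<or> \<sigma> = -1"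
  obtains g where "l2 g" "((\<lambda>R. nrm (\<lambda>x. g x - fourier_int \<sigma> (trunc R u) x)) \<longlongrightarrow> 0) at_top"
proof -
  define F where "F = (\<lambda>R. fourier_int \<sigma> (trunc R u))"
  have Fl: "l2 (F R)" for R unfolding F_def by (intro fourier_int_plancherel trunc_integrable trunc_l2 u \<sigma>)
  have Fd: "nrm (\<lambda>x. F R' x - F R x) \<le> nrm (\<lambda>x. u x - trunc R u x)" if "R \<le> R'" for R R'
  proof -
    have "(\<lambda>x. F R' x - F R x) = fourier_int \<sigma> (\<lambda>x. trunc R' u x - trunc R u x)"
      unfolding F_def by (intro ext fourier_int_diff[symmetric] trunc_integrable u)
    moreover have "nrm (fourier_int \<sigma> (\<lambda>x. trunc R' u x - trunc R u x)) \<le> nrm (\<lambda>x. trunc R' u x - trunc R u x)"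
      by (intro fourier_int_plancherel Bochner_Integration.integrable_diff trunc_integrable l2_diff trunc_l2 u \<sigma>)
    ultimately show ?thesis using nrm_trunc_diff[OF u that] by simp
  qed
  have e: "(\<lambda>m. nrm (\<lambda>x. u x - trunc (real m) u x)) \<longlonglongrightarrow> 0"
    by (rule filterlim_compose[OF trunc_tendsto[OF u] filterlim_real_sequentially])
  obtain g where g: "l2 g" "\<And>m. nrm (\<lambda>x. g x - F (real m) x) \<le> nrm (\<lambda>x. u x - trunc (real m) u x)"
    using l2_complete[of "\<lambda>m. F (real m)" "\<lambda>m. nrm (\<lambda>x. u x - trunc (real m) u x)"] Fl Fd e by auto
  have "((\<lambda>R. nrm (\<lambda>x. g x - F R x)) \<longlongrightarrow> 0) at_top"
  proof (rule tendsto_sandwich[OF _ _ tendsto_const])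
    have fl: "filterlim (\<lambda>R. nat \<lfloor>R\<rfloor>) at_top (at_top :: real filter)"
      by (intro filterlim_compose[OF filterlim_nat_sequentially] filterlim_floor_sequentially)
    have "((\<lambda>R::real. 2 * nrm (\<lambda>x. u x - trunc (real (nat \<lfloor>R\<rfloor>)) u x)) \<longlongrightarrow> 2 * 0) at_top"
      by (intro tendsto_mult tendsto_const filterlim_compose[OF e fl])
    thus "((\<lambda>R::real. 2 * nrm (\<lambda>x. u x - trunc (real (nat \<lfloor>R\<rfloor>)) u x)) \<longlongrightarrow> 0) at_top" by simp
    show "\<forall>\<^sub>F R in at_top. nrm (\<lambda>x. g x - F R x) \<le> 2 * nrm (\<lambda>x. u x - trunc (real (nat \<lfloor>R\<rfloor>)) u x)"
      using eventually_ge_at_top[of "0::real"]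
    proof eventually_elim
      fix R :: real assume "0 \<le> R"
      define m where "m = real (nat \<lfloor>R\<rfloor>)"
      have "m \<le> R" using \<open>0 \<le> R\<close> by (simp add: m_def)
      have "nrm (\<lambda>x. g x - F R x) \<le> nrm (\<lambda>x. g x - F m x) + nrm (\<lambda>x. F m x - F R x)"
        by (rule nrm_triangle_diff[OF g(1) Fl Fl])
      also have "\<dots> \<le> nrm (\<lambda>x. u x - trunc m u x) + nrm (\<lambda>x. u x - trunc m u x)"
        using g(2)[of "nat \<lfloor>R\<rfloor>"] Fd[OF \<open>m \<le> R\<close>] nrm_commute[of "F m" "F R"] by (intro add_mono) (auto simp: m_def)
      finally show "nrm (\<lambda>x. g x - F R x) \<le> 2 * nrm (\<lambda>x. u x - trunc (real (nat \<lfloor>R\<rfloor>)) u x)" by (simp add: m_def)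
    qed
  qed simp
  thus ?thesis using that g(1) by (simp add: F_def)
qed

text \<open>\<open>fourier_L2\<close> picks one representative by choice; existence of a limit makes
  its defining property available. The rest translates convergence of \<open>wnorm2 0\<close> into
  convergence of \<open>nrm\<close>.\<close>

lemma fourier_L2_spec:
  fixes u :: "real^'n::finite \<Rightarrow> complex^'k::finite"
  assumes u: "l2 u" and \<sigma>: "\<sigma> = 1 \<or> \<sigma> = -1"
  shows "l2 (fourier_L2 \<sigma> u)" "((\<lambda>R. nrm (\<lambda>x. fourier_L2 \<sigma> u x - fourier_int \<sigma> (trunc R u) x)) \<longlongrightarrow> 0) at_top"
proof -
  have Fl: "l2 (fourier_int \<sigma> (trunc R u))" for R by (intro fourier_int_plancherel trunc_integrable trunc_l2 u \<sigma>)
  have w: "wnorm2 0 (\<lambda>\<xi>. g \<xi> - fourier_int \<sigma> (trunc R u) \<xi>) = ennreal ((nrm (\<lambda>x. g x - fourier_int \<sigma> (trunc R u) x))\<^sup>2)"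
    if "l2 g" for g R
    using wnorm2_eq[of 0 "\<lambda>\<xi>. g \<xi> - fourier_int \<sigma> (trunc R u) \<xi>"] l2_diff[OF that Fl] by (simp add: jap_zero)
  let ?P = "\<lambda>g. g \<in> L2w 0 \<and> ((\<lambda>R. wnorm2 0 (\<lambda>\<xi>. g \<xi> - fourier_int \<sigma> (\<lambda>x. indicator (cball 0 R) x *\<^sub>R u x) \<xi>)) \<longlongrightarrow> 0) at_top"
  have t: "(\<lambda>x. indicator (cball 0 R) x *\<^sub>R u x) = trunc R u" for R by (auto simp: trunc_def)
  obtain g where g: "l2 g" "((\<lambda>R. nrm (\<lambda>x. g x - fourier_int \<sigma> (trunc R u) x)) \<longlongrightarrow> 0) at_top"
    by (rule fourier_L2_exists[OF u \<sigma>])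
  have "?P g"
  proof
    show "g \<in> L2w 0" using g by (simp add: L2w_iff jap_zero)
    have "((\<lambda>R. ennreal ((nrm (\<lambda>x. g x - fourier_int \<sigma> (trunc R u) x))\<^sup>2)) \<longlongrightarrow> ennreal (0\<^sup>2)) at_top"
      by (intro tendsto_ennrealI tendsto_power g)
    thus "((\<lambda>R. wnorm2 0 (\<lambda>\<xi>. g \<xi> - fourier_int \<sigma> (\<lambda>x. indicator (cball 0 R) x *\<^sub>R u x) \<xi>)) \<longlongrightarrow> 0) at_top"
      unfolding t w[OF g(1)] by simp
  qed
  hence P: "?P (fourier_L2 \<sigma> u)" unfolding fourier_L2_def by (rule someI[where P="?P"])
  thus l: "l2 (fourier_L2 \<sigma> u)" by (simp add: L2w_iff jap_zero)
  have "((\<lambda>R. ennreal ((nrm (\<lambda>x. fourier_L2 \<sigma> u x - fourier_int \<sigma> (trunc R u) x))\<^sup>2)) \<longlongrightarrow> ennreal 0) at_top"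
    using conjunct2[OF P] unfolding t w[OF l] by simp
  hence "((\<lambda>R. (nrm (\<lambda>x. fourier_L2 \<sigma> u x - fourier_int \<sigma> (trunc R u) x))\<^sup>2) \<longlongrightarrow> 0) at_top"
    by (subst (asm) tendsto_ennreal_iff) auto
  from tendsto_real_sqrt[OF this]
  show "((\<lambda>R. nrm (\<lambda>x. fourier_L2 \<sigma> u x - fourier_int \<sigma> (trunc R u) x)) \<longlongrightarrow> 0) at_top" by simp
qed

lemma fourier_L2_bound:
  fixes u :: "real^'n::finite \<Rightarrow> complex^'k::finite"
  assumes u: "l2 u" and \<sigma>: "\<sigma> = 1 \<or> \<sigma> = -1" shows "nrm (fourier_L2 \<sigma> u) \<le> nrm u"
proof (rule tendsto_lowerbound)
  note F = fourier_L2_spec[OF u \<sigma>]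
  have Fl: "l2 (fourier_int \<sigma> (trunc R u))" "nrm (fourier_int \<sigma> (trunc R u)) \<le> nrm u" for R
    using fourier_int_plancherel[OF trunc_integrable[OF u] trunc_l2(1)[OF u] \<sigma>] trunc_l2(2)[OF u] order_trans by blast+
  show "((\<lambda>R. nrm u + nrm (\<lambda>x. fourier_L2 \<sigma> u x - fourier_int \<sigma> (trunc R u) x)) \<longlongrightarrow> nrm u) at_top"
    using tendsto_add[OF tendsto_const[of "nrm u"] F(2)] by simp
  show "\<forall>\<^sub>F R in at_top. nrm (fourier_L2 \<sigma> u) \<le> nrm u + nrm (\<lambda>x. fourier_L2 \<sigma> u x - fourier_int \<sigma> (trunc R u) x)"
    using nrm_triangle_sub[OF F(1) Fl(1)] Fl(2) by (intro always_eventually allI) (meson add_right_mono order_trans)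
qed simp

text \<open>Representatives are chosen independently for different arguments, so linearity can hold
  only up to null functions; it is expressed as a vanishing seminorm of the defect.\<close>

lemma fourier_L2_linear:
  fixes u v :: "real^'n::finite \<Rightarrow> complex^'k::finite"
  assumes u: "l2 u" and v: "l2 v" and \<sigma>: "\<sigma> = 1 \<or> \<sigma> = -1"
  shows "nrm (\<lambda>x. fourier_L2 \<sigma> (\<lambda>y. a *s u y + b *s v y) x - (a *s fourier_L2 \<sigma> u x + b *s fourier_L2 \<sigma> v x)) = 0"
proof -
  let ?w = "\<lambda>y. a *s u y + b *s v y"
  have w: "l2 ?w" by (intro l2_add l2_scale u v)
  note Fu = fourier_L2_spec[OF u \<sigma>] and Fv = fourier_L2_spec[OF v \<sigma>] and Fw = fourier_L2_spec[OF w \<sigma>]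
  define Tu Tv Tw where "Tu = (\<lambda>R. fourier_int \<sigma> (trunc R u))" and "Tv = (\<lambda>R. fourier_int \<sigma> (trunc R v))" and "Tw = (\<lambda>R. fourier_int \<sigma> (trunc R ?w))"
  have l: "l2 (Tu R)" "l2 (Tv R)" "l2 (Tw R)" for R unfolding Tu_def Tv_def Tw_def
    by (intro fourier_int_plancherel trunc_integrable trunc_l2 u v w \<sigma>)+
  have lin: "Tw R x = a *s Tu R x + b *s Tv R x" for R x
  proof -
    have tw: "trunc R ?w = (\<lambda>x. a *s trunc R u x + b *s trunc R v x)" by (auto simp: trunc_def indicator_def vec_eq_iff)
    show ?thesis unfolding Tw_def Tu_def Tv_def tw by (rule fourier_int_linear) (intro trunc_integrable u v)+
  qed
  let ?B = "\<lambda>R. nrm (\<lambda>x. fourier_L2 \<sigma> ?w x - Tw R x) + (cmod a * nrm (\<lambda>x. fourier_L2 \<sigma> u x - Tu R x) + cmod b * nrm (\<lambda>x. fourier_L2 \<sigma> v x - Tv R x))"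
  have "nrm (\<lambda>x. fourier_L2 \<sigma> ?w x - (a *s fourier_L2 \<sigma> u x + b *s fourier_L2 \<sigma> v x)) \<le> 0"
  proof (rule tendsto_lowerbound)
    show "(?B \<longlongrightarrow> 0) at_top"
      using tendsto_add[OF Fw(2) tendsto_add[OF tendsto_mult[OF tendsto_const Fu(2), of "cmod a"] tendsto_mult[OF tendsto_const Fv(2), of "cmod b"]]]
      by (simp add: Tu_def Tv_def Tw_def)
    have "nrm (\<lambda>x. fourier_L2 \<sigma> ?w x - (a *s fourier_L2 \<sigma> u x + b *s fourier_L2 \<sigma> v x)) \<le> ?B R" for R
    proof -
      have eq: "(\<lambda>x. Tw R x - (a *s fourier_L2 \<sigma> u x + b *s fourier_L2 \<sigma> v x)) =
         (\<lambda>x. a *s (Tu R x - fourier_L2 \<sigma> u x) + b *s (Tv R x - fourier_L2 \<sigma> v x))"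
        by (auto simp: lin vec_eq_iff algebra_simps)
      have "nrm (\<lambda>x. Tw R x - (a *s fourier_L2 \<sigma> u x + b *s fourier_L2 \<sigma> v x)) \<le>
          nrm (\<lambda>x. a *s (Tu R x - fourier_L2 \<sigma> u x)) + nrm (\<lambda>x. b *s (Tv R x - fourier_L2 \<sigma> v x))"
        unfolding eq by (intro nrm_triangle l2_scale l2_diff l Fu Fv)
      also have "\<dots> = cmod a * nrm (\<lambda>x. fourier_L2 \<sigma> u x - Tu R x) + cmod b * nrm (\<lambda>x. fourier_L2 \<sigma> v x - Tv R x)"
        using l2_scale(2)[OF l2_diff[OF l(1) Fu(1)]] l2_scale(2)[OF l2_diff[OF l(2) Fv(1)]]
        by (simp add: nrm_commute[of "Tu R"] nrm_commute[of "Tv R"])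
      finally show ?thesis
        using nrm_triangle_diff[OF Fw(1) l(3)[of R] l2_add[OF l2_scale(1)[OF Fu(1), of a] l2_scale(1)[OF Fv(1), of b]]] by linarith
    qed
    thus "\<forall>\<^sub>F R in at_top. nrm (\<lambda>x. fourier_L2 \<sigma> ?w x - (a *s fourier_L2 \<sigma> u x + b *s fourier_L2 \<sigma> v x)) \<le> ?B R" by simp
  qed simp
  thus ?thesis by (simp add: antisym)
qed

text \<open>The identity for truncations passes to the limit on both sides. It transfers the inverse
  transform in the definition of the resolvent to the test function, so forms can be computed in
  frequency.\<close>

lemma fourier_L2_adjoint:
  fixes u v :: "real^'n::finite \<Rightarrow> complex^'k::finite"
  assumes u: "l2 u" and v: "l2 v"
  shows "ipr (fourier_L2 1 u) v = ipr u (fourier_L2 (-1) v)"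
proof -
  note Fu = fourier_L2_spec[OF u, of 1, simplified] and Fv = fourier_L2_spec[OF v, of "-1", simplified]
  have l: "l2 (fourier_int 1 (trunc R u))" "l2 (fourier_int (-1) (trunc R v))" for R
    by (intro fourier_int_plancherel trunc_integrable trunc_l2 u v; simp)+
  have 1: "((\<lambda>R. ipr (fourier_int 1 (trunc R u)) (trunc R v)) \<longlongrightarrow> ipr (fourier_L2 1 u) v) at_top"
    by (intro ipr_tendsto l Fu trunc_l2 u v trunc_tendsto)
  have 2: "((\<lambda>R. ipr (trunc R u) (fourier_int (-1) (trunc R v))) \<longlongrightarrow> ipr u (fourier_L2 (-1) v)) at_top"
    by (intro ipr_tendsto l Fv trunc_l2 u v trunc_tendsto)
  have "ipr (fourier_int 1 (trunc R u)) (trunc R v) = ipr (trunc R u) (fourier_int (-1) (trunc R v))" for R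
    by (rule fourier_int_adjoint) (intro trunc_integrable u v)+
  with 1 2 show ?thesis using tendsto_unique[OF trivial_limit_at_top_linorder] by simp
qed

subsection \<open>Estimates on a single spatial scale\<close>

lemma iexp_bound1: "cmod (iexp a - 1) \<le> \<bar>a\<bar>"
  using iexp_approx1[of a 0] by simp

lemma iexp_bound2: "cmod (iexp a - 1 - \<i> * of_real a) \<le> a\<^sup>2"
proof -
  have "cmod (iexp a - (\<Sum>k\<le>1. (\<i> * a)^k / fact k)) \<le> \<bar>a\<bar>^(Suc 1) / fact (Suc 1)" by (rule iexp_approx1)
  moreover have "(\<Sum>k\<le>(1::nat). (\<i> * complex_of_real a)^k / fact k) = 1 + \<i> * of_real a" by simp
  ultimately have "cmod (iexp a - (1 + \<i> * of_real a)) \<le> a\<^sup>2 / 2" by (simp add: power2_eq_square)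
  also have "\<dots> \<le> a\<^sup>2" by simp
  finally show ?thesis by (simp add: diff_diff_eq)
qed

lemma has_vector_derivative_quadratic:
  fixes F :: "real \<Rightarrow> 'a::real_normed_vector"
  assumes "\<And>s. norm (F s - F t - (s - t) *\<^sub>R D) \<le> K * (s - t)\<^sup>2"
  shows "(F has_vector_derivative D) (at t)"
  unfolding has_vector_derivative_def has_derivative_iff_norm
proof
  show "bounded_linear (\<lambda>x. x *\<^sub>R D)" by (rule bounded_linear_scaleR_left)
  have K: "0 \<le> K * (s - t)\<^sup>2" for s using assms[of s] norm_ge_zero order_trans by blast
  have b: "norm (norm (F s - F t - (s - t) *\<^sub>R D) / norm (s - t)) \<le> K * \<bar>s - t\<bar>" if "s \<noteq> t" for s
  proof -
    have "norm (F s - F t - (s - t) *\<^sub>R D) / norm (s - t) \<le> K * (s - t)\<^sup>2 / \<bar>s - t\<bar>"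
      using assms[of s] by (intro frac_le) (use that K in auto)
    also have "\<dots> = K * \<bar>s - t\<bar>" using that by (simp add: power2_eq_square field_simps flip: abs_mult)
    finally show ?thesis by simp
  qed
  show "((\<lambda>s. norm (F s - F t - (s - t) *\<^sub>R D) / norm (s - t)) \<longlongrightarrow> 0) (at t)"
  proof (rule Lim_null_comparison)
    show "\<forall>\<^sub>F s in at t. norm (norm (F s - F t - (s - t) *\<^sub>R D) / norm (s - t)) \<le> K * \<bar>s - t\<bar>"
      using b by (auto simp: eventually_at_filter)
    have "((\<lambda>s. K * \<bar>s - t\<bar>) \<longlongrightarrow> K * \<bar>t - t\<bar>) (at t)" by (intro tendsto_intros)
    thus "((\<lambda>s. K * \<bar>s - t\<bar>) \<longlongrightarrow> 0) (at t)" by simp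
  qed
qed

text \<open>Differentiating \<open>iexp (\<sigma> * (\<xi> \<bullet> x))\<close> in the l-th
  frequency coordinate produces this factor: the partial derivative of a transform is the transform
  of \<open>mulx \<sigma> l u\<close>.\<close>

definition mulx :: "real \<Rightarrow> 'n \<Rightarrow> (real^'n::finite \<Rightarrow> complex^'k::finite) \<Rightarrow> (real^'n \<Rightarrow> complex^'k)" where
  "mulx \<sigma> l u x = (\<i> * of_real (\<sigma> * x $ l)) *s u x"

context
  fixes u :: "real^'n::finite \<Rightarrow> complex^'k::finite" and R \<sigma> :: real
  assumes u: "l2 u" and supp: "\<And>x. x \<notin> cball 0 R \<Longrightarrow> u x = 0" and \<sigma>: "\<sigma> = 1 \<or> \<sigma> = -1" and R: "0 \<le> R"
begin

lemma bounded_support_integrable: "integrable lborel u"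
  by (rule l2_bounded_support_integrable[OF u supp])

text \<open>On the support each coordinate is at most R in modulus. This is the only source of the
  factor R per frequency derivative.\<close>

lemma mulx_l2: "l2 (mulx \<sigma> l u)" "nrm (mulx \<sigma> l u) \<le> R * nrm u"
proof -
  note [measurable] = l2_measurable[OF u]
  have m: "mulx \<sigma> l u \<in> borel_measurable borel" unfolding mulx_def by measurable
  have "norm (mulx \<sigma> l u x) \<le> R * norm (u x)" for x
  proof (cases "x \<in> cball 0 R")
    case True
    hence "\<bar>x $ l\<bar> \<le> R" using component_le_norm_cart[of x l] by simp
    thus ?thesis using \<sigma> by (auto simp: mulx_def norm_cscale norm_mult intro!: mult_right_mono)
  qed (simp add: mulx_def supp)
  from l2_dominated[OF u m R this] show "l2 (mulx \<sigma> l u)" "nrm (mulx \<sigma> l u) \<le> R * nrm u" by auto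
qed

lemma mulx_integrable: "integrable lborel (mulx \<sigma> l u)"
  by (rule l2_bounded_support_integrable[OF mulx_l2(1), where R=R]) (simp add: mulx_def supp)

lemma continuous_fourier_int: "continuous_on UNIV (fourier_int \<sigma> u)"
proof -
  note iu = bounded_support_integrable
  define K where "K = fconst TYPE('n) * (R * (\<integral>x. norm (u x) \<partial>lborel))"
  have K0: "K \<ge> 0" unfolding K_def using R fconst_pos[where 'n='n] by (intro mult_nonneg_nonneg) auto
  have "norm (fourier_int \<sigma> u \<xi> - fourier_int \<sigma> u \<eta>) \<le> K * norm (\<xi> - \<eta>)" for \<xi> \<eta>
  proof -
    have "fourier_int \<sigma> u \<xi> - fourier_int \<sigma> u \<eta> =
        fconst TYPE('n) *\<^sub>R (\<integral>x. iexp (\<sigma> * (\<xi> \<bullet> x)) *s u x - iexp (\<sigma> * (\<eta> \<bullet> x)) *s u x \<partial>lborel)"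
      unfolding fourier_int_eq
      by (simp only: Bochner_Integration.integral_diff[OF integrable_iexp_cscale[OF iu] integrable_iexp_cscale[OF iu]] scaleR_diff_right)
    hence "norm (fourier_int \<sigma> u \<xi> - fourier_int \<sigma> u \<eta>) =
        fconst TYPE('n) * norm (\<integral>x. iexp (\<sigma> * (\<xi> \<bullet> x)) *s u x - iexp (\<sigma> * (\<eta> \<bullet> x)) *s u x \<partial>lborel)"
      using fconst_pos[where 'n='n] by simp
    also have "norm (\<integral>x. iexp (\<sigma> * (\<xi> \<bullet> x)) *s u x - iexp (\<sigma> * (\<eta> \<bullet> x)) *s u x \<partial>lborel) \<le>
        (\<integral>x. (R * norm (\<xi> - \<eta>)) * norm (u x) \<partial>lborel)"
    proof (rule order_trans[OF integral_norm_bound], rule integral_mono)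
      show "integrable lborel (\<lambda>x. norm (iexp (\<sigma> * (\<xi> \<bullet> x)) *s u x - iexp (\<sigma> * (\<eta> \<bullet> x)) *s u x))"
        by (intro integrable_norm Bochner_Integration.integrable_diff integrable_iexp_cscale iu)
      show "integrable lborel (\<lambda>x. (R * norm (\<xi> - \<eta>)) * norm (u x))" using iu by simp
      fix x
      have "iexp (\<sigma> * (\<xi> \<bullet> x)) *s u x - iexp (\<sigma> * (\<eta> \<bullet> x)) *s u x =
          (iexp (\<sigma> * (\<eta> \<bullet> x)) * (iexp (\<sigma> * ((\<xi> - \<eta>) \<bullet> x)) - 1)) *s u x"
        by (simp add: vec_eq_iff inner_diff_left right_diff_distrib exp_diff algebra_simps)
      hence "norm (iexp (\<sigma> * (\<xi> \<bullet> x)) *s u x - iexp (\<sigma> * (\<eta> \<bullet> x)) *s u x) =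
          cmod (iexp (\<sigma> * ((\<xi> - \<eta>) \<bullet> x)) - 1) * norm (u x)"
        by (simp only: norm_cscale norm_mult norm_exp_i_times mult_1)
      also have "\<dots> \<le> \<bar>\<sigma> * ((\<xi> - \<eta>) \<bullet> x)\<bar> * norm (u x)" by (intro mult_right_mono iexp_bound1) auto
      also have "\<dots> \<le> (R * norm (\<xi> - \<eta>)) * norm (u x)"
      proof (cases "x \<in> cball 0 R")
        case True
        have "\<bar>\<sigma> * ((\<xi> - \<eta>) \<bullet> x)\<bar> \<le> norm (\<xi> - \<eta>) * norm x" using \<sigma> Cauchy_Schwarz_ineq2[of "\<xi> - \<eta>" x] by auto
        also have "\<dots> \<le> norm (\<xi> - \<eta>) * R" using True by (intro mult_left_mono) auto
        finally show ?thesis by (intro mult_right_mono) (auto simp: mult.commute)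
      qed (simp add: supp)
      finally show "norm (iexp (\<sigma> * (\<xi> \<bullet> x)) *s u x - iexp (\<sigma> * (\<eta> \<bullet> x)) *s u x) \<le> (R * norm (\<xi> - \<eta>)) * norm (u x)" .
    qed
    also have "(\<integral>x. (R * norm (\<xi> - \<eta>)) * norm (u x) \<partial>lborel) = (R * norm (\<xi> - \<eta>)) * (\<integral>x. norm (u x) \<partial>lborel)" by simp
    finally show ?thesis using fconst_pos[where 'n='n] by (simp add: K_def mult_ac)
  qed
  hence "K-lipschitz_on UNIV (fourier_int \<sigma> u)" using K0 by (auto simp: lipschitz_on_def dist_norm)
  thus ?thesis by (rule lipschitz_on_continuous_on)
qed

text \<open>Bounded support makes the second-order Taylor remainder of the exponential quadratic in
  s - t uniformly in x; integrating it gives a quadratic error for the transform. The sum over l is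
  the chain rule along the ray.\<close>

lemma fourier_int_ray_derivative:
  "((\<lambda>t. fourier_int \<sigma> u (t *\<^sub>R \<xi>)) has_vector_derivative
     (\<Sum>l\<in>UNIV. \<xi> $ l *\<^sub>R fourier_int \<sigma> (mulx \<sigma> l u) (t *\<^sub>R \<xi>))) (at t)"
proof -
  note iu = bounded_support_integrable and im = mulx_integrable
  define d where "d = (\<lambda>x. (\<i> * of_real (\<sigma> * (\<xi> \<bullet> x))) *s u x)"
  have dsum: "d = (\<lambda>x. \<Sum>l\<in>UNIV. \<xi> $ l *\<^sub>R mulx \<sigma> l u x)"
    by (rule ext) (simp add: d_def mulx_def vec_eq_iff inner_vec_def sum_distrib_left sum_distrib_right
        scaleR_conv_of_real[where 'a=complex] mult_ac)
  have id: "integrable lborel d" unfolding dsum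
    by (intro Bochner_Integration.integrable_sum integrable_scaleR_right im)
  have D: "(\<Sum>l\<in>UNIV. \<xi> $ l *\<^sub>R fourier_int \<sigma> (mulx \<sigma> l u) \<eta>) = fourier_int \<sigma> d \<eta>" for \<eta>
  proof -
    have "(\<integral>x. iexp (\<sigma> * (\<eta> \<bullet> x)) *s d x \<partial>lborel) = (\<integral>x. (\<Sum>l\<in>UNIV. \<xi> $ l *\<^sub>R (iexp (\<sigma> * (\<eta> \<bullet> x)) *s mulx \<sigma> l u x)) \<partial>lborel)"
      unfolding dsum by (intro Bochner_Integration.integral_cong)
        (auto simp: vec_eq_iff sum_distrib_left scaleR_conv_of_real[where 'a=complex] mult_ac)
    also have "\<dots> = (\<Sum>l\<in>UNIV. \<xi> $ l *\<^sub>R (\<integral>x. iexp (\<sigma> * (\<eta> \<bullet> x)) *s mulx \<sigma> l u x \<partial>lborel))"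
      by (simp only: Bochner_Integration.integral_sum[OF integrable_scaleR_right[OF integrable_iexp_cscale[OF im]]] integral_scaleR_right)
    finally show ?thesis unfolding fourier_int_eq by (simp add: scaleR_sum_right mult.commute)
  qed
  define K where "K = fconst TYPE('n) * ((norm \<xi> * R)\<^sup>2 * (\<integral>x. norm (u x) \<partial>lborel))"
  have "norm (fourier_int \<sigma> u (s *\<^sub>R \<xi>) - fourier_int \<sigma> u (t *\<^sub>R \<xi>) - (s - t) *\<^sub>R fourier_int \<sigma> d (t *\<^sub>R \<xi>)) \<le> K * (s - t)\<^sup>2" for s
  proof -
    let ?k = "\<lambda>x. iexp (\<sigma> * ((s *\<^sub>R \<xi>) \<bullet> x)) *s u x - iexp (\<sigma> * ((t *\<^sub>R \<xi>) \<bullet> x)) *s u x - (s - t) *\<^sub>R (iexp (\<sigma> * ((t *\<^sub>R \<xi>) \<bullet> x)) *s d x)"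
    have "fourier_int \<sigma> u (s *\<^sub>R \<xi>) - fourier_int \<sigma> u (t *\<^sub>R \<xi>) - (s - t) *\<^sub>R fourier_int \<sigma> d (t *\<^sub>R \<xi>) =
        fconst TYPE('n) *\<^sub>R (\<integral>x. ?k x \<partial>lborel)"
    proof -
      have "(\<integral>x. ?k x \<partial>lborel) = (\<integral>x. iexp (\<sigma> * ((s *\<^sub>R \<xi>) \<bullet> x)) *s u x \<partial>lborel) - (\<integral>x. iexp (\<sigma> * ((t *\<^sub>R \<xi>) \<bullet> x)) *s u x \<partial>lborel)
          - (s - t) *\<^sub>R (\<integral>x. iexp (\<sigma> * ((t *\<^sub>R \<xi>) \<bullet> x)) *s d x \<partial>lborel)"
        by (simp only: Bochner_Integration.integral_diff Bochner_Integration.integrable_diff integrable_scaleR_right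
            integrable_iexp_cscale[OF iu] integrable_iexp_cscale[OF id] integral_scaleR_right)
      thus ?thesis unfolding fourier_int_eq by (simp only: scaleR_diff_right scaleR_left_commute)
    qed
    hence "norm (fourier_int \<sigma> u (s *\<^sub>R \<xi>) - fourier_int \<sigma> u (t *\<^sub>R \<xi>) - (s - t) *\<^sub>R fourier_int \<sigma> d (t *\<^sub>R \<xi>)) =
        fconst TYPE('n) * norm (\<integral>x. ?k x \<partial>lborel)" using fconst_pos[where 'n='n] by simp
    also have "norm (\<integral>x. ?k x \<partial>lborel) \<le> (\<integral>x. ((norm \<xi> * R)\<^sup>2 * (s - t)\<^sup>2) * norm (u x) \<partial>lborel)"
    proof (rule order_trans[OF integral_norm_bound], rule integral_mono)
      show "integrable lborel (\<lambda>x. norm (?k x))"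
        by (intro integrable_norm Bochner_Integration.integrable_diff integrable_iexp_cscale iu id integrable_scaleR_right)
      show "integrable lborel (\<lambda>x. ((norm \<xi> * R)\<^sup>2 * (s - t)\<^sup>2) * norm (u x))" using iu by simp
      fix x
      define a where "a = \<sigma> * ((s - t) * (\<xi> \<bullet> x))"
      have "iexp (\<sigma> * ((s *\<^sub>R \<xi>) \<bullet> x)) = iexp (\<sigma> * ((t *\<^sub>R \<xi>) \<bullet> x)) * iexp a"
        by (simp add: a_def exp_add[symmetric] algebra_simps)
      hence "?k x = (iexp (\<sigma> * ((t *\<^sub>R \<xi>) \<bullet> x)) * (iexp a - 1 - \<i> * of_real a)) *s u x"
        by (simp add: vec_eq_iff d_def a_def scaleR_conv_of_real[where 'a=complex] algebra_simps)
      hence "norm (?k x) = cmod (iexp a - 1 - \<i> * of_real a) * norm (u x)"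
        by (simp only: norm_cscale norm_mult norm_exp_i_times mult_1)
      also have "\<dots> \<le> a\<^sup>2 * norm (u x)" by (intro mult_right_mono iexp_bound2) auto
      also have "\<dots> \<le> ((norm \<xi> * R)\<^sup>2 * (s - t)\<^sup>2) * norm (u x)"
      proof (cases "x \<in> cball 0 R")
        case True
        have "\<bar>\<xi> \<bullet> x\<bar> \<le> norm \<xi> * norm x" by (rule Cauchy_Schwarz_ineq2)
        also have "\<dots> \<le> norm \<xi> * R" using True by (intro mult_left_mono) auto
        finally have "\<bar>\<xi> \<bullet> x\<bar>\<^sup>2 \<le> (norm \<xi> * R)\<^sup>2" by (intro power_mono) auto
        moreover have "a\<^sup>2 = \<bar>\<xi> \<bullet> x\<bar>\<^sup>2 * (s - t)\<^sup>2" using \<sigma> by (auto simp: a_def power_mult_distrib)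
        ultimately show ?thesis by (auto intro!: mult_right_mono)
      qed (simp add: supp)
      finally show "norm (?k x) \<le> ((norm \<xi> * R)\<^sup>2 * (s - t)\<^sup>2) * norm (u x)" .
    qed
    also have "(\<integral>x. ((norm \<xi> * R)\<^sup>2 * (s - t)\<^sup>2) * norm (u x) \<partial>lborel) = ((norm \<xi> * R)\<^sup>2 * (s - t)\<^sup>2) * (\<integral>x. norm (u x) \<partial>lborel)" by simp
    finally show ?thesis using fconst_pos[where 'n='n] by (simp add: K_def mult_ac)
  qed
  from has_vector_derivative_quadratic[OF this] show ?thesis unfolding D .
qed

end

lemma continuous_mulx_fourier:
  fixes u :: "real^'n::finite \<Rightarrow> complex^'k::finite"
  assumes u: "l2 u" and supp: "\<And>x. x \<notin> cball 0 R \<Longrightarrow> u x = 0" and \<sigma>: "\<sigma> = 1 \<or> \<sigma> = -1" and R: "0 \<le> R"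
  shows "continuous_on UNIV (fourier_int \<sigma> (mulx \<sigma> l u))"
  by (rule continuous_fourier_int[OF mulx_l2(1)[OF u supp \<sigma> R] _ \<sigma> R]) (auto simp: mulx_def supp)

section \<open>The resolvent multiplier along a ray\<close>

definition sres :: "('n::finite \<Rightarrow> complex^'k::finite^'k) \<Rightarrow> complex \<Rightarrow> (real^'n \<Rightarrow> complex^'k) \<Rightarrow> (real^'n \<Rightarrow> complex^'k)" where
  "sres M z f \<xi> = matrix_inv (symb M \<xi> - mat z) *v f \<xi>"

lemma sres_l2:
  assumes "\<forall>j. hermitian_mat (M j)" "Im z \<noteq> 0" "l2 f"
  shows "l2 (sres M z f)" "nrm (sres M z f) \<le> (1 / \<bar>Im z\<bar>) * nrm f"
proof -
  have m: "sres M z f \<in> borel_measurable borel"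
    unfolding sres_def by (intro borel_measurable_symb_resolvent assms l2_measurable)
  have b: "norm (sres M z f \<xi>) \<le> (1 / \<bar>Im z\<bar>) * norm (f \<xi>)" for \<xi>
    using hermitian_resolvent_bound[OF hermitian_symb[OF assms(1)] assms(2)] by (simp add: sres_def)
  show "l2 (sres M z f)" "nrm (sres M z f) \<le> (1 / \<bar>Im z\<bar>) * nrm f"
    by (rule l2_dominated[OF assms(3) m _ b]; simp)+
qed

lemma sres_diff: "sres M z (\<lambda>x. f x - g x) = (\<lambda>x. sres M z f x - sres M z g x)"
  by (auto simp: sres_def matrix_vector_mult_diff_distrib)

text \<open>A frame diagonalising the symbol at \<xi> diagonalises it at all multiples, with
  eigenvalues scaled by t. The form of the squared resolvent therefore splits along the whole ray
  into scalar fractions with t-independent eigenvectors.\<close>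

lemma sres_spectral:
  assumes herm: "\<forall>j. hermitian_mat (M j)" and z: "Im z \<noteq> 0"
    and S: "finite S" "\<And>x. x = (\<Sum>e\<in>S. cip x e *s e)"
    and l: "\<And>e. e \<in> S \<Longrightarrow> symb M \<xi> *v e = complex_of_real (l e) *s e"
  shows "cip (sres M z (sres M z f) (t *\<^sub>R \<xi>)) y =
     (\<Sum>e\<in>S. cip (f (t *\<^sub>R \<xi>)) e * cnj (cip y e) / (of_real (l e * t) - z)\<^sup>2)"
proof -
  define B where "B = matrix_inv (symb M (t *\<^sub>R \<xi>) - mat z)"
  have ev: "B *v e = (1 / (of_real (l e * t) - z)) *s e" if e: "e \<in> S" for e
  proof -
    have "symb M (t *\<^sub>R \<xi>) *v e = of_real (l e * t) *s e" unfolding symb_scaleR l[OF e] by (simp add: mult.commute)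
    thus ?thesis unfolding B_def by (rule hermitian_resolvent_eigenvector[OF hermitian_symb[OF herm] z])
  qed
  let ?x = "f (t *\<^sub>R \<xi>)"
  have "B *v (B *v ?x) = (\<Sum>e\<in>S. (cip ?x e / (of_real (l e * t) - z)\<^sup>2) *s e)"
  proof -
    have Bs: "B *v (\<Sum>e\<in>S. c e *s e) = (\<Sum>e\<in>S. (c e / (of_real (l e * t) - z)) *s e)" for c
    proof -
      have "B *v (\<Sum>e\<in>S. c e *s e) = (\<Sum>e\<in>S. B *v (c e *s e))"
        by (rule vec.linear_sum[OF matrix_vector_mul_linear_gen])
      also have "\<dots> = (\<Sum>e\<in>S. (c e / (of_real (l e * t) - z)) *s e)"
        by (intro sum.cong refl) (simp add: vector_scalar_commute ev)
      finally show ?thesis .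
    qed
    have "B *v (B *v ?x) = B *v (B *v (\<Sum>e\<in>S. cip ?x e *s e))" using S(2)[of ?x] by simp
    also have "\<dots> = (\<Sum>e\<in>S. (cip ?x e / (of_real (l e * t) - z)\<^sup>2) *s e)" unfolding Bs by (simp add: power2_eq_square)
    finally show ?thesis .
  qed
  hence "cip (sres M z (sres M z f) (t *\<^sub>R \<xi>)) y = (\<Sum>e\<in>S. (cip ?x e / (of_real (l e * t) - z)\<^sup>2) * cip e y)"
    unfolding sres_def B_def[symmetric] by (simp add: cip_sum_left cip_scale_left)
  also have "\<dots> = (\<Sum>e\<in>S. cip ?x e * cnj (cip y e) / (of_real (l e * t) - z)\<^sup>2)"
  proof (intro sum.cong refl)
    fix e
    have "cip e y = cnj (cip y e)" by (rule cip_commute)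
    thus "(cip ?x e / (of_real (l e * t) - z)\<^sup>2) * cip e y = cip ?x e * cnj (cip y e) / (of_real (l e * t) - z)\<^sup>2" by simp
  qed
  finally show ?thesis .
qed

lemma set_Cauchy_Schwarz:
  fixes f g :: "real \<Rightarrow> real"
  assumes f: "continuous_on {1..2} f" and g: "continuous_on {1..2} g"
  shows "(LINT t:{1..2}|lborel. f t * g t) \<le> sqrt (LINT t:{1..2}|lborel. (f t)\<^sup>2) * sqrt (LINT t:{1..2}|lborel. (g t)\<^sup>2)"
proof -
  let ?i = "indicator {1..2::real} :: real \<Rightarrow> real"
  have m: "(\<lambda>t. ?i t * h t) \<in> borel_measurable lborel" "integrable lborel (\<lambda>t. (?i t * h t)\<^sup>2)"
    if h: "continuous_on {1..2} h" for h
  proof -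
    have "set_integrable lborel {1..2} h" by (rule borel_integrable_atLeastAtMost'[OF h])
    thus "(\<lambda>t. ?i t * h t) \<in> borel_measurable lborel"
      unfolding set_integrable_def by (auto dest: borel_measurable_integrable)
    have "set_integrable lborel {1..2} (\<lambda>t. (h t)\<^sup>2)" by (intro borel_integrable_atLeastAtMost' continuous_intros h)
    moreover have "(\<lambda>t. ?i t *\<^sub>R (h t)\<^sup>2) = (\<lambda>t. (?i t * h t)\<^sup>2)" by (auto simp: indicator_def)
    ultimately show "integrable lborel (\<lambda>t. (?i t * h t)\<^sup>2)" unfolding set_integrable_def by simp
  qed
  have "(LINT t|lborel. (?i t * f t) * (?i t * g t)) \<le> sqrt (LINT t|lborel. (?i t * f t)\<^sup>2) * sqrt (LINT t|lborel. (?i t * g t)\<^sup>2)"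
    by (intro Cauchy_Schwarz_integral m f g)
  moreover have "(\<lambda>t. (?i t * f t) * (?i t * g t)) = (\<lambda>t. ?i t *\<^sub>R (f t * g t))"
    "(\<lambda>t. (?i t * f t)\<^sup>2) = (\<lambda>t. ?i t *\<^sub>R (f t)\<^sup>2)" "(\<lambda>t. (?i t * g t)\<^sup>2) = (\<lambda>t. ?i t *\<^sub>R (g t)\<^sup>2)"
    by (auto simp: indicator_def)
  ultimately show ?thesis unfolding set_lebesgue_integral_def by simp
qed

text \<open>When the denominator stays away from zero its size is estimated directly and
  Cauchy-Schwarz suffices; no derivative is taken, hence no bound on \<open>norm \<xi>\<close> is
  called for.\<close>

lemma ray_nonresonant:
  fixes F G :: "real \<Rightarrow> complex"
  assumes F: "continuous_on {1..2} F" and G: "continuous_on {1..2} G" and m: "m > 0" and z: "Im z \<noteq> 0"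
    and far: "\<And>t. t \<in> {1..2} \<Longrightarrow> m / 2 \<le> cmod (of_real (l * t) - z)"
    and P: "(LINT t:{1..2}|lborel. (cmod (F t))\<^sup>2) \<le> P\<^sup>2" "P \<ge> 0"
    and Q: "(LINT t:{1..2}|lborel. (cmod (G t))\<^sup>2) \<le> Q\<^sup>2" "Q \<ge> 0"
  shows "cmod (LINT t:{1..2}|lborel. of_real (wt t) * (F t * cnj (G t)) / (of_real (l * t) - z)\<^sup>2) \<le> 4 / m\<^sup>2 * P * Q"
proof -
  let ?h = "\<lambda>t. of_real (wt t) * (F t * cnj (G t)) / (of_real (l * t) - z)\<^sup>2"
  have nz: "complex_of_real (l * t) - z \<noteq> 0" for t using z by (auto simp: complex_eq_iff)
  have hc: "continuous_on {1..2} ?h"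
    unfolding wt_def by (intro continuous_intros F G) (use nz in auto)
  have b: "cmod (?h t) \<le> 4 / m\<^sup>2 * (cmod (F t) * cmod (G t))" if t: "t \<in> {1..2}" for t
  proof -
    have "(m/2)\<^sup>2 \<le> (cmod (of_real (l * t) - z))\<^sup>2" using far[OF t] m by (intro power_mono) auto
    hence "m\<^sup>2 / 4 \<le> cmod ((of_real (l * t) - z)\<^sup>2)" by (simp add: norm_power power_divide)
    moreover have "cmod (of_real (wt t) * (F t * cnj (G t))) \<le> 1 * (cmod (F t) * cmod (G t))"
      unfolding norm_mult complex_mod_cnj using wt_bounds[OF t] by (intro mult_right_mono) auto
    ultimately have "cmod (?h t) \<le> (1 * (cmod (F t) * cmod (G t))) / (m\<^sup>2 / 4)"
      unfolding norm_divide using m by (intro frac_le) auto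
    thus ?thesis by (simp add: mult_ac)
  qed
  have "cmod (LINT t:{1..2}|lborel. ?h t) \<le> (LINT t:{1..2}|lborel. cmod (?h t))"
    by (intro set_integral_norm_bound borel_integrable_atLeastAtMost' hc)
  also have "\<dots> \<le> (LINT t:{1..2}|lborel. 4 / m\<^sup>2 * (cmod (F t) * cmod (G t)))"
    by (intro set_integral_mono borel_integrable_atLeastAtMost' continuous_intros continuous_on_norm[OF hc] F G b)
  also have "\<dots> = 4 / m\<^sup>2 * (LINT t:{1..2}|lborel. cmod (F t) * cmod (G t))" by simp
  also have "\<dots> \<le> 4 / m\<^sup>2 * (sqrt (LINT t:{1..2}|lborel. (cmod (F t))\<^sup>2) * sqrt (LINT t:{1..2}|lborel. (cmod (G t))\<^sup>2))"
    by (intro mult_left_mono set_Cauchy_Schwarz continuous_intros F G) simp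
  also have "\<dots> \<le> 4 / m\<^sup>2 * (sqrt (P\<^sup>2) * sqrt (Q\<^sup>2))"
    using P Q by (intro mult_left_mono mult_mono real_sqrt_le_mono) (auto simp: set_lebesgue_integral_def)
  finally show ?thesis using P Q by simp
qed

text \<open>On the ball of radius C, the energy controls the transform together with its radial
  derivative, the latter measured on the scale R of the support.\<close>

definition energy :: "real \<Rightarrow> real \<Rightarrow> (real^'n::finite \<Rightarrow> complex^'k::finite) \<Rightarrow> real^'n \<Rightarrow> real" where
  "energy C R u \<xi> = (norm (fourier_int (-1) u \<xi>))\<^sup>2 +
     (C\<^sup>2 * real CARD('n) / R\<^sup>2) * (\<Sum>l\<in>UNIV. (norm (fourier_int (-1) (mulx (-1) l u) \<xi>))\<^sup>2)"

context
  fixes u :: "real^'n::finite \<Rightarrow> complex^'k::finite" and R C :: real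
  assumes u: "l2 u" and supp: "\<And>x. x \<notin> cball 0 R \<Longrightarrow> u x = 0" and R: "1 \<le> R" and C: "0 \<le> C"
begin

lemma R_nonneg: "0 \<le> R" using R by simp

lemma energy_nonneg: "0 \<le> energy C R u \<xi>"
  unfolding energy_def by (intro add_nonneg_nonneg mult_nonneg_nonneg sum_nonneg) auto

lemma continuous_fourier_neg: "continuous_on A (fourier_int (-1) u)" "continuous_on A (fourier_int (-1) (mulx (-1) l u))"
  using continuous_fourier_int[OF u supp _ R_nonneg, of "-1"] continuous_mulx_fourier[OF u supp _ R_nonneg, of "-1" l]
    continuous_on_subset[of UNIV _ A] by auto

lemma continuous_energy: "continuous_on A (energy C R u)"
  unfolding energy_def by (intro continuous_intros continuous_fourier_neg)

lemma continuous_energy_ray: "continuous_on A (\<lambda>t. energy C R u (t *\<^sub>R \<xi>))"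
  by (rule continuous_on_compose2[OF continuous_energy[of UNIV]]) (auto intro!: continuous_intros)

text \<open>Plancherel's inequality for u and for its coordinate multiples. The factor R squared
  from the supports cancels the one in the denominator of \<open>energy\<close>, leaving a constant
  that does not see the scale.\<close>

lemma energy_integral: "(\<integral>\<^sup>+\<xi>. ennreal (energy C R u \<xi>) \<partial>lborel) \<le> ennreal ((1 + C\<^sup>2 * (real CARD('n))\<^sup>2) * (nrm u)\<^sup>2)"
proof -
  let ?f = "fourier_int (-1) u" and ?g = "\<lambda>l. fourier_int (-1) (mulx (-1) l u)"
  let ?D = "C\<^sup>2 * real CARD('n) / R\<^sup>2"
  have f: "l2 ?f" "nrm ?f \<le> nrm u"
    using fourier_int_plancherel[OF bounded_support_integrable[OF u supp _ R_nonneg] u] by auto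
  have g: "l2 (?g l)" "nrm (?g l) \<le> R * nrm u" for l
  proof -
    have i: "integrable lborel (mulx (-1) l u)" by (rule mulx_integrable[OF u supp _ R_nonneg]) auto
    have j: "l2 (mulx (-1) l u)" "nrm (mulx (-1) l u) \<le> R * nrm u" by (rule mulx_l2[OF u supp _ R_nonneg]; simp)+
    show "l2 (?g l)" "nrm (?g l) \<le> R * nrm u"
      using fourier_int_plancherel[OF i j(1), of "-1"] j(2) by auto
  qed
  note [measurable] = l2_measurable[OF f(1)] l2_measurable[OF g(1)]
  have "(\<integral>\<^sup>+\<xi>. ennreal (energy C R u \<xi>) \<partial>lborel) =
      (\<integral>\<^sup>+\<xi>. ennreal ((norm (?f \<xi>))\<^sup>2) + ennreal ?D * (\<Sum>l\<in>UNIV. ennreal ((norm (?g l \<xi>))\<^sup>2)) \<partial>lborel)"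
    unfolding energy_def by (intro nn_integral_cong) (simp add: ennreal_plus[symmetric] sum_ennreal ennreal_mult'[symmetric] sum_nonneg del: ennreal_plus)
  also have "\<dots> = ennreal ((nrm ?f)\<^sup>2) + ennreal ?D * (\<Sum>l\<in>UNIV. ennreal ((nrm (?g l))\<^sup>2))"
    by (simp add: nn_integral_add nn_integral_cmult nn_integral_sum nn_integral_l2[OF f(1)] nn_integral_l2[OF g(1)] del: sum_ennreal)
  also have "\<dots> = ennreal ((nrm ?f)\<^sup>2 + ?D * (\<Sum>l\<in>UNIV. (nrm (?g l))\<^sup>2))"
    by (simp add: ennreal_plus[symmetric] sum_ennreal ennreal_mult'[symmetric] sum_nonneg del: ennreal_plus)
  also have "\<dots> \<le> ennreal ((1 + C\<^sup>2 * (real CARD('n))\<^sup>2) * (nrm u)\<^sup>2)"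
  proof (rule ennreal_leI)
    have "(\<Sum>l\<in>UNIV. (nrm (?g l))\<^sup>2) \<le> (\<Sum>l\<in>(UNIV::'n set). (R * nrm u)\<^sup>2)"
      by (intro sum_mono power_mono g) simp
    hence "?D * (\<Sum>l\<in>UNIV. (nrm (?g l))\<^sup>2) \<le> ?D * (real CARD('n) * (R * nrm u)\<^sup>2)"
      by (intro mult_left_mono) auto
    also have "\<dots> = C\<^sup>2 * (real CARD('n))\<^sup>2 * (nrm u)\<^sup>2" using R by (simp add: power2_eq_square)
    finally have 2: "?D * (\<Sum>l\<in>UNIV. (nrm (?g l))\<^sup>2) \<le> C\<^sup>2 * (real CARD('n))\<^sup>2 * (nrm u)\<^sup>2" .
    have 1: "(nrm ?f)\<^sup>2 \<le> (nrm u)\<^sup>2" by (intro power_mono f) simp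
    show "(nrm ?f)\<^sup>2 + ?D * (\<Sum>l\<in>UNIV. (nrm (?g l))\<^sup>2) \<le> (1 + C\<^sup>2 * (real CARD('n))\<^sup>2) * (nrm u)\<^sup>2"
      using add_mono[OF 1 2] by (simp only: distrib_right mult_1)
  qed
  finally show ?thesis .
qed

text \<open>Collects what \<open>ray_estimate\<close> and \<open>ray_nonresonant\<close> ask of a
  scalar component along the ray, with P the same for all unit vectors e. Only the bound on the
  derivative restricts \<xi>, as the chain rule brings in its coordinates.\<close>

lemma ray_component:
  fixes \<xi> :: "real^'n" and e :: "complex^'k"
  assumes e: "norm e = 1"
  defines "F \<equiv> \<lambda>t. cip (fourier_int (-1) u (t *\<^sub>R \<xi>)) e"
    and "F' \<equiv> \<lambda>t. cip (\<Sum>l\<in>UNIV. \<xi> $ l *\<^sub>R fourier_int (-1) (mulx (-1) l u) (t *\<^sub>R \<xi>)) e"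
    and "P \<equiv> sqrt (LINT t:{1..2}|lborel. energy C R u (t *\<^sub>R \<xi>))"
  shows "(F has_vector_derivative F' t) (at t)" "continuous_on {1..2} F" "continuous_on {1..2} F'"
    "0 \<le> P" "(LINT t:{1..2}|lborel. (cmod (F t))\<^sup>2) \<le> P\<^sup>2"
    "norm \<xi> \<le> C \<Longrightarrow> (LINT t:{1..2}|lborel. (cmod (F' t))\<^sup>2) \<le> (R * P)\<^sup>2"
proof -
  show D: "(F has_vector_derivative F' t) (at t)" for t
    unfolding F_def F'_def
    by (rule bounded_linear.has_vector_derivative[OF bounded_linear_cip_left fourier_int_ray_derivative[OF u supp _ R_nonneg]]) auto
  show Fc: "continuous_on {1..2} F"
    using D by (intro continuous_at_imp_continuous_on ballI has_vector_derivative_continuous) blast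
  have gc: "continuous_on {1..2} (\<lambda>t. fourier_int (-1) (mulx (-1) l u) (t *\<^sub>R \<xi>))" for l
    by (rule continuous_on_compose2[OF continuous_fourier_neg(2)[of UNIV]]) (auto intro!: continuous_intros)
  show F'c: "continuous_on {1..2} F'"
    unfolding F'_def
    by (rule continuous_on_compose2[OF linear_continuous_on[OF bounded_linear_cip_left, of UNIV]])
       (auto intro!: continuous_intros gc)
  have E: "set_integrable lborel {1..2} (\<lambda>t. energy C R u (t *\<^sub>R \<xi>))"
    by (rule borel_integrable_atLeastAtMost'[OF continuous_energy_ray])
  have E0: "0 \<le> (LINT t:{1..2}|lborel. energy C R u (t *\<^sub>R \<xi>))"
    unfolding set_lebesgue_integral_def by (intro integral_nonneg_AE AE_I2) (auto simp: energy_nonneg)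
  show "0 \<le> P" by (simp add: P_def E0)
  have P2: "P\<^sup>2 = (LINT t:{1..2}|lborel. energy C R u (t *\<^sub>R \<xi>))" by (simp add: P_def E0)
  show "(LINT t:{1..2}|lborel. (cmod (F t))\<^sup>2) \<le> P\<^sup>2"
    unfolding P2
  proof (intro set_integral_mono E borel_integrable_atLeastAtMost' continuous_intros Fc)
    fix t
    have "(cmod (F t))\<^sup>2 \<le> (norm (fourier_int (-1) u (t *\<^sub>R \<xi>)))\<^sup>2"
      using norm_cip_le[of "fourier_int (-1) u (t *\<^sub>R \<xi>)" e] e unfolding F_def by (intro power_mono) auto
    also have "\<dots> \<le> energy C R u (t *\<^sub>R \<xi>)"
      unfolding energy_def by (simp add: sum_nonneg)
    finally show "(cmod (F t))\<^sup>2 \<le> energy C R u (t *\<^sub>R \<xi>)" .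
  qed
  assume \<xi>: "norm \<xi> \<le> C"
  have "(LINT t:{1..2}|lborel. (cmod (F' t))\<^sup>2) \<le> (LINT t:{1..2}|lborel. R\<^sup>2 * energy C R u (t *\<^sub>R \<xi>))"
  proof (intro set_integral_mono set_integrable_mult_right E borel_integrable_atLeastAtMost' continuous_intros F'c)
    fix t
    let ?g = "\<lambda>l. norm (fourier_int (-1) (mulx (-1) l u) (t *\<^sub>R \<xi>))"
    have "cmod (F' t) \<le> norm (\<Sum>l\<in>UNIV. \<xi> $ l *\<^sub>R fourier_int (-1) (mulx (-1) l u) (t *\<^sub>R \<xi>))"
      using norm_cip_le[of "\<Sum>l\<in>UNIV. \<xi> $ l *\<^sub>R fourier_int (-1) (mulx (-1) l u) (t *\<^sub>R \<xi>)" e] e by (simp add: F'_def)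
    also have "\<dots> \<le> (\<Sum>l\<in>UNIV. \<bar>\<xi> $ l\<bar> * ?g l)" by (rule order_trans[OF norm_sum]) simp
    also have "\<dots> \<le> (\<Sum>l\<in>UNIV. C * ?g l)"
      by (intro sum_mono mult_right_mono order_trans[OF component_le_norm_cart \<xi>]) auto
    finally have "(cmod (F' t))\<^sup>2 \<le> (\<Sum>l\<in>UNIV. C * ?g l)\<^sup>2" by (intro power_mono) auto
    \<comment> \<open>Cauchy-Schwarz over the coordinates produces the factor
      \<open>CARD('n)\<close> that is built into \<open>energy\<close>.\<close>
    also have "\<dots> = C\<^sup>2 * (\<Sum>l\<in>UNIV. 1 * ?g l)\<^sup>2" by (simp add: sum_distrib_left[symmetric] power_mult_distrib)
    also have "\<dots> \<le> C\<^sup>2 * ((\<Sum>l\<in>(UNIV::'n set). 1\<^sup>2) * (\<Sum>l\<in>UNIV. (?g l)\<^sup>2))"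
      by (intro mult_left_mono Cauchy_Schwarz_ineq_sum) auto
    also have "\<dots> = R\<^sup>2 * ((C\<^sup>2 * real CARD('n) / R\<^sup>2) * (\<Sum>l\<in>UNIV. (?g l)\<^sup>2))" using R by simp
    also have "\<dots> \<le> R\<^sup>2 * energy C R u (t *\<^sub>R \<xi>)" unfolding energy_def by (intro mult_left_mono) auto
    finally show "(cmod (F' t))\<^sup>2 \<le> R\<^sup>2 * energy C R u (t *\<^sub>R \<xi>)" .
  qed
  also have "\<dots> = (R * P)\<^sup>2" by (simp add: P2 power_mult_distrib)
  finally show "(LINT t:{1..2}|lborel. (cmod (F' t))\<^sup>2) \<le> (R * P)\<^sup>2" .
qed

end

text \<open>The first summand belongs to resonant eigenvalues. The second, 12 = 4 * 3, belongs to
  the nonresonant ones, with 3 from \<open>powr_ge_const\<close>.\<close>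

definition ray_const :: "real \<Rightarrow> real \<Rightarrow> real" where
  "ray_const \<alpha> m = 20 * (singular_const \<alpha> * (m/4) powr (-1 - \<alpha>) + 96 / m\<^sup>2) + 12 / m\<^sup>2"

lemma ray_const_nonneg: "m > 0 \<Longrightarrow> 0 \<le> ray_const \<alpha> m"
  using singular_const_nonneg[of \<alpha>] by (simp add: ray_const_def)

text \<open>As t runs over [1, 2], l t can come near Re z only if |l| lies between |Re z| / 4 and 2
  |Re z|. For other eigenvalues the denominator is at least m / 2. For these, which are nonzero, the
  gap gives c \<open>norm \<xi>\<close> at most 2 X, so \<xi> lies in the ball of radius C where the
  energy controls the radial derivative.\<close>

lemma frequency_ray_bound:
  fixes M :: "'n::finite \<Rightarrow> complex^'k::finite^'k" and u v :: "real^'n \<Rightarrow> complex^'k"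
  assumes herm: "\<forall>j. hermitian_mat (M j)" and c: "c > 0"
    and gap: "\<And>\<xi> v l. v \<noteq> 0 \<Longrightarrow> symb M \<xi> *v v = of_real l *s v \<Longrightarrow> l \<noteq> 0 \<Longrightarrow> c * norm \<xi> \<le> \<bar>l\<bar>"
    and \<alpha>: "0 < \<alpha>" "\<alpha> \<le> 1/2" and m: "0 < m" and z: "m \<le> \<bar>Re z\<bar>" "\<bar>Re z\<bar> \<le> X" "Im z \<noteq> 0" "\<bar>Im z\<bar> \<le> 3"
    and u: "l2 u" "\<And>x. x \<notin> cball 0 R \<Longrightarrow> u x = 0" "1 \<le> R"
    and v: "l2 v" "\<And>x. x \<notin> cball 0 S \<Longrightarrow> v x = 0" "1 \<le> S"
  defines "C \<equiv> 2 * X / c"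
  shows "cmod (LINT t:{1..2}|lborel. of_real (wt t) *
      cip (sres M z (sres M z (fourier_int (-1) u)) (t *\<^sub>R \<xi>)) (fourier_int (-1) v (t *\<^sub>R \<xi>))) \<le>
    (real DIM(complex^'k) * ray_const \<alpha> m * (R * S) powr (1/2 + \<alpha>) * \<bar>Im z\<bar> powr (\<alpha> - 1)) *
      (sqrt (LINT t:{1..2}|lborel. energy C R u (t *\<^sub>R \<xi>)) * sqrt (LINT t:{1..2}|lborel. energy C S v (t *\<^sub>R \<xi>)))"
proof -
  \<comment> \<open>The frame depends on \<xi> in an uncontrolled way; only its cardinality survives
    in the final bound.\<close>
  obtain B where B: "eigen_frame (symb M \<xi>) B" "finite B" "card B \<le> DIM(complex^'k)" "\<And>x. x = (\<Sum>e\<in>B. cip x e *s e)"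
    using hermitian_spectral[OF hermitian_symb[OF herm, of \<xi>]] by blast
  have "\<forall>e\<in>B. \<exists>l. symb M \<xi> *v e = complex_of_real l *s e" using B(1) by (auto simp: eigen_frame_def)
  then obtain l where l: "\<And>e. e \<in> B \<Longrightarrow> symb M \<xi> *v e = complex_of_real (l e) *s e" by metis
  have e1: "e \<in> B \<Longrightarrow> norm e = 1" for e using B(1) by (auto simp: eigen_frame_def)
  have C0: "0 \<le> C" using z m c by (simp add: C_def)
  define F where "F = (\<lambda>e t. cip (fourier_int (-1) u (t *\<^sub>R \<xi>)) e)"
  define G where "G = (\<lambda>e t. cip (fourier_int (-1) v (t *\<^sub>R \<xi>)) e)"
  define F' where "F' = (\<lambda>e t. cip (\<Sum>l\<in>UNIV. \<xi> $ l *\<^sub>R fourier_int (-1) (mulx (-1) l u) (t *\<^sub>R \<xi>)) e)"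
  define G' where "G' = (\<lambda>e t. cip (\<Sum>l\<in>UNIV. \<xi> $ l *\<^sub>R fourier_int (-1) (mulx (-1) l v) (t *\<^sub>R \<xi>)) e)"
  define P where "P = sqrt (LINT t:{1..2}|lborel. energy C R u (t *\<^sub>R \<xi>))"
  define Q where "Q = sqrt (LINT t:{1..2}|lborel. energy C S v (t *\<^sub>R \<xi>))"
  have Fs: "(F e has_vector_derivative F' e t) (at t)" "continuous_on {1..2} (F e)" "continuous_on {1..2} (F' e)"
    "0 \<le> P" "(LINT t:{1..2}|lborel. (cmod (F e t))\<^sup>2) \<le> P\<^sup>2"
    "norm \<xi> \<le> C \<Longrightarrow> (LINT t:{1..2}|lborel. (cmod (F' e t))\<^sup>2) \<le> (R * P)\<^sup>2" if "e \<in> B" for e t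
    using ray_component[OF u C0 e1[OF that], of \<xi>] by (auto simp: F_def F'_def P_def)
  have Gs: "(G e has_vector_derivative G' e t) (at t)" "continuous_on {1..2} (G e)" "continuous_on {1..2} (G' e)"
    "0 \<le> Q" "(LINT t:{1..2}|lborel. (cmod (G e t))\<^sup>2) \<le> Q\<^sup>2"
    "norm \<xi> \<le> C \<Longrightarrow> (LINT t:{1..2}|lborel. (cmod (G' e t))\<^sup>2) \<le> (S * Q)\<^sup>2" if "e \<in> B" for e t
    using ray_component[OF v C0 e1[OF that], of \<xi>] by (auto simp: G_def G'_def Q_def)
  have PQ: "0 \<le> P" "0 \<le> Q" using energy_nonneg[OF u C0] energy_nonneg[OF v C0]
    by (auto simp: P_def Q_def set_lebesgue_integral_def intro!: integral_nonneg_AE)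
  let ?K = "ray_const \<alpha> m * (R * S) powr (1/2 + \<alpha>) * \<bar>Im z\<bar> powr (\<alpha> - 1)"
  define h where "h = (\<lambda>e t. of_real (wt t) * (F e t * cnj (G e t)) / (of_real (l e * t) - z)\<^sup>2)"
  have nz: "complex_of_real (l e * t) - z \<noteq> 0" for e t using z by (auto simp: complex_eq_iff)
  have hi: "set_integrable lborel {1..2} (h e)" if "e \<in> B" for e
    unfolding h_def wt_def
    by (intro borel_integrable_atLeastAtMost' continuous_intros Fs(2)[OF that] Gs(2)[OF that]) (use nz in auto)
  have sc0: "0 \<le> singular_const \<alpha> * (m/4) powr (-1 - \<alpha>) + 96 / m\<^sup>2" using singular_const_nonneg[of \<alpha>] by simp
  have bnd: "cmod (LINT t:{1..2}|lborel. h e t) \<le> ?K * (P * Q)" if e: "e \<in> B" for e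
  proof (cases "\<bar>l e\<bar> \<le> \<bar>Re z\<bar> / 4 \<or> 2 * \<bar>Re z\<bar> \<le> \<bar>l e\<bar>")
    case True
    have far: "m / 2 \<le> cmod (of_real (l e * t) - z)" if t: "t \<in> {1..2}" for t
    proof -
      have "\<bar>Re z\<bar> / 2 \<le> \<bar>l e * t - Re z\<bar>"
      proof (cases "\<bar>l e\<bar> \<le> \<bar>Re z\<bar> / 4")
        case True
        have "\<bar>l e * t\<bar> \<le> \<bar>Re z\<bar> / 4 * 2" unfolding abs_mult using True t by (intro mult_mono) auto
        thus ?thesis by linarith
      next
        case False
        hence "2 * \<bar>Re z\<bar> \<le> \<bar>l e\<bar>" using \<open>_ \<or> _\<close> by blast
        moreover have "\<bar>l e\<bar> * 1 \<le> \<bar>l e * t\<bar>" unfolding abs_mult using t by (intro mult_left_mono) auto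
        ultimately show ?thesis by linarith
      qed
      also have "\<dots> \<le> cmod (of_real (l e * t) - z)" using abs_Re_le_cmod[of "of_real (l e * t) - z"] by simp
      finally show ?thesis using z(1) by linarith
    qed
    have "cmod (LINT t:{1..2}|lborel. h e t) \<le> 4 / m\<^sup>2 * P * Q"
      unfolding h_def by (rule ray_nonresonant[OF Fs(2)[OF e] Gs(2)[OF e] m z(3) far Fs(5)[OF e] PQ(1) Gs(5)[OF e] PQ(2)])
    also have "\<dots> = 4 / m\<^sup>2 * 1 * 1 * (P * Q)" by simp
    \<comment> \<open>Two factors of size at least 1 are inserted, so that the nonresonant bound
      takes the shape of the resonant one.\<close>
    also have "\<dots> \<le> 4 / m\<^sup>2 * (R * S) powr (1/2 + \<alpha>) * (3 * \<bar>Im z\<bar> powr (\<alpha> - 1)) * (P * Q)"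
    proof (intro mult_mono mult_nonneg_nonneg order_refl)
      show "1 \<le> 3 * \<bar>Im z\<bar> powr (\<alpha> - 1)" using z \<alpha> by (intro powr_ge_const) auto
      have "1 \<le> R * S" using mult_mono[OF u(3) v(3)] u(3) by simp
      thus "1 \<le> (R * S) powr (1/2 + \<alpha>)" using \<alpha> by (intro ge_one_powr_ge_zero) auto
    qed (use PQ in auto)
    also have "\<dots> = 12 / m\<^sup>2 * ((R * S) powr (1/2 + \<alpha>) * \<bar>Im z\<bar> powr (\<alpha> - 1) * (P * Q))" by simp
    also have "\<dots> \<le> ray_const \<alpha> m * ((R * S) powr (1/2 + \<alpha>) * \<bar>Im z\<bar> powr (\<alpha> - 1) * (P * Q))"
    proof (intro mult_right_mono)
      have "0 \<le> 20 * (singular_const \<alpha> * (m/4) powr (-1 - \<alpha>) + 96 / m\<^sup>2)"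
        by (rule mult_nonneg_nonneg[OF _ sc0]) simp
      thus "12 / m\<^sup>2 \<le> ray_const \<alpha> m" unfolding ray_const_def by (simp only: le_add_same_cancel2)
    qed (use PQ in auto)
    finally show ?thesis by (simp add: mult_ac)
  next
    case False
    hence l1: "\<bar>Re z\<bar> / 4 \<le> \<bar>l e\<bar>" "\<bar>l e\<bar> \<le> 2 * \<bar>Re z\<bar>" by auto
    hence l2: "m / 4 \<le> \<bar>l e\<bar>" using z(1) by linarith
    hence "l e \<noteq> 0" using m by auto
    moreover have "e \<noteq> 0" using e1[OF e] by auto
    ultimately have "c * norm \<xi> \<le> \<bar>l e\<bar>" using gap l[OF e] by blast
    hence "c * norm \<xi> \<le> 2 * X" using l1 z(2) by linarith
    hence \<xi>: "norm \<xi> \<le> C" using c by (simp add: C_def field_simps)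
    have "cmod (LINT t:{1..2}|lborel. h e t) \<le>
       20 * (singular_const \<alpha> * (m/4) powr (-1 - \<alpha>) + 96 / m\<^sup>2) * (R * S) powr (1/2 + \<alpha>) * P * Q * \<bar>Im z\<bar> powr (\<alpha> - 1)"
      unfolding h_def
      by (rule ray_estimate[OF \<alpha> m l2 z(3,4) Fs(1)[OF e] Fs(3)[OF e] u(3) PQ(1) Fs(5)[OF e] Fs(6)[OF e \<xi>]
            Gs(1)[OF e] Gs(3)[OF e] v(3) PQ(2) Gs(5)[OF e] Gs(6)[OF e \<xi>]])
    also have "\<dots> = 20 * (singular_const \<alpha> * (m/4) powr (-1 - \<alpha>) + 96 / m\<^sup>2) * ((R * S) powr (1/2 + \<alpha>) * \<bar>Im z\<bar> powr (\<alpha> - 1) * (P * Q))"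
      by (simp only: mult_ac)
    also have "\<dots> \<le> ray_const \<alpha> m * ((R * S) powr (1/2 + \<alpha>) * \<bar>Im z\<bar> powr (\<alpha> - 1) * (P * Q))"
      using PQ by (intro mult_right_mono) (auto simp: ray_const_def intro: divide_right_mono)
    finally show ?thesis by (simp add: mult_ac)
  qed
  have sp0: "cip (sres M z (sres M z (fourier_int (-1) u)) (t *\<^sub>R \<xi>)) y =
     (\<Sum>e\<in>B. cip (fourier_int (-1) u (t *\<^sub>R \<xi>)) e * cnj (cip y e) / (of_real (l e * t) - z)\<^sup>2)" for t y
    by (rule sres_spectral[OF herm z(3) B(2,4)]) (rule l)
  have sp: "of_real (wt t) * cip (sres M z (sres M z (fourier_int (-1) u)) (t *\<^sub>R \<xi>)) (fourier_int (-1) v (t *\<^sub>R \<xi>)) = (\<Sum>e\<in>B. h e t)" for t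
    unfolding sp0 h_def F_def G_def by (simp add: sum_distrib_left)
  have "cmod (LINT t:{1..2}|lborel. (\<Sum>e\<in>B. h e t)) = cmod (\<Sum>e\<in>B. LINT t:{1..2}|lborel. h e t)"
    using hi unfolding set_lebesgue_integral_def set_integrable_def scaleR_sum_right
    by (subst Bochner_Integration.integral_sum) auto
  also have "\<dots> \<le> (\<Sum>e\<in>B. ?K * (P * Q))" by (intro order_trans[OF norm_sum] sum_mono bnd)
  also have "\<dots> = real (card B) * (?K * (P * Q))" by simp
  also have "\<dots> \<le> real DIM(complex^'k) * (?K * (P * Q))"
    using B(3) PQ ray_const_nonneg[OF m, of \<alpha>] by (intro mult_right_mono of_nat_mono) auto
  finally show ?thesis unfolding sp P_def Q_def by (simp only: mult.assoc)
qed

section \<open>Dilations of frequency space and averages over them\<close>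

lemma nn_integral_lborel_scaleR:
  fixes f :: "'a::euclidean_space \<Rightarrow> ennreal"
  assumes [measurable]: "f \<in> borel_measurable borel" and c: "c > 0"
  shows "(\<integral>\<^sup>+x. f (c *\<^sub>R x) \<partial>lborel) = ennreal (1 / c ^ DIM('a)) * (\<integral>\<^sup>+x. f x \<partial>lborel)"
proof -
  have "(\<integral>\<^sup>+x. f x \<partial>lborel) = (\<integral>\<^sup>+x. f x \<partial>density (distr lborel borel (\<lambda>x. 0 + c *\<^sub>R x)) (\<lambda>_. ennreal (\<bar>c\<bar> ^ DIM('a))))"
    using lborel_affine[of c "0::'a"] c by simp
  also have "\<dots> = ennreal (c ^ DIM('a)) * (\<integral>\<^sup>+x. f (c *\<^sub>R x) \<partial>lborel)"
    using c by (simp add: nn_integral_density nn_integral_distr nn_integral_cmult)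
  finally have "ennreal (1 / c ^ DIM('a)) * (\<integral>\<^sup>+x. f x \<partial>lborel) =
     (ennreal (1 / c ^ DIM('a)) * ennreal (c ^ DIM('a))) * (\<integral>\<^sup>+x. f (c *\<^sub>R x) \<partial>lborel)" by (simp add: mult.assoc)
  also have "ennreal (1 / c ^ DIM('a)) * ennreal (c ^ DIM('a)) = 1"
    using c by (subst ennreal_mult'[symmetric]) auto
  finally show ?thesis by simp
qed

lemma integral_lborel_scaleR:
  fixes f :: "'a::euclidean_space \<Rightarrow> complex"
  assumes f: "integrable lborel f" and c: "c > 0"
  shows "integrable lborel (\<lambda>x. f (c *\<^sub>R x))"
    "(\<integral>x. f (c *\<^sub>R x) \<partial>lborel) = of_real (1 / c ^ DIM('a)) * (\<integral>x. f x \<partial>lborel)"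
proof -
  have fm[measurable]: "f \<in> borel_measurable borel" using f by (auto dest: borel_measurable_integrable)
  show "integrable lborel (\<lambda>x. f (c *\<^sub>R x))"
  proof (rule integrableI_bounded)
    have "(\<integral>\<^sup>+x. ennreal (cmod (f (c *\<^sub>R x))) \<partial>lborel) = ennreal (1 / c ^ DIM('a)) * (\<integral>\<^sup>+x. ennreal (cmod (f x)) \<partial>lborel)"
      by (rule nn_integral_lborel_scaleR) (use c in auto)
    thus "(\<integral>\<^sup>+x. ennreal (cmod (f (c *\<^sub>R x))) \<partial>lborel) < \<infinity>"
      using f unfolding integrable_iff_bounded by (simp add: ennreal_mult_less_top)
  qed measurable
  have "(\<integral>x. f x \<partial>lborel) = (\<integral>x. f x \<partial>density (distr lborel borel (\<lambda>x. 0 + c *\<^sub>R x)) (\<lambda>_. ennreal (\<bar>c\<bar> ^ DIM('a))))"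
    using lborel_affine[of c "0::'a"] c by simp
  also have "\<dots> = of_real (c ^ DIM('a)) * (\<integral>x. f (c *\<^sub>R x) \<partial>lborel)"
    using c by (subst integral_density) (auto simp: integral_distr scaleR_conv_of_real)
  finally show "(\<integral>x. f (c *\<^sub>R x) \<partial>lborel) = of_real (1 / c ^ DIM('a)) * (\<integral>x. f x \<partial>lborel)"
    using c by simp
qed

text \<open>The factor gained when an integral over frequency space is averaged over dilations: t^n
  is the Jacobian of the dilation by t.\<close>

definition avg_const :: "nat \<Rightarrow> real" where
  "avg_const n = (LINT t:{1..2}|lborel. wt t / t ^ n)"

text \<open>On [5/4, 7/4] both factors of the weight are at least 1/4 and t^n is at most 2^n; the
  rest of the interval contributes a nonnegative amount. Positivity permits division by the
  constant.\<close>

lemma avg_const_pos: "avg_const n > 0"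
proof -
  define c where "c = (1/16 :: real) / 2 ^ n"
  have ci: "set_integrable lborel {1..2} (\<lambda>t. wt t / t ^ n)"
    unfolding wt_def by (intro borel_integrable_atLeastAtMost' continuous_intros) auto
  have "(LINT t:{5/4..7/4::real}|lborel. c) \<le> (LINT t:{5/4..7/4}|lborel. wt t / t ^ n)"
  proof (intro set_integral_mono)
    show "set_integrable lborel {5/4..7/4::real} (\<lambda>t. c)"
      by (intro borel_integrable_atLeastAtMost' continuous_intros)
    show "set_integrable lborel {5/4..7/4} (\<lambda>t. wt t / t ^ n)"
      by (rule set_integrable_subset[OF ci]) auto
    fix t :: real assume t: "t \<in> {5/4..7/4}"
    have "(1/4) * (1/4) \<le> (t - 1) * (2 - t)" using t by (intro mult_mono) auto
    hence "1/16 \<le> wt t" by (simp add: wt_def)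
    moreover have "t ^ n \<le> 2 ^ n" using t by (intro power_mono) auto
    ultimately show "c \<le> wt t / t ^ n" unfolding c_def using t by (intro frac_le) auto
  qed
  also have "\<dots> \<le> avg_const n" unfolding avg_const_def
    by (rule set_integral_mono_subset_nonneg[OF ci]) (auto simp: wt_bounds)
  finally have "(LINT t:{5/4..7/4::real}|lborel. c) \<le> avg_const n" .
  moreover have "(LINT t:{5/4..7/4::real}|lborel. c) = c / 2"
    unfolding set_lebesgue_integral_def by simp
  moreover have "c > 0" by (simp add: c_def)
  ultimately show ?thesis by simp
qed

text \<open>Integrating over dilates replaces polar coordinates: every point is averaged along a
  segment of its ray.\<close>

lemma dilation_average:
  fixes f :: "real^'n::finite \<Rightarrow> complex"
  assumes f: "integrable lborel f"
  defines "g \<equiv> \<lambda>\<xi>. LINT t:{1..2}|lborel. of_real (wt t) * f (t *\<^sub>R \<xi>)"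
  shows "integrable lborel g" "(\<integral>\<xi>. g \<xi> \<partial>lborel) = of_real (avg_const CARD('n)) * (\<integral>\<xi>. f \<xi> \<partial>lborel)"
proof -
  have fm[measurable]: "f \<in> borel_measurable borel" using f by (auto dest: borel_measurable_integrable)
  have wm[measurable]: "wt \<in> borel_measurable borel" unfolding wt_def by measurable
  define k where "k = (\<lambda>(t::real) (\<xi>::real^'n). indicator {1..2} t *\<^sub>R (complex_of_real (wt t) * f (t *\<^sub>R \<xi>)))"
  have k_eq: "(\<integral>\<xi>. k t \<xi> \<partial>lborel) = indicator {1..2} t *\<^sub>R (of_real (wt t / t ^ CARD('n)) * (\<integral>\<xi>. f \<xi> \<partial>lborel))" for t
    unfolding k_def using integral_lborel_scaleR(2)[OF f, of t] by (cases "t \<in> {1..2}") auto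
  have ki: "integrable lborel (k t)" for t
    unfolding k_def using integral_lborel_scaleR(1)[OF f, of t] by (cases "t \<in> {1..2}") auto
  have kn: "(\<integral>\<xi>. cmod (k t \<xi>) \<partial>lborel) = indicator {1..2} t *\<^sub>R (wt t / t ^ CARD('n) * (\<integral>\<xi>. cmod (f \<xi>) \<partial>lborel))" for t
  proof (cases "t \<in> {1..2}")
    case True
    have fn: "integrable lborel (\<lambda>\<xi>. complex_of_real (cmod (f \<xi>)))" using f by auto
    have "complex_of_real (\<integral>\<xi>. cmod (f (t *\<^sub>R \<xi>)) \<partial>lborel) = complex_of_real (1 / t ^ CARD('n) * (\<integral>\<xi>. cmod (f \<xi>) \<partial>lborel))"
      using integral_lborel_scaleR(2)[OF fn, of t] True unfolding integral_complex_of_real by simp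
    hence "(\<integral>\<xi>. cmod (f (t *\<^sub>R \<xi>)) \<partial>lborel) = 1 / t ^ CARD('n) * (\<integral>\<xi>. cmod (f \<xi>) \<partial>lborel)" by (simp only: of_real_eq_iff)
    moreover have "cmod (k t \<xi>) = wt t * cmod (f (t *\<^sub>R \<xi>))" for \<xi>
      unfolding k_def using True wt_bounds[OF True] by (simp add: norm_mult)
    ultimately show ?thesis using True by simp
  qed (simp add: k_def)
  have kint: "integrable (lborel \<Otimes>\<^sub>M lborel) (\<lambda>(t, \<xi>). k t \<xi>)"
  proof (rule lborel_pair.Fubini_integrable)
    show "(\<lambda>(t, \<xi>). k t \<xi>) \<in> borel_measurable (lborel \<Otimes>\<^sub>M lborel)" unfolding k_def by measurable
    have "set_integrable lborel {1..2} (\<lambda>t. wt t / t ^ CARD('n) * (\<integral>\<xi>. cmod (f \<xi>) \<partial>lborel))"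
      unfolding wt_def by (intro borel_integrable_atLeastAtMost' continuous_intros) auto
    thus "integrable lborel (\<lambda>t. \<integral>\<xi>. norm (case (t, \<xi>) of (t, \<xi>) \<Rightarrow> k t \<xi>) \<partial>lborel)"
      by (simp add: kn set_integrable_def)
  qed (use ki in auto)
  have g: "g = (\<lambda>\<xi>. \<integral>t. k t \<xi> \<partial>lborel)" unfolding g_def k_def set_lebesgue_integral_def ..
  show "integrable lborel g" unfolding g by (rule lborel_pair.integrable_snd[OF kint])
  have "(\<integral>\<xi>. g \<xi> \<partial>lborel) = (\<integral>t. (\<integral>\<xi>. k t \<xi> \<partial>lborel) \<partial>lborel)"
    unfolding g by (rule lborel_pair.Fubini_integral[OF kint])
  also have "\<dots> = (\<integral>t. complex_of_real (indicator {1..2} t *\<^sub>R (wt t / t ^ CARD('n))) * (\<integral>\<xi>. f \<xi> \<partial>lborel) \<partial>lborel)"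
    unfolding k_eq by (intro Bochner_Integration.integral_cong) (auto simp: scaleR_conv_of_real)
  also have "\<dots> = (\<integral>t. complex_of_real (indicator {1..2} t *\<^sub>R (wt t / t ^ CARD('n))) \<partial>lborel) * (\<integral>\<xi>. f \<xi> \<partial>lborel)"
    by (rule integral_mult_left_zero)
  also have "(\<integral>t. complex_of_real (indicator {1..2} t *\<^sub>R (wt t / t ^ CARD('n))) \<partial>lborel) = of_real (avg_const CARD('n))"
    unfolding avg_const_def set_lebesgue_integral_def by (rule integral_complex_of_real)
  finally show "(\<integral>\<xi>. g \<xi> \<partial>lborel) = of_real (avg_const CARD('n)) * (\<integral>\<xi>. f \<xi> \<partial>lborel)" .
qed

text \<open>Dilations by t at least 1 do not increase integrals of nonnegative functions, and the
  parameter interval has length 1; so the bound D survives the average unchanged.\<close>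

lemma dilation_average_nonneg:
  fixes E :: "real^'n::finite \<Rightarrow> real"
  assumes Ec: "continuous_on UNIV E" and E0: "\<And>\<xi>. 0 \<le> E \<xi>"
    and Ei: "(\<integral>\<^sup>+\<xi>. ennreal (E \<xi>) \<partial>lborel) \<le> ennreal D" and D: "D \<ge> 0"
  defines "p \<equiv> \<lambda>\<xi>. LINT t:{1..2}|lborel. E (t *\<^sub>R \<xi>)"
  shows "integrable lborel p" "(\<integral>\<xi>. p \<xi> \<partial>lborel) \<le> D" "\<And>\<xi>. 0 \<le> p \<xi>"
proof -
  have Em[measurable]: "E \<in> borel_measurable borel" using Ec by (rule borel_measurable_continuous_onI)
  show p0: "0 \<le> p \<xi>" for \<xi>
    unfolding p_def set_lebesgue_integral_def by (intro integral_nonneg_AE AE_I2) (auto simp: E0)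
  have pm[measurable]: "p \<in> borel_measurable borel"
    unfolding p_def set_lebesgue_integral_def by measurable
  have "(\<integral>\<^sup>+\<xi>. ennreal (p \<xi>) \<partial>lborel) = (\<integral>\<^sup>+\<xi>. (\<integral>\<^sup>+t. ennreal (indicator {1..2} t * E (t *\<^sub>R \<xi>)) \<partial>lborel) \<partial>lborel)"
  proof (intro nn_integral_cong)
    fix \<xi>
    have "continuous_on {1..2} (\<lambda>t. E (t *\<^sub>R \<xi>))"
      by (rule continuous_on_compose2[OF Ec]) (auto intro!: continuous_intros)
    hence "set_integrable lborel {1..2} (\<lambda>t. E (t *\<^sub>R \<xi>))" by (rule borel_integrable_atLeastAtMost')
    thus "ennreal (p \<xi>) = (\<integral>\<^sup>+t. ennreal (indicator {1..2} t * E (t *\<^sub>R \<xi>)) \<partial>lborel)"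
      unfolding p_def set_lebesgue_integral_def set_integrable_def
      by (subst nn_integral_eq_integral) (auto simp: E0)
  qed
  also have "\<dots> = (\<integral>\<^sup>+t. (\<integral>\<^sup>+\<xi>. ennreal (indicator {1..2} t * E (t *\<^sub>R \<xi>)) \<partial>lborel) \<partial>lborel)"
    by (rule lborel_pair.Fubini') measurable
  also have "\<dots> \<le> (\<integral>\<^sup>+t. indicator {1..2} t * ennreal D \<partial>(lborel::real measure))"
  proof (intro nn_integral_mono)
    fix t :: real
    show "(\<integral>\<^sup>+\<xi>. ennreal (indicator {1..2} t * E (t *\<^sub>R \<xi>)) \<partial>lborel) \<le> indicator {1..2} t * ennreal D"
    proof (cases "t \<in> {1..2}")
      case True
      have "(\<integral>\<^sup>+\<xi>. ennreal (E (t *\<^sub>R \<xi>)) \<partial>lborel) = ennreal (1 / t ^ DIM(real^'n)) * (\<integral>\<^sup>+\<xi>. ennreal (E \<xi>) \<partial>lborel)"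
        by (rule nn_integral_lborel_scaleR) (use True in auto)
      also have "\<dots> \<le> 1 * ennreal D"
      proof (intro mult_mono Ei)
        have "1 / t ^ DIM(real^'n) \<le> 1" using True one_le_power[of t "DIM(real^'n)"] by (auto simp: divide_le_eq_1)
        thus "ennreal (1 / t ^ DIM(real^'n)) \<le> 1" using ennreal_leI by fastforce
      qed auto
      finally show ?thesis using True by simp
    qed simp
  qed
  also have "\<dots> = ennreal D" by (simp add: nn_integral_multc)
  finally have le: "(\<integral>\<^sup>+\<xi>. ennreal (p \<xi>) \<partial>lborel) \<le> ennreal D" .
  show pi: "integrable lborel p"
    by (rule integrableI_nonneg) (use p0 le in \<open>auto intro: le_less_trans\<close>)
  have "ennreal (\<integral>\<xi>. p \<xi> \<partial>lborel) \<le> ennreal D" using le nn_integral_eq_integral[OF pi] p0 by simp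
  thus "(\<integral>\<xi>. p \<xi> \<partial>lborel) \<le> D" using D by (simp add: ennreal_le_iff)
qed

text \<open>The integral defining the form equals, up to the positive factor
  \<open>avg_const\<close>, the integral of its ray averages. The ray bound is a product of square
  roots of averaged energies, and Cauchy-Schwarz in \<xi> leaves their integrals. K is fixed before
  z, the radii and the functions.\<close>

lemma single_scale_bound:
  fixes M :: "'n::finite \<Rightarrow> complex^'k::finite^'k"
  assumes herm: "\<forall>j. hermitian_mat (M j)" and sp: "strongly_propagative M"
    and \<alpha>: "0 < \<alpha>" "\<alpha> \<le> 1/2" and m: "0 < m" "m \<le> X"
  obtains K where "K \<ge> 0" "\<And>z R S u v. \<lbrakk>m \<le> \<bar>Re z\<bar>; \<bar>Re z\<bar> \<le> X; Im z \<noteq> 0; \<bar>Im z\<bar> \<le> 3; l2 u; \<And>x. x \<notin> cball 0 R \<Longrightarrow> u x = 0; 1 \<le> R;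
      l2 v; \<And>x. x \<notin> cball 0 S \<Longrightarrow> v x = 0; 1 \<le> S\<rbrakk> \<Longrightarrow>
      cmod (ipr (sres M z (sres M z (fourier_int (-1) u))) (fourier_int (-1) v)) \<le>
        K * \<bar>Im z\<bar> powr (\<alpha> - 1) * (R powr (1/2 + \<alpha>) * nrm u) * (S powr (1/2 + \<alpha>) * nrm v)"
proof -
  obtain c where c: "c > 0" and gap: "\<And>\<xi> v l. v \<noteq> 0 \<Longrightarrow> symb M \<xi> *v v = of_real l *s v \<Longrightarrow> l \<noteq> 0 \<Longrightarrow> c * norm \<xi> \<le> \<bar>l\<bar>"
    using spectral_gap[OF herm sp] by blast
  define C where "C = 2 * X / c"
  have C0: "C \<ge> 0" using m c by (simp add: C_def)
  define a where "a = avg_const CARD('n)"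
  have a: "a > 0" unfolding a_def by (rule avg_const_pos)
  define D where "D = 1 + C\<^sup>2 * (real CARD('n))\<^sup>2"
  have D0: "D \<ge> 0" by (simp add: D_def)
  \<comment> \<open>The maximal number of eigenvectors, the constant of the ray bound, the constant
    of \<open>energy_integral\<close> (its square root once for u and once for v), and the division
    by the dilation factor.\<close>
  define K where "K = real DIM(complex^'k) * ray_const \<alpha> m * D / a"
  have K0: "K \<ge> 0" unfolding K_def using ray_const_nonneg[OF m(1), of \<alpha>] D0 a by simp
  show ?thesis
  proof (rule that[OF K0])
    fix z R S and u v :: "real^'n \<Rightarrow> complex^'k"
    assume z: "m \<le> \<bar>Re z\<bar>" "\<bar>Re z\<bar> \<le> X" "Im z \<noteq> 0" "\<bar>Im z\<bar> \<le> 3"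
      and u: "l2 u" "\<And>x. x \<notin> cball 0 R \<Longrightarrow> u x = 0" "1 \<le> R"
      and v: "l2 v" "\<And>x. x \<notin> cball 0 S \<Longrightarrow> v x = 0" "1 \<le> S"
    define f g where "f = fourier_int (-1) u" and "g = fourier_int (-1) v"
    have f: "l2 f" unfolding f_def by (rule fourier_int_plancherel(1)[OF l2_bounded_support_integrable[OF u(1,2)] u(1)]) auto
    have g: "l2 g" unfolding g_def by (rule fourier_int_plancherel(1)[OF l2_bounded_support_integrable[OF v(1,2)] v(1)]) auto
    define \<Phi> where "\<Phi> = (\<lambda>\<xi>. cip (sres M z (sres M z f) \<xi>) (g \<xi>))"
    have \<Phi>i: "integrable lborel \<Phi>" unfolding \<Phi>_def by (intro integrable_cip sres_l2 herm z f g)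
    define p q where "p = (\<lambda>\<xi>. LINT t:{1..2}|lborel. energy C R u (t *\<^sub>R \<xi>))"
      and "q = (\<lambda>\<xi>. LINT t:{1..2}|lborel. energy C S v (t *\<^sub>R \<xi>))"
    have Du: "0 \<le> D * (nrm u)\<^sup>2" "0 \<le> D * (nrm v)\<^sup>2" using D0 by auto
    have p: "integrable lborel p" "(\<integral>\<xi>. p \<xi> \<partial>lborel) \<le> D * (nrm u)\<^sup>2" "0 \<le> p \<xi>" for \<xi>
      unfolding p_def
      using dilation_average_nonneg[OF continuous_energy[OF u C0] energy_nonneg[OF u C0] energy_integral[OF u C0, folded D_def] Du(1)] by blast+
    have q: "integrable lborel q" "(\<integral>\<xi>. q \<xi> \<partial>lborel) \<le> D * (nrm v)\<^sup>2" "0 \<le> q \<xi>" for \<xi>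
      unfolding q_def
      using dilation_average_nonneg[OF continuous_energy[OF v C0] energy_nonneg[OF v C0] energy_integral[OF v C0, folded D_def] Du(2)] by blast+
    define L where "L = real DIM(complex^'k) * ray_const \<alpha> m * (R * S) powr (1/2 + \<alpha>) * \<bar>Im z\<bar> powr (\<alpha> - 1)"
    have L0: "L \<ge> 0" unfolding L_def using ray_const_nonneg[OF m(1), of \<alpha>] by simp
    note av = dilation_average[OF \<Phi>i]
    have pt: "cmod (LINT t:{1..2}|lborel. of_real (wt t) * \<Phi> (t *\<^sub>R \<xi>)) \<le> L * (sqrt (p \<xi>) * sqrt (q \<xi>))" for \<xi>
      unfolding \<Phi>_def f_def g_def L_def p_def q_def C_def
      by (rule frequency_ray_bound[OF herm c gap \<alpha> m(1) z u v])
    have pm[measurable]: "p \<in> borel_measurable borel" "q \<in> borel_measurable borel"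
      using p(1) q(1) by (auto dest: borel_measurable_integrable)
    have sq: "integrable lborel (\<lambda>\<xi>. (sqrt (p \<xi>))\<^sup>2)" "integrable lborel (\<lambda>\<xi>. (sqrt (q \<xi>))\<^sup>2)" using p q by auto
    have pqi: "integrable lborel (\<lambda>\<xi>. sqrt (p \<xi>) * sqrt (q \<xi>))" by (rule integrable_mult_L2[OF _ _ sq]) measurable
    have "a * cmod (ipr (sres M z (sres M z f)) g) = cmod (\<integral>\<xi>. (LINT t:{1..2}|lborel. of_real (wt t) * \<Phi> (t *\<^sub>R \<xi>)) \<partial>lborel)"
      unfolding av(2) using a by (simp add: norm_mult a_def ipr_def \<Phi>_def)
    also have "\<dots> \<le> (\<integral>\<xi>. cmod (LINT t:{1..2}|lborel. of_real (wt t) * \<Phi> (t *\<^sub>R \<xi>)) \<partial>lborel)" by (rule integral_norm_bound)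
    also have "\<dots> \<le> (\<integral>\<xi>. L * (sqrt (p \<xi>) * sqrt (q \<xi>)) \<partial>lborel)"
      by (intro integral_mono integrable_norm av(1) pt) (use pqi in simp)
    also have "\<dots> = L * (\<integral>\<xi>. sqrt (p \<xi>) * sqrt (q \<xi>) \<partial>lborel)" by simp
    also have "\<dots> \<le> L * (sqrt (\<integral>\<xi>. (sqrt (p \<xi>))\<^sup>2 \<partial>lborel) * sqrt (\<integral>\<xi>. (sqrt (q \<xi>))\<^sup>2 \<partial>lborel))"
      by (intro mult_left_mono L0 Cauchy_Schwarz_integral[OF _ _ sq]) measurable
    also have "\<dots> = L * (sqrt (\<integral>\<xi>. p \<xi> \<partial>lborel) * sqrt (\<integral>\<xi>. q \<xi> \<partial>lborel))" using p(3) q(3) by simp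
    also have "\<dots> \<le> L * (sqrt (D * (nrm u)\<^sup>2) * sqrt (D * (nrm v)\<^sup>2))"
      using L0 p q Du by (intro mult_left_mono mult_mono real_sqrt_le_mono) auto
    also have "\<dots> = L * D * nrm u * nrm v" using D0 by (simp add: real_sqrt_mult)
    finally have "cmod (ipr (sres M z (sres M z f)) g) \<le> (L * D * nrm u * nrm v) / a"
      using a by (simp add: field_simps)
    also have "\<dots> = K * \<bar>Im z\<bar> powr (\<alpha> - 1) * (R powr (1/2 + \<alpha>) * nrm u) * (S powr (1/2 + \<alpha>) * nrm v)"
      using u(3) v(3) by (simp add: K_def L_def powr_mult)
    finally show "cmod (ipr (sres M z (sres M z (fourier_int (-1) u))) (fourier_int (-1) v)) \<le>
        K * \<bar>Im z\<bar> powr (\<alpha> - 1) * (R powr (1/2 + \<alpha>) * nrm u) * (S powr (1/2 + \<alpha>) * nrm v)" unfolding f_def g_def .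
  qed
qed

subsection \<open>Summation over dyadic scales\<close>

text \<open>The index 0 takes the full closed unit ball, so the shells up to j add up exactly to the
  truncation at radius 2^j.\<close>

definition shell :: "nat \<Rightarrow> (real^'n::finite \<Rightarrow> complex^'k::finite) \<Rightarrow> (real^'n \<Rightarrow> complex^'k)" where
  "shell j u x = indicator (if j = 0 then cball 0 1 else cball 0 (2 ^ j) - cball 0 (2 ^ (j - 1))) x *\<^sub>R u x"

lemma shell_supp: "x \<notin> cball 0 (2 ^ j) \<Longrightarrow> shell j u x = 0"
  by (auto simp: shell_def indicator_def)

lemma shell_l2: "l2 u \<Longrightarrow> l2 (shell j u)"
  unfolding shell_def by (rule l2_indicator) auto

lemma trunc_shell_0: "trunc (2 ^ 0) u = shell 0 u"
  by (auto simp: trunc_def shell_def)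

lemma trunc_shell_Suc:
  fixes u :: "real^'n::finite \<Rightarrow> complex^'k::finite"
  shows "trunc (2 ^ Suc j) u = (\<lambda>x. trunc (2 ^ j) u x + shell (Suc j) u x)"
proof
  fix x :: "real^'n"
  have le: "norm x \<le> 2 ^ j \<Longrightarrow> norm x \<le> 2 * 2 ^ j"
    by (erule order_trans) simp
  show "trunc (2 ^ Suc j) u x = trunc (2 ^ j) u x + shell (Suc j) u x"
    using le by (cases "norm x \<le> 2 ^ j"; cases "norm x \<le> 2 * 2 ^ j") (auto simp: trunc_def shell_def indicator_def)
qed

text \<open>On the shell j > 0 the weight is at least the s-th power of the inner radius 2^(j - 1);
  the shift by one is the surplus factor 2^s, which also makes the estimate valid on the unit
  ball.\<close>

lemma nrm_shell:
  fixes u :: "real^'n::finite \<Rightarrow> complex^'k::finite"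
  assumes u: "l2 (jap s u)" and s: "s > 0"
  shows "nrm (shell j u) \<le> 2 powr (s - s * real j) * nrm (jap s u)"
proof -
  have l: "l2 u" using jap_mono(1)[OF u, of 0] s by (simp add: jap_zero)
  have "norm (shell j u x) \<le> 2 powr (s - s * real j) * norm (jap s u x)" for x
  proof (cases "shell j u x = 0")
    case False
    have eq: "shell j u x = u x" using False by (auto simp: shell_def indicator_def split: if_splits)
    have "1 \<le> 2 powr (s - s * real j) * (1 + (norm x)\<^sup>2) powr (s / 2)"
    proof (cases j)
      case 0
      have "1 \<le> (2::real) powr s" "1 \<le> (1 + (norm x)\<^sup>2) powr (s/2)" using s by (auto intro: ge_one_powr_ge_zero)
      thus ?thesis using 0 mult_mono[of 1 "2 powr s" 1 "(1 + (norm x)\<^sup>2) powr (s/2)"] by simp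
    next
      case (Suc i)
      have "2 ^ i \<le> norm x" using False Suc by (auto simp: shell_def indicator_def split: if_splits)
      hence "(2 ^ i)\<^sup>2 \<le> (norm x)\<^sup>2" by (intro power_mono) auto
      hence "(2 ^ i)\<^sup>2 \<le> 1 + (norm x)\<^sup>2" by linarith
      hence "((2 ^ i)\<^sup>2) powr (s/2) \<le> (1 + (norm x)\<^sup>2) powr (s/2)" using s by (intro powr_mono2) auto
      moreover have "((2 ^ i)\<^sup>2 :: real) powr (s/2) = 2 powr (s * real i)"
      proof -
        have "((2 ^ i)\<^sup>2 :: real) = 2 powr (real (2 * i))"
          by (subst powr_realpow) (auto simp: power_mult[symmetric] mult.commute)
        thus ?thesis by (simp add: powr_powr mult.commute)
      qed
      ultimately have "2 powr (s - s * real j) * 2 powr (s * real i) \<le> 2 powr (s - s * real j) * (1 + (norm x)\<^sup>2) powr (s/2)"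
        by (intro mult_left_mono) auto
      moreover have "2 powr (s - s * real j) * 2 powr (s * real i) = (1::real)"
        using Suc by (simp add: powr_add[symmetric] algebra_simps)
      ultimately show ?thesis by simp
    qed
    hence "1 * norm (u x) \<le> 2 powr (s - s * real j) * (1 + (norm x)\<^sup>2) powr (s / 2) * norm (u x)"
      by (intro mult_right_mono) auto
    thus ?thesis by (simp add: eq jap_def mult.assoc)
  qed simp
  from l2_dominated(2)[OF u l2_measurable[OF shell_l2[OF l]] _ this] show ?thesis by simp
qed

text \<open>The loss 2^(j b) on a shell against the gain 2^(-j s) leaves a geometric series of ratio
  2^(b - s). This is the point at which s has to exceed b = 1/2 + \<alpha>.\<close>

lemma dyadic_sum_bound:
  fixes u :: "real^'n::finite \<Rightarrow> complex^'k::finite"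
  assumes u: "l2 (jap s u)" and s: "0 < b" "b < s"
  shows "(\<Sum>j\<le>m. (2 ^ j) powr b * nrm (shell j u)) \<le> (2 powr s / (1 - 2 powr (b - s))) * nrm (jap s u)"
proof -
  define q where "q = (2::real) powr (b - s)"
  have q: "0 < q" "q < 1" using s powr_less_mono[of "b - s" 0 2] by (auto simp: q_def)
  have "(2 ^ j) powr b * nrm (shell j u) \<le> (2 powr s * nrm (jap s u)) * q ^ j" for j
  proof -
    have e0: "(2 ^ j :: real) powr b = 2 powr (b * real j)"
      by (simp add: powr_realpow[symmetric] powr_powr mult.commute)
    have "2 powr (b * real j) * nrm (shell j u) \<le> 2 powr (b * real j) * (2 powr (s - s * real j) * nrm (jap s u))"
      using s by (intro mult_left_mono nrm_shell[OF u]) auto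
    also have "2 powr (b * real j) * (2 powr (s - s * real j) * nrm (jap s u)) = 2 powr s * 2 powr ((b - s) * real j) * nrm (jap s u)"
    proof -
      have e: "b * real j + (s - s * real j) = s + (b - s) * real j" by (simp add: algebra_simps)
      show ?thesis by (simp only: mult.assoc[symmetric] powr_add[symmetric] e)
    qed
    also have "2 powr ((b - s) * real j) = q ^ j" using q by (simp add: q_def powr_powr[symmetric] powr_realpow)
    finally show ?thesis unfolding e0 by (simp add: mult_ac)
  qed
  hence "(\<Sum>j\<le>m. (2 ^ j) powr b * nrm (shell j u)) \<le> (\<Sum>j\<le>m. (2 powr s * nrm (jap s u)) * q ^ j)" by (rule sum_mono)
  also have "\<dots> = (2 powr s * nrm (jap s u)) * (\<Sum>j\<le>m. q ^ j)" by (simp add: sum_distrib_left)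
  also have "\<dots> \<le> (2 powr s * nrm (jap s u)) * (1 / (1 - q))"
  proof (rule mult_left_mono)
    have "(\<Sum>j\<le>m. q ^ j) \<le> (\<Sum>j. q ^ j)" using q by (intro sum_le_suminf) auto
    also have "(\<Sum>j. q ^ j) = 1 / (1 - q)" using q by (intro suminf_geometric) auto
    finally show "(\<Sum>j\<le>m. q ^ j) \<le> 1 / (1 - q)" .
  qed simp
  finally show ?thesis by (simp add: q_def)
qed

lemma ipr_add_left: "l2 u \<Longrightarrow> l2 v \<Longrightarrow> l2 w \<Longrightarrow> ipr (\<lambda>x. u x + v x) w = ipr u w + ipr v w"
  unfolding ipr_def cip_add_left by (intro Bochner_Integration.integral_add integrable_cip)

lemma ipr_add_right: "l2 u \<Longrightarrow> l2 v \<Longrightarrow> l2 w \<Longrightarrow> ipr w (\<lambda>x. u x + v x) = ipr w u + ipr w v"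
  unfolding ipr_def cip_add_right by (intro Bochner_Integration.integral_add integrable_cip)

lemma fourier_int_add:
  fixes u v :: "real^'n::finite \<Rightarrow> complex^'k::finite"
  assumes u: "integrable lborel u" and v: "integrable lborel v"
  shows "fourier_int \<sigma> (\<lambda>x. u x + v x) = (\<lambda>\<xi>. fourier_int \<sigma> u \<xi> + fourier_int \<sigma> v \<xi>)"
  using fourier_int_linear[OF assms, of \<sigma> 1 1] by auto

lemma sres_add: "sres M z (\<lambda>x. f x + g x) = (\<lambda>x. sres M z f x + sres M z g x)"
  by (auto simp: sres_def matrix_vector_right_distrib)

text \<open>The single-scale bound is a product of a factor for u and one for v, so the double sum
  over pairs of shells factorises into two convergent sums. Finite sums represent truncations, and
  the limit removes them.\<close>

lemma weighted_square_bound: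
  fixes M :: "'n::finite \<Rightarrow> complex^'k::finite^'k"
  assumes herm: "\<forall>j. hermitian_mat (M j)" and sp: "strongly_propagative M"
    and \<alpha>: "0 < \<alpha>" "\<alpha> \<le> 1/2" "1/2 + \<alpha> < s" and m: "0 < m" "m \<le> X"
  obtains K where "K \<ge> 0" "\<And>z u v. \<lbrakk>m \<le> \<bar>Re z\<bar>; \<bar>Re z\<bar> \<le> X; Im z \<noteq> 0; \<bar>Im z\<bar> \<le> 3; l2 (jap s u); l2 (jap s v)\<rbrakk> \<Longrightarrow>
      cmod (ipr (sres M z (sres M z (fourier_L2 (-1) u))) (fourier_L2 (-1) v)) \<le>
        K * \<bar>Im z\<bar> powr (\<alpha> - 1) * nrm (jap s u) * nrm (jap s v)"
proof -
  obtain K where K: "K \<ge> 0" and ss: "\<And>z R S u v. \<lbrakk>m \<le> \<bar>Re z\<bar>; \<bar>Re z\<bar> \<le> X; Im z \<noteq> 0; \<bar>Im z\<bar> \<le> 3; l2 u; \<And>x. x \<notin> cball 0 R \<Longrightarrow> u x = 0; 1 \<le> R;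
      l2 v; \<And>x. x \<notin> cball 0 S \<Longrightarrow> v x = 0; 1 \<le> S\<rbrakk> \<Longrightarrow>
      cmod (ipr (sres M z (sres M z (fourier_int (-1) u))) (fourier_int (-1) v)) \<le>
        K * \<bar>Im z\<bar> powr (\<alpha> - 1) * (R powr (1/2 + \<alpha>) * nrm u) * (S powr (1/2 + \<alpha>) * nrm v)"
    using single_scale_bound[OF herm sp \<alpha>(1,2) m] by blast
  define b where "b = 1/2 + \<alpha>"
  have b: "0 < b" "b < s" using \<alpha> by (auto simp: b_def)
  define D where "D = 2 powr s / (1 - 2 powr (b - s))"
  have D0: "D \<ge> 0" using b powr_less_mono[of "b - s" 0 2] by (simp add: D_def)
  show ?thesis
  proof (rule that[of "K * D * D"])
    show "0 \<le> K * D * D" using K D0 by simp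
    fix z and u v :: "real^'n \<Rightarrow> complex^'k"
    assume z: "m \<le> \<bar>Re z\<bar>" "\<bar>Re z\<bar> \<le> X" "Im z \<noteq> 0" "\<bar>Im z\<bar> \<le> 3" and ju: "l2 (jap s u)" and jv: "l2 (jap s v)"
    have u: "l2 u" and v: "l2 v" using jap_mono(1)[OF ju, of 0] jap_mono(1)[OF jv, of 0] b by (auto simp: jap_zero)
    define T where "T = (\<lambda>w. sres M z (sres M z w))"
    define F where "F = (fourier_int (-1) :: (real^'n \<Rightarrow> complex^'k) \<Rightarrow> _)"
    define Y where "Y = \<bar>Im z\<bar> powr (\<alpha> - 1)"
    have Y0: "Y \<ge> 0" by (simp add: Y_def)
    have Tl: "l2 (T w)" if "l2 w" for w unfolding T_def by (intro sres_l2 herm z that)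
    have Fl: "l2 (F w)" if "l2 w" "integrable lborel w" for w unfolding F_def by (rule fourier_int_plancherel) (use that in auto)
    have ri: "integrable lborel (shell j w)" if "l2 w" for j w
      by (rule l2_bounded_support_integrable[OF shell_l2[OF that] shell_supp])
    have base: "cmod (ipr (T (F (shell j u))) (F (shell k v))) \<le> K * Y * ((2^j) powr b * nrm (shell j u)) * ((2^k) powr b * nrm (shell k v))" for j k
      unfolding T_def F_def Y_def b_def
      by (rule ss[OF z shell_l2[OF u] shell_supp _ shell_l2[OF v] shell_supp]) auto
    \<comment> \<open>One argument at a time: the shells of u are added with a fixed shell of v, and
      the next step then adds the shells of v.\<close>
    have step1: "cmod (ipr (T (F (trunc (2^i) u))) (F (shell k v))) \<le> (\<Sum>j\<le>i. K * Y * ((2^j) powr b * nrm (shell j u)) * ((2^k) powr b * nrm (shell k v)))" for i k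
    proof (induction i)
      case 0
      show ?case using base[of 0 k] unfolding trunc_shell_0 by simp
    next
      case (Suc i)
      have l: "l2 (T (F (trunc (2^i) u)))" "l2 (T (F (shell (Suc i) u)))" "l2 (F (shell k v))"
        by (intro Tl Fl trunc_l2 trunc_integrable shell_l2 ri u v)+
      have "ipr (T (F (trunc (2^Suc i) u))) (F (shell k v)) = ipr (T (F (trunc (2^i) u))) (F (shell k v)) + ipr (T (F (shell (Suc i) u))) (F (shell k v))"
        unfolding trunc_shell_Suc ipr_add_left[OF l, symmetric]
        unfolding F_def T_def fourier_int_add[OF trunc_integrable[OF u] ri[OF u]] sres_add ..
      thus ?case using Suc.IH base[of "Suc i" k] norm_triangle_ineq[of "ipr (T (F (trunc (2^i) u))) (F (shell k v))" "ipr (T (F (shell (Suc i) u))) (F (shell k v))"]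
        by simp
    qed
    have step2: "cmod (ipr (T (F (trunc (2^i) u))) (F (trunc (2^i') v))) \<le> (\<Sum>k\<le>i'. \<Sum>j\<le>i. K * Y * ((2^j) powr b * nrm (shell j u)) * ((2^k) powr b * nrm (shell k v)))" for i i'
    proof (induction i')
      case 0
      show ?case using step1[of i 0] unfolding trunc_shell_0 by simp
    next
      case (Suc i')
      have l: "l2 (F (trunc (2^i') v))" "l2 (F (shell (Suc i') v))" "l2 (T (F (trunc (2^i) u)))"
        by (intro Tl Fl trunc_l2 trunc_integrable shell_l2 ri u v)+
      have "ipr (T (F (trunc (2^i) u))) (F (trunc (2^Suc i') v)) = ipr (T (F (trunc (2^i) u))) (F (trunc (2^i') v)) + ipr (T (F (trunc (2^i) u))) (F (shell (Suc i') v))"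
        unfolding trunc_shell_Suc ipr_add_right[OF l, symmetric]
        unfolding F_def fourier_int_add[OF trunc_integrable[OF v] ri[OF v]] ..
      thus ?case using Suc.IH step1[of i "Suc i'"] norm_triangle_ineq[of "ipr (T (F (trunc (2^i) u))) (F (trunc (2^i') v))" "ipr (T (F (trunc (2^i) u))) (F (shell (Suc i') v))"]
        by simp
    qed
    have fin: "cmod (ipr (T (F (trunc (2^i) u))) (F (trunc (2^i) v))) \<le> K * D * D * Y * nrm (jap s u) * nrm (jap s v)" for i
    proof -
      have "(\<Sum>k\<le>i. \<Sum>j\<le>i. K * Y * ((2^j) powr b * nrm (shell j u)) * ((2^k) powr b * nrm (shell k v))) =
         K * Y * ((\<Sum>j\<le>i. (2^j) powr b * nrm (shell j u)) * (\<Sum>k\<le>i. (2^k) powr b * nrm (shell k v)))"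
        by (simp add: sum_product sum_distrib_left mult_ac)
      also have "\<dots> \<le> K * Y * ((D * nrm (jap s u)) * (D * nrm (jap s v)))"
      proof (intro mult_left_mono mult_mono)
        show "(\<Sum>j\<le>i. (2^j) powr b * nrm (shell j u)) \<le> D * nrm (jap s u)"
          unfolding D_def by (rule dyadic_sum_bound[OF ju b])
        show "(\<Sum>k\<le>i. (2^k) powr b * nrm (shell k v)) \<le> D * nrm (jap s v)"
          unfolding D_def by (rule dyadic_sum_bound[OF jv b])
      qed (use K Y0 D0 in \<open>auto intro!: sum_nonneg\<close>)
      finally show ?thesis using step2[of i i] by (simp add: mult_ac)
    qed
    have two: "filterlim (\<lambda>i. (2::real) ^ i) at_top sequentially"
      by (rule filterlim_at_top_mono[OF filterlim_real_sequentially]) (auto intro!: always_eventually simp: less_imp_le of_nat_less_two_power)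
    note Fu = fourier_L2_spec[OF u, of "-1", simplified] and Fv = fourier_L2_spec[OF v, of "-1", simplified]
    have lu: "(\<lambda>i. nrm (\<lambda>x. fourier_L2 (-1) u x - F (trunc (2^i) u) x)) \<longlonglongrightarrow> 0"
      unfolding F_def by (rule filterlim_compose[OF Fu(2) two])
    have lv: "(\<lambda>i. nrm (\<lambda>x. fourier_L2 (-1) v x - F (trunc (2^i) v) x)) \<longlonglongrightarrow> 0"
      unfolding F_def by (rule filterlim_compose[OF Fv(2) two])
    \<comment> \<open>For fixed z the squared resolvent is bounded, with a norm that blows up at the
      real axis. This norm serves only for convergence and leaves no trace in the final
      constant.\<close>
    have lT: "(\<lambda>i. nrm (\<lambda>x. T (fourier_L2 (-1) u) x - T (F (trunc (2^i) u)) x)) \<longlonglongrightarrow> 0"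
    proof (rule tendsto_sandwich[OF _ _ tendsto_const])
      have "(\<lambda>i. (1 / \<bar>Im z\<bar>) * ((1 / \<bar>Im z\<bar>) * nrm (\<lambda>x. fourier_L2 (-1) u x - F (trunc (2^i) u) x))) \<longlonglongrightarrow> (1 / \<bar>Im z\<bar>) * ((1 / \<bar>Im z\<bar>) * 0)"
        by (intro tendsto_mult tendsto_const lu)
      thus "(\<lambda>i. (1 / \<bar>Im z\<bar>) * ((1 / \<bar>Im z\<bar>) * nrm (\<lambda>x. fourier_L2 (-1) u x - F (trunc (2^i) u) x))) \<longlonglongrightarrow> 0" by simp
      have "nrm (\<lambda>x. T (fourier_L2 (-1) u) x - T (F (trunc (2^i) u)) x) \<le> (1 / \<bar>Im z\<bar>) * ((1 / \<bar>Im z\<bar>) * nrm (\<lambda>x. fourier_L2 (-1) u x - F (trunc (2^i) u) x))" for i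
      proof -
        let ?d = "\<lambda>x. fourier_L2 (-1) u x - F (trunc (2^i) u) x"
        have dl: "l2 ?d" by (intro l2_diff Fu Fl trunc_l2 trunc_integrable u)
        have "nrm (sres M z (sres M z ?d)) \<le> (1 / \<bar>Im z\<bar>) * nrm (sres M z ?d)" by (intro sres_l2 herm z dl)
        also have "\<dots> \<le> (1 / \<bar>Im z\<bar>) * ((1 / \<bar>Im z\<bar>) * nrm ?d)" by (intro mult_left_mono sres_l2 herm z dl) auto
        finally show ?thesis unfolding T_def sres_diff .
      qed
      thus "\<forall>\<^sub>F i in sequentially. nrm (\<lambda>x. T (fourier_L2 (-1) u) x - T (F (trunc (2^i) u)) x) \<le>
        (1 / \<bar>Im z\<bar>) * ((1 / \<bar>Im z\<bar>) * nrm (\<lambda>x. fourier_L2 (-1) u x - F (trunc (2^i) u) x))" by simp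
    qed simp
    have "(\<lambda>i. ipr (T (F (trunc (2^i) u))) (F (trunc (2^i) v))) \<longlonglongrightarrow> ipr (T (fourier_L2 (-1) u)) (fourier_L2 (-1) v)"
      by (intro ipr_tendsto Tl Fl trunc_l2 trunc_integrable u v Fu Fv lT lv)
    hence "cmod (ipr (T (fourier_L2 (-1) u)) (fourier_L2 (-1) v)) \<le> K * D * D * Y * nrm (jap s u) * nrm (jap s v)"
      by (intro tendsto_upperbound[OF tendsto_norm]) (use fin in auto)
    thus "cmod (ipr (sres M z (sres M z (fourier_L2 (-1) u))) (fourier_L2 (-1) v)) \<le>
        K * D * D * \<bar>Im z\<bar> powr (\<alpha> - 1) * nrm (jap s u) * nrm (jap s v)" by (simp add: T_def Y_def)
  qed
qed

subsection \<open>Boundary values of the resolvent\<close>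

lemma powr_diff_le:
  fixes a d \<alpha> :: real
  assumes "0 < a" "0 \<le> d" "0 < \<alpha>" "\<alpha> \<le> 1"
  shows "(a + d) powr \<alpha> - a powr \<alpha> \<le> d powr \<alpha>"
proof -
  have p: "a + d > 0" using assms by simp
  have "1 = a / (a + d) + d / (a + d)" using p by (simp add: add_divide_distrib[symmetric])
  also have "\<dots> \<le> (a / (a + d)) powr \<alpha> + (d / (a + d)) powr \<alpha>"
    using assms p by (intro add_mono le_powr_self) auto
  also have "\<dots> = (a powr \<alpha> + d powr \<alpha>) / (a + d) powr \<alpha>"
    using assms p by (simp add: powr_divide add_divide_distrib)
  finally have "(a + d) powr \<alpha> \<le> a powr \<alpha> + d powr \<alpha>" using p by (simp add: field_simps)
  thus ?thesis by simp
qed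

text \<open>With d the distance of the two points, go up from each by d and across at that height.
  On a vertical leg the singular bound integrates to at most K / \<alpha> times d^\<alpha>; across,
  the derivative is at most K d^(\<alpha> - 1) over length d. Two vertical legs and one horizontal
  give 2 / \<alpha> + 1.\<close>

lemma hardy_littlewood:
  fixes B B' :: "complex \<Rightarrow> complex"
  assumes \<alpha>: "0 < \<alpha>" "\<alpha> \<le> 1/2" and K: "K \<ge> 0" and w: "hi - lo \<le> 1"
    and der: "\<And>z. \<lbrakk>lo \<le> Re z; Re z \<le> hi; 0 < Im z; Im z \<le> 3\<rbrakk> \<Longrightarrow> (B has_field_derivative B' z) (at z)"
    and bd: "\<And>z. \<lbrakk>lo \<le> Re z; Re z \<le> hi; 0 < Im z; Im z \<le> 3\<rbrakk> \<Longrightarrow> cmod (B' z) \<le> K * Im z powr (\<alpha> - 1)"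
    and z1: "lo \<le> Re z1" "Re z1 \<le> hi" "0 < Im z1" "Im z1 \<le> 1"
    and z2: "lo \<le> Re z2" "Re z2 \<le> hi" "0 < Im z2" "Im z2 \<le> 1"
  shows "cmod (B z1 - B z2) \<le> K * (2 / \<alpha> + 1) * cmod (z1 - z2) powr \<alpha>"
proof (cases "z1 = z2")
  case False
  define d where "d = cmod (z1 - z2)"
  have d0: "d > 0" using False by (simp add: d_def)
  \<comment> \<open>Real parts differ by at most the width 1 and imaginary parts by at most 1; hence
    the detour stays below height 3, where the derivative is controlled.\<close>
  have d2: "d \<le> 2"
  proof -
    have "d \<le> \<bar>Re (z1 - z2)\<bar> + \<bar>Im (z1 - z2)\<bar>" unfolding d_def by (rule cmod_le)
    also have "\<dots> \<le> 1 + 1" using z1 z2 w by (intro add_mono) auto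
    finally show ?thesis by simp
  qed
  have vert: "cmod (B (z + \<i> * of_real d) - B z) \<le> K / \<alpha> * d powr \<alpha>"
    if z: "lo \<le> Re z" "Re z \<le> hi" "0 < Im z" "Im z \<le> 1" for z
  proof -
    define p where "p = (\<lambda>t. z + \<i> * complex_of_real t)"
    define \<phi> where "\<phi> = (\<lambda>t. K / \<alpha> * (Im z + t) powr \<alpha>)"
    have fd: "((B \<circ> p) has_vector_derivative \<i> * B' (p t)) (at t)" if t: "0 \<le> t" "t \<le> d" for t
    proof (rule field_vector_diff_chain_at)
      show "(p has_vector_derivative \<i>) (at t)" unfolding p_def
        by (auto intro!: derivative_eq_intros)
      show "(B has_field_derivative B' (p t)) (at (p t))"
        by (rule der) (use z t d2 in \<open>auto simp: p_def\<close>)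
    qed
    have pd: "(\<phi> has_vector_derivative K * (Im z + t) powr (\<alpha> - 1)) (at t)" if t: "0 \<le> t" for t
    proof -
      have "(\<phi> has_real_derivative K / \<alpha> * (\<alpha> * (Im z + t) powr (\<alpha> - 1))) (at t)"
        unfolding \<phi>_def using z t by (auto intro!: derivative_eq_intros)
      thus ?thesis using \<alpha> by (simp add: has_real_derivative_iff_has_vector_derivative)
    qed
    have "norm ((B \<circ> p) d - (B \<circ> p) 0) \<le> \<phi> d - \<phi> 0"
    proof (rule differentiable_bound_general[OF d0])
      show "continuous_on {0..d} (B \<circ> p)"
        using fd by (intro continuous_at_imp_continuous_on ballI has_vector_derivative_continuous) auto
      show "continuous_on {0..d} \<phi>"
        using pd by (intro continuous_at_imp_continuous_on ballI has_vector_derivative_continuous) auto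
      fix t assume t: "0 < t" "t < d"
      show "((B \<circ> p) has_vector_derivative \<i> * B' (p t)) (at t)" using fd t by simp
      show "(\<phi> has_vector_derivative K * (Im z + t) powr (\<alpha> - 1)) (at t)" using pd t by simp
      have "cmod (B' (p t)) \<le> K * Im (p t) powr (\<alpha> - 1)"
        by (rule bd) (use z t d2 in \<open>auto simp: p_def\<close>)
      thus "norm (\<i> * B' (p t)) \<le> K * (Im z + t) powr (\<alpha> - 1)" by (simp add: norm_mult p_def)
    qed
    also have "\<dots> = K / \<alpha> * ((Im z + d) powr \<alpha> - Im z powr \<alpha>)" by (simp add: \<phi>_def right_diff_distrib)
    also have "\<dots> \<le> K / \<alpha> * d powr \<alpha>" using K \<alpha> z d0 by (intro mult_left_mono powr_diff_le) auto
    finally show ?thesis by (simp add: p_def)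
  qed
  have hor: "cmod (B (z1 + \<i> * of_real d) - B (z2 + \<i> * of_real d)) \<le> K * d powr \<alpha>"
  proof -
    \<comment> \<open>The part of the box above height d is convex and contains both raised points,
      so the mean value inequality applies with the derivative bound at height d.\<close>
    define S where "S = {z. lo \<le> Re z} \<inter> {z. Re z \<le> hi} \<inter> {z. d \<le> Im z} \<inter> {z. Im z \<le> 3}"
    have "convex S" unfolding S_def
      using convex_halfspace_Re_ge convex_halfspace_Re_le convex_halfspace_Im_ge convex_halfspace_Im_le
      by (intro convex_Int) auto
    moreover have "(B has_field_derivative B' z) (at z within S)" if "z \<in> S" for z
      by (rule has_field_derivative_at_within, rule der) (use that d0 in \<open>auto simp: S_def\<close>)
    moreover have "cmod (B' z) \<le> K * d powr (\<alpha> - 1)" if z: "z \<in> S" for z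
    proof -
      have "cmod (B' z) \<le> K * Im z powr (\<alpha> - 1)" by (rule bd) (use z d0 in \<open>auto simp: S_def\<close>)
      also have "\<dots> \<le> K * d powr (\<alpha> - 1)" using z d0 K \<alpha> by (intro mult_left_mono powr_mono2') (auto simp: S_def)
      finally show ?thesis .
    qed
    moreover have "z1 + \<i> * of_real d \<in> S" "z2 + \<i> * of_real d \<in> S" using z1 z2 d0 d2 by (auto simp: S_def)
    ultimately have "cmod (B (z1 + \<i> * of_real d) - B (z2 + \<i> * of_real d)) \<le> K * d powr (\<alpha> - 1) * cmod ((z1 + \<i> * of_real d) - (z2 + \<i> * of_real d))"
      by (rule field_differentiable_bound)
    also have "\<dots> = K * (d powr (\<alpha> - 1) * d)" by (simp add: d_def)
    also have "d powr (\<alpha> - 1) * d = d powr \<alpha>" using d0 powr_add[of d "\<alpha> - 1" 1] by simp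
    finally show ?thesis .
  qed
  have "cmod (B z1 - B z2) \<le> cmod (B (z1 + \<i> * of_real d) - B z1) + cmod (B (z1 + \<i> * of_real d) - B (z2 + \<i> * of_real d)) + cmod (B (z2 + \<i> * of_real d) - B z2)"
    by norm
  also have "\<dots> \<le> K / \<alpha> * d powr \<alpha> + K * d powr \<alpha> + K / \<alpha> * d powr \<alpha>"
    by (intro add_mono vert hor z1 z2)
  also have "\<dots> = K * (2 / \<alpha> + 1) * d powr \<alpha>" by (simp add: algebra_simps)
  finally show ?thesis by (simp add: d_def)
qed simp

section \<open>The resolvent form and its derivative\<close>

lemma sres_identity:
  assumes herm: "\<forall>j. hermitian_mat (M j)" and z: "Im z \<noteq> 0" "Im w \<noteq> 0"
  shows "sres M w f x - sres M z f x = (w - z) *s sres M w (sres M z f) x"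
  unfolding sres_def by (rule hermitian_resolvent_identity[OF hermitian_symb[OF herm] z(2) z(1)])

lemma sres_scale: "sres M z (\<lambda>x. c *s f x) = (\<lambda>x. c *s sres M z f x)"
  by (auto simp: sres_def vector_scalar_commute)

text \<open>The resolvent identity used once computes the difference quotient as a mixed product of
  the resolvents at w and z; used again, it shows this product to differ from the square by O(|w -
  z|), as |Im w| is at least half of |Im z| near z.\<close>

lemma sres_form_derivative:
  assumes herm: "\<forall>j. hermitian_mat (M j)" and z: "Im z \<noteq> 0" and f: "l2 f" and g: "l2 g"
  shows "((\<lambda>z. ipr (sres M z f) g) has_field_derivative ipr (sres M z (sres M z f)) g) (at z)"
  unfolding has_field_derivative_iff
proof (rule Lim_null[THEN iffD2], rule Lim_null_comparison)
  define y where "y = \<bar>Im z\<bar>"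
  have y: "y > 0" using z by (simp add: y_def)
  define K where "K = (2 / y) * ((1 / y) * ((1 / y) * nrm f)) * nrm g"
  have "cmod ((ipr (sres M w f) g - ipr (sres M z f) g) / (w - z) - ipr (sres M z (sres M z f)) g) \<le> K * cmod (w - z)"
    if w: "w \<noteq> z" "dist w z < y / 2" for w
  proof -
    have "\<bar>Im w - Im z\<bar> < y / 2" using w(2) abs_Im_le_cmod[of "w - z"] by (simp add: dist_norm)
    hence iw: "\<bar>Im w\<bar> \<ge> y / 2" using abs_triangle_ineq2_sym[of "Im z" "Im w"] unfolding y_def by linarith
    hence iw: "\<bar>Im w\<bar> \<ge> y / 2" "Im w \<noteq> 0" using y by auto
    define h where "h = sres M z f"
    have h: "l2 h" unfolding h_def by (rule sres_l2[OF herm z f])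
    have l: "l2 (sres M w f)" "l2 (sres M z f)" "l2 (sres M w h)" "l2 (sres M z h)" "l2 (sres M w (sres M z h))"
      by (intro sres_l2 herm z iw f h)+
    have "ipr (sres M w f) g - ipr (sres M z f) g = ipr (\<lambda>x. (w - z) *s sres M w h x) g"
      unfolding ipr_diff_left[OF l(1,2) g, symmetric] h_def sres_identity[OF herm z iw(2)] ..
    also have "\<dots> = (w - z) * ipr (sres M w h) g" by (rule ipr_scale_left)
    finally have e1: "(ipr (sres M w f) g - ipr (sres M z f) g) / (w - z) = ipr (sres M w h) g" using w by simp
    have "ipr (sres M w h) g - ipr (sres M z h) g = ipr (\<lambda>x. (w - z) *s sres M w (sres M z h) x) g"
      unfolding ipr_diff_left[OF l(3,4) g, symmetric] sres_identity[OF herm z iw(2)] ..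
    also have "\<dots> = (w - z) * ipr (sres M w (sres M z h)) g" by (rule ipr_scale_left)
    finally have "cmod ((ipr (sres M w f) g - ipr (sres M z f) g) / (w - z) - ipr (sres M z h) g) = cmod (w - z) * cmod (ipr (sres M w (sres M z h)) g)"
      unfolding e1 by (simp add: norm_mult)
    also have "cmod (ipr (sres M w (sres M z h)) g) \<le> nrm (sres M w (sres M z h)) * nrm g" by (rule norm_ipr_le[OF l(5) g])
    also have "nrm (sres M w (sres M z h)) \<le> (2 / y) * ((1 / y) * ((1 / y) * nrm f))"
    proof -
      have "nrm (sres M w (sres M z h)) \<le> (1 / \<bar>Im w\<bar>) * nrm (sres M z h)" by (rule sres_l2[OF herm iw(2) l(4)])
      also have "\<dots> \<le> (2 / y) * nrm (sres M z h)"
      proof (rule mult_right_mono)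
        have "1 / \<bar>Im w\<bar> \<le> 1 / (y / 2)" using iw y by (intro divide_left_mono) auto
        thus "1 / \<bar>Im w\<bar> \<le> 2 / y" by simp
      qed simp
      also have "\<dots> \<le> (2 / y) * ((1 / y) * nrm h)" using y sres_l2(2)[OF herm z h] by (intro mult_left_mono) (auto simp: y_def)
      also have "\<dots> \<le> (2 / y) * ((1 / y) * ((1 / y) * nrm f))"
        using y sres_l2(2)[OF herm z f] by (intro mult_left_mono) (auto simp: y_def h_def)
      finally show ?thesis .
    qed
    finally show ?thesis unfolding h_def K_def by (simp add: mult_ac mult_left_mono mult_right_mono)
  qed
  thus "\<forall>\<^sub>F w in at z. cmod ((ipr (sres M w f) g - ipr (sres M z f) g) / (w - z) - ipr (sres M z (sres M z f)) g) \<le> K * cmod (w - z)"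
    unfolding eventually_at using y by (intro exI[of _ "y / 2"]) auto
  have "((\<lambda>w. K * cmod (w - z)) \<longlongrightarrow> K * cmod (z - z)) (at z)" by (intro tendsto_intros)
  thus "((\<lambda>w. K * cmod (w - z)) \<longlongrightarrow> 0) (at z)" by simp
qed

lemma resolvent_eq: "resolvent M z u = fourier_L2 1 (sres M z (fourier_L2 (-1) u))"
  unfolding resolvent_def sres_def ..

lemma resolvent_l2:
  assumes herm: "\<forall>j. hermitian_mat (M j)" and z: "Im z \<noteq> 0" and u: "l2 u"
  shows "l2 (resolvent M z u)" "nrm (resolvent M z u) \<le> (1 / \<bar>Im z\<bar>) * nrm u"
proof -
  have f: "l2 (fourier_L2 (-1) u)" "nrm (fourier_L2 (-1) u) \<le> nrm u"
    using fourier_L2_spec(1)[OF u] fourier_L2_bound[OF u] by auto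
  note g = sres_l2[OF herm z f(1)]
  show "l2 (resolvent M z u)" unfolding resolvent_eq using fourier_L2_spec(1)[OF g(1)] by auto
  have "nrm (resolvent M z u) \<le> nrm (sres M z (fourier_L2 (-1) u))"
    unfolding resolvent_eq using fourier_L2_bound[OF g(1)] by auto
  also have "\<dots> \<le> (1 / \<bar>Im z\<bar>) * nrm (fourier_L2 (-1) u)" by (rule g)
  also have "\<dots> \<le> (1 / \<bar>Im z\<bar>) * nrm u" using f by (intro mult_left_mono) auto
  finally show "nrm (resolvent M z u) \<le> (1 / \<bar>Im z\<bar>) * nrm u" .
qed

text \<open>The outer inverse transform of the resolvent is moved onto v, which reduces everything
  to the frequency-side form estimated before.\<close>

lemma resolvent_form:
  assumes herm: "\<forall>j. hermitian_mat (M j)" and z: "Im z \<noteq> 0" and u: "l2 u" and v: "l2 v"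
  shows "ipr (resolvent M z u) v = ipr (sres M z (fourier_L2 (-1) u)) (fourier_L2 (-1) v)"
  unfolding resolvent_eq
  by (rule fourier_L2_adjoint[OF sres_l2(1)[OF herm z] v]) (use fourier_L2_spec(1)[OF u] in auto)

lemma fourier_L2_diff_le:
  fixes f g :: "real^'n::finite \<Rightarrow> complex^'k::finite"
  assumes f: "l2 f" and g: "l2 g" and \<sigma>: "\<sigma> = 1 \<or> \<sigma> = -1"
  shows "nrm (\<lambda>x. fourier_L2 \<sigma> f x - fourier_L2 \<sigma> g x) \<le> nrm (\<lambda>x. f x - g x)"
proof -
  have e: "(\<lambda>y. 1 *s f y + (-1) *s g y) = (\<lambda>y. f y - g y)" by (auto simp: vec_eq_iff)
  have e2: "(\<lambda>x. fourier_L2 \<sigma> (\<lambda>y. f y - g y) x - (1 *s fourier_L2 \<sigma> f x + (-1) *s fourier_L2 \<sigma> g x)) =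
     (\<lambda>x. fourier_L2 \<sigma> (\<lambda>y. f y - g y) x - (fourier_L2 \<sigma> f x - fourier_L2 \<sigma> g x))" by (auto simp: vec_eq_iff)
  have z: "nrm (\<lambda>x. fourier_L2 \<sigma> (\<lambda>y. f y - g y) x - (fourier_L2 \<sigma> f x - fourier_L2 \<sigma> g x)) = 0"
    using fourier_L2_linear[OF f g \<sigma>, of 1 "-1"] unfolding e e2 .
  note l = fourier_L2_spec(1)[OF l2_diff[OF f g] \<sigma>] l2_diff[OF fourier_L2_spec(1)[OF f \<sigma>] fourier_L2_spec(1)[OF g \<sigma>]]
  have "nrm (\<lambda>x. fourier_L2 \<sigma> f x - fourier_L2 \<sigma> g x) \<le> nrm (fourier_L2 \<sigma> (\<lambda>y. f y - g y)) + 0"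
    using nrm_triangle_sub[OF l(2) l(1)] z nrm_commute[of "fourier_L2 \<sigma> (\<lambda>y. f y - g y)"] by simp
  thus ?thesis using fourier_L2_bound[OF l2_diff[OF f g] \<sigma>] by simp
qed

text \<open>Two transforms are chosen independently, before and after the multiplier. The defect of
  the inner one has seminorm 0 and keeps it under the bounded multiplier and the contractive outer
  transform.\<close>

lemma resolvent_linear:
  fixes M :: "'n::finite \<Rightarrow> complex^'k::finite^'k"
  assumes herm: "\<forall>j. hermitian_mat (M j)" and z: "Im z \<noteq> 0" and u: "l2 u" and v: "l2 v"
  shows "nrm (\<lambda>x. resolvent M z (\<lambda>y. a *s u y + b *s v y) x - (a *s resolvent M z u x + b *s resolvent M z v x)) = 0"
proof -
  let ?w = "\<lambda>y. a *s u y + b *s v y"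
  have w: "l2 ?w" by (intro l2_add l2_scale u v)
  define fu fv fw where "fu = fourier_L2 (-1) u" and "fv = fourier_L2 (-1) v" and "fw = fourier_L2 (-1) ?w"
  have l: "l2 fu" "l2 fv" "l2 fw" unfolding fu_def fv_def fw_def by (rule fourier_L2_spec(1)[OF u] fourier_L2_spec(1)[OF v] fourier_L2_spec(1)[OF w]; simp)+
  have n0: "nrm (\<lambda>x. fw x - (a *s fu x + b *s fv x)) = 0"
    unfolding fu_def fv_def fw_def by (rule fourier_L2_linear[OF u v]) simp
  define h where "h = (\<lambda>x. a *s sres M z fu x + b *s sres M z fv x)"
  have hs: "l2 (sres M z fu)" "l2 (sres M z fv)" "l2 (sres M z fw)" by (intro sres_l2 herm z l)+
  have h: "l2 h" unfolding h_def by (intro l2_add l2_scale hs)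
  have he: "h = sres M z (\<lambda>x. a *s fu x + b *s fv x)" unfolding h_def sres_add sres_scale ..
  have lc: "l2 (\<lambda>x. a *s fu x + b *s fv x)" by (intro l2_add l2_scale l)
  have "nrm (\<lambda>x. sres M z fw x - h x) \<le> (1 / \<bar>Im z\<bar>) * nrm (\<lambda>x. fw x - (a *s fu x + b *s fv x))"
    unfolding he sres_diff[symmetric] by (intro sres_l2 herm z l2_diff l lc)
  hence n1: "nrm (\<lambda>x. sres M z fw x - h x) \<le> 0" using n0 by simp
  have "nrm (\<lambda>x. fourier_L2 1 (sres M z fw) x - fourier_L2 1 h x) \<le> nrm (\<lambda>x. sres M z fw x - h x)"
    by (rule fourier_L2_diff_le[OF hs(3) h]) simp
  moreover have "nrm (\<lambda>x. fourier_L2 1 h x - (a *s fourier_L2 1 (sres M z fu) x + b *s fourier_L2 1 (sres M z fv) x)) = 0"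
    unfolding h_def by (rule fourier_L2_linear[OF hs(1,2)]) simp
  moreover have "nrm (\<lambda>x. fourier_L2 1 (sres M z fw) x - (a *s fourier_L2 1 (sres M z fu) x + b *s fourier_L2 1 (sres M z fv) x)) \<le>
     nrm (\<lambda>x. fourier_L2 1 (sres M z fw) x - fourier_L2 1 h x) + nrm (\<lambda>x. fourier_L2 1 h x - (a *s fourier_L2 1 (sres M z fu) x + b *s fourier_L2 1 (sres M z fv) x))"
    by (intro nrm_triangle_diff l2_add l2_scale fourier_L2_spec hs h) auto
  ultimately have "nrm (\<lambda>x. fourier_L2 1 (sres M z fw) x - (a *s fourier_L2 1 (sres M z fu) x + b *s fourier_L2 1 (sres M z fv) x)) \<le> 0" using n1 by linarith
  thus ?thesis unfolding resolvent_eq fu_def fv_def fw_def by (simp add: antisym)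
qed

text \<open>Testing against the weighted function itself turns the bound on the sesquilinear form into
  a bound in the dual weighted norm.\<close>

lemma resolvent_holder:
  fixes M :: "'n::finite \<Rightarrow> complex^'k::finite^'k"
  assumes herm: "\<forall>j. hermitian_mat (M j)" and sp: "strongly_propagative M"
    and \<alpha>: "0 < \<alpha>" "\<alpha> \<le> 1/2" "1/2 + \<alpha> < s" and m: "0 < m" "m \<le> X" and \<sigma>: "\<sigma> = 1 \<or> \<sigma> = -1"
  obtains H where "H \<ge> 0" "\<And>lo hi z1 z2 u. \<lbrakk>hi - lo \<le> 1; \<And>x. lo \<le> x \<Longrightarrow> x \<le> hi \<Longrightarrow> m \<le> \<bar>x\<bar> \<and> \<bar>x\<bar> \<le> X;
      lo \<le> Re z1; Re z1 \<le> hi; 0 < Im z1; Im z1 \<le> 1; lo \<le> Re z2; Re z2 \<le> hi; 0 < Im z2; Im z2 \<le> 1; l2 (jap s u)\<rbrakk> \<Longrightarrow>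
      nrm (jap (-s) (\<lambda>x. resolvent M (of_real \<sigma> * z1) u x - resolvent M (of_real \<sigma> * z2) u x)) \<le> H * cmod (z1 - z2) powr \<alpha> * nrm (jap s u)"
proof -
  obtain K where K: "K \<ge> 0" and bd: "\<And>z u v. \<lbrakk>m \<le> \<bar>Re z\<bar>; \<bar>Re z\<bar> \<le> X; Im z \<noteq> 0; \<bar>Im z\<bar> \<le> 3; l2 (jap s u); l2 (jap s v)\<rbrakk> \<Longrightarrow>
      cmod (ipr (sres M z (sres M z (fourier_L2 (-1) u))) (fourier_L2 (-1) v)) \<le>
        K * \<bar>Im z\<bar> powr (\<alpha> - 1) * nrm (jap s u) * nrm (jap s v)"
    using weighted_square_bound[OF herm sp \<alpha> m] by blast
  have s: "s > 0" using \<alpha> by simp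
  show ?thesis
  proof (rule that[of "K * (2 / \<alpha> + 1)"])
    show "0 \<le> K * (2 / \<alpha> + 1)" using K \<alpha> by simp
    fix lo hi z1 z2 and u :: "real^'n \<Rightarrow> complex^'k"
    assume w: "hi - lo \<le> 1" and x: "\<And>x. lo \<le> x \<Longrightarrow> x \<le> hi \<Longrightarrow> m \<le> \<bar>x\<bar> \<and> \<bar>x\<bar> \<le> X"
      and z1: "lo \<le> Re z1" "Re z1 \<le> hi" "0 < Im z1" "Im z1 \<le> 1"
      and z2: "lo \<le> Re z2" "Re z2 \<le> hi" "0 < Im z2" "Im z2 \<le> 1" and ju: "l2 (jap s u)"
    have u: "l2 u" using jap_mono(1)[OF ju, of 0] s by (simp add: jap_zero)
    have i1: "Im (of_real \<sigma> * z1) \<noteq> 0" "Im (of_real \<sigma> * z2) \<noteq> 0" using z1 z2 \<sigma> by auto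
    define r where "r = (\<lambda>x. resolvent M (of_real \<sigma> * z1) u x - resolvent M (of_real \<sigma> * z2) u x)"
    have lr: "l2 (resolvent M (of_real \<sigma> * z1) u)" "l2 (resolvent M (of_real \<sigma> * z2) u)" by (intro resolvent_l2 herm i1 u)+
    have r: "l2 r" unfolding r_def by (intro l2_diff lr)
    have r0: "l2 (jap 0 r)" using r by (simp add: jap_zero)
    \<comment> \<open>With this test function the pairing with r is the squared weighted norm of r,
      while \<open>jap s v\<close> is \<open>jap (-s) r\<close> itself; both sides of the estimate
      then contain the quantity to be bounded.\<close>
    define v where "v = jap (- (2 * s)) r"
    have v: "l2 v" unfolding v_def by (rule jap_mono[OF r0]) (use s in simp)
    have jv: "jap s v = jap (-s) r" unfolding v_def jap_jap by simp
    have jvl: "l2 (jap s v)" unfolding jv by (rule jap_mono[OF r0]) (use s in simp)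
    have "ipr r v = of_real ((nrm (jap (-s) r))\<^sup>2)"
    proof -
      have "cip (r x) (v x) = of_real ((norm (jap (-s) r x))\<^sup>2)" for x
        unfolding norm_jap_sq by (simp add: v_def jap_def cip_scaleR_right cip_self)
      thus ?thesis unfolding ipr_def nrm_sq by (simp only: integral_complex_of_real)
    qed
    hence N: "(nrm (jap (-s) r))\<^sup>2 = cmod (ipr r v)" by (simp add: norm_power)
    define f g where "f = fourier_L2 (-1) u" and "g = fourier_L2 (-1) v"
    have fg: "l2 f" "l2 g" unfolding f_def g_def by (rule fourier_L2_spec(1)[OF u] fourier_L2_spec(1)[OF v]; simp)+
    define B where "B = (\<lambda>z. ipr (sres M (of_real \<sigma> * z) f) g)"
    \<comment> \<open>The factor \<sigma> is the inner derivative of the reflection and has modulus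
      1. With it B is considered in the upper half-plane for both signs.\<close>
    define B' where "B' = (\<lambda>z. of_real \<sigma> * ipr (sres M (of_real \<sigma> * z) (sres M (of_real \<sigma> * z) f)) g)"
    have "ipr r v = B z1 - B z2"
      unfolding r_def ipr_diff_left[OF lr v] B_def f_def g_def resolvent_form[OF herm i1(1) u v] resolvent_form[OF herm i1(2) u v] ..
    also have "cmod \<dots> \<le> (K * nrm (jap s u) * nrm (jap s v)) * (2 / \<alpha> + 1) * cmod (z1 - z2) powr \<alpha>"
    proof (rule hardy_littlewood[OF \<alpha>(1,2) _ w _ _ z1 z2])
      show "0 \<le> K * nrm (jap s u) * nrm (jap s v)" using K by simp
      fix z assume z: "lo \<le> Re z" "Re z \<le> hi" "0 < Im z" "Im z \<le> 3"
      have iz: "Im (of_real \<sigma> * z) \<noteq> 0" using z \<sigma> by auto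
      have lin: "((\<lambda>z. of_real \<sigma> * z) has_field_derivative of_real \<sigma>) (at z)"
        by (auto intro!: derivative_eq_intros)
      have "((\<lambda>z. ipr (sres M (of_real \<sigma> * z) f) g) has_field_derivative
          ipr (sres M (of_real \<sigma> * z) (sres M (of_real \<sigma> * z) f)) g * of_real \<sigma>) (at z)"
        by (rule DERIV_chain2[where f="\<lambda>z. ipr (sres M z f) g" and g="\<lambda>z. of_real \<sigma> * z",
              OF sres_form_derivative[OF herm iz fg] lin])
      thus "(B has_field_derivative B' z) (at z)" unfolding B_def B'_def by (simp add: mult.commute)
      have "cmod (B' z) = cmod (ipr (sres M (of_real \<sigma> * z) (sres M (of_real \<sigma> * z) f)) g)"
        using \<sigma> by (auto simp: B'_def)
      also have "\<dots> \<le> K * \<bar>Im (of_real \<sigma> * z)\<bar> powr (\<alpha> - 1) * nrm (jap s u) * nrm (jap s v)"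
        unfolding f_def g_def by (rule bd) (use x[OF z(1,2)] z \<sigma> ju jvl in auto)
      also have "\<bar>Im (of_real \<sigma> * z)\<bar> = Im z" using \<sigma> z by auto
      finally show "cmod (B' z) \<le> K * nrm (jap s u) * nrm (jap s v) * Im z powr (\<alpha> - 1)" by (simp add: mult_ac)
    qed
    \<comment> \<open>One factor of the norm cancels; when it is zero the claim is trivial.\<close>
    finally have "nrm (jap (-s) r) * nrm (jap (-s) r) \<le> (K * (2 / \<alpha> + 1) * cmod (z1 - z2) powr \<alpha> * nrm (jap s u)) * nrm (jap (-s) r)"
      using N unfolding jv by (simp only: power2_eq_square mult_ac)
    moreover have "0 \<le> K * (2 / \<alpha> + 1) * cmod (z1 - z2) powr \<alpha> * nrm (jap s u)" using K \<alpha> by simp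
    ultimately show "nrm (jap (-s) (\<lambda>x. resolvent M (of_real \<sigma> * z1) u x - resolvent M (of_real \<sigma> * z2) u x)) \<le> K * (2 / \<alpha> + 1) * cmod (z1 - z2) powr \<alpha> * nrm (jap s u)"
      unfolding r_def[symmetric] by (cases "nrm (jap (-s) r) = 0") (auto simp: order_less_le)
  qed
qed

text \<open>The lower half-plane is covered by the sign -1, through the reflection of the spectral
  parameter at the origin.\<close>

definition res_at :: "('n::finite \<Rightarrow> complex^'k::finite^'k) \<Rightarrow> real \<Rightarrow> real \<Rightarrow> real \<Rightarrow> (real^'n \<Rightarrow> complex^'k) \<Rightarrow> (real^'n \<Rightarrow> complex^'k)" where
  "res_at M \<sigma> \<mu> \<epsilon> = resolvent M (of_real \<sigma> * (of_real \<mu> + \<i> * of_real \<epsilon>))"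

text \<open>The limit is chosen separately for each u and is determined only up to null functions.
  Its linearity in u is therefore recovered afterwards, in the seminorm.\<close>

definition res_lim :: "('n::finite \<Rightarrow> complex^'k::finite^'k) \<Rightarrow> real \<Rightarrow> real \<Rightarrow> real \<Rightarrow> (real^'n \<Rightarrow> complex^'k) \<Rightarrow> (real^'n \<Rightarrow> complex^'k)" where
  "res_lim M s \<sigma> \<mu> u = (SOME g. l2 (jap (-s) g) \<and>
     ((\<lambda>\<epsilon>. nrm (jap (-s) (\<lambda>x. res_at M \<sigma> \<mu> \<epsilon> u x - g x))) \<longlongrightarrow> 0) (at_right 0))"

section \<open>Limits in the weighted operator norm\<close>

lemma jap_linear: "jap s (\<lambda>x. u x - (a *s v x + b *s w x)) = (\<lambda>x. jap s u x - (a *s jap s v x + b *s jap s w x))"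
  by (auto simp: jap_def vec_eq_iff scaleR_conv_of_real[where 'a=complex] algebra_simps)

lemma jap_cancel: "jap s (jap (-s) u) = u" "jap (-s) (jap s u) = u"
  by (simp_all add: jap_jap jap_zero)

text \<open>Elements of \<open>Upsilon s M\<close> lie in the weighted space, so the supremum is
  dominated by a bound on the unit ball of that space, where \<open>wnorm\<close> is
  \<open>nrm\<close> of the weighted function.\<close>

lemma opnorm_le:
  assumes "\<And>u. l2 (jap s u) \<Longrightarrow> nrm (jap s u) \<le> 1 \<Longrightarrow> l2 (jap (-s) (T u)) \<and> nrm (jap (-s) (T u)) \<le> C"
  shows "opnorm s M T \<le> ennreal C"
  unfolding opnorm_def
proof (rule SUP_least)
  fix u assume "u \<in> {u \<in> Upsilon s M. wnorm s u \<le> 1}"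
  hence u: "l2 (jap s u)" and w: "wnorm s u \<le> 1" by (auto simp: Upsilon_def L2w_iff)
  have "ennreal (nrm (jap s u)) \<le> ennreal 1" using w by (simp add: wnorm_eq[OF u])
  hence "nrm (jap s u) \<le> 1" by (simp add: ennreal_le_iff)
  from assms[OF u this] show "wnorm (- s) (T u) \<le> ennreal C" by (simp add: wnorm_eq ennreal_leI)
qed

text \<open>The radius is at most 1/2 so that the box has the width 1 demanded by
  \<open>hardy_littlewood\<close>, and at most half of |\<mu>0| so that the box keeps away from
  0.\<close>

lemma local_box:
  fixes \<mu>0 :: real
  assumes "\<mu>0 \<noteq> 0"
  obtains \<delta> where "\<delta> > 0" "2 * \<delta> \<le> 1" "\<And>x. \<bar>x - \<mu>0\<bar> \<le> \<delta> \<Longrightarrow> \<bar>\<mu>0\<bar> / 2 \<le> \<bar>x\<bar> \<and> \<bar>x\<bar> \<le> 2 * \<bar>\<mu>0\<bar>"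
proof (rule that[of "min (1/2) (\<bar>\<mu>0\<bar> / 2)"])
  fix x assume "\<bar>x - \<mu>0\<bar> \<le> min (1/2) (\<bar>\<mu>0\<bar> / 2)"
  hence "\<bar>x - \<mu>0\<bar> \<le> \<bar>\<mu>0\<bar> / 2" by simp
  thus "\<bar>\<mu>0\<bar> / 2 \<le> \<bar>x\<bar> \<and> \<bar>x\<bar> \<le> 2 * \<bar>\<mu>0\<bar>" by linarith
qed (use assms in auto)

context
  fixes M :: "'n::finite \<Rightarrow> complex^'k::finite^'k" and s \<alpha> \<sigma> :: real
  assumes herm: "\<forall>j. hermitian_mat (M j)" and sp: "strongly_propagative M"
    and \<alpha>: "0 < \<alpha>" "\<alpha> \<le> 1/2" "1/2 + \<alpha> < s" and \<sigma>: "\<sigma> = 1 \<or> \<sigma> = -1"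
begin

lemma s_pos: "s > 0" using \<alpha> by simp

lemma l2_of_jap: "l2 (jap s u) \<Longrightarrow> l2 u" "l2 (jap s u) \<Longrightarrow> nrm u \<le> nrm (jap s u)"
  using jap_mono[of s u 0] s_pos by (auto simp: jap_zero)

lemma jap_neg_le: assumes "l2 u" shows "l2 (jap (-s) u)" "nrm (jap (-s) u) \<le> nrm u"
  using jap_mono[of 0 u "-s"] s_pos assms by (auto simp: jap_zero)

lemma Im_spectral: "\<epsilon> > 0 \<Longrightarrow> \<bar>Im (of_real \<sigma> * (of_real \<mu> + \<i> * of_real \<epsilon>))\<bar> = \<epsilon>"
  using \<sigma> by auto

lemma res_at_l2:
  assumes "\<epsilon> > 0" "l2 (jap s u)"
  shows "l2 (res_at M \<sigma> \<mu> \<epsilon> u)" "nrm (res_at M \<sigma> \<mu> \<epsilon> u) \<le> (1 / \<epsilon>) * nrm (jap s u)" "l2 (jap (-s) (res_at M \<sigma> \<mu> \<epsilon> u))"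
proof -
  have i: "Im (of_real \<sigma> * (of_real \<mu> + \<i> * of_real \<epsilon>)) \<noteq> 0" using Im_spectral[OF assms(1), of \<mu>] assms(1) by auto
  note r = resolvent_l2[OF herm i l2_of_jap(1)[OF assms(2)], folded res_at_def, unfolded Im_spectral[OF assms(1)]]
  show "l2 (res_at M \<sigma> \<mu> \<epsilon> u)" by (rule r)
  thus "l2 (jap (-s) (res_at M \<sigma> \<mu> \<epsilon> u))" by (rule jap_neg_le)
  have "(1 / \<epsilon>) * nrm u \<le> (1 / \<epsilon>) * nrm (jap s u)" using assms(1) by (intro mult_left_mono l2_of_jap(2)[OF assms(2)]) auto
  thus "nrm (res_at M \<sigma> \<mu> \<epsilon> u) \<le> (1 / \<epsilon>) * nrm (jap s u)" using r(2) by linarith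
qed

text \<open>Joint Hoelder continuity in the real parameter and in \<epsilon>, uniform down to
  \<epsilon> = 0. The same inequality later yields existence of the limits, the rate of convergence
  and the regularity in \<mu>.\<close>

lemma res_at_holder:
  assumes "\<mu>0 \<noteq> 0"
  obtains \<delta> H where "\<delta> > 0" "2 * \<delta> \<le> 1" "H \<ge> 0" "\<And>\<mu>. \<bar>\<mu> - \<mu>0\<bar> \<le> \<delta> \<Longrightarrow> \<mu> \<noteq> 0"
    "\<And>\<mu> \<mu>' \<epsilon> \<epsilon>' u. \<lbrakk>\<bar>\<mu> - \<mu>0\<bar> \<le> \<delta>; \<bar>\<mu>' - \<mu>0\<bar> \<le> \<delta>; 0 < \<epsilon>; \<epsilon> \<le> 1; 0 < \<epsilon>'; \<epsilon>' \<le> 1; l2 (jap s u)\<rbrakk> \<Longrightarrow>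
      nrm (\<lambda>x. jap (-s) (res_at M \<sigma> \<mu> \<epsilon> u) x - jap (-s) (res_at M \<sigma> \<mu>' \<epsilon>' u) x) \<le>
        H * (\<bar>\<mu> - \<mu>'\<bar> + \<bar>\<epsilon> - \<epsilon>'\<bar>) powr \<alpha> * nrm (jap s u)"
proof -
  obtain \<delta> where \<delta>: "\<delta> > 0" "2 * \<delta> \<le> 1" and box: "\<And>x. \<bar>x - \<mu>0\<bar> \<le> \<delta> \<Longrightarrow> \<bar>\<mu>0\<bar> / 2 \<le> \<bar>x\<bar> \<and> \<bar>x\<bar> \<le> 2 * \<bar>\<mu>0\<bar>"
    using local_box[OF assms] by blast
  have m: "0 < \<bar>\<mu>0\<bar> / 2" "\<bar>\<mu>0\<bar> / 2 \<le> 2 * \<bar>\<mu>0\<bar>" using assms by auto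
  obtain H where H: "H \<ge> 0" and hol: "\<And>lo hi z1 z2 u. \<lbrakk>hi - lo \<le> 1; \<And>x. lo \<le> x \<Longrightarrow> x \<le> hi \<Longrightarrow> \<bar>\<mu>0\<bar> / 2 \<le> \<bar>x\<bar> \<and> \<bar>x\<bar> \<le> 2 * \<bar>\<mu>0\<bar>;
      lo \<le> Re z1; Re z1 \<le> hi; 0 < Im z1; Im z1 \<le> 1; lo \<le> Re z2; Re z2 \<le> hi; 0 < Im z2; Im z2 \<le> 1; l2 (jap s u)\<rbrakk> \<Longrightarrow>
      nrm (jap (-s) (\<lambda>x. resolvent M (of_real \<sigma> * z1) u x - resolvent M (of_real \<sigma> * z2) u x)) \<le> H * cmod (z1 - z2) powr \<alpha> * nrm (jap s u)"
    using resolvent_holder[OF herm sp \<alpha> m \<sigma>] by blast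
  show ?thesis
  proof (rule that[OF \<delta> H])
    fix \<mu> assume "\<bar>\<mu> - \<mu>0\<bar> \<le> \<delta>" thus "\<mu> \<noteq> 0" using box[of \<mu>] m(1) by auto
  next
    fix \<mu> \<mu>' \<epsilon> \<epsilon>' :: real and u :: "real^'n \<Rightarrow> complex^'k"
    assume a: "\<bar>\<mu> - \<mu>0\<bar> \<le> \<delta>" "\<bar>\<mu>' - \<mu>0\<bar> \<le> \<delta>" "0 < \<epsilon>" "\<epsilon> \<le> 1" "0 < \<epsilon>'" "\<epsilon>' \<le> 1" "l2 (jap s u)"
    let ?z = "complex_of_real \<mu> + \<i> * of_real \<epsilon>" and ?w = "complex_of_real \<mu>' + \<i> * of_real \<epsilon>'"
    have "nrm (jap (-s) (\<lambda>x. resolvent M (of_real \<sigma> * ?z) u x - resolvent M (of_real \<sigma> * ?w) u x)) \<le> H * cmod (?z - ?w) powr \<alpha> * nrm (jap s u)"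
      by (rule hol[of "\<mu>0 + \<delta>" "\<mu>0 - \<delta>"]) (use a \<delta> box in \<open>auto simp: abs_le_iff\<close>)
    also have "\<dots> \<le> H * (\<bar>\<mu> - \<mu>'\<bar> + \<bar>\<epsilon> - \<epsilon>'\<bar>) powr \<alpha> * nrm (jap s u)"
      using H \<alpha> cmod_le[of "?z - ?w"] by (intro mult_right_mono mult_left_mono powr_mono2) auto
    finally show "nrm (\<lambda>x. jap (-s) (res_at M \<sigma> \<mu> \<epsilon> u) x - jap (-s) (res_at M \<sigma> \<mu>' \<epsilon>' u) x) \<le>
        H * (\<bar>\<mu> - \<mu>'\<bar> + \<bar>\<epsilon> - \<epsilon>'\<bar>) powr \<alpha> * nrm (jap s u)" unfolding res_at_def jap_diff .
  qed
qed

lemma powr_tendsto_0: "((\<lambda>\<epsilon>. C * \<epsilon> powr \<alpha> * D) \<longlongrightarrow> 0) (at_right 0)"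
proof -
  have "((\<lambda>\<epsilon>. \<epsilon> powr \<alpha>) \<longlongrightarrow> 0) (at_right 0)"
  proof (rule tendsto_zero_powrI[OF _ tendsto_const _ \<alpha>(1)])
    show "((\<lambda>\<epsilon>::real. \<epsilon>) \<longlongrightarrow> 0) (at_right 0)" by (rule tendsto_ident_at)
    show "\<forall>\<^sub>F \<epsilon>::real in at_right 0. 0 \<le> \<epsilon>" by (rule eventually_mono[OF eventually_at_right_less]) simp
  qed
  from tendsto_mult[OF tendsto_mult[OF tendsto_const this, of C] tendsto_const, of D] show ?thesis by simp
qed

text \<open>The Hoelder bound in \<epsilon> makes the family Cauchy. Completeness is invoked along 1
  / (m + 1), and the same bound compares any other \<epsilon> with a smaller member of this
  sequence.\<close>

lemma res_lim_spec:
  assumes "\<mu> \<noteq> 0" and u: "l2 (jap s u)"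
  shows "l2 (jap (-s) (res_lim M s \<sigma> \<mu> u))"
    "((\<lambda>\<epsilon>. nrm (\<lambda>x. jap (-s) (res_at M \<sigma> \<mu> \<epsilon> u) x - jap (-s) (res_lim M s \<sigma> \<mu> u) x)) \<longlongrightarrow> 0) (at_right 0)"
proof -
  let ?P = "\<lambda>g. l2 (jap (-s) g) \<and> ((\<lambda>\<epsilon>. nrm (jap (-s) (\<lambda>x. res_at M \<sigma> \<mu> \<epsilon> u x - g x))) \<longlongrightarrow> 0) (at_right 0)"
  obtain \<delta> H where \<delta>: "\<delta> > 0" "2 * \<delta> \<le> 1" and H: "H \<ge> 0" and "\<And>\<mu>1. \<bar>\<mu>1 - \<mu>\<bar> \<le> \<delta> \<Longrightarrow> \<mu>1 \<noteq> 0"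
    and hol: "\<And>\<mu>1 \<mu>' \<epsilon> \<epsilon>' u. \<lbrakk>\<bar>\<mu>1 - \<mu>\<bar> \<le> \<delta>; \<bar>\<mu>' - \<mu>\<bar> \<le> \<delta>; 0 < \<epsilon>; \<epsilon> \<le> 1; 0 < \<epsilon>'; \<epsilon>' \<le> 1; l2 (jap s u)\<rbrakk> \<Longrightarrow>
      nrm (\<lambda>x. jap (-s) (res_at M \<sigma> \<mu>1 \<epsilon> u) x - jap (-s) (res_at M \<sigma> \<mu>' \<epsilon>' u) x) \<le>
        H * (\<bar>\<mu>1 - \<mu>'\<bar> + \<bar>\<epsilon> - \<epsilon>'\<bar>) powr \<alpha> * nrm (jap s u)"
    using res_at_holder[OF assms(1)] by blast
  define T where "T = (\<lambda>\<epsilon>. jap (-s) (res_at M \<sigma> \<mu> \<epsilon> u))"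
  define N where "N = nrm (jap s u)"
  have Tl: "l2 (T \<epsilon>)" if "\<epsilon> > 0" for \<epsilon> unfolding T_def by (rule res_at_l2[OF that u])
  have Th: "nrm (\<lambda>x. T \<epsilon> x - T \<epsilon>' x) \<le> H * e powr \<alpha> * N" if "0 < \<epsilon>" "\<epsilon> \<le> e" "0 < \<epsilon>'" "\<epsilon>' \<le> e" "e \<le> 1" for \<epsilon> \<epsilon>' e
  proof -
    have "nrm (\<lambda>x. T \<epsilon> x - T \<epsilon>' x) \<le> H * (\<bar>\<mu> - \<mu>\<bar> + \<bar>\<epsilon> - \<epsilon>'\<bar>) powr \<alpha> * N"
      unfolding T_def N_def by (rule hol) (use that \<delta> u in auto)
    also have "\<dots> \<le> H * e powr \<alpha> * N"
      using that H \<alpha> by (intro mult_right_mono mult_left_mono powr_mono2) (auto simp: N_def)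
    finally show ?thesis .
  qed
  define e where "e = (\<lambda>m. 1 / real (Suc m))"
  have e: "0 < e m" "e m \<le> 1" for m by (auto simp: e_def)
  have edec: "e k \<le> e m" if "m \<le> k" for m k using that by (auto simp: e_def intro!: divide_left_mono)
  have e0: "e \<longlonglongrightarrow> 0" unfolding e_def using LIMSEQ_inverse_real_of_nat by (simp add: inverse_eq_divide)
  have c: "nrm (\<lambda>x. T (e k) x - T (e m) x) \<le> H * (e m) powr \<alpha> * N" if "m \<le> k" for m k
    by (rule Th) (use e edec[OF that] in auto)
  have fl: "filterlim e (at_right 0) sequentially"
    unfolding filterlim_at
  proof (intro conjI always_eventually allI e0)
    show "e m \<noteq> 0" "e m \<in> {0<..}" for m using e(1)[of m] by auto
  qed
  have "(\<lambda>m. H * (e m) powr \<alpha> * N) \<longlonglongrightarrow> 0" by (rule filterlim_compose[OF powr_tendsto_0 fl])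
  then obtain g where g: "l2 g" "\<And>m. nrm (\<lambda>x. g x - T (e m) x) \<le> H * (e m) powr \<alpha> * N"
    using l2_complete[of "\<lambda>m. T (e m)" "\<lambda>m. H * (e m) powr \<alpha> * N"] Tl[OF e(1)] c by blast
  have bound: "nrm (\<lambda>x. T \<epsilon> x - g x) \<le> (2 * H) * \<epsilon> powr \<alpha> * N" if \<epsilon>: "0 < \<epsilon>" "\<epsilon> \<le> 1" for \<epsilon>
  proof -
    obtain m where m: "e m < \<epsilon>" using order_tendstoD(2)[OF e0 \<epsilon>(1)] by (auto simp: eventually_sequentially)
    have "nrm (\<lambda>x. T \<epsilon> x - g x) \<le> nrm (\<lambda>x. T \<epsilon> x - T (e m) x) + nrm (\<lambda>x. T (e m) x - g x)"
      by (rule nrm_triangle_diff[OF Tl[OF \<epsilon>(1)] Tl[OF e(1)] g(1)])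
    also have "nrm (\<lambda>x. T \<epsilon> x - T (e m) x) \<le> H * \<epsilon> powr \<alpha> * N" by (rule Th) (use \<epsilon> m e in auto)
    also have "nrm (\<lambda>x. T (e m) x - g x) \<le> H * (e m) powr \<alpha> * N" using g(2)[of m] nrm_commute[of g] by simp
    also have "\<dots> \<le> H * \<epsilon> powr \<alpha> * N"
      using H \<alpha> m e[of m] by (intro mult_right_mono mult_left_mono powr_mono2) (auto simp: N_def less_imp_le)
    finally show ?thesis by (simp add: mult_ac)
  qed
  have "((\<lambda>\<epsilon>. nrm (\<lambda>x. T \<epsilon> x - g x)) \<longlongrightarrow> 0) (at_right 0)"
  proof (rule tendsto_sandwich[OF _ _ tendsto_const powr_tendsto_0[of "2 * H" N]])
    show "\<forall>\<^sub>F \<epsilon> in at_right 0. nrm (\<lambda>x. T \<epsilon> x - g x) \<le> (2 * H) * \<epsilon> powr \<alpha> * N"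
      unfolding eventually_at_right_field using bound by (intro exI[of _ 1]) auto
  qed simp
  \<comment> \<open>g is the limit of the weighted functions; \<open>jap s\<close> removes the
    weight \<open>jap (-s)\<close> from it.\<close>
  hence "?P (jap s g)" using g(1) unfolding jap_diff jap_cancel T_def by simp
  hence P: "?P (res_lim M s \<sigma> \<mu> u)" unfolding res_lim_def by (rule someI[where P="?P"])
  show "l2 (jap (-s) (res_lim M s \<sigma> \<mu> u))" using P by blast
  show "((\<lambda>\<epsilon>. nrm (\<lambda>x. jap (-s) (res_at M \<sigma> \<mu> \<epsilon> u) x - jap (-s) (res_lim M s \<sigma> \<mu> u) x)) \<longlongrightarrow> 0) (at_right 0)"
    using P unfolding jap_diff by blast
qed

text \<open>All estimates for limits are inherited from positive \<epsilon>: the rate by letting the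
  second \<epsilon> tend to 0, the bound by comparison with \<epsilon> = 1, the regularity by
  passing through a suitable positive \<epsilon>.\<close>

lemma res_lim_estimates:
  assumes "\<mu>0 \<noteq> 0"
  obtains \<delta> H where "\<delta> > 0" "H \<ge> 0" "\<And>\<mu>. \<bar>\<mu> - \<mu>0\<bar> \<le> \<delta> \<Longrightarrow> \<mu> \<noteq> 0"
    "\<And>\<mu> \<epsilon> u. \<lbrakk>\<bar>\<mu> - \<mu>0\<bar> \<le> \<delta>; 0 < \<epsilon>; \<epsilon> \<le> 1; l2 (jap s u)\<rbrakk> \<Longrightarrow>
      nrm (\<lambda>x. jap (-s) (res_at M \<sigma> \<mu> \<epsilon> u) x - jap (-s) (res_lim M s \<sigma> \<mu> u) x) \<le> H * \<epsilon> powr \<alpha> * nrm (jap s u)"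
    "\<And>\<mu> u. \<lbrakk>\<bar>\<mu> - \<mu>0\<bar> \<le> \<delta>; l2 (jap s u)\<rbrakk> \<Longrightarrow> nrm (jap (-s) (res_lim M s \<sigma> \<mu> u)) \<le> H * nrm (jap s u)"
    "\<And>\<mu> \<mu>' u. \<lbrakk>\<bar>\<mu> - \<mu>0\<bar> \<le> \<delta>; \<bar>\<mu>' - \<mu>0\<bar> \<le> \<delta>; l2 (jap s u)\<rbrakk> \<Longrightarrow>
      nrm (\<lambda>x. jap (-s) (res_lim M s \<sigma> \<mu> u) x - jap (-s) (res_lim M s \<sigma> \<mu>' u) x) \<le> H * \<bar>\<mu> - \<mu>'\<bar> powr \<alpha> * nrm (jap s u)"
proof -
  obtain \<delta> H where \<delta>: "\<delta> > 0" "2 * \<delta> \<le> 1" and H: "H \<ge> 0" and nz: "\<And>\<mu>. \<bar>\<mu> - \<mu>0\<bar> \<le> \<delta> \<Longrightarrow> \<mu> \<noteq> 0"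
    and hol: "\<And>\<mu> \<mu>' \<epsilon> \<epsilon>' u. \<lbrakk>\<bar>\<mu> - \<mu>0\<bar> \<le> \<delta>; \<bar>\<mu>' - \<mu>0\<bar> \<le> \<delta>; 0 < \<epsilon>; \<epsilon> \<le> 1; 0 < \<epsilon>'; \<epsilon>' \<le> 1; l2 (jap s u)\<rbrakk> \<Longrightarrow>
      nrm (\<lambda>x. jap (-s) (res_at M \<sigma> \<mu> \<epsilon> u) x - jap (-s) (res_at M \<sigma> \<mu>' \<epsilon>' u) x) \<le>
        H * (\<bar>\<mu> - \<mu>'\<bar> + \<bar>\<epsilon> - \<epsilon>'\<bar>) powr \<alpha> * nrm (jap s u)"
    using res_at_holder[OF assms] by blast
  define T where "T = (\<lambda>\<mu> \<epsilon> u. jap (-s) (res_at M \<sigma> \<mu> \<epsilon> u))"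
  define L where "L = (\<lambda>\<mu> u. jap (-s) (res_lim M s \<sigma> \<mu> u))"
  have Tl: "l2 (T \<mu> \<epsilon> u)" if "\<epsilon> > 0" "l2 (jap s u)" for \<mu> \<epsilon> u unfolding T_def by (rule res_at_l2[OF that])
  have Ll: "l2 (L \<mu> u)" if "\<bar>\<mu> - \<mu>0\<bar> \<le> \<delta>" "l2 (jap s u)" for \<mu> u unfolding L_def by (rule res_lim_spec[OF nz[OF that(1)] that(2)])
  have a: "nrm (\<lambda>x. T \<mu> \<epsilon> u x - L \<mu> u x) \<le> H * \<epsilon> powr \<alpha> * nrm (jap s u)"
    if \<mu>: "\<bar>\<mu> - \<mu>0\<bar> \<le> \<delta>" and \<epsilon>: "0 < \<epsilon>" "\<epsilon> \<le> 1" and u: "l2 (jap s u)" for \<mu> \<epsilon> u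
  proof (rule tendsto_lowerbound)
    have "((\<lambda>\<epsilon>'. nrm (\<lambda>x. T \<mu> \<epsilon>' u x - L \<mu> u x)) \<longlongrightarrow> 0) (at_right 0)"
      unfolding T_def L_def by (rule res_lim_spec(2)[OF nz[OF \<mu>] u])
    from tendsto_add[OF tendsto_const[of "H * \<epsilon> powr \<alpha> * nrm (jap s u)"] this]
    show "((\<lambda>\<epsilon>'. H * \<epsilon> powr \<alpha> * nrm (jap s u) + nrm (\<lambda>x. T \<mu> \<epsilon>' u x - L \<mu> u x)) \<longlongrightarrow> H * \<epsilon> powr \<alpha> * nrm (jap s u)) (at_right 0)" by simp
    have "nrm (\<lambda>x. T \<mu> \<epsilon> u x - L \<mu> u x) \<le> H * \<epsilon> powr \<alpha> * nrm (jap s u) + nrm (\<lambda>x. T \<mu> \<epsilon>' u x - L \<mu> u x)" if \<epsilon>': "0 < \<epsilon>'" "\<epsilon>' < \<epsilon>" for \<epsilon>'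
    proof -
      have "nrm (\<lambda>x. T \<mu> \<epsilon> u x - L \<mu> u x) \<le> nrm (\<lambda>x. T \<mu> \<epsilon> u x - T \<mu> \<epsilon>' u x) + nrm (\<lambda>x. T \<mu> \<epsilon>' u x - L \<mu> u x)"
        by (rule nrm_triangle_diff[OF Tl[OF \<epsilon>(1) u] Tl[OF \<epsilon>'(1) u] Ll[OF \<mu> u]])
      also have "nrm (\<lambda>x. T \<mu> \<epsilon> u x - T \<mu> \<epsilon>' u x) \<le> H * (\<bar>\<mu> - \<mu>\<bar> + \<bar>\<epsilon> - \<epsilon>'\<bar>) powr \<alpha> * nrm (jap s u)"
        unfolding T_def by (rule hol) (use \<mu> \<epsilon> \<epsilon>' u in auto)
      also have "\<dots> \<le> H * \<epsilon> powr \<alpha> * nrm (jap s u)"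
        using H \<alpha> \<epsilon>' by (intro mult_right_mono mult_left_mono powr_mono2) auto
      finally show ?thesis by simp
    qed
    thus "\<forall>\<^sub>F \<epsilon>' in at_right 0. nrm (\<lambda>x. T \<mu> \<epsilon> u x - L \<mu> u x) \<le> H * \<epsilon> powr \<alpha> * nrm (jap s u) + nrm (\<lambda>x. T \<mu> \<epsilon>' u x - L \<mu> u x)"
      unfolding eventually_at_right_field using \<epsilon> by (intro exI[of _ \<epsilon>]) auto
  qed simp
  \<comment> \<open>At distance 1 from the axis the resolvent has norm at most 1, and the limit
    differs from it by at most H.\<close>
  have b: "nrm (L \<mu> u) \<le> (H + 1) * nrm (jap s u)" if \<mu>: "\<bar>\<mu> - \<mu>0\<bar> \<le> \<delta>" and u: "l2 (jap s u)" for \<mu> u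
  proof -
    have "nrm (L \<mu> u) \<le> nrm (T \<mu> 1 u) + nrm (\<lambda>x. L \<mu> u x - T \<mu> 1 u x)"
      by (rule nrm_triangle_sub[OF Ll[OF \<mu> u] Tl[OF _ u]]) simp
    also have "nrm (\<lambda>x. L \<mu> u x - T \<mu> 1 u x) \<le> H * nrm (jap s u)" using a[OF \<mu> _ _ u, of 1] nrm_commute[of "L \<mu> u"] by simp
    also have "nrm (T \<mu> 1 u) \<le> nrm (jap s u)"
      using jap_neg_le(2)[OF res_at_l2(1)[OF _ u, of 1 \<mu>]] res_at_l2(2)[OF _ u, of 1 \<mu>] by (simp add: T_def)
    finally show ?thesis by (simp add: algebra_simps)
  qed
  have c: "nrm (\<lambda>x. L \<mu> u x - L \<mu>' u x) \<le> (3 * H) * \<bar>\<mu> - \<mu>'\<bar> powr \<alpha> * nrm (jap s u)"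
    if \<mu>: "\<bar>\<mu> - \<mu>0\<bar> \<le> \<delta>" "\<bar>\<mu>' - \<mu>0\<bar> \<le> \<delta>" and u: "l2 (jap s u)" for \<mu> \<mu>' u
  proof (cases "\<mu> = \<mu>'")
    case True
    thus ?thesis by (simp add: nrm_def)
  next
    case False
    \<comment> \<open>Leaving the axis to the height |\<mu> - \<mu>'| costs as much as moving
      horizontally there; the three legs make the factor 3. The height is at most 1 because 2
      \<delta> is.\<close>
    define \<epsilon> where "\<epsilon> = \<bar>\<mu> - \<mu>'\<bar>"
    have \<epsilon>: "0 < \<epsilon>" "\<epsilon> \<le> 1" using False \<mu> \<delta> by (auto simp: \<epsilon>_def)
    note t = Tl[OF \<epsilon>(1) u]
    have "nrm (\<lambda>x. L \<mu> u x - L \<mu>' u x) \<le> nrm (\<lambda>x. L \<mu> u x - T \<mu> \<epsilon> u x) + nrm (\<lambda>x. T \<mu> \<epsilon> u x - L \<mu>' u x)"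
      by (rule nrm_triangle_diff[OF Ll[OF \<mu>(1) u] t Ll[OF \<mu>(2) u]])
    moreover have "nrm (\<lambda>x. T \<mu> \<epsilon> u x - L \<mu>' u x) \<le> nrm (\<lambda>x. T \<mu> \<epsilon> u x - T \<mu>' \<epsilon> u x) + nrm (\<lambda>x. T \<mu>' \<epsilon> u x - L \<mu>' u x)"
      by (rule nrm_triangle_diff[OF t t Ll[OF \<mu>(2) u]])
    moreover have "nrm (\<lambda>x. L \<mu> u x - T \<mu> \<epsilon> u x) \<le> H * \<epsilon> powr \<alpha> * nrm (jap s u)"
      using a[OF \<mu>(1) \<epsilon> u] nrm_commute[of "L \<mu> u"] by simp
    moreover have "nrm (\<lambda>x. T \<mu>' \<epsilon> u x - L \<mu>' u x) \<le> H * \<epsilon> powr \<alpha> * nrm (jap s u)" by (rule a[OF \<mu>(2) \<epsilon> u])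
    moreover have "nrm (\<lambda>x. T \<mu> \<epsilon> u x - T \<mu>' \<epsilon> u x) \<le> H * \<epsilon> powr \<alpha> * nrm (jap s u)"
      using hol[OF \<mu> \<epsilon> \<epsilon> u] by (simp add: T_def \<epsilon>_def)
    ultimately show ?thesis unfolding \<epsilon>_def[symmetric] by simp
  qed
  define C where "C = 3 * H + 1"
  have C: "C \<ge> 0" "H \<le> C" "H + 1 \<le> C" "3 * H \<le> C" using H by (auto simp: C_def)
  show ?thesis
  proof (rule that[OF \<delta>(1) C(1) nz])
    fix \<mu> \<mu>' \<epsilon> :: real and u :: "real^'n \<Rightarrow> complex^'k"
    assume \<mu>: "\<bar>\<mu> - \<mu>0\<bar> \<le> \<delta>" and u: "l2 (jap s u)"
    show "nrm (\<lambda>x. jap (-s) (res_at M \<sigma> \<mu> \<epsilon> u) x - jap (-s) (res_lim M s \<sigma> \<mu> u) x) \<le> C * \<epsilon> powr \<alpha> * nrm (jap s u)" if "0 < \<epsilon>" "\<epsilon> \<le> 1"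
      using order_trans[OF a[OF \<mu> that u] mult_right_mono[OF mult_right_mono[OF C(2)]]] by (simp add: T_def L_def)
    show "nrm (jap (-s) (res_lim M s \<sigma> \<mu> u)) \<le> C * nrm (jap s u)"
      using order_trans[OF b[OF \<mu> u] mult_right_mono[OF C(3)]] by (simp add: L_def)
    show "nrm (\<lambda>x. jap (-s) (res_lim M s \<sigma> \<mu> u) x - jap (-s) (res_lim M s \<sigma> \<mu>' u) x) \<le> C * \<bar>\<mu> - \<mu>'\<bar> powr \<alpha> * nrm (jap s u)" if "\<bar>\<mu>' - \<mu>0\<bar> \<le> \<delta>"
      using order_trans[OF c[OF \<mu> that u] mult_right_mono[OF mult_right_mono[OF C(4)]]] by (simp add: L_def)
  qed auto
qed

text \<open>For each positive \<epsilon> the resolvent is linear up to null functions, and the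
  defect of the limit is bounded by convergence errors tending to 0. Membership in \<open>l2\<close>
  is proved too, since \<open>wnorm\<close> can be replaced by \<open>nrm\<close> only
  there.\<close>

lemma res_lim_linear:
  assumes \<mu>: "\<mu> \<noteq> 0" and u: "l2 (jap s u)" and v: "l2 (jap s v)"
  shows "nrm (jap (-s) (\<lambda>x. res_lim M s \<sigma> \<mu> (\<lambda>y. a *s u y + b *s v y) x - (a *s res_lim M s \<sigma> \<mu> u x + b *s res_lim M s \<sigma> \<mu> v x))) = 0"
    "l2 (jap (-s) (\<lambda>x. res_lim M s \<sigma> \<mu> (\<lambda>y. a *s u y + b *s v y) x - (a *s res_lim M s \<sigma> \<mu> u x + b *s res_lim M s \<sigma> \<mu> v x)))"
proof -
  let ?w = "\<lambda>y. a *s u y + b *s v y"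
  have "jap s ?w = (\<lambda>x. a *s jap s u x + b *s jap s v x)"
    by (auto simp: jap_def vec_eq_iff scaleR_conv_of_real[where 'a=complex] algebra_simps)
  hence w: "l2 (jap s ?w)" using u v by (simp add: l2_add l2_scale)
  define L where "L = (\<lambda>u. jap (-s) (res_lim M s \<sigma> \<mu> u))"
  define T where "T = (\<lambda>\<epsilon> u. jap (-s) (res_at M \<sigma> \<mu> \<epsilon> u))"
  have Le: "jap (-s) (res_lim M s \<sigma> \<mu> f) = L f" for f by (simp add: L_def)
  have Ll: "l2 (L u)" "l2 (L v)" "l2 (L ?w)" unfolding L_def by (intro res_lim_spec \<mu> u v w)+
  have lc: "l2 (\<lambda>x. a *s L u x + b *s L v x)" by (intro l2_add l2_scale Ll)
  show "l2 (jap (-s) (\<lambda>x. res_lim M s \<sigma> \<mu> ?w x - (a *s res_lim M s \<sigma> \<mu> u x + b *s res_lim M s \<sigma> \<mu> v x)))"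
    unfolding jap_linear Le by (rule l2_diff[OF Ll(3) lc])
  let ?d = "\<lambda>\<epsilon> u. nrm (\<lambda>x. T \<epsilon> u x - L u x)"
  have "nrm (\<lambda>x. L ?w x - (a *s L u x + b *s L v x)) \<le> 0"
  proof (rule tendsto_lowerbound)
    have d: "((\<lambda>\<epsilon>. ?d \<epsilon> f) \<longlongrightarrow> 0) (at_right 0)" if "l2 (jap s f)" for f
      unfolding T_def L_def by (rule res_lim_spec(2)[OF \<mu> that])
    have "((\<lambda>\<epsilon>. ?d \<epsilon> ?w + (cmod a * ?d \<epsilon> u + cmod b * ?d \<epsilon> v)) \<longlongrightarrow> 0 + (cmod a * 0 + cmod b * 0)) (at_right 0)"
      by (intro tendsto_add tendsto_mult tendsto_const d u v w)
    thus "((\<lambda>\<epsilon>. ?d \<epsilon> ?w + (cmod a * ?d \<epsilon> u + cmod b * ?d \<epsilon> v)) \<longlongrightarrow> 0) (at_right 0)" by simp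
    have "nrm (\<lambda>x. L ?w x - (a *s L u x + b *s L v x)) \<le> ?d \<epsilon> ?w + (cmod a * ?d \<epsilon> u + cmod b * ?d \<epsilon> v)" if \<epsilon>: "\<epsilon> > 0" for \<epsilon>
    proof -
      have Tl: "l2 (T \<epsilon> u)" "l2 (T \<epsilon> v)" "l2 (T \<epsilon> ?w)" unfolding T_def by (intro res_at_l2 \<epsilon> u v w)+
      have tc: "l2 (\<lambda>x. a *s T \<epsilon> u x + b *s T \<epsilon> v x)" by (intro l2_add l2_scale Tl)
      have i: "Im (of_real \<sigma> * (of_real \<mu> + \<i> * of_real \<epsilon>)) \<noteq> 0" using Im_spectral[OF \<epsilon>, of \<mu>] \<epsilon> by auto
      have lin: "nrm (\<lambda>x. T \<epsilon> ?w x - (a *s T \<epsilon> u x + b *s T \<epsilon> v x)) \<le> 0"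
      proof -
        have "l2 (\<lambda>x. res_at M \<sigma> \<mu> \<epsilon> ?w x - (a *s res_at M \<sigma> \<mu> \<epsilon> u x + b *s res_at M \<sigma> \<mu> \<epsilon> v x))"
          by (intro l2_diff l2_add l2_scale res_at_l2 \<epsilon> u v w)
        from jap_neg_le(2)[OF this] show ?thesis
          using resolvent_linear[OF herm i l2_of_jap(1)[OF u] l2_of_jap(1)[OF v], of a b]
          unfolding T_def jap_linear[symmetric] res_at_def by simp
      qed
      have e: "(\<lambda>x. (a *s T \<epsilon> u x + b *s T \<epsilon> v x) - (a *s L u x + b *s L v x)) = (\<lambda>x. a *s (T \<epsilon> u x - L u x) + b *s (T \<epsilon> v x - L v x))"
        by (auto simp: vec_eq_iff algebra_simps)
      have "nrm (\<lambda>x. (a *s T \<epsilon> u x + b *s T \<epsilon> v x) - (a *s L u x + b *s L v x)) \<le> nrm (\<lambda>x. a *s (T \<epsilon> u x - L u x)) + nrm (\<lambda>x. b *s (T \<epsilon> v x - L v x))"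
        unfolding e by (intro nrm_triangle l2_scale l2_diff Tl Ll)
      also have "\<dots> = cmod a * ?d \<epsilon> u + cmod b * ?d \<epsilon> v"
        by (simp only: l2_scale(2)[OF l2_diff[OF Tl(1) Ll(1)]] l2_scale(2)[OF l2_diff[OF Tl(2) Ll(2)]])
      finally have 3: "nrm (\<lambda>x. (a *s T \<epsilon> u x + b *s T \<epsilon> v x) - (a *s L u x + b *s L v x)) \<le> cmod a * ?d \<epsilon> u + cmod b * ?d \<epsilon> v" .
      have 1: "nrm (\<lambda>x. L ?w x - (a *s L u x + b *s L v x)) \<le> nrm (\<lambda>x. L ?w x - T \<epsilon> ?w x) + nrm (\<lambda>x. T \<epsilon> ?w x - (a *s L u x + b *s L v x))"
        by (rule nrm_triangle_diff[OF Ll(3) Tl(3) lc])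
      have 2: "nrm (\<lambda>x. T \<epsilon> ?w x - (a *s L u x + b *s L v x)) \<le> nrm (\<lambda>x. T \<epsilon> ?w x - (a *s T \<epsilon> u x + b *s T \<epsilon> v x)) + nrm (\<lambda>x. (a *s T \<epsilon> u x + b *s T \<epsilon> v x) - (a *s L u x + b *s L v x))"
        by (rule nrm_triangle_diff[OF Tl(3) tc lc])
      show ?thesis using 1 2 3 lin nrm_commute[of "L ?w" "T \<epsilon> ?w"] by linarith
    qed
    thus "\<forall>\<^sub>F \<epsilon> in at_right 0. nrm (\<lambda>x. L ?w x - (a *s L u x + b *s L v x)) \<le> ?d \<epsilon> ?w + (cmod a * ?d \<epsilon> u + cmod b * ?d \<epsilon> v)"
      unfolding eventually_at_right_field by (intro exI[of _ 1]) auto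
  qed simp
  thus "nrm (jap (-s) (\<lambda>x. res_lim M s \<sigma> \<mu> ?w x - (a *s res_lim M s \<sigma> \<mu> u x + b *s res_lim M s \<sigma> \<mu> v x))) = 0"
    unfolding jap_linear Le by (simp add: antisym)
qed

text \<open>One sign at a time: for \<sigma> = -1 the parameter -(\<mu> + i \<epsilon>) approaches
  -\<mu> from the lower half-plane. The exponent \<alpha> is fixed in advance by the slack in
  s.\<close>

lemma limiting_absorption:
  "\<exists>R. (\<forall>\<mu>::real. \<mu> \<noteq> 0 \<longrightarrow> bounded_op s M (R \<mu>) \<and>
         ((\<lambda>\<epsilon>. opdist s M (resolvent M (of_real \<sigma> * (of_real \<mu> + \<i> * of_real \<epsilon>))) (R \<mu>)) \<longlongrightarrow> 0) (at_right 0)) \<and>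
       (\<forall>\<mu>0::real. \<mu>0 \<noteq> 0 \<longrightarrow> (\<exists>\<delta>>0. \<exists>C. C \<ge> 0 \<and> (\<forall>\<mu>. \<bar>\<mu> - \<mu>0\<bar> < \<delta> \<longrightarrow> opnorm s M (R \<mu>) \<le> ennreal C) \<and>
         (\<forall>\<mu> \<mu>'. \<bar>\<mu> - \<mu>0\<bar> < \<delta> \<and> \<bar>\<mu>' - \<mu>0\<bar> < \<delta> \<longrightarrow> opdist s M (R \<mu>) (R \<mu>') \<le> ennreal (C * \<bar>\<mu> - \<mu>'\<bar> powr \<alpha>))))"
proof (intro exI[of _ "res_lim M s \<sigma>"] conjI allI impI)
  fix \<mu>0 :: real assume \<mu>0: "\<mu>0 \<noteq> 0"
  obtain \<delta> H where \<delta>: "\<delta> > 0" and H: "H \<ge> 0" and nz: "\<And>\<mu>. \<bar>\<mu> - \<mu>0\<bar> \<le> \<delta> \<Longrightarrow> \<mu> \<noteq> 0"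
    and at: "\<And>\<mu> \<epsilon> u. \<lbrakk>\<bar>\<mu> - \<mu>0\<bar> \<le> \<delta>; 0 < \<epsilon>; \<epsilon> \<le> 1; l2 (jap s u)\<rbrakk> \<Longrightarrow>
      nrm (\<lambda>x. jap (-s) (res_at M \<sigma> \<mu> \<epsilon> u) x - jap (-s) (res_lim M s \<sigma> \<mu> u) x) \<le> H * \<epsilon> powr \<alpha> * nrm (jap s u)"
    and bd: "\<And>\<mu> u. \<lbrakk>\<bar>\<mu> - \<mu>0\<bar> \<le> \<delta>; l2 (jap s u)\<rbrakk> \<Longrightarrow> nrm (jap (-s) (res_lim M s \<sigma> \<mu> u)) \<le> H * nrm (jap s u)"
    and ho: "\<And>\<mu> \<mu>' u. \<lbrakk>\<bar>\<mu> - \<mu>0\<bar> \<le> \<delta>; \<bar>\<mu>' - \<mu>0\<bar> \<le> \<delta>; l2 (jap s u)\<rbrakk> \<Longrightarrow>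
      nrm (\<lambda>x. jap (-s) (res_lim M s \<sigma> \<mu> u) x - jap (-s) (res_lim M s \<sigma> \<mu>' u) x) \<le> H * \<bar>\<mu> - \<mu>'\<bar> powr \<alpha> * nrm (jap s u)"
    using res_lim_estimates[OF \<mu>0] by blast
  have le1: "K * nrm (jap s u) \<le> K" if "K \<ge> 0" "nrm (jap s u) \<le> 1" for K u
    using mult_left_mono[OF that(2,1)] by simp
  have on: "opnorm s M (res_lim M s \<sigma> \<mu>) \<le> ennreal H" if "\<bar>\<mu> - \<mu>0\<bar> < \<delta>" for \<mu>
  proof (rule opnorm_le)
    fix u :: "real^'n \<Rightarrow> complex^'k" assume u: "l2 (jap s u)" "nrm (jap s u) \<le> 1"
    have \<mu>: "\<bar>\<mu> - \<mu>0\<bar> \<le> \<delta>" using that by simp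
    show "l2 (jap (-s) (res_lim M s \<sigma> \<mu> u)) \<and> nrm (jap (-s) (res_lim M s \<sigma> \<mu> u)) \<le> H"
      using res_lim_spec(1)[OF nz[OF \<mu>] u(1)] order_trans[OF bd[OF \<mu> u(1)] le1[OF H u(2)]] by blast
  qed
  have od: "opdist s M (res_lim M s \<sigma> \<mu>) (res_lim M s \<sigma> \<mu>') \<le> ennreal (H * \<bar>\<mu> - \<mu>'\<bar> powr \<alpha>)"
    if \<mu>: "\<bar>\<mu> - \<mu>0\<bar> < \<delta>" "\<bar>\<mu>' - \<mu>0\<bar> < \<delta>" for \<mu> \<mu>'
    unfolding opdist_def
  proof (rule opnorm_le)
    fix u :: "real^'n \<Rightarrow> complex^'k" assume u: "l2 (jap s u)" "nrm (jap s u) \<le> 1"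
    have le: "H * \<bar>\<mu> - \<mu>'\<bar> powr \<alpha> * nrm (jap s u) \<le> H * \<bar>\<mu> - \<mu>'\<bar> powr \<alpha>" using H by (intro le1 u) simp
    have \<mu>': "\<bar>\<mu> - \<mu>0\<bar> \<le> \<delta>" "\<bar>\<mu>' - \<mu>0\<bar> \<le> \<delta>" using \<mu> by auto
    show "l2 (jap (-s) (\<lambda>x. res_lim M s \<sigma> \<mu> u x - res_lim M s \<sigma> \<mu>' u x)) \<and>
       nrm (jap (-s) (\<lambda>x. res_lim M s \<sigma> \<mu> u x - res_lim M s \<sigma> \<mu>' u x)) \<le> H * \<bar>\<mu> - \<mu>'\<bar> powr \<alpha>"
      unfolding jap_diff
      by (intro conjI l2_diff res_lim_spec(1)[OF nz u(1)] \<mu>' order_trans[OF ho[OF \<mu>' u(1)] le])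
  qed
  show "bounded_op s M (res_lim M s \<sigma> \<mu>0)"
    unfolding bounded_op_def
  proof (intro conjI ballI allI)
    show "res_lim M s \<sigma> \<mu>0 u \<in> L2w (- s)" if "u \<in> Upsilon s M" for u
      using that res_lim_spec(1)[OF \<mu>0, of u] by (simp add: Upsilon_def L2w_iff)
    show "wnorm (- s) (\<lambda>x. res_lim M s \<sigma> \<mu>0 (\<lambda>y. a *s u y + b *s v y) x - (a *s res_lim M s \<sigma> \<mu>0 u x + b *s res_lim M s \<sigma> \<mu>0 v x)) = 0"
      if "u \<in> Upsilon s M" "v \<in> Upsilon s M" for u v a b
    proof -
      have uv: "l2 (jap s u)" "l2 (jap s v)" using that by (auto simp: Upsilon_def L2w_iff)
      show ?thesis by (simp only: wnorm_eq[OF res_lim_linear(2)[OF \<mu>0 uv]] res_lim_linear(1)[OF \<mu>0 uv] ennreal_0)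
    qed
    show "opnorm s M (res_lim M s \<sigma> \<mu>0) < \<infinity>" using on[of \<mu>0] \<delta> by (auto intro: le_less_trans)
  qed
  show "((\<lambda>\<epsilon>. opdist s M (resolvent M (of_real \<sigma> * (of_real \<mu>0 + \<i> * of_real \<epsilon>))) (res_lim M s \<sigma> \<mu>0)) \<longlongrightarrow> 0) (at_right 0)"
  proof (rule tendsto_sandwich[OF _ _ tendsto_const])
    have "((\<lambda>\<epsilon>. ennreal (H * \<epsilon> powr \<alpha> * 1)) \<longlongrightarrow> ennreal 0) (at_right 0)" by (intro tendsto_ennrealI powr_tendsto_0)
    thus "((\<lambda>\<epsilon>. ennreal (H * \<epsilon> powr \<alpha>)) \<longlongrightarrow> 0) (at_right 0)" by simp
    have "opdist s M (res_at M \<sigma> \<mu>0 \<epsilon>) (res_lim M s \<sigma> \<mu>0) \<le> ennreal (H * \<epsilon> powr \<alpha>)" if \<epsilon>: "0 < \<epsilon>" "\<epsilon> < 1" for \<epsilon>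
      unfolding opdist_def
    proof (rule opnorm_le)
      fix u :: "real^'n \<Rightarrow> complex^'k" assume u: "l2 (jap s u)" "nrm (jap s u) \<le> 1"
      have le: "H * \<epsilon> powr \<alpha> * nrm (jap s u) \<le> H * \<epsilon> powr \<alpha>" using H by (intro le1 u) simp
      have d: "\<bar>\<mu>0 - \<mu>0\<bar> \<le> \<delta>" using \<delta> by simp
      show "l2 (jap (-s) (\<lambda>x. res_at M \<sigma> \<mu>0 \<epsilon> u x - res_lim M s \<sigma> \<mu>0 u x)) \<and>
         nrm (jap (-s) (\<lambda>x. res_at M \<sigma> \<mu>0 \<epsilon> u x - res_lim M s \<sigma> \<mu>0 u x)) \<le> H * \<epsilon> powr \<alpha>"
        unfolding jap_diff
        by (intro conjI l2_diff res_lim_spec(1)[OF \<mu>0 u(1)] res_at_l2(3)[OF \<epsilon>(1) u(1)]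
            order_trans[OF at[OF d \<epsilon>(1) less_imp_le[OF \<epsilon>(2)] u(1)] le])
    qed
    thus "\<forall>\<^sub>F \<epsilon> in at_right 0. opdist s M (resolvent M (of_real \<sigma> * (of_real \<mu>0 + \<i> * of_real \<epsilon>))) (res_lim M s \<sigma> \<mu>0) \<le> ennreal (H * \<epsilon> powr \<alpha>)"
      unfolding eventually_at_right_field res_at_def by (intro exI[of _ 1]) auto
  qed simp
  show "\<exists>\<delta>>0. \<exists>C. C \<ge> 0 \<and> (\<forall>\<mu>. \<bar>\<mu> - \<mu>0\<bar> < \<delta> \<longrightarrow> opnorm s M (res_lim M s \<sigma> \<mu>) \<le> ennreal C) \<and>
         (\<forall>\<mu> \<mu>'. \<bar>\<mu> - \<mu>0\<bar> < \<delta> \<and> \<bar>\<mu>' - \<mu>0\<bar> < \<delta> \<longrightarrow> opdist s M (res_lim M s \<sigma> \<mu>) (res_lim M s \<sigma> \<mu>') \<le> ennreal (C * \<bar>\<mu> - \<mu>'\<bar> powr \<alpha>))"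
    using \<delta> H on od by blast
qed

end

section \<open>Boundary values from both half-planes\<close>

theorem theorem5p13:
  fixes M :: "'n::finite \<Rightarrow> complex^'k::finite^'k" and s :: real
  assumes n2: "CARD('n) \<ge> 2"
    and herm: "\<forall>j. hermitian_mat (M j)"
    and sp: "strongly_propagative M"
    and s: "s > 1/2"
  shows "\<exists>Rp Rm. (\<forall>\<mu>::real. \<mu> \<noteq> 0 \<longrightarrow>
             bounded_op s M (Rp \<mu>) \<and> bounded_op s M (Rm \<mu>) \<and>
             ((\<lambda>\<epsilon>. opdist s M (resolvent M (complex_of_real \<mu> + \<i> * complex_of_real \<epsilon>)) (Rp \<mu>))
                 \<longlongrightarrow> 0) (at_right 0) \<and>
             ((\<lambda>\<epsilon>. opdist s M (resolvent M (complex_of_real \<mu> - \<i> * complex_of_real \<epsilon>)) (Rm \<mu>))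
                 \<longlongrightarrow> 0) (at_right 0))
     \<and> (\<forall>\<mu>0::real. \<mu>0 \<noteq> 0 \<longrightarrow> (\<exists>\<delta>>0. \<exists>C::real. \<forall>\<mu>. \<mu> \<noteq> 0 \<and> \<bar>\<mu> - \<mu>0\<bar> < \<delta> \<longrightarrow>
             opnorm s M (Rp \<mu>) \<le> ennreal C \<and> opnorm s M (Rm \<mu>) \<le> ennreal C))
     \<and> (\<forall>\<mu>0::real. \<mu>0 \<noteq> 0 \<longrightarrow> (\<exists>\<delta>>0. \<exists>C::real. \<exists>\<alpha>::real. 0 < \<alpha> \<and> \<alpha> \<le> 1 \<and>
             (\<forall>\<mu> \<mu>'. \<mu> \<noteq> 0 \<and> \<mu>' \<noteq> 0 \<and> \<bar>\<mu> - \<mu>0\<bar> < \<delta> \<and> \<bar>\<mu>' - \<mu>0\<bar> < \<delta> \<longrightarrow>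
                opdist s M (Rp \<mu>) (Rp \<mu>') \<le> ennreal (C * \<bar>\<mu> - \<mu>'\<bar> powr \<alpha>) \<and>
                opdist s M (Rm \<mu>) (Rm \<mu>') \<le> ennreal (C * \<bar>\<mu> - \<mu>'\<bar> powr \<alpha>))))"
proof -
  \<comment> \<open>Half of the slack s - 1/2 leaves 1/2 + \<alpha> strictly below s; the cap 1/2 is
    the limit for Hoelder exponents coming from one square-integrable derivative.\<close>
  define \<alpha> where "\<alpha> = min (1/2) ((s - 1/2) / 2)"
  have \<alpha>: "0 < \<alpha>" "\<alpha> \<le> 1/2" "1/2 + \<alpha> < s" using s by (auto simp: \<alpha>_def min_def field_simps)
  obtain P where P1: "\<And>\<mu>::real. \<mu> \<noteq> 0 \<Longrightarrow> bounded_op s M (P \<mu>) \<and>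
       ((\<lambda>\<epsilon>. opdist s M (resolvent M (of_real 1 * (of_real \<mu> + \<i> * of_real \<epsilon>))) (P \<mu>)) \<longlongrightarrow> 0) (at_right 0)"
    and P2: "\<And>\<mu>0::real. \<mu>0 \<noteq> 0 \<Longrightarrow> \<exists>\<delta>>0. \<exists>C. C \<ge> 0 \<and> (\<forall>\<mu>. \<bar>\<mu> - \<mu>0\<bar> < \<delta> \<longrightarrow> opnorm s M (P \<mu>) \<le> ennreal C) \<and>
         (\<forall>\<mu> \<mu>'. \<bar>\<mu> - \<mu>0\<bar> < \<delta> \<and> \<bar>\<mu>' - \<mu>0\<bar> < \<delta> \<longrightarrow> opdist s M (P \<mu>) (P \<mu>') \<le> ennreal (C * \<bar>\<mu> - \<mu>'\<bar> powr \<alpha>))"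
    using limiting_absorption[OF herm sp \<alpha>, of 1] by blast
  obtain Q where Q1: "\<And>\<mu>::real. \<mu> \<noteq> 0 \<Longrightarrow> bounded_op s M (Q \<mu>) \<and>
       ((\<lambda>\<epsilon>. opdist s M (resolvent M (of_real (-1) * (of_real \<mu> + \<i> * of_real \<epsilon>))) (Q \<mu>)) \<longlongrightarrow> 0) (at_right 0)"
    and Q2: "\<And>\<mu>0::real. \<mu>0 \<noteq> 0 \<Longrightarrow> \<exists>\<delta>>0. \<exists>C. C \<ge> 0 \<and> (\<forall>\<mu>. \<bar>\<mu> - \<mu>0\<bar> < \<delta> \<longrightarrow> opnorm s M (Q \<mu>) \<le> ennreal C) \<and>
         (\<forall>\<mu> \<mu>'. \<bar>\<mu> - \<mu>0\<bar> < \<delta> \<and> \<bar>\<mu>' - \<mu>0\<bar> < \<delta> \<longrightarrow> opdist s M (Q \<mu>) (Q \<mu>') \<le> ennreal (C * \<bar>\<mu> - \<mu>'\<bar> powr \<alpha>))"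
    using limiting_absorption[OF herm sp \<alpha>, of "-1"] by blast
  \<comment> \<open>Undoes the reflection: at -\<mu> the sign -1 gives the spectral parameter
    -(-\<mu> + i \<epsilon>) = \<mu> - i \<epsilon>.\<close>
  define N where "N = (\<lambda>\<mu>. Q (- \<mu>))"
  have loc: "\<exists>\<delta>>0. \<exists>C. (\<forall>\<mu>. \<bar>\<mu> - \<mu>0\<bar> < \<delta> \<longrightarrow> opnorm s M (P \<mu>) \<le> ennreal C \<and> opnorm s M (N \<mu>) \<le> ennreal C) \<and>
     (\<forall>\<mu> \<mu>'. \<bar>\<mu> - \<mu>0\<bar> < \<delta> \<and> \<bar>\<mu>' - \<mu>0\<bar> < \<delta> \<longrightarrow>
        opdist s M (P \<mu>) (P \<mu>') \<le> ennreal (C * \<bar>\<mu> - \<mu>'\<bar> powr \<alpha>) \<and> opdist s M (N \<mu>) (N \<mu>') \<le> ennreal (C * \<bar>\<mu> - \<mu>'\<bar> powr \<alpha>))"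
    if \<mu>0: "\<mu>0 \<noteq> 0" for \<mu>0
  proof -
    obtain \<delta>1 C1 where 1: "\<delta>1 > 0" "C1 \<ge> 0" "\<And>\<mu>. \<bar>\<mu> - \<mu>0\<bar> < \<delta>1 \<Longrightarrow> opnorm s M (P \<mu>) \<le> ennreal C1"
      "\<And>\<mu> \<mu>'. \<bar>\<mu> - \<mu>0\<bar> < \<delta>1 \<Longrightarrow> \<bar>\<mu>' - \<mu>0\<bar> < \<delta>1 \<Longrightarrow> opdist s M (P \<mu>) (P \<mu>') \<le> ennreal (C1 * \<bar>\<mu> - \<mu>'\<bar> powr \<alpha>)"
      using P2[OF \<mu>0] by blast
    obtain \<delta>2 C2 where 2: "\<delta>2 > 0" "C2 \<ge> 0" "\<And>\<mu>. \<bar>\<mu> - (-\<mu>0)\<bar> < \<delta>2 \<Longrightarrow> opnorm s M (Q \<mu>) \<le> ennreal C2"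
      "\<And>\<mu> \<mu>'. \<bar>\<mu> - (-\<mu>0)\<bar> < \<delta>2 \<Longrightarrow> \<bar>\<mu>' - (-\<mu>0)\<bar> < \<delta>2 \<Longrightarrow> opdist s M (Q \<mu>) (Q \<mu>') \<le> ennreal (C2 * \<bar>\<mu> - \<mu>'\<bar> powr \<alpha>)"
      using Q2[of "-\<mu>0"] \<mu>0 by (metis neg_equal_0_iff_equal)
    define C where "C = max C1 C2"
    have C1: "ennreal (C1 * t) \<le> ennreal (C * t)" if "t \<ge> 0" for t using that by (intro ennreal_leI mult_right_mono) (auto simp: C_def)
    have C2: "ennreal (C2 * t) \<le> ennreal (C * t)" if "t \<ge> 0" for t using that by (intro ennreal_leI mult_right_mono) (auto simp: C_def)
    have flip: "\<bar>- \<mu> - (-\<mu>0)\<bar> = \<bar>\<mu> - \<mu>0\<bar>" for \<mu> by simp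
    have flip2: "\<bar>- \<mu> - (-\<mu>')\<bar> = \<bar>\<mu> - \<mu>'\<bar>" for \<mu> \<mu>' :: real by simp
    define \<delta> where "\<delta> = min \<delta>1 \<delta>2"
    have "\<delta> > 0" using 1 2 by (simp add: \<delta>_def)
    moreover have "opnorm s M (P \<mu>) \<le> ennreal C \<and> opnorm s M (N \<mu>) \<le> ennreal C" if \<mu>: "\<bar>\<mu> - \<mu>0\<bar> < \<delta>" for \<mu>
      using 1(3)[of \<mu>] 2(3)[of "-\<mu>", unfolded flip] \<mu> C1[of 1] C2[of 1]
      by (auto simp: N_def \<delta>_def intro: order_trans)
    moreover have "opdist s M (P \<mu>) (P \<mu>') \<le> ennreal (C * \<bar>\<mu> - \<mu>'\<bar> powr \<alpha>) \<and>
        opdist s M (N \<mu>) (N \<mu>') \<le> ennreal (C * \<bar>\<mu> - \<mu>'\<bar> powr \<alpha>)"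
      if \<mu>: "\<bar>\<mu> - \<mu>0\<bar> < \<delta>" "\<bar>\<mu>' - \<mu>0\<bar> < \<delta>" for \<mu> \<mu>'
    proof
      show "opdist s M (P \<mu>) (P \<mu>') \<le> ennreal (C * \<bar>\<mu> - \<mu>'\<bar> powr \<alpha>)"
        by (rule order_trans[OF 1(4) C1]) (use \<mu> in \<open>auto simp: \<delta>_def\<close>)
      have "opdist s M (Q (-\<mu>)) (Q (-\<mu>')) \<le> ennreal (C2 * \<bar>\<mu> - \<mu>'\<bar> powr \<alpha>)"
        using 2(4)[of "-\<mu>" "-\<mu>'", unfolded flip flip2] \<mu> by (auto simp: \<delta>_def)
      thus "opdist s M (N \<mu>) (N \<mu>') \<le> ennreal (C * \<bar>\<mu> - \<mu>'\<bar> powr \<alpha>)"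
        unfolding N_def by (rule order_trans[OF _ C2]) simp
    qed
    ultimately show ?thesis by blast
  qed
  have conv: "bounded_op s M (P \<mu>) \<and> bounded_op s M (N \<mu>) \<and>
     ((\<lambda>\<epsilon>. opdist s M (resolvent M (complex_of_real \<mu> + \<i> * complex_of_real \<epsilon>)) (P \<mu>)) \<longlongrightarrow> 0) (at_right 0) \<and>
     ((\<lambda>\<epsilon>. opdist s M (resolvent M (complex_of_real \<mu> - \<i> * complex_of_real \<epsilon>)) (N \<mu>)) \<longlongrightarrow> 0) (at_right 0)"
    if "\<mu> \<noteq> 0" for \<mu>
    using P1[OF that] Q1[of "-\<mu>"] that by (simp add: N_def)
  show ?thesis
  proof (rule exI[of _ P], rule exI[of _ N], intro conjI allI impI)
    fix \<mu>0 :: real assume "\<mu>0 \<noteq> 0"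
    from loc[OF this]
    show "\<exists>\<delta>>0. \<exists>C::real. \<forall>\<mu>. \<mu> \<noteq> 0 \<and> \<bar>\<mu> - \<mu>0\<bar> < \<delta> \<longrightarrow>
             opnorm s M (P \<mu>) \<le> ennreal C \<and> opnorm s M (N \<mu>) \<le> ennreal C" by blast
  next
    fix \<mu>0 :: real assume "\<mu>0 \<noteq> 0"
    moreover have "\<alpha> \<le> 1" using \<alpha>(2) by simp
    ultimately show "\<exists>\<delta>>0. \<exists>C::real. \<exists>\<alpha>::real. 0 < \<alpha> \<and> \<alpha> \<le> 1 \<and>
             (\<forall>\<mu> \<mu>'. \<mu> \<noteq> 0 \<and> \<mu>' \<noteq> 0 \<and> \<bar>\<mu> - \<mu>0\<bar> < \<delta> \<and> \<bar>\<mu>' - \<mu>0\<bar> < \<delta> \<longrightarrow>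
                opdist s M (P \<mu>) (P \<mu>') \<le> ennreal (C * \<bar>\<mu> - \<mu>'\<bar> powr \<alpha>) \<and>
                opdist s M (N \<mu>) (N \<mu>') \<le> ennreal (C * \<bar>\<mu> - \<mu>'\<bar> powr \<alpha>))"
      using loc[of \<mu>0] \<alpha>(1) by blast
  qed (use conv in blast)+
qed

end
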